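(* Let $\Bbbk$ be a field and let $A=\Bbbk[[x^2,y^2,xy,x^2y,xy^2]]\subset R=\Bbbk[[x,y]]$, with $u=x^2$, $v=y^2$, $w=xy$, $a=x^2y$, $b=xy^2$; thus $A\cong\Bbbk[[u,v,w,a,b]]/(uv-w^2,ab-w^3,aw-bu,bw-av,a^2-uw^2,b^2-vw^2)$. Up to isomorphism, the only maximal Cohen--Macaulay $A$-modules of rank one are the following (written as ideals of $A$), where $(\Theta_1,\Theta_2)$ is the gluing datum of the corresponding triple: Upper part: $\Theta_1=(1),\Theta_2=(1)$: $A$; $\Theta_1=(z),\Theta_2=(z)$: $(w^2,a,b)$; $\Theta_1=(z),\Theta_2=(1)$: $(w^2,a,vw)$; $\Theta_1=(1),\Theta_2=(z)$: $(w^2,b,uw)$. Lower part: $\Theta_1=(1\ z),\Theta_2=(1\ z)$: $R\cong I$; $\Theta_1=(1),\Theta_2=(1\ z)$: $(w,b)$; $\Theta_1=(1\ z),\Theta_2=(1)$: $(w,a)$; $\Theta_1=(z),\Theta_2=(1\ z)$: $(w^2,a,b,vw)$; $\Theta_1=(1\ z),\Theta_2=(z)$: $(w^2,a,b,uw)$. Moreover, the modules in the upper part are locally free on the punctured spectrum of $A$, whereas those in the lower part are not. In particular, up to isomorphism there exist only finitely many maximal Cohen--Macaulay $A$-modules of rank one.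
   Context: $A$ is an integral Cohen--Macaulay surface singularity with normalization $R$; the conductor is $I=\mathrm{Ann}_A(R/A)=(w,a,b)A=(xy)R$; $\bar A=A/I\cong\Bbbk[[\tilde x,\tilde y]]/(\tilde x\tilde y)$ embeds in $\bar R=R/I=\Bbbk[[x,y]]/(xy)$ by $\tilde x\mapsto x^2$, $\tilde y\mapsto y^2$. Put $\mathbb K=\Bbbk((z))$, $\mathbb L=\Bbbk((z^2))$; then $Q(\bar A)\cong\mathbb L_1\times\mathbb L_2$, $Q(\bar R)\cong\mathbb K_1\times\mathbb K_2$ (copies of $\mathbb L$, $\mathbb K$; first component: $x\leftrightarrow z$, second component: $y\leftrightarrow z$). The category of maximal Cohen--Macaulay $A$-modules is equivalent, via $M\mapsto\bigl((R\otimes_AM)^{**},\ Q(\bar A)\otimes_AM,\ \theta_M\bigr)$ (with $(-)^{**}$ the $R$-bidual and $\theta_M$ induced by the canonical map $R\otimes_AM\to(R\otimes_AM)^{**}$), to the category of triples $(\widetilde M,V,\theta)$, where $\widetilde M\cong R^m$, $V\cong\mathbb L_1^{p_1}\oplus\mathbb L_2^{p_2}$ and $\theta:Q(\bar R)\otimes_{Q(\bar A)}V\to Q(\bar R)\otimes_R\widetilde M$ is an epimorphism with injective adjoint $V\to Q(\bar R)\otimes_R\widetilde M$; $\theta$ is given by a pair of matrices $\Theta_i\in\mathrm{Mat}_{m\times p_i}(\mathbb K)$, $i=1,2$. Rank one means $m=1$. Locally free on the punctured spectrum: $M_{\mathfrak p}$ is free over $A_{\mathfrak p}$ for every non-maximal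 prime $\mathfrak p$. *)

theory Defs
  imports
    "HOL-Computational_Algebra.Formal_Laurent_Series"
    "HOL-Library.Extended_Nat"
    "HOL-Algebra.Algebraic_Closure_Type"
    "HOL-Algebra.Chinese_Remainder"
    "HOL-Algebra.Free_Abelian_Groups"
    "Jordan_Normal_Form.Matrix"
begin

section \<open>Modules over a commutative ring\<close>

text \<open>The fields \<open>mult\<close> and \<open>one\<close> that the record type of modules inherits from rings are
  irrelevant for a module; they are left undefined below.\<close>

definition module_hom ::
    "('r, 'c) ring_scheme \<Rightarrow> ('r, 'm, 'd) module_scheme \<Rightarrow> ('r, 'n, 'e) module_scheme \<Rightarrow> ('m \<Rightarrow> 'n) set" where
  "module_hom R M N = {f. f \<in> carrier M \<rightarrow> carrier N \<and>
     (\<forall>x\<in>carrier M. \<forall>y\<in>carrier M. f (x \<oplus>\<^bsub>M\<^esub> y) = f x \<oplus>\<^bsub>N\<^esub> f y) \<and>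
     (\<forall>r\<in>carrier R. \<forall>x\<in>carrier M. f (r \<odot>\<^bsub>M\<^esub> x) = r \<odot>\<^bsub>N\<^esub> f x)}"

definition module_iso ::
    "('r, 'c) ring_scheme \<Rightarrow> ('r, 'm, 'd) module_scheme \<Rightarrow> ('r, 'n, 'e) module_scheme \<Rightarrow> ('m \<Rightarrow> 'n) set" where
  "module_iso R M N = {f \<in> module_hom R M N. bij_betw f (carrier M) (carrier N)}"

definition module_isomorphic ::
    "('r, 'c) ring_scheme \<Rightarrow> ('r, 'm, 'd) module_scheme \<Rightarrow> ('r, 'n, 'e) module_scheme \<Rightarrow> bool" where
  "module_isomorphic R M N \<longleftrightarrow> module_iso R M N \<noteq> {}"

definition regular_module :: "('r, 'c) ring_scheme \<Rightarrow> ('r, 'r) module" where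
  "regular_module R = \<lparr>carrier = carrier R, monoid.mult = undefined, one = undefined,
     ring.zero = \<zero>\<^bsub>R\<^esub>, add = add R, module.smult = monoid.mult R\<rparr>"

definition ideal_module :: "('r, 'c) ring_scheme \<Rightarrow> 'r set \<Rightarrow> ('r, 'r) module" where
  "ideal_module R J = (regular_module R)\<lparr>carrier := J\<rparr>"

definition finitely_generated_module ::
    "('r, 'c) ring_scheme \<Rightarrow> ('r, 'm, 'd) module_scheme \<Rightarrow> bool" where
  "finitely_generated_module R M \<longleftrightarrow> (\<exists>gs. set gs \<subseteq> carrier M \<and>
     (\<forall>m\<in>carrier M. \<exists>c \<in> {..<length gs} \<rightarrow> carrier R.
        m = (\<Oplus>\<^bsub>M\<^esub>i\<in>{..<length gs}. c i \<odot>\<^bsub>M\<^esub> gs ! i)))"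

definition free_module :: "('r, 'c) ring_scheme \<Rightarrow> ('r, 'm, 'd) module_scheme \<Rightarrow> bool" where
  "free_module R M \<longleftrightarrow> (\<exists>B\<subseteq>carrier M. \<forall>m\<in>carrier M.
     \<exists>!c. (\<forall>b. c b \<in> carrier R) \<and> (\<forall>b. b \<notin> B \<longrightarrow> c b = \<zero>\<^bsub>R\<^esub>) \<and> finite {b. c b \<noteq> \<zero>\<^bsub>R\<^esub>} \<and>
          m = (\<Oplus>\<^bsub>M\<^esub>b\<in>{b. c b \<noteq> \<zero>\<^bsub>R\<^esub>}. c b \<odot>\<^bsub>M\<^esub> b))"

definition dual_module :: "('r, 'c) ring_scheme \<Rightarrow> ('r, 'm, 'd) module_scheme \<Rightarrow> ('r, 'm \<Rightarrow> 'r) module" where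
  "dual_module R M = \<lparr>carrier = module_hom R M (regular_module R) \<inter> extensional (carrier M),
     monoid.mult = undefined, one = undefined,
     ring.zero = (\<lambda>m\<in>carrier M. \<zero>\<^bsub>R\<^esub>),
     add = (\<lambda>f g. \<lambda>m\<in>carrier M. f m \<oplus>\<^bsub>R\<^esub> g m),
     module.smult = (\<lambda>r f. \<lambda>m\<in>carrier M. r \<otimes>\<^bsub>R\<^esub> f m)\<rparr>"

abbreviation bidual_module ::
    "('r, 'c) ring_scheme \<Rightarrow> ('r, 'm, 'd) module_scheme \<Rightarrow> ('r, ('m \<Rightarrow> 'r) \<Rightarrow> 'r) module" where
  "bidual_module R M \<equiv> dual_module R (dual_module R M)"

definition bidual_map :: "('r, 'c) ring_scheme \<Rightarrow> ('r, 'm, 'd) module_scheme \<Rightarrow> 'm \<Rightarrow> ('m \<Rightarrow> 'r) \<Rightarrow> 'r" where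
  "bidual_map R M m = (\<lambda>f\<in>carrier (dual_module R M). f m)"


section \<open>Base change\<close>

text \<open>For a ring homomorphism \<open>h\<close> from \<open>A\<close> to \<open>S\<close> and an \<open>A\<close>-module \<open>M\<close>, the tensor product of
  \<open>S\<close> and \<open>M\<close> over \<open>A\<close> is the free abelian group on \<open>S \<times> M\<close> modulo the usual relations.\<close>

definition tensor_relations ::
    "('a, 'c) ring_scheme \<Rightarrow> ('s, 'd) ring_scheme \<Rightarrow> ('a \<Rightarrow> 's) \<Rightarrow> ('a, 'm, 'e) module_scheme
      \<Rightarrow> ('s \<times> 'm \<Rightarrow>\<^sub>0 int) set" where
  "tensor_relations A S h M =
     {frag_of (s \<oplus>\<^bsub>S\<^esub> t, m) - frag_of (s, m) - frag_of (t, m) | s t m.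
        s \<in> carrier S \<and> t \<in> carrier S \<and> m \<in> carrier M} \<union>
     {frag_of (s, m \<oplus>\<^bsub>M\<^esub> n) - frag_of (s, m) - frag_of (s, n) | s m n.
        s \<in> carrier S \<and> m \<in> carrier M \<and> n \<in> carrier M} \<union>
     {frag_of (s \<otimes>\<^bsub>S\<^esub> h r, m) - frag_of (s, r \<odot>\<^bsub>M\<^esub> m) | s r m.
        s \<in> carrier S \<and> r \<in> carrier A \<and> m \<in> carrier M}"

definition tensor_kernel ::
    "('a, 'c) ring_scheme \<Rightarrow> ('s, 'd) ring_scheme \<Rightarrow> ('a \<Rightarrow> 's) \<Rightarrow> ('a, 'm, 'e) module_scheme
      \<Rightarrow> ('s \<times> 'm \<Rightarrow>\<^sub>0 int) set" where
  "tensor_kernel A S h M =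
     generate (free_Abelian_group (carrier S \<times> carrier M)) (tensor_relations A S h M)"

definition tensor_class ::
    "('a, 'c) ring_scheme \<Rightarrow> ('s, 'd) ring_scheme \<Rightarrow> ('a \<Rightarrow> 's) \<Rightarrow> ('a, 'm, 'e) module_scheme
      \<Rightarrow> ('s \<times> 'm \<Rightarrow>\<^sub>0 int) \<Rightarrow> ('s \<times> 'm \<Rightarrow>\<^sub>0 int) set" where
  "tensor_class A S h M p =
     tensor_kernel A S h M #>\<^bsub>free_Abelian_group (carrier S \<times> carrier M)\<^esub> p"

definition pure_tensor ::
    "('a, 'c) ring_scheme \<Rightarrow> ('s, 'd) ring_scheme \<Rightarrow> ('a \<Rightarrow> 's) \<Rightarrow> ('a, 'm, 'e) module_scheme
      \<Rightarrow> 's \<Rightarrow> 'm \<Rightarrow> ('s \<times> 'm \<Rightarrow>\<^sub>0 int) set" where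
  "pure_tensor A S h M s m = tensor_class A S h M (frag_of (s, m))"

definition base_change ::
    "('a, 'c) ring_scheme \<Rightarrow> ('s, 'd) ring_scheme \<Rightarrow> ('a \<Rightarrow> 's) \<Rightarrow> ('a, 'm, 'e) module_scheme
      \<Rightarrow> ('s, ('s \<times> 'm \<Rightarrow>\<^sub>0 int) set) module" where
  "base_change A S h M =
     (let T = free_Abelian_group (carrier S \<times> carrier M) Mod tensor_kernel A S h M
      in \<lparr>carrier = carrier T, monoid.mult = undefined, one = undefined,
          ring.zero = \<one>\<^bsub>T\<^esub>, add = monoid.mult T,
          module.smult = (\<lambda>s Z. \<Union>p\<in>Z. tensor_class A S h M
                      (frag_extend (\<lambda>(t, m). frag_of (s \<otimes>\<^bsub>S\<^esub> t, m)) p))\<rparr>)"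

text \<open>The \<open>S\<close>-linear map on the base change of \<open>M\<close> that is adjoint to an \<open>A\<close>-linear map \<open>\<beta>\<close> from
  \<open>M\<close> to the \<open>S\<close>-module \<open>N\<close>, i.e. the one sending \<open>s \<otimes> m\<close> to \<open>s \<beta>(m)\<close>.\<close>

definition base_change_adjoint ::
    "('a, 'c) ring_scheme \<Rightarrow> ('s, 'd) ring_scheme \<Rightarrow> ('a \<Rightarrow> 's) \<Rightarrow> ('a, 'm, 'e) module_scheme
      \<Rightarrow> ('s, 'n, 'f) module_scheme \<Rightarrow> ('m \<Rightarrow> 'n) \<Rightarrow> ('s \<times> 'm \<Rightarrow>\<^sub>0 int) set \<Rightarrow> 'n" where
  "base_change_adjoint A S h M N \<beta> =
     (THE f. f \<in> module_hom S (base_change A S h M) N \<inter> extensional (carrier (base_change A S h M)) \<and>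
        (\<forall>s\<in>carrier S. \<forall>m\<in>carrier M. f (pure_tensor A S h M s m) = s \<odot>\<^bsub>N\<^esub> \<beta> m))"

definition base_change_map ::
    "('a, 'c) ring_scheme \<Rightarrow> ('s, 'd) ring_scheme \<Rightarrow> ('a \<Rightarrow> 's) \<Rightarrow> ('a, 'm, 'e) module_scheme
      \<Rightarrow> ('a, 'n, 'f) module_scheme \<Rightarrow> ('m \<Rightarrow> 'n)
      \<Rightarrow> ('s \<times> 'm \<Rightarrow>\<^sub>0 int) set \<Rightarrow> ('s \<times> 'n \<Rightarrow>\<^sub>0 int) set" where
  "base_change_map A S h M N \<phi> =
     base_change_adjoint A S h M (base_change A S h N) (\<lambda>m. pure_tensor A S h N \<one>\<^bsub>S\<^esub> (\<phi> m))"


section \<open>Localization\<close>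

definition loc_rel ::
    "('r, 'c) ring_scheme \<Rightarrow> 'r set \<Rightarrow> ('r, 'm, 'd) module_scheme \<Rightarrow> (('m \<times> 'r) \<times> ('m \<times> 'r)) set" where
  "loc_rel R S M = {((m, s), (n, t)). m \<in> carrier M \<and> n \<in> carrier M \<and> s \<in> S \<and> t \<in> S \<and>
     (\<exists>u\<in>S. u \<odot>\<^bsub>M\<^esub> (t \<odot>\<^bsub>M\<^esub> m) = u \<odot>\<^bsub>M\<^esub> (s \<odot>\<^bsub>M\<^esub> n))}"

definition loc_frac ::
    "('r, 'c) ring_scheme \<Rightarrow> 'r set \<Rightarrow> ('r, 'm, 'd) module_scheme \<Rightarrow> 'm \<Rightarrow> 'r \<Rightarrow> ('m \<times> 'r) set" where
  "loc_frac R S M m s = loc_rel R S M `` {(m, s)}"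

definition localized_ring :: "('r, 'c) ring_scheme \<Rightarrow> 'r set \<Rightarrow> ('r \<times> 'r) set ring" where
  "localized_ring R S =
     (let frac = loc_frac R S (regular_module R)
      in \<lparr>carrier = (carrier R \<times> S) // loc_rel R S (regular_module R),
          monoid.mult = (\<lambda>Y Z. \<Union>(a, s)\<in>Y. \<Union>(b, t)\<in>Z. frac (a \<otimes>\<^bsub>R\<^esub> b) (s \<otimes>\<^bsub>R\<^esub> t)),
          one = frac \<one>\<^bsub>R\<^esub> \<one>\<^bsub>R\<^esub>,
          ring.zero = frac \<zero>\<^bsub>R\<^esub> \<one>\<^bsub>R\<^esub>,
          add = (\<lambda>Y Z. \<Union>(a, s)\<in>Y. \<Union>(b, t)\<in>Z.
                   frac (t \<otimes>\<^bsub>R\<^esub> a \<oplus>\<^bsub>R\<^esub> s \<otimes>\<^bsub>R\<^esub> b) (s \<otimes>\<^bsub>R\<^esub> t))\<rparr>)"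

definition localized_module ::
    "('r, 'c) ring_scheme \<Rightarrow> 'r set \<Rightarrow> ('r, 'm, 'd) module_scheme \<Rightarrow> (('r \<times> 'r) set, ('m \<times> 'r) set) module" where
  "localized_module R S M =
     (let frac = loc_frac R S M
      in \<lparr>carrier = (carrier M \<times> S) // loc_rel R S M,
          monoid.mult = undefined, one = undefined,
          ring.zero = frac \<zero>\<^bsub>M\<^esub> \<one>\<^bsub>R\<^esub>,
          add = (\<lambda>Y Z. \<Union>(m, s)\<in>Y. \<Union>(n, t)\<in>Z.
                   frac (t \<odot>\<^bsub>M\<^esub> m \<oplus>\<^bsub>M\<^esub> s \<odot>\<^bsub>M\<^esub> n) (s \<otimes>\<^bsub>R\<^esub> t)),
          module.smult = (\<lambda>Y Z. \<Union>(a, s)\<in>Y. \<Union>(n, t)\<in>Z. frac (a \<odot>\<^bsub>M\<^esub> n) (s \<otimes>\<^bsub>R\<^esub> t))\<rparr>)"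

definition locally_free_on_punctured_spectrum ::
    "('r, 'c) ring_scheme \<Rightarrow> ('r, 'm, 'd) module_scheme \<Rightarrow> bool" where
  "locally_free_on_punctured_spectrum R M \<longleftrightarrow>
     (\<forall>\<pp>. primeideal \<pp> R \<and> \<not> maximalideal \<pp> R \<longrightarrow>
        free_module (localized_ring R (carrier R - \<pp>)) (localized_module R (carrier R - \<pp>) M))"


section \<open>Maximal Cohen--Macaulay modules\<close>

definition krull_dim :: "('r, 'c) ring_scheme \<Rightarrow> enat" where
  "krull_dim R = Sup {enat n | n. \<exists>\<pp>. (\<forall>i\<le>n. primeideal (\<pp> i) R) \<and> (\<forall>i<n. \<pp> i \<subset> \<pp> (Suc i))}"

text \<open>The submodule \<open>(x\<^sub>1, \<dots>, x\<^sub>n) M\<close>.\<close>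

definition seq_submodule :: "('r, 'c) ring_scheme \<Rightarrow> ('r, 'm, 'd) module_scheme \<Rightarrow> 'r list \<Rightarrow> 'm set" where
  "seq_submodule R M xs =
     {\<Oplus>\<^bsub>M\<^esub>i\<in>{..<length xs}. xs ! i \<odot>\<^bsub>M\<^esub> f i | f. f \<in> {..<length xs} \<rightarrow> carrier M}"

definition regular_sequence :: "('r, 'c) ring_scheme \<Rightarrow> ('r, 'm, 'd) module_scheme \<Rightarrow> 'r list \<Rightarrow> bool" where
  "regular_sequence R M xs \<longleftrightarrow> set xs \<subseteq> carrier R \<and>
     (\<forall>i<length xs. \<forall>m\<in>carrier M.
        xs ! i \<odot>\<^bsub>M\<^esub> m \<in> seq_submodule R M (take i xs) \<longrightarrow> m \<in> seq_submodule R M (take i xs)) \<and>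
     seq_submodule R M xs \<noteq> carrier M"

text \<open>Depth over a local ring, whose maximal ideal is the set of non-units.\<close>

definition depth :: "('r, 'c) ring_scheme \<Rightarrow> ('r, 'm, 'd) module_scheme \<Rightarrow> enat" where
  "depth R M = Sup {enat (length xs) | xs. regular_sequence R M xs \<and> set xs \<subseteq> carrier R - Units R}"

definition maximal_CM :: "('r, 'c) ring_scheme \<Rightarrow> ('r, 'm, 'd) module_scheme \<Rightarrow> bool" where
  "maximal_CM R M \<longleftrightarrow> module R M \<and> finitely_generated_module R M \<and> depth R M = krull_dim R"


section \<open>The surface singularity\<close>

text \<open>An element \<open>f\<close> of \<open>\<k>[[x,y]]\<close> is a power series in \<open>x\<close> over \<open>\<k>[[y]]\<close>: the coefficient of
  \<open>x\<^sup>i y\<^sup>j\<close> is \<open>fps_nth (fps_nth f i) j\<close>. Likewise, \<open>\<k>[[u,v,w,a,b]]\<close> is nested with \<open>u\<close> outermost.\<close>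

type_synonym 'k fps2 = "'k fps fps"
type_synonym 'k fps5 = "'k fps fps fps fps fps"

abbreviation ring_R :: "'k::field fps2 ring" where
  "ring_R \<equiv> ring_of_type_algebra"

abbreviation ring_P :: "'k::field fps5 ring" where
  "ring_P \<equiv> ring_of_type_algebra"

definition el_x :: "'k::field fps2" where "el_x = fps_X"
definition el_y :: "'k::field fps2" where "el_y = fps_const fps_X"

definition el_u :: "'k::field fps2" where "el_u = el_x ^ 2"
definition el_v :: "'k::field fps2" where "el_v = el_y ^ 2"
definition el_w :: "'k::field fps2" where "el_w = el_x * el_y"
definition el_a :: "'k::field fps2" where "el_a = el_x ^ 2 * el_y"
definition el_b :: "'k::field fps2" where "el_b = el_x * el_y ^ 2"

text \<open>The substitution \<open>F(x\<^sup>2, y\<^sup>2, x y, x\<^sup>2 y, x y\<^sup>2)\<close>.\<close>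

definition subst_P :: "'k::field fps5 \<Rightarrow> 'k fps2" where
  "subst_P F = Abs_fps (\<lambda>i. Abs_fps (\<lambda>j.
     \<Sum>(p, q, r, s, t) \<in> {(p, q, r, s, t). 2 * p + r + 2 * s + t = i \<and> 2 * q + r + s + 2 * t = j}.
       fps_nth (fps_nth (fps_nth (fps_nth (fps_nth F p) q) r) s) t))"

definition ring_A :: "'k::field fps2 ring" where
  "ring_A = ring_R\<lparr>carrier := range subst_P\<rparr>"

definition relations_A :: "'k::field fps5 set" where
  "relations_A =
     (let u = fps_X; v = fps_const fps_X; w = fps_const (fps_const fps_X);
          a = fps_const (fps_const (fps_const fps_X));
          b = fps_const (fps_const (fps_const (fps_const fps_X)))
      in {u * v - w ^ 2, a * b - w ^ 3, a * w - b * u, b * w - a * v,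
          a ^ 2 - u * w ^ 2, b ^ 2 - v * w ^ 2})"

abbreviation relation_ideal :: "'k::field fps5 set" where
  "relation_ideal \<equiv> Idl\<^bsub>ring_P\<^esub> relations_A"

text \<open>The conductor \<open>Ann\<^sub>A(R/A)\<close>.\<close>

definition conductor_A :: "'k::field fps2 set" where
  "conductor_A = {c \<in> carrier ring_A. \<forall>r. c * r \<in> carrier ring_A}"


section \<open>Triples\<close>

abbreviation ring_K :: "'k::field fls ring" where
  "ring_K \<equiv> ring_of_type_algebra"

definition field_L :: "'k::field fls set" where
  "field_L = {f. \<forall>n. odd n \<longrightarrow> fls_nth f n = 0}"

text \<open>The total quotient rings of \<open>R/I\<close> and \<open>A/I\<close>, identified with \<open>\<K> \<times> \<K>\<close> and \<open>\<L> \<times> \<L>\<close>, so that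
  the inclusion of the second into the first is the identity; \<open>restr_axes\<close> is the canonical map
  to them, \<open>f \<mapsto> (f(z,0), f(0,z))\<close>.\<close>

definition ring_QR :: "('k::field fls \<times> 'k fls) ring" where
  "ring_QR = RDirProd ring_K ring_K"

definition ring_QA :: "('k::field fls \<times> 'k fls) ring" where
  "ring_QA = ring_QR\<lparr>carrier := field_L \<times> field_L\<rparr>"

definition restr_axes :: "'k::field fps2 \<Rightarrow> 'k fls \<times> 'k fls" where
  "restr_axes f = (fps_to_fls (Abs_fps (\<lambda>i. fps_nth (fps_nth f i) 0)), fps_to_fls (fps_nth f 0))"

type_synonym ('k, 'v) tensor_QR = "(('k fls \<times> 'k fls) \<times> 'v \<Rightarrow>\<^sub>0 int) set"

type_synonym ('k, 'm, 'v) triple =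
  "('k fps2, 'm) module \<times> ('k fls \<times> 'k fls, 'v) module \<times> (('k, 'v) tensor_QR \<Rightarrow> ('k, 'm) tensor_QR)"

abbreviation QR_R :: "('k::field fps2, 'm) module \<Rightarrow> ('k fls \<times> 'k fls, ('k, 'm) tensor_QR) module" where
  "QR_R M \<equiv> base_change ring_R ring_QR restr_axes M"

abbreviation QR_QA :: "('k::field fls \<times> 'k fls, 'v) module \<Rightarrow> ('k fls \<times> 'k fls, ('k, 'v) tensor_QR) module" where
  "QR_QA V \<equiv> base_change ring_QA ring_QR (\<lambda>c. c) V"

definition triple_isomorphic :: "('k::field, 'm, 'v) triple \<Rightarrow> ('k, 'n, 'w) triple \<Rightarrow> bool" where
  "triple_isomorphic T T' \<longleftrightarrow>
     (case T of (M, V, \<theta>) \<Rightarrow> case T' of (M', V', \<theta>') \<Rightarrow>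
        \<exists>\<phi>\<in>module_iso ring_R M M'. \<exists>\<psi>\<in>module_iso ring_QA V V'.
          \<forall>Z\<in>carrier (QR_QA V).
            base_change_map ring_R ring_QR restr_axes M M' \<phi> (\<theta> Z) =
            \<theta>' (base_change_map ring_QA ring_QR (\<lambda>c. c) V V' \<psi> Z))"

definition reflexive_hull ::
    "('k::field fps2, 'm) module \<Rightarrow> ('k fps2, (('k fps2 \<times> 'm \<Rightarrow>\<^sub>0 int) set \<Rightarrow> 'k fps2) \<Rightarrow> 'k fps2) module" where
  "reflexive_hull M = bidual_module ring_R (base_change ring_A ring_R (\<lambda>f. f) M)"

definition to_reflexive_hull ::
    "('k::field fps2, 'm) module \<Rightarrow> 'm \<Rightarrow> (('k fps2 \<times> 'm \<Rightarrow>\<^sub>0 int) set \<Rightarrow> 'k fps2) \<Rightarrow> 'k fps2" where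
  "to_reflexive_hull M m =
     bidual_map ring_R (base_change ring_A ring_R (\<lambda>f. f) M) (pure_tensor ring_A ring_R (\<lambda>f. f) M 1 m)"

text \<open>\<open>\<theta>\<^sub>M\<close> sends \<open>c \<otimes> (d \<otimes> m)\<close> to \<open>c d \<otimes> j(1 \<otimes> m)\<close>, where \<open>j\<close> is the canonical map from the base
  change of \<open>M\<close> to its bidual.\<close>

definition triple_of_module ::
    "('k::field fps2, 'm) module
      \<Rightarrow> ('k, (('k fps2 \<times> 'm \<Rightarrow>\<^sub>0 int) set \<Rightarrow> 'k fps2) \<Rightarrow> 'k fps2, ('k, 'm) tensor_QR) triple" where
  "triple_of_module M =
     (let H = reflexive_hull M;
          V = base_change ring_A ring_QA restr_axes M;
          \<gamma> = base_change_adjoint ring_A ring_QA restr_axes M (QR_R H)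
                (\<lambda>m. pure_tensor ring_R ring_QR restr_axes H (1, 1) (to_reflexive_hull M m))
      in (H, V, base_change_adjoint ring_QA ring_QR (\<lambda>c. c) V (QR_R H) \<gamma>))"

text \<open>\<open>\<L>\<^sub>1\<^sup>p \<oplus> \<L>\<^sub>2\<^sup>q\<close> as a module over \<open>\<L>\<^sub>1 \<times> \<L>\<^sub>2\<close>.\<close>

definition L_space :: "nat \<Rightarrow> nat \<Rightarrow> ('k::field fls \<times> 'k fls, 'k fls vec \<times> 'k fls vec) module" where
  "L_space p q = \<lparr>carrier = {v \<in> carrier_vec p. vec_set v \<subseteq> field_L} \<times> {v \<in> carrier_vec q. vec_set v \<subseteq> field_L},
     monoid.mult = undefined, one = undefined,
     ring.zero = (0\<^sub>v p, 0\<^sub>v q),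
     add = (\<lambda>(v1, v2) (w1, w2). (v1 + w1, v2 + w2)),
     module.smult = (\<lambda>(c1, c2) (v1, v2). (c1 \<cdot>\<^sub>v v1, c2 \<cdot>\<^sub>v v2))\<rparr>"

text \<open>The triple over \<open>R\<^sup>m\<close> given by matrices \<open>\<Theta>\<^sub>1\<close>, \<open>\<Theta>\<^sub>2\<close> with \<open>m\<close> rows: \<open>\<theta>\<close> is adjoint to
  \<open>(v\<^sub>1, v\<^sub>2) \<mapsto> \<Sum>\<^sub>i ((\<Theta>\<^sub>1 v\<^sub>1)\<^sub>i, (\<Theta>\<^sub>2 v\<^sub>2)\<^sub>i) \<otimes> e\<^sub>i\<close>.\<close>

definition matrix_triple ::
    "'k::field fls mat \<Rightarrow> 'k fls mat \<Rightarrow> ('k, 'k fps2 vec, 'k fls vec \<times> 'k fls vec) triple" where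
  "matrix_triple \<Theta>1 \<Theta>2 =
     (let m = dim_row \<Theta>1; F = module_vec TYPE('k fps2) m; V = L_space (dim_col \<Theta>1) (dim_col \<Theta>2)
      in (F, V, base_change_adjoint ring_QA ring_QR (\<lambda>c. c) V (QR_R F)
            (\<lambda>(v1, v2). \<Oplus>\<^bsub>QR_R F\<^esub>i\<in>{..<m}.
               pure_tensor ring_R ring_QR restr_axes F
                 (vec_index (\<Theta>1 *\<^sub>v v1) i, vec_index (\<Theta>2 *\<^sub>v v2) i) (unit_vec m i))))"

definition has_gluing_datum :: "('k::field fps2, 'm) module \<Rightarrow> 'k fls mat \<Rightarrow> 'k fls mat \<Rightarrow> bool" where
  "has_gluing_datum M \<Theta>1 \<Theta>2 \<longleftrightarrow> triple_isomorphic (triple_of_module M) (matrix_triple \<Theta>1 \<Theta>2)"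

definition has_rank :: "('k::field fps2, 'm) module \<Rightarrow> nat \<Rightarrow> bool" where
  "has_rank M m \<longleftrightarrow> module_isomorphic ring_R (reflexive_hull M) (module_vec TYPE('k fps2) m)"


section \<open>The list of gluing data and ideals\<close>

abbreviation glue_1 :: "'k::field fls mat" where "glue_1 \<equiv> mat_of_rows_list 1 [[1]]"
abbreviation glue_z :: "'k::field fls mat" where "glue_z \<equiv> mat_of_rows_list 1 [[fls_X]]"
abbreviation glue_1z :: "'k::field fls mat" where "glue_1z \<equiv> mat_of_rows_list 2 [[1, fls_X]]"

definition upper_part :: "('k::field fls mat \<times> 'k fls mat \<times> 'k fps2 set) list" where
  "upper_part =
     [(glue_1, glue_1, carrier ring_A),
      (glue_z, glue_z, Idl\<^bsub>ring_A\<^esub> {el_w ^ 2, el_a, el_b}),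
      (glue_z, glue_1, Idl\<^bsub>ring_A\<^esub> {el_w ^ 2, el_a, el_v * el_w}),
      (glue_1, glue_z, Idl\<^bsub>ring_A\<^esub> {el_w ^ 2, el_b, el_u * el_w})]"

definition lower_part :: "('k::field fls mat \<times> 'k fls mat \<times> 'k fps2 set) list" where
  "lower_part =
     [(glue_1z, glue_1z, conductor_A),
      (glue_1, glue_1z, Idl\<^bsub>ring_A\<^esub> {el_w, el_b}),
      (glue_1z, glue_1, Idl\<^bsub>ring_A\<^esub> {el_w, el_a}),
      (glue_z, glue_1z, Idl\<^bsub>ring_A\<^esub> {el_w ^ 2, el_a, el_b, el_v * el_w}),
      (glue_1z, glue_z, Idl\<^bsub>ring_A\<^esub> {el_w ^ 2, el_a, el_b, el_u * el_w})]"

end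

theory Submission
  imports Defs
begin

text \<open>Restriction to the axes sends \<open>f\<close> to \<open>(f(z,0), f(0,z))\<close>, with kernel \<open>w R \<subseteq> A\<close>, and \<open>f\<close> lies in \<open>A\<close> iff both
  restrictions are even. Every module of the list is, up to a factor \<open>w\<close>, of the form
  \<open>{f \<in> R. f(z,0) has exponents in P, f(0,z) has exponents in Q}\<close> with \<open>P\<close>, \<open>Q\<close> the even, the odd or all exponents;
  \<open>P\<close> and \<open>Q\<close> correspond to the gluing matrices \<open>(1)\<close>, \<open>(z)\<close>, \<open>(1 z)\<close>. All \<open>A\<close>-linear maps from such a module to \<open>R\<close>
  are multiplications, which gives the rank, the triples, and the absence of isomorphisms.

  Conversely, a maximal Cohen--Macaulay module of rank one is torsion-free and embeds in \<open>R\<close> as an \<open>A\<close>-module \<open>V\<close> with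
  \<open>(R : V) = R\<close>. The ideal \<open>V R\<close> then contains powers of \<open>x\<close> and \<open>y\<close>, and since the depth is two, \<open>w R \<subseteq> V\<close>. So \<open>V\<close> is
  determined by its restrictions to the axes; these are \<open>\<k>[[z\<^sup>2]]\<close>-submodules of \<open>\<k>[[z]]\<close> closed under division by
  \<open>z\<^sup>2\<close>, and each is a unit times one of the three sets of series above.\<close>

section \<open>Power series in two variables and their restrictions to the axes\<close>

text \<open>The equivalence with triples is not invoked: modules are compared inside R, and triples
  are computed only for the listed ideals. The comparison works because every shape contains
  \<open>el_w\<close> and some powers of x and y, which forces a linear map to R to be determined by
  its value at \<open>el_w\<close>.

  For an abstract module, rank one speaks only about the bidual of the base change. It yields a map
  to R of which every other map to R is a multiple, but not the injectivity of that map. Injectivity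
  needs functionals that separate elements, hence torsion-freeness, and here lies the obstacle. A
  torsion element turns out to be infinitely divisible by the first member f of a regular sequence,
  so a form of Krull's intersection theorem has to exclude it; the chain condition comes from power
  series in five variables, of which A is a quotient.

  The same elementary statement, that non-units are nilpotent modulo two elements in the weak sense
  of \<open>bset\<close>, bounds the dimension, bounds the depth and gives this
  divisibility.\<close>

abbreviation cf :: "'k::zero fps2 \<Rightarrow> nat \<Rightarrow> nat \<Rightarrow> 'k" where
  "cf f i j \<equiv> fps_nth (fps_nth f i) j"

definition rx :: "'k::field fps2 \<Rightarrow> 'k fps" where
  "rx f = Abs_fps (\<lambda>i. cf f i 0)"

definition ry :: "'k::field fps2 \<Rightarrow> 'k fps" where
  "ry f = fps_nth f 0"

definition cx :: "'k::field fps \<Rightarrow> 'k fps2" where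
  "cx \<alpha> = Abs_fps (\<lambda>i. fps_const (fps_nth \<alpha> i))"

definition cy :: "'k::field fps \<Rightarrow> 'k fps2" where
  "cy \<beta> = fps_const \<beta>"

text \<open>Exchanging x and y is an automorphism of R that fixes w and preserves A. It carries
  statements about the x-axis to the y-axis.\<close>

definition sw :: "'k::field fps2 \<Rightarrow> 'k fps2" where
  "sw f = Abs_fps (\<lambda>j. Abs_fps (\<lambda>i. cf f i j))"

lemma fps2_eqI: "(\<And>i j. cf f i j = cf g i j) \<Longrightarrow> f = g"
  by (simp add: fps_eq_iff)

lemma nth_rx [simp]: "fps_nth (rx f) i = cf f i 0"
  by (simp add: rx_def)

lemma nth_ry [simp]: "fps_nth (ry f) j = cf f 0 j"
  by (simp add: ry_def)

lemma rx_1 [simp]: "rx 1 = 1"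
  by (rule fps_ext) (simp add: fps_one_nth)

lemma rx_hom [simp]:
  "rx (f + g) = rx f + rx g" "rx (f * g) = rx f * rx g" "rx 0 = 0"
  "rx (f - g) = rx f - rx g" "rx (- f) = - rx f" "rx (f ^ n) = rx f ^ n"
proof -
  have m: "rx (f * g) = rx f * rx g" for f g :: "'a fps2"
    by (rule fps_ext) (simp add: fps_mult_nth fps_sum_nth)
  show "rx (f * g) = rx f * rx g"
    by (rule m)
  show "rx (f ^ n) = rx f ^ n"
    by (induction n) (simp_all add: m)
qed (rule fps_ext; simp)+

lemma ry_hom [simp]:
  "ry (f + g) = ry f + ry g" "ry (f * g) = ry f * ry g" "ry 0 = 0" "ry 1 = 1"
  "ry (f - g) = ry f - ry g" "ry (- f) = - ry f" "ry (f ^ n) = ry f ^ n"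
  by (simp_all add: ry_def fps_power_zeroth)

lemma cx_1 [simp]: "cx 1 = 1"
  by (rule fps_ext) (simp add: cx_def)

lemma cx_hom [simp]:
  "cx (\<alpha> + \<beta>) = cx \<alpha> + cx \<beta>" "cx (\<alpha> * \<beta>) = cx \<alpha> * cx \<beta>" "cx 0 = 0"
  "cx (\<alpha> - \<beta>) = cx \<alpha> - cx \<beta>" "cx (\<alpha> ^ n) = cx \<alpha> ^ n"
proof -
  have s: "fps_const (sum g S) = (\<Sum>i\<in>S. fps_const (g i))" for g :: "nat \<Rightarrow> 'a" and S
    by (induction S rule: infinite_finite_induct) (simp_all flip: fps_const_add)
  have m: "cx (\<alpha> * \<beta>) = cx \<alpha> * cx \<beta>" for \<alpha> \<beta> :: "'a fps"
    by (rule fps_ext) (simp add: cx_def fps_mult_nth s flip: fps_const_mult)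
  show "cx (\<alpha> * \<beta>) = cx \<alpha> * cx \<beta>"
    by (rule m)
  show "cx (\<alpha> ^ n) = cx \<alpha> ^ n"
    by (induction n) (simp_all add: m)
qed (rule fps_ext; simp add: cx_def)+

lemma cy_hom [simp]:
  "cy (\<alpha> + \<beta>) = cy \<alpha> + cy \<beta>" "cy (\<alpha> * \<beta>) = cy \<alpha> * cy \<beta>" "cy 0 = 0" "cy 1 = 1"
  "cy (\<alpha> - \<beta>) = cy \<alpha> - cy \<beta>"
  by (simp_all add: cy_def)

lemma rx_cx [simp]: "rx (cx \<alpha>) = \<alpha>" and ry_cx [simp]: "ry (cx \<alpha>) = fps_const (fps_nth \<alpha> 0)"
  and rx_cy [simp]: "rx (cy \<beta>) = fps_const (fps_nth \<beta> 0)" and ry_cy [simp]: "ry (cy \<beta>) = \<beta>"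
  by (auto simp: fps_eq_iff cx_def cy_def)

lemma cx_X [simp]: "cx fps_X = el_x"
  by (rule fps_ext) (simp add: cx_def el_x_def fps_X_def)

lemma cy_X [simp]: "cy fps_X = el_y"
  by (simp add: cy_def el_y_def)

lemma axes_xy [simp]: "rx el_x = fps_X" "rx el_y = 0" "ry el_x = 0" "ry el_y = fps_X"
  by (auto simp: fps_eq_iff el_x_def el_y_def fps_X_def)

lemma axes_w [simp]: "rx el_w = 0" "ry el_w = 0"
  by (simp_all add: el_w_def)

lemma xy_nonzero [simp]: "el_x \<noteq> 0" "el_y \<noteq> 0" "el_w \<noteq> 0"
  by (simp_all add: el_x_def el_y_def el_w_def)

lemma ry_zero_iff: "ry f = 0 \<longleftrightarrow> el_x dvd f"
proof
  assume "ry f = 0"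
  then have "f = el_x * fps_shift 1 f"
    by (intro fps_ext) (simp add: el_x_def ry_def)
  then show "el_x dvd f" ..
qed (auto simp: dvd_def)

lemma sw_sw [simp]: "sw (sw f) = f"
  by (rule fps2_eqI) (simp add: sw_def)

lemma rx_sw [simp]: "rx (sw f) = ry f" and ry_sw [simp]: "ry (sw f) = rx f"
  by (auto simp: fps_eq_iff sw_def)

lemma cf_mult: "cf (f * g) i j = (\<Sum>a=0..i. \<Sum>b=0..j. cf f a b * cf g (i - a) (j - b))"
  by (simp add: fps_mult_nth fps_sum_nth)

lemma sw_1 [simp]: "sw 1 = 1"
  by (rule fps2_eqI) (simp add: sw_def fps_one_nth)

lemma sw_hom [simp]:
  "sw (f + g) = sw f + sw g" "sw (f * g) = sw f * sw g" "sw 0 = 0" "sw (f ^ n) = sw f ^ n"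
proof -
  have m: "sw (f * g) = sw f * sw g" for f g :: "'a fps2"
  proof (rule fps2_eqI)
    fix i j
    have "cf (sw (f * g)) i j = (\<Sum>a=0..j. \<Sum>b=0..i. cf f a b * cf g (j - a) (i - b))"
      by (simp add: sw_def cf_mult)
    also have "\<dots> = (\<Sum>b=0..i. \<Sum>a=0..j. cf f a b * cf g (j - a) (i - b))"
      by (rule sum.swap)
    also have "\<dots> = cf (sw f * sw g) i j"
      by (simp add: sw_def cf_mult)
    finally show "cf (sw (f * g)) i j = cf (sw f * sw g) i j" .
  qed
  show "sw (f * g) = sw f * sw g"
    by (rule m)
  show "sw (f ^ n) = sw f ^ n"
    by (induction n) (simp_all add: m)
qed (rule fps2_eqI; simp add: sw_def)+

lemma sw_xy [simp]: "sw el_x = el_y" "sw el_y = el_x"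
  by (rule fps2_eqI; simp add: sw_def el_x_def el_y_def fps_X_def)+

lemma sw_w [simp]: "sw el_w = el_w"
  by (simp add: el_w_def mult.commute)

lemma sw_eq_0_iff [simp]: "sw f = 0 \<longleftrightarrow> f = 0"
  by (metis sw_sw sw_hom(3))

lemma sw_dvd: "f dvd g \<Longrightarrow> sw f dvd sw g"
  by (auto simp: dvd_def)

lemma rx_zero_iff: "rx f = 0 \<longleftrightarrow> el_y dvd f"
  using ry_zero_iff[of "sw f"] sw_dvd[of el_y f] sw_dvd[of el_x "sw f"] by auto

lemma axes_zero_iff: "rx f = 0 \<and> ry f = 0 \<longleftrightarrow> el_w dvd f"
proof
  assume a: "rx f = 0 \<and> ry f = 0"
  then obtain g where g: "f = el_x * g"
    by (auto simp: ry_zero_iff dvd_def)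
  with a have "rx g = 0"
    by simp
  then show "el_w dvd f"
    by (auto simp: rx_zero_iff g el_w_def)
qed (auto simp: dvd_def)

text \<open>The two restrictions share their constant term, so the sum of their lifts minus this
  term has the same restrictions as f. The difference then vanishes on both axes and is a multiple
  of w.\<close>

lemma axes_decomp:
  obtains r where "f = cx (rx f) + cy (ry f) - cx (fps_const (cf f 0 0)) + el_w * r"
proof -
  let ?g = "f - (cx (rx f) + cy (ry f) - cx (fps_const (cf f 0 0)))"
  have "rx ?g = 0 \<and> ry ?g = 0"
    by simp
  then obtain r where "?g = el_w * r"
    by (auto simp only: axes_zero_iff dvd_def)
  then have "f = cx (rx f) + cy (ry f) - cx (fps_const (cf f 0 0)) + el_w * r"
    by (simp add: algebra_simps)
  then show thesis
    by (rule that)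
qed

lemma fps_unit_inverse:
  fixes \<epsilon> :: "'k::field fps"
  assumes "fps_nth \<epsilon> 0 \<noteq> 0"
  obtains \<eta> where "\<epsilon> * \<eta> = 1" "fps_nth \<eta> 0 \<noteq> 0"
  using assms inverse_mult_eq_1'[of \<epsilon>] by (intro that[of "inverse \<epsilon>"]) auto

lemma fps2_unit_inverse:
  fixes f :: "'k::field fps2"
  assumes "cf f 0 0 \<noteq> 0"
  obtains g where "f * g = 1"
proof -
  obtain \<eta> where \<eta>: "fps_nth f 0 * \<eta> = 1" "fps_nth \<eta> 0 \<noteq> 0"
    by (rule fps_unit_inverse[OF assms])
  show thesis
    by (rule that[OF fps_right_inverse[OF \<eta>(1)]])
qed

lemma fps_factor:
  fixes \<alpha> :: "'k::field fps"
  assumes "\<alpha> \<noteq> 0"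
  obtains n \<epsilon> where "\<alpha> = fps_X ^ n * \<epsilon>" "fps_nth \<epsilon> 0 \<noteq> 0"
proof (rule that)
  show "\<alpha> = fps_X ^ subdegree \<alpha> * fps_shift (subdegree \<alpha>) \<alpha>"
    by (subst mult.commute) (rule subdegree_decompose)
qed (use assms in simp)

lemma fps2_factor_x:
  assumes "f \<noteq> 0"
  obtains n g where "f = el_x ^ n * g" "ry g \<noteq> 0"
proof (rule that)
  show "f = el_x ^ subdegree f * fps_shift (subdegree f) f"
    unfolding el_x_def by (subst mult.commute) (rule subdegree_decompose)
  show "ry (fps_shift (subdegree f) f) \<noteq> 0"
    using assms by (simp add: ry_def)
qed

lemma fps2_factor_y:
  assumes "f \<noteq> 0"
  obtains n g where "f = el_y ^ n * g" "rx g \<noteq> 0"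
proof -
  obtain n g where "sw f = el_x ^ n * g" "ry g \<noteq> 0"
    using fps2_factor_x[of "sw f"] assms by auto
  then show thesis
    using that[of n "sw g"] by (metis sw_sw sw_hom(2,4) sw_xy(1) rx_sw)
qed

section \<open>Series with prescribed exponents and the fractional ideals they define\<close>

definition supp_on :: "(nat \<Rightarrow> bool) \<Rightarrow> 'k::field fps set" where
  "supp_on P = {\<alpha>. \<forall>i. fps_nth \<alpha> i \<noteq> 0 \<longrightarrow> P i}"

text \<open>The choice \<open>even\<close>, \<open>even\<close> gives A and the choice of all
  exponents on both axes gives R. Every choice contains w R, the conductor.\<close>

definition Mset :: "(nat \<Rightarrow> bool) \<Rightarrow> (nat \<Rightarrow> bool) \<Rightarrow> 'k::field fps2 set" where
  "Mset P Q = {f. rx f \<in> supp_on P \<and> ry f \<in> supp_on Q}"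

text \<open>Periodicity with period two makes \<open>supp_on P\<close> stable under multiplication
  by even series and under division by \<open>fps_X ^ 2\<close>.\<close>

definition per2 :: "(nat \<Rightarrow> bool) \<Rightarrow> bool" where
  "per2 P \<longleftrightarrow> (\<forall>i. P (i + 2) = P i)"

lemma per2_simps [simp]: "per2 even" "per2 odd" "per2 (\<lambda>_. True)"
  by (simp_all add: per2_def)

lemma per2D: "per2 P \<Longrightarrow> even i \<Longrightarrow> P (i + j) = P j"
proof -
  assume P: "per2 P" and i: "even i"
  then obtain k where k: "i = 2 * k" by auto
  have "P (2 * k + j) = P j"
  proof (induction k)
    case (Suc k)
    then show ?case
      using P[unfolded per2_def, rule_format, of "2 * k + j"] by (simp add: algebra_simps)
  qed simp
  then show ?thesis
    by (simp add: k)
qed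

lemma supp_on_simps [simp]:
  "0 \<in> supp_on P" "\<alpha> \<in> supp_on P \<Longrightarrow> \<beta> \<in> supp_on P \<Longrightarrow> \<alpha> + \<beta> \<in> supp_on P"
  "\<alpha> \<in> supp_on P \<Longrightarrow> - \<alpha> \<in> supp_on P" "\<alpha> \<in> supp_on P \<Longrightarrow> \<beta> \<in> supp_on P \<Longrightarrow> \<alpha> - \<beta> \<in> supp_on P"
  "P 0 \<Longrightarrow> fps_const c \<in> supp_on P" "P 0 \<Longrightarrow> 1 \<in> supp_on P"
  "\<alpha> \<in> supp_on (\<lambda>_. True)"
      apply (auto simp: supp_on_def split: if_splits)
   apply (metis add_0)
  by (metis diff_0_right)

lemma supp_on_mult:
  assumes P: "per2 P" and a: "\<alpha> \<in> supp_on even" and b: "\<beta> \<in> supp_on P"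
  shows "\<alpha> * \<beta> \<in> supp_on P"
  unfolding supp_on_def
proof (intro CollectI allI impI)
  fix n
  assume "fps_nth (\<alpha> * \<beta>) n \<noteq> 0"
  then have "(\<Sum>i=0..n. fps_nth \<alpha> i * fps_nth \<beta> (n - i)) \<noteq> 0"
    by (simp add: fps_mult_nth)
  then obtain i where i: "i \<le> n" "fps_nth \<alpha> i * fps_nth \<beta> (n - i) \<noteq> 0"
    by (meson atLeastAtMost_iff sum.not_neutral_contains_not_neutral)
  then have "even i" "P (n - i)"
    using a b by (auto simp: supp_on_def)
  then show "P n"
    using per2D[OF P, of i "n - i"] i by simp
qed

lemma supp_on_X_power_mult: "fps_X ^ n * \<alpha> \<in> supp_on P \<longleftrightarrow> \<alpha> \<in> supp_on (\<lambda>i. P (i + n))"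
  by (auto simp: supp_on_def fps_X_power_mult_nth)

lemma supp_on_X_even_mult:
  assumes "per2 P" "even n"
  shows "fps_X ^ n * \<alpha> \<in> supp_on P \<longleftrightarrow> \<alpha> \<in> supp_on P"
  using per2D[OF assms] by (simp add: supp_on_X_power_mult add.commute)

lemma X_power_supp_on [simp]: "fps_X ^ n \<in> supp_on P \<longleftrightarrow> P n"
  by (auto simp: supp_on_def fps_X_power_nth)

lemma X_supp_on [simp]: "fps_X \<in> supp_on P \<longleftrightarrow> P 1"
  using X_power_supp_on[of 1 P] by simp

text \<open>At the least odd exponent n of \<beta>, every product in the coefficient of
  \<open>\<alpha> * \<beta>\<close> except the one with the constant term of \<alpha> vanishes, by
  parity or by minimality. That coefficient is zero because the product is 1, which contradicts the
  choice of n.\<close>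

lemma supp_on_even_inverse:
  assumes a: "\<alpha> \<in> supp_on even" and ab: "\<alpha> * \<beta> = 1"
  shows "\<beta> \<in> supp_on even"
proof (rule ccontr)
  assume "\<beta> \<notin> supp_on even"
  then have ex: "\<exists>i. odd i \<and> fps_nth \<beta> i \<noteq> 0"
    by (auto simp: supp_on_def)
  define n where "n = (LEAST i. odd i \<and> fps_nth \<beta> i \<noteq> 0)"
  have n: "odd n" "fps_nth \<beta> n \<noteq> 0"
    using LeastI_ex[OF ex] by (auto simp: n_def)
  have less: "fps_nth \<beta> i = 0" if "i < n" "odd i" for i
    using not_less_Least[of i "\<lambda>i. odd i \<and> fps_nth \<beta> i \<noteq> 0"] that by (auto simp: n_def)
  have "fps_nth \<alpha> i * fps_nth \<beta> (n - i) = 0" if "i \<in> {1..n}" for i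
    using a less[of "n - i"] that n by (cases "even i") (auto simp: supp_on_def)
  then have "(\<Sum>i=1..n. fps_nth \<alpha> i * fps_nth \<beta> (n - i)) = 0"
    by (rule sum.neutral[OF ballI])
  then have "fps_nth (\<alpha> * \<beta>) n = fps_nth \<alpha> 0 * fps_nth \<beta> n"
    by (simp add: fps_mult_nth sum.atLeast_Suc_atMost)
  moreover have "fps_nth \<alpha> 0 \<noteq> 0"
    using arg_cong[OF ab, of "\<lambda>f. fps_nth f 0"] by (cases "fps_nth \<alpha> 0 = 0") simp_all
  moreover have "fps_nth (\<alpha> * \<beta>) n = 0"
    using n(1) unfolding ab by (cases n) simp_all
  ultimately show False
    using n(2) by simp
qed

lemma Mset_add: "f \<in> Mset P Q \<Longrightarrow> g \<in> Mset P Q \<Longrightarrow> f + g \<in> Mset P Q"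
  and Mset_diff: "f \<in> Mset P Q \<Longrightarrow> g \<in> Mset P Q \<Longrightarrow> f - g \<in> Mset P Q"
  and Mset_uminus: "f \<in> Mset P Q \<Longrightarrow> - f \<in> Mset P Q"
  and Mset_0: "0 \<in> Mset P Q"
  by (simp_all add: Mset_def)

lemma Mset_mult:
  "per2 P \<Longrightarrow> per2 Q \<Longrightarrow> f \<in> Mset even even \<Longrightarrow> g \<in> Mset P Q \<Longrightarrow> f * g \<in> Mset P Q"
  by (simp add: Mset_def supp_on_mult)

lemma w_mult_Mset [simp]: "el_w * f \<in> Mset P Q"
  by (simp add: Mset_def)

lemma Mset_all [simp]: "Mset (\<lambda>_. True) (\<lambda>_. True) = UNIV"
  by (simp add: Mset_def)

lemma sw_Mset: "sw f \<in> Mset P Q \<longleftrightarrow> f \<in> Mset Q P"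
  by (auto simp: Mset_def)

section \<open>The presentation of A\<close>

text \<open>The bidegree in x and y of the monomial with these exponents of u, v, w, a, b after the
  substitution.\<close>

fun wt5 :: "nat \<times> nat \<times> nat \<times> nat \<times> nat \<Rightarrow> nat \<times> nat" where
  "wt5 (p, q, r, s, t) = (2 * p + r + 2 * s + t, 2 * q + r + s + 2 * t)"

abbreviation exps :: "nat \<Rightarrow> nat \<Rightarrow> (nat \<times> nat \<times> nat \<times> nat \<times> nat) set" where
  "exps i j \<equiv> {e. wt5 e = (i, j)}"

definition cP :: "'k::field fps5 \<Rightarrow> nat \<times> nat \<times> nat \<times> nat \<times> nat \<Rightarrow> 'k" where
  "cP F = (\<lambda>(p, q, r, s, t). fps_nth (fps_nth (fps_nth (fps_nth (fps_nth F p) q) r) s) t)"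

lemma cf_subst_P: "cf (subst_P F) i j = (\<Sum>e\<in>exps i j. cP F e)"
proof -
  have "exps i j = {(p, q, r, s, t). 2 * p + r + 2 * s + t = i \<and> 2 * q + r + s + 2 * t = j}"
    by auto
  then show ?thesis
    by (simp add: subst_P_def cP_def)
qed

lemma finite_exps: "finite (exps i j)"
proof (rule finite_subset)
  show "exps i j \<subseteq> {..i} \<times> {..j} \<times> {..i} \<times> {..i} \<times> {..i}"
    by auto
qed simp

fun box :: "nat \<times> nat \<times> nat \<times> nat \<times> nat \<Rightarrow> (nat \<times> nat \<times> nat \<times> nat \<times> nat) set" where
  "box (p, q, r, s, t) = {0..p} \<times> {0..q} \<times> {0..r} \<times> {0..s} \<times> {0..t}"

fun diff5 :: "nat \<times> nat \<times> nat \<times> nat \<times> nat \<Rightarrow> nat \<times> nat \<times> nat \<times> nat \<times> nat \<Rightarrow> nat \<times> nat \<times> nat \<times> nat \<times> nat" where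
  "diff5 (p, q, r, s, t) (p', q', r', s', t') = (p - p', q - q', r - r', s - s', t - t')"

fun add5 :: "nat \<times> nat \<times> nat \<times> nat \<times> nat \<Rightarrow> nat \<times> nat \<times> nat \<times> nat \<times> nat \<Rightarrow> nat \<times> nat \<times> nat \<times> nat \<times> nat" where
  "add5 (p, q, r, s, t) (p', q', r', s', t') = (p + p', q + q', r + r', s + s', t + t')"

lemma add5_diff5: "e' \<in> box e \<Longrightarrow> add5 e' (diff5 e e') = e"
  by (cases e; cases e') simp

lemma diff5_add5 [simp]: "diff5 (add5 e e') e = e'"
  by (cases e; cases e') simp

lemma box_add5 [simp]: "e \<in> box (add5 e e')"
  by (cases e; cases e') simp

lemma wt5_add5 [simp]: "wt5 (add5 e e') = (fst (wt5 e) + fst (wt5 e'), snd (wt5 e) + snd (wt5 e'))"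
  by (cases e; cases e') simp

lemma cP_mult: "cP (F * G) e = (\<Sum>e'\<in>box e. cP F e' * cP G (diff5 e e'))"
proof (cases e)
  case (fields p q r s t)
  have "(\<Sum>e'\<in>box e. g e') = (\<Sum>p'=0..p. \<Sum>q'=0..q. \<Sum>r'=0..r. \<Sum>s'=0..s. \<Sum>t'=0..t. g (p', q', r', s', t'))"
    for g :: "nat \<times> nat \<times> nat \<times> nat \<times> nat \<Rightarrow> 'a"
    by (simp add: fields sum.cartesian_product case_prod_beta)
  then show ?thesis
    by (simp add: fields cP_def fps_mult_nth fps_sum_nth)
qed

text \<open>Both sides sum the products of coefficients over pairs of exponent vectors of total
  bidegree \<open>(i, j)\<close>. The left side groups the pairs by the sum of the vectors, the
  right side by the bidegree of the first one.\<close>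

lemma subst_P_mult [simp]: "subst_P (F * G) = subst_P F * subst_P G"
proof (rule fps2_eqI)
  fix i j
  have "cf (subst_P (F * G)) i j =
      (\<Sum>(e, e')\<in>Sigma (exps i j) box. cP F e' * cP G (diff5 e e'))"
    by (subst sum.Sigma[symmetric]) (auto simp: cf_subst_P cP_mult finite_exps)
  also have "\<dots> = (\<Sum>(ab, e1, e2)\<in>Sigma ({0..i} \<times> {0..j})
      (\<lambda>ab. exps (fst ab) (snd ab) \<times> exps (i - fst ab) (j - snd ab)). cP F e1 * cP G e2)"
  proof (rule sum.reindex_bij_witness[where i = "\<lambda>(ab, e1, e2). (add5 e1 e2, e1)"
        and j = "\<lambda>(e, e'). (wt5 e', e', diff5 e e')"])
    fix z
    assume "z \<in> Sigma (exps i j) box"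
    then obtain e e' where z: "z = (e, e')" "wt5 e = (i, j)" "e' \<in> box e"
      by blast
    have "wt5 (add5 e' (diff5 e e')) = (i, j)"
      by (simp only: add5_diff5[OF z(3)] z(2))
    then have w: "fst (wt5 e') + fst (wt5 (diff5 e e')) = i" "snd (wt5 e') + snd (wt5 (diff5 e e')) = j"
      by simp_all
    show "(case case z of (e, e') \<Rightarrow> (wt5 e', e', diff5 e e') of (ab, e1, e2) \<Rightarrow> (add5 e1 e2, e1)) = z"
      by (simp add: z(1) add5_diff5[OF z(3)])
    show "(case z of (e, e') \<Rightarrow> (wt5 e', e', diff5 e e')) \<in> Sigma ({0..i} \<times> {0..j})
        (\<lambda>ab. exps (fst ab) (snd ab) \<times> exps (i - fst ab) (j - snd ab))"
      unfolding z(1) prod.case mem_Sigma_iff mem_Collect_eq mem_Times_iff using w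
      by (auto simp: prod_eq_iff)
    show "(case case z of (e, e') \<Rightarrow> (wt5 e', e', diff5 e e') of (ab, e1, e2) \<Rightarrow> cP F e1 * cP G e2) =
        (case z of (e, e') \<Rightarrow> cP F e' * cP G (diff5 e e'))"
      by (simp add: z(1))
  next
    fix z
    assume "z \<in> Sigma ({0..i} \<times> {0..j}) (\<lambda>ab. exps (fst ab) (snd ab) \<times> exps (i - fst ab) (j - snd ab))"
    then obtain a b e1 e2 where z: "z = ((a, b), e1, e2)" "a \<le> i" "b \<le> j"
      "wt5 e1 = (a, b)" "wt5 e2 = (i - a, j - b)"
      by fastforce
    show "(case case z of (ab, e1, e2) \<Rightarrow> (add5 e1 e2, e1) of (e, e') \<Rightarrow> (wt5 e', e', diff5 e e')) = z"
      by (simp add: z)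
    show "(case z of (ab, e1, e2) \<Rightarrow> (add5 e1 e2, e1)) \<in> Sigma (exps i j) box"
      unfolding z(1) prod.case mem_Sigma_iff mem_Collect_eq using z(2-) by simp
  qed
  also have "\<dots> = (\<Sum>ab\<in>{0..i} \<times> {0..j}.
      \<Sum>(e1, e2)\<in>exps (fst ab) (snd ab) \<times> exps (i - fst ab) (j - snd ab). cP F e1 * cP G e2)"
    by (subst sum.Sigma) (auto simp: finite_exps)
  also have "\<dots> = (\<Sum>ab\<in>{0..i} \<times> {0..j}.
      cf (subst_P F) (fst ab) (snd ab) * cf (subst_P G) (i - fst ab) (j - snd ab))"
    by (simp only: cf_subst_P sum_product sum.cartesian_product)
  also have "\<dots> = cf (subst_P F * subst_P G) i j"
    unfolding cf_mult sum.cartesian_product by (rule sum.cong) auto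
  finally show "cf (subst_P (F * G)) i j = cf (subst_P F * subst_P G) i j" .
qed

lemma subst_P_add [simp]: "subst_P (F + G) = subst_P F + subst_P G"
proof (rule fps2_eqI)
  have c: "cP (F + G) e = cP F e + cP G e" for e
    by (cases e) (simp add: cP_def)
  show "cf (subst_P (F + G)) i j = cf (subst_P F + subst_P G) i j" for i j
    by (simp only: fps_add_nth cf_subst_P c sum.distrib)
qed

lemma subst_P_0 [simp]: "subst_P 0 = 0"
  by (rule fps2_eqI) (simp add: cf_subst_P cP_def case_prod_beta)

lemma subst_P_minus [simp]: "subst_P (- F) = - subst_P F"
  using subst_P_add[of F "- F"] by (simp add: eq_neg_iff_add_eq_0 add.commute)

lemma subst_P_diff [simp]: "subst_P (F - G) = subst_P F - subst_P G"
  using subst_P_add[of F "- G"] by simp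

definition mon5 :: "nat \<times> nat \<times> nat \<times> nat \<times> nat \<Rightarrow> 'k::field fps5" where
  "mon5 = (\<lambda>(p, q, r, s, t). fps_X ^ p * fps_const (fps_X ^ q * fps_const (fps_X ^ r * fps_const
     (fps_X ^ s * fps_const (fps_X ^ t)))))"

lemma cP_mon5: "cP (mon5 e) e' = (if e' = e then 1 else 0)"
  by (cases e; cases e') (auto simp: cP_def mon5_def fps_X_power_mult_nth)

lemma mult_const_nth2: "cf (fps_X ^ m * fps_const (fps_X ^ n)) i j = (if (i, j) = (m, n) then 1 else (0 :: 'k::field))"
  by (auto simp: fps_X_power_mult_nth)

lemma subst_P_mon5: "subst_P (mon5 (p, q, r, s, t)) = el_u ^ p * el_v ^ q * el_w ^ r * el_a ^ s * el_b ^ t"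
proof (rule fps2_eqI)
  fix i j
  have "el_u ^ p * el_v ^ q * el_w ^ r * el_a ^ s * el_b ^ t
      = el_x ^ (2 * p + r + 2 * s + t) * el_y ^ (2 * q + r + s + 2 * t)"
    unfolding el_u_def el_v_def el_w_def el_a_def el_b_def power_mult_distrib power_add power_mult
    by (simp add: algebra_simps flip: power_mult)
  also have "\<dots> = fps_X ^ (2 * p + r + 2 * s + t) * fps_const (fps_X ^ (2 * q + r + s + 2 * t) :: 'a fps)"
    by (simp add: el_x_def el_y_def)
  finally have "cf (el_u ^ p * el_v ^ q * el_w ^ r * el_a ^ s * el_b ^ t :: 'a fps2) i j
      = (if (i, j) = wt5 (p, q, r, s, t) then 1 else 0)"
    by (simp only: mult_const_nth2 wt5.simps)
  moreover have "cf (subst_P (mon5 (p, q, r, s, t)) :: 'a fps2) i j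
      = (if (p, q, r, s, t) \<in> exps i j then 1 else 0)"
    by (simp only: cf_subst_P cP_mon5 sum.delta[OF finite_exps])
  ultimately show "cf (subst_P (mon5 (p, q, r, s, t))) i j
      = cf (el_u ^ p * el_v ^ q * el_w ^ r * el_a ^ s * el_b ^ t :: 'a fps2) i j"
    by auto
qed

lemma subst_P_vars [simp]:
  "subst_P fps_X = el_u"
  "subst_P (fps_const fps_X) = el_v"
  "subst_P (fps_const (fps_const fps_X)) = el_w"
  "subst_P (fps_const (fps_const (fps_const fps_X))) = el_a"
  "subst_P (fps_const (fps_const (fps_const (fps_const fps_X)))) = el_b"
  using subst_P_mon5[of 1 0 0 0 0] subst_P_mon5[of 0 1 0 0 0] subst_P_mon5[of 0 0 1 0 0]
    subst_P_mon5[of 0 0 0 1 0] subst_P_mon5[of 0 0 0 0 1]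
  by (simp_all add: mon5_def)

lemma subst_P_1 [simp]: "subst_P 1 = 1"
  using subst_P_mon5[of 0 0 0 0 0] by (simp add: mon5_def)

lemma subst_P_power [simp]: "subst_P (F ^ n) = subst_P F ^ n"
  by (induction n) simp_all

text \<open>These are the series c0 + c1 w + c2 a + c3 b with coefficients in \<k>[[u,v]]. The six
  relations rewrite each product of two among w, a, b, so normal forms represent all
  classes.\<close>

definition normal_forms :: "'k::field fps5 set" where
  "normal_forms = {F. \<forall>p q r s t. cP F (p, q, r, s, t) \<noteq> 0 \<longrightarrow> r + s + t \<le> 1}"

text \<open>Monomials in normal form have pairwise different bidegrees: the parities of the two
  degrees tell which of 1, w, a, b occurs, and then the exponents of u and v are determined. Hence
  each coefficient of the image is a single coefficient of F.\<close>

lemma cf_subst_P_normal: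
  assumes "F \<in> normal_forms"
  shows "cf (subst_P F) (2 * p) (2 * q) = cP F (p, q, 0, 0, 0)"
    and "cf (subst_P F) (2 * p + 1) (2 * q + 1) = cP F (p, q, 1, 0, 0)"
    and "cf (subst_P F) (2 * p + 2) (2 * q + 1) = cP F (p, q, 0, 1, 0)"
    and "cf (subst_P F) (2 * p + 1) (2 * q + 2) = cP F (p, q, 0, 0, 1)"
proof -
  have single: "cf (subst_P F) i j = cP F e"
    if "e \<in> exps i j"
      and u: "\<And>p q r s t. (p, q, r, s, t) \<in> exps i j \<Longrightarrow>
        (r, s, t) \<in> {(0, 0, 0), (1, 0, 0), (0, 1, 0), (0, 0, 1)} \<Longrightarrow> (p, q, r, s, t) = e" for i j e
  proof -
    have "cP F e' = 0" if e': "e' \<in> exps i j - {e}" for e'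
    proof -
      obtain p q r s t where [simp]: "e' = (p, q, r, s, t)"
        by (cases e')
      have "\<not> r + s + t \<le> 1"
        using u[of p q r s t] e' by (cases "r = 0"; cases "s = 0"; cases "t = 0") (auto simp: le_Suc_eq)
      moreover have "cP F (p, q, r, s, t) \<noteq> 0 \<longrightarrow> r + s + t \<le> 1"
        using assms by (simp add: normal_forms_def)
      ultimately show ?thesis
        by auto
    qed
    then have "sum (cP F) (exps i j) = sum (cP F) {e}"
      using that(1) by (intro sum.mono_neutral_right[OF finite_exps]) auto
    then show ?thesis
      by (simp add: cf_subst_P)
  qed
  show "cf (subst_P F) (2 * p) (2 * q) = cP F (p, q, 0, 0, 0)"
    and "cf (subst_P F) (2 * p + 1) (2 * q + 1) = cP F (p, q, 1, 0, 0)"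
    and "cf (subst_P F) (2 * p + 2) (2 * q + 1) = cP F (p, q, 0, 1, 0)"
    and "cf (subst_P F) (2 * p + 1) (2 * q + 2) = cP F (p, q, 0, 0, 1)"
    by (rule single; auto; presburger)+
qed

lemma subst_P_in_Mset: "subst_P F \<in> Mset even even"
proof -
  have "exps i 0 = {}" "exps 0 i = {}" if "odd i" for i
    using that by auto
  then have "cf (subst_P F) i 0 = 0" "cf (subst_P F) 0 i = 0" if "odd i" for i
    by (simp_all only: cf_subst_P that not_False_eq_True sum.empty)
  then show ?thesis
    by (auto simp: Mset_def supp_on_def)
qed

text \<open>The four families of bidegrees of normal forms miss exactly the pairs in which one
  exponent is zero and the other is odd. There a series with even restrictions has no coefficient,
  so a preimage in normal form can be read off.\<close>

lemma range_subst_P: "range subst_P = (Mset even even :: 'k::field fps2 set)"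
proof (intro equalityI subsetI)
  fix f :: "'k fps2"
  assume "f \<in> range subst_P"
  then show "f \<in> Mset even even"
    using subst_P_in_Mset by auto
next
  fix f :: "'k fps2"
  assume f: "f \<in> Mset even even"
  define F :: "'k fps5" where
    "F = Abs_fps (\<lambda>p. Abs_fps (\<lambda>q. Abs_fps (\<lambda>r. Abs_fps (\<lambda>s. Abs_fps (\<lambda>t.
       if r + s + t \<le> 1 then cf f (2 * p + r + 2 * s + t) (2 * q + r + s + 2 * t) else 0)))))"
  have cF: "cP F (p, q, r, s, t) =
      (if r + s + t \<le> 1 then cf f (2 * p + r + 2 * s + t) (2 * q + r + s + 2 * t) else 0)" for p q r s t
    by (simp add: cP_def F_def)
  have F: "F \<in> normal_forms"
    by (auto simp: normal_forms_def cF)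
  have z: "cf g i 0 = 0" "cf g 0 i = 0" if "odd i" "g \<in> Mset even even" for i and g :: "'k fps2"
    using that by (auto simp: Mset_def supp_on_def)
  have "cf (subst_P F) i j = cf f i j" for i j
  proof -
    consider p q where "i = 2 * p" "j = 2 * q" | p q where "i = 2 * p + 1" "j = 2 * q + 1"
      | p q where "i = 2 * p + 2" "j = 2 * q + 1" | p q where "i = 2 * p + 1" "j = 2 * q + 2"
      | "i = 0" "odd j" | "odd i" "j = 0"
    proof -
      assume th: "\<And>p q. i = 2 * p \<Longrightarrow> j = 2 * q \<Longrightarrow> thesis"
        "\<And>p q. i = 2 * p + 1 \<Longrightarrow> j = 2 * q + 1 \<Longrightarrow> thesis"
        "\<And>p q. i = 2 * p + 2 \<Longrightarrow> j = 2 * q + 1 \<Longrightarrow> thesis"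
        "\<And>p q. i = 2 * p + 1 \<Longrightarrow> j = 2 * q + 2 \<Longrightarrow> thesis"
        "i = 0 \<Longrightarrow> odd j \<Longrightarrow> thesis" "odd i \<Longrightarrow> j = 0 \<Longrightarrow> thesis"
      have c: "k = 0 \<or> (\<exists>p. k = 2 * p + 2) \<or> (\<exists>p. k = 2 * p + 1)" for k :: nat
        by presburger
      show thesis
        using c[of i]
      proof (elim disjE exE)
        assume "i = 0"
        then show thesis
          using c[of j] th(1)[of 0 "j div 2"] th(5) by auto
      next
        fix p
        assume "i = 2 * p + 2"
        then show thesis
          using c[of j] th(1)[of "p + 1" "j div 2"] th(3)[of p "j div 2"] by auto
      next
        fix p
        assume "i = 2 * p + 1"
        then show thesis
          using c[of j] th(2)[of p "j div 2"] th(4)[of p "j div 2 - 1"] th(6) by auto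
      qed
    qed
    then show ?thesis
    proof cases
      case 5
      then show ?thesis
        using z(2)[OF _ f] z(2)[OF _ subst_P_in_Mset] by simp
    next
      case 6
      then show ?thesis
        using z(1)[OF _ f] z(1)[OF _ subst_P_in_Mset] by simp
    qed (simp_all only: cf_subst_P_normal[OF F] cF, simp_all)
  qed
  then have "f = subst_P F"
    by (intro fps2_eqI) simp
  then show "f \<in> range subst_P"
    by simp
qed

text \<open>Division by power series in \<open>T\<close> whose constant terms admit division with remainder in \<open>N\<close>;
  the quotients are found one power of \<open>T\<close> at a time. Applied to a single series with constant term
  \<open>y\<^sup>d\<close> up to a unit, this is Weierstrass division.\<close>

lemma fps_division:
  fixes d :: "nat \<Rightarrow> 'a::comm_ring_1 fps" and n :: nat
  assumes "\<And>f. \<exists>q. f - (\<Sum>i<n. fps_nth (d i) 0 * q i) \<in> N"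
  shows "\<exists>Q. \<forall>m. fps_nth (F - (\<Sum>i<n. d i * Q i)) m \<in> N"
proof -
  let ?P = "\<lambda>f m r. fps_nth F m - (\<Sum>i<n. \<Sum>j=1..m. fps_nth (d i) j * f (m - j) i)
      - (\<Sum>i<n. fps_nth (d i) 0 * r i) \<in> N"
  have "\<exists>f :: nat \<Rightarrow> nat \<Rightarrow> 'a. \<forall>m. ?P f m (f m)"
  proof (rule dependent_wf_choice[OF wf_less])
    fix f g :: "nat \<Rightarrow> nat \<Rightarrow> 'a" and m r
    assume "\<And>z. (z, m) \<in> {(x, y). x < y} \<Longrightarrow> f z = g z"
    then have "(\<Sum>j=1..m. fps_nth (d i) j * f (m - j) i) = (\<Sum>j=1..m. fps_nth (d i) j * g (m - j) i)" for i
      by (intro sum.cong) auto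
    then show "?P f m r = ?P g m r"
      by simp
  qed (use assms in blast)
  then obtain f where f: "?P f m (f m)" for m
    by blast
  have "fps_nth (F - (\<Sum>i<n. d i * Abs_fps (\<lambda>m. f m i))) m \<in> N" for m
  proof -
    have "fps_nth (F - (\<Sum>i<n. d i * Abs_fps (\<lambda>m. f m i))) m =
        fps_nth F m - (\<Sum>i<n. \<Sum>j=0..m. fps_nth (d i) j * f (m - j) i)"
      by (simp add: fps_sum_nth fps_mult_nth)
    also have "\<dots> = fps_nth F m - (\<Sum>i<n. \<Sum>j=1..m. fps_nth (d i) j * f (m - j) i)
        - (\<Sum>i<n. fps_nth (d i) 0 * f m i)"
      by (simp add: sum.atLeast_Suc_atMost sum.distrib)
    finally show ?thesis
      using f[of m] by (simp only:)
  qed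
  then show ?thesis
    by (intro exI[of _ "\<lambda>i. Abs_fps (\<lambda>m. f m i)"] allI)
qed

lemma lessThan_six: "(\<Sum>i<6. g i) = g 0 + g 1 + g 2 + g 3 + g 4 + g (5::nat)" for g :: "nat \<Rightarrow> 'a::comm_monoid_add"
  by (simp add: eval_nat_numeral)

text \<open>The variables are adjoined in the order a and b, then w, v, u. Setting v or u to zero
  turns the six divisors of a stage into those of the stage before, so \<open>fps_division\<close>
  lifts the division. At the stage of w this works only for the divisors lifting
  \<open>b ^ 2\<close>, \<open>a * b\<close>, \<open>a ^ 2\<close>; the other three vanish at w = 0
  and are divided out separately.\<close>

lemma normal_form_exists:
  fixes F :: "'k::field fps5"
  defines "u \<equiv> fps_X :: 'k fps5" and "v \<equiv> fps_const fps_X :: 'k fps5"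
    and "w \<equiv> fps_const (fps_const fps_X) :: 'k fps5"
    and "a \<equiv> fps_const (fps_const (fps_const fps_X)) :: 'k fps5"
    and "b \<equiv> fps_const (fps_const (fps_const (fps_const fps_X))) :: 'k fps5"
  shows "\<exists>Q. F - ((b ^ 2 - v * w ^ 2) * Q 0 + (a * b - w ^ 3) * Q 1 + (a ^ 2 - u * w ^ 2) * Q 2 +
      (a * w - b * u) * Q 3 + (b * w - a * v) * Q 4 + (w ^ 2 - u * v) * Q (5::nat)) \<in> normal_forms"
proof -
  define N1 :: "'k fps2 set" where "N1 = {f. \<forall>i j. cf f i j \<noteq> 0 \<longrightarrow> i + j \<le> 1}"
  define a1 b1 :: "'k fps2" where "a1 = fps_X" and "b1 = fps_const fps_X"
  have 1: "\<exists>q. f - (\<Sum>i<3. [b1 ^ 2, a1 * b1, a1 ^ 2] ! i * q i) \<in> N1" for f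
  proof -
    \<comment> \<open>The monomials of degree at least two are distributed: those free of a go to
      \<open>b1 ^ 2\<close>, those with exactly one a to \<open>a1 * b1\<close>, the rest to
      \<open>a1 ^ 2\<close>.\<close>
    define q where "q = (!) [fps_const (fps_shift 2 (fps_nth f 0)), fps_const (fps_shift 1 (fps_nth f 1)),
      fps_shift 2 f]"
    have "cf (b1 ^ 2 * q 0 + a1 * b1 * q 1 + a1 ^ 2 * q 2) i j =
        (if i + j \<le> 1 then 0 else cf f i j)" for i j
      by (cases i; cases "i - 1"; cases j)
        (auto simp: a1_def b1_def q_def fps_X_power_mult_nth mult.assoc numeral_2_eq_2)
    then have "f - (\<Sum>i<3. [b1 ^ 2, a1 * b1, a1 ^ 2] ! i * q i) \<in> N1"
      by (simp add: N1_def eval_nat_numeral)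
    then show ?thesis
      by (intro exI[of _ q])
  qed
  define w2 a2 b2 :: "'k fps fps fps" where "w2 = fps_X" and "a2 = fps_const a1" and "b2 = fps_const b1"
  define d2 where "d2 = [b2 ^ 2, a2 * b2 - w2 ^ 3, a2 ^ 2]"
  define N2 where "N2 = {f :: 'k fps fps fps. \<forall>i j k. cf (fps_nth f i) j k \<noteq> 0 \<longrightarrow> i + j + k \<le> 1}"
  have d2_0: "fps_nth (d2 ! i) 0 = [b1 ^ 2, a1 * b1, a1 ^ 2] ! i" if "i < 3" for i
    using that by (auto simp: d2_def a2_def b2_def w2_def less_Suc_eq eval_nat_numeral)
  have 2: "\<exists>q. f - (\<Sum>i<6. [b2 ^ 2, a2 * b2 - w2 ^ 3, a2 ^ 2, a2 * w2, b2 * w2, w2 ^ 2] ! i * q i) \<in> N2" for f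
  proof -
    have "\<exists>q. g - (\<Sum>i<3. fps_nth (d2 ! i) 0 * q i) \<in> N1" for g
      using 1[of g] by (simp add: d2_0)
    then obtain q where q: "fps_nth (f - (\<Sum>i<3. d2 ! i * q i)) m \<in> N1" for m
      using fps_division[where d = "(!) d2" and n = 3 and N = N1 and F = f] by blast
    define g where "g = f - (\<Sum>i<3. d2 ! i * q i)"
    have g: "cf (fps_nth g i) j k = 0" if "j + k > 1" for i j k
    proof -
      have "cf (fps_nth g i) j k \<noteq> 0 \<longrightarrow> j + k \<le> 1"
        using q[of i] unfolding g_def N1_def by blast
      then show ?thesis
        using that by auto
    qed
    \<comment> \<open>In \<open>g\<close> each power of w is multiplied only by 1, a or b up to
      constants. What remains to be removed is the pair of monomials \<open>a * w\<close>,
      \<open>b * w\<close> with constant coefficients, and all multiples of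
      \<open>w ^ 2\<close>.\<close>
    define Q where "Q = (!) [q 0, q 1, q 2, fps_const (fps_const (fps_const (cf (fps_nth g 1) 1 0))),
      fps_const (fps_const (fps_const (cf (fps_nth g 1) 0 1))), fps_shift 2 g]"
    have "cf (fps_nth (a2 * w2 * Q 3 + b2 * w2 * Q 4 + w2 ^ 2 * Q 5) i) j k =
        (if i + j + k \<le> 1 then 0 else cf (fps_nth g i) j k)" if "i > 0" for i j k
    proof -
      have "cf (fps_nth (a2 * w2 * Q 3 + b2 * w2 * Q 4 + w2 ^ 2 * Q 5) i) j k =
         (if i = 1 then (if (j, k) = (1, 0) then cf (fps_nth g 1) 1 0 else
            if (j, k) = (0, 1) then cf (fps_nth g 1) 0 1 else 0) else cf (fps_nth g i) j k)"
        using that unfolding a2_def b2_def w2_def a1_def b1_def Q_def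
        by (cases i; cases "i - 1")
          (auto simp: mult.assoc fps_X_power_mult_nth numeral_2_eq_2 mult.left_commute[of "fps_const _" fps_X])
      then show ?thesis
        using that g[of j k i] by auto
    qed
    moreover have "cf (fps_nth (a2 * w2 * Q 3 + b2 * w2 * Q 4 + w2 ^ 2 * Q 5) 0) j k = 0" for j k
      by (simp add: w2_def)
    ultimately have "cf (fps_nth (g - (a2 * w2 * Q 3 + b2 * w2 * Q 4 + w2 ^ 2 * Q 5)) i) j k = 0"
      if "\<not> i + j + k \<le> 1" for i j k
      using g[of j k i] that unfolding fps_sub_nth by (cases "i = 0") (simp_all only:, simp_all)
    then have "g - (a2 * w2 * Q 3 + b2 * w2 * Q 4 + w2 ^ 2 * Q 5) \<in> N2"
      unfolding N2_def by blast
    then have "f - (\<Sum>i<6. [b2 ^ 2, a2 * b2 - w2 ^ 3, a2 ^ 2, a2 * w2, b2 * w2, w2 ^ 2] ! i * Q i) \<in> N2"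
      unfolding lessThan_six by (simp add: g_def Q_def d2_def eval_nat_numeral algebra_simps)
    then show ?thesis
      by (intro exI[of _ Q])
  qed
  define v3 w3 a3 b3 :: "'k fps fps fps fps" where "v3 = fps_X" and "w3 = fps_const w2"
    and "a3 = fps_const a2" and "b3 = fps_const b2"
  define d3 where "d3 = [b3 ^ 2 - v3 * w3 ^ 2, a3 * b3 - w3 ^ 3, a3 ^ 2, a3 * w3, b3 * w3 - a3 * v3, w3 ^ 2]"
  have d3_0: "fps_nth (d3 ! i) 0 = [b2 ^ 2, a2 * b2 - w2 ^ 3, a2 ^ 2, a2 * w2, b2 * w2, w2 ^ 2] ! i" if "i < 6" for i
    using that by (auto simp: d3_def v3_def w3_def a3_def b3_def less_Suc_eq eval_nat_numeral)
  define N3 :: "'k fps fps fps fps set" where "N3 = {f. \<forall>i. fps_nth f i \<in> N2}"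
  have 3: "\<exists>q. f - (\<Sum>i<6. d3 ! i * q i) \<in> N3" for f
  proof -
    have "\<exists>q. g - (\<Sum>i<6. fps_nth (d3 ! i) 0 * q i) \<in> N2" for g
      using 2[of g] by (simp add: d3_0)
    then show ?thesis
      unfolding N3_def mem_Collect_eq by (rule fps_division)
  qed
  define d4 where "d4 = [b ^ 2 - v * w ^ 2, a * b - w ^ 3, a ^ 2 - u * w ^ 2, a * w - b * u, b * w - a * v, w ^ 2 - u * v]"
  have d4_0: "fps_nth (d4 ! i) 0 = d3 ! i" if "i < 6" for i
    using that
    by (auto simp: d4_def d3_def v3_def w3_def a3_def b3_def w2_def a2_def b2_def a1_def b1_def less_Suc_eq
        eval_nat_numeral u_def v_def w_def a_def b_def)
  have "\<exists>q. g - (\<Sum>i<6. fps_nth (d4 ! i) 0 * q i) \<in> N3" for g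
    using 3[of g] by (simp add: d4_0)
  then obtain Q where Q: "fps_nth (F - (\<Sum>i<6. d4 ! i * Q i)) m \<in> N3" for m
    using fps_division[where d = "(!) d4" and n = 6 and N = N3 and F = F] by blast
  then have "F - (\<Sum>i<6. d4 ! i * Q i) \<in> normal_forms"
    by (auto simp: normal_forms_def cP_def N3_def N2_def)
  then show ?thesis
    unfolding lessThan_six d4_def by (intro exI[of _ Q]) simp
qed


section \<open>A as a subring of R, and its presentation\<close>

lemma ring_of_type_algebra_simps [simp]:
  "carrier ring_of_type_algebra = UNIV" "f \<otimes>\<^bsub>ring_of_type_algebra\<^esub> g = f * g"
  "f \<oplus>\<^bsub>ring_of_type_algebra\<^esub> g = f + g" "\<one>\<^bsub>ring_of_type_algebra\<^esub> = 1" "\<zero>\<^bsub>ring_of_type_algebra\<^esub> = 0"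
  by (simp_all add: ring_of_type_algebra_def)

lemma ring_of_type_algebra_minus [simp]:
  "\<ominus>\<^bsub>ring_of_type_algebra\<^esub> (f :: 'a::comm_ring_1) = - f"
proof -
  interpret cring "ring_of_type_algebra :: 'a ring"
    by (rule cring_from_type_algebra)
  have "f \<oplus>\<^bsub>ring_of_type_algebra\<^esub> (- f) = \<zero>\<^bsub>ring_of_type_algebra\<^esub>"
    by simp
  then show ?thesis
    by (intro minus_equality[symmetric, THEN sym]) (simp_all add: add.commute)
qed

lemma ring_A_simps [simp]:
  "carrier ring_A = Mset even even" "f \<otimes>\<^bsub>ring_A\<^esub> g = f * g"
  "f \<oplus>\<^bsub>ring_A\<^esub> g = f + g" "\<one>\<^bsub>ring_A\<^esub> = 1" "\<zero>\<^bsub>ring_A\<^esub> = 0"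
  by (simp_all add: ring_A_def range_subst_P)

lemma A_closed [simp, intro]:
  "0 \<in> Mset even even" "1 \<in> Mset even even"
  "f \<in> Mset even even \<Longrightarrow> g \<in> Mset even even \<Longrightarrow> f + g \<in> Mset even even"
  "f \<in> Mset even even \<Longrightarrow> g \<in> Mset even even \<Longrightarrow> f - g \<in> Mset even even"
  "f \<in> Mset even even \<Longrightarrow> - f \<in> Mset even even"
  "f \<in> Mset even even \<Longrightarrow> g \<in> Mset even even \<Longrightarrow> f * g \<in> Mset even even"
  by (auto simp: Mset_0 Mset_add Mset_diff Mset_uminus Mset_mult) (simp add: Mset_def)

lemma A_power [simp, intro]: "f \<in> Mset even even \<Longrightarrow> f ^ n \<in> Mset even even"
  by (induction n) auto

lemma uvwab_in_A [simp]: "el_u \<in> Mset even even" "el_v \<in> Mset even even" "el_w \<in> Mset even even"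
  "el_a \<in> Mset even even" "el_b \<in> Mset even even"
  by (simp_all add: Mset_def el_u_def el_v_def el_a_def el_b_def)

lemma cring_ring_A: "cring (ring_A :: 'k::field fps2 ring)"
proof (rule cringI)
  show "abelian_group (ring_A :: 'k fps2 ring)"
  proof (rule abelian_groupI)
    show "\<exists>y\<in>carrier ring_A. y \<oplus>\<^bsub>ring_A\<^esub> f = \<zero>\<^bsub>ring_A\<^esub>" if "f \<in> carrier ring_A" for f :: "'k fps2"
      using that by (intro bexI[of _ "- f"]) auto
  qed (auto simp: algebra_simps)
  show "comm_monoid (ring_A :: 'k fps2 ring)"
    by (rule comm_monoidI) (auto simp: algebra_simps)
qed (auto simp: algebra_simps)

lemma a_minus_ring_A [simp]: "f \<in> Mset even even \<Longrightarrow> \<ominus>\<^bsub>ring_A\<^esub> f = - f"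
proof -
  interpret cring "ring_A :: 'a fps2 ring"
    by (rule cring_ring_A)
  assume "f \<in> Mset even even"
  then show ?thesis
    by (intro minus_equality) auto
qed

lemma ideal_ring_AI:
  assumes "J \<subseteq> Mset even even" "J \<noteq> {}" "\<And>f g. f \<in> J \<Longrightarrow> g \<in> J \<Longrightarrow> f + g \<in> J"
    and "\<And>c f. c \<in> Mset even even \<Longrightarrow> f \<in> J \<Longrightarrow> c * f \<in> J"
  shows "ideal J ring_A"
proof -
  interpret cring "ring_A :: 'a fps2 ring"
    by (rule cring_ring_A)
  have "- f \<in> J" if "f \<in> J" for f
    using assms(4)[of "- 1" f] that by simp
  moreover have "f * c \<in> J" if "c \<in> Mset even even" "f \<in> J" for c f
    using assms(4)[OF that] by (simp add: mult.commute)
  ultimately show ?thesis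
    using assms
    by (intro idealI ring_axioms add.subgroupI) (auto simp: a_inv_def[symmetric] subset_eq)
qed

lemma subst_P_hom: "ring_hom_ring ring_P ring_A subst_P"
proof (rule ring_hom_ringI)
  show "ring (ring_P :: 'a fps5 ring)"
    by (rule ring_from_type_algebra)
  show "ring (ring_A :: 'a fps2 ring)"
    using cring_ring_A by (rule cring.axioms)
qed (simp_all add: subst_P_in_Mset)

lemma relations_in_A: "el_u * el_v = el_w ^ 2" "el_a * el_b = el_w ^ 3" "el_a * el_w = el_b * el_u"
  "el_b * el_w = el_a * el_v" "el_a ^ 2 = el_u * el_w ^ 2" "el_b ^ 2 = el_v * el_w ^ 2"
  by (simp_all add: el_u_def el_v_def el_w_def el_a_def el_b_def power2_eq_square power3_eq_cube)

text \<open>Modulo the relations every series is in normal form, and a normal form in the kernel is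
  zero because its coefficients reappear as coefficients of its image.\<close>

lemma relation_ideal_eq_kernel: "relation_ideal = a_kernel ring_P ring_A (subst_P :: 'k::field fps5 \<Rightarrow> 'k fps2)"
proof
  interpret P: cring "ring_P :: 'k fps5 ring"
    by (rule cring_from_type_algebra)
  interpret h: ring_hom_ring ring_P ring_A "subst_P :: 'k fps5 \<Rightarrow> 'k fps2"
    by (rule subst_P_hom)
  have ker: "F \<in> a_kernel ring_P ring_A subst_P \<longleftrightarrow> subst_P F = 0" for F :: "'k fps5"
    unfolding a_kernel_def' by (simp only: mem_Collect_eq ring_of_type_algebra_simps ring_A_simps UNIV_I simp_thms)
  show "relation_ideal \<subseteq> a_kernel ring_P ring_A (subst_P :: 'k fps5 \<Rightarrow> 'k fps2)"
  proof (rule P.genideal_minimal[OF h.kernel_is_ideal])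
    show "relations_A \<subseteq> a_kernel ring_P ring_A (subst_P :: 'k fps5 \<Rightarrow> 'k fps2)"
      unfolding relations_A_def Let_def
      by (simp only: insert_subset empty_subsetI ker subst_P_diff subst_P_mult subst_P_power subst_P_vars
          relations_in_A diff_self simp_thms)
  qed
  show "a_kernel ring_P ring_A (subst_P :: 'k fps5 \<Rightarrow> 'k fps2) \<subseteq> relation_ideal"
  proof
    fix F :: "'k fps5"
    assume "F \<in> a_kernel ring_P ring_A subst_P"
    then have F0: "subst_P F = 0"
      by (simp add: ker)
    define u :: "'k fps5" where "u = fps_X"
    define v :: "'k fps5" where "v = fps_const fps_X"
    define w :: "'k fps5" where "w = fps_const (fps_const fps_X)"
    define a :: "'k fps5" where "a = fps_const (fps_const (fps_const fps_X))"
    define b :: "'k fps5" where "b = fps_const (fps_const (fps_const (fps_const fps_X)))"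
    have "(relations_A :: 'k fps5 set) \<subseteq> relation_ideal"
      by (rule P.genideal_self) simp
    then have rel: "u * v - w ^ 2 \<in> relation_ideal" "a * b - w ^ 3 \<in> relation_ideal"
      "a * w - b * u \<in> relation_ideal" "b * w - a * v \<in> relation_ideal"
      "a ^ 2 - u * w ^ 2 \<in> relation_ideal" "b ^ 2 - v * w ^ 2 \<in> relation_ideal"
      unfolding relations_A_def Let_def u_def v_def w_def a_def b_def by auto
    interpret I: ideal relation_ideal "ring_P :: 'k fps5 ring"
      by (rule P.genideal_ideal) simp
    have add: "f + g \<in> relation_ideal" if "f \<in> relation_ideal" "g \<in> relation_ideal" for f g :: "'k fps5"
      using I.a_closed[OF that] by simp
    have mult: "f * g \<in> relation_ideal" if "f \<in> relation_ideal" for f g :: "'k fps5"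
      using I.I_r_closed[OF that, of g] by simp
    obtain Q where Q: "F - ((b ^ 2 - v * w ^ 2) * Q 0 + (a * b - w ^ 3) * Q 1 + (a ^ 2 - u * w ^ 2) * Q 2 +
        (a * w - b * u) * Q 3 + (b * w - a * v) * Q 4 + (w ^ 2 - u * v) * Q (5::nat)) \<in> normal_forms"
      unfolding u_def v_def w_def a_def b_def using normal_form_exists by blast
    define G where "G = (b ^ 2 - v * w ^ 2) * Q 0 + (a * b - w ^ 3) * Q 1 + (a ^ 2 - u * w ^ 2) * Q 2 +
        (a * w - b * u) * Q 3 + (b * w - a * v) * Q 4 + (w ^ 2 - u * v) * Q 5"
    \<comment> \<open>The division used the negative of the listed relation between u, v and
      w.\<close>
    have w5: "(w ^ 2 - u * v) * Q 5 = (u * v - w ^ 2) * (- Q 5)"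
      by (simp add: algebra_simps)
    have G: "G \<in> relation_ideal"
      unfolding G_def w5 by (intro add mult rel)
    then have "subst_P G = 0"
      using \<open>relation_ideal \<subseteq> _\<close> ker by blast
    then have 0: "subst_P (F - G) = 0"
      by (simp add: F0)
    have N: "F - G \<in> normal_forms"
      using Q by (simp add: G_def)
    have "cP (F - G) (p, q, r, s, t) = 0" for p q r s t
    proof (cases "r + s + t \<le> 1")
      case True
      then consider "r = 0 \<and> s = 0 \<and> t = 0" | "r = 1 \<and> s = 0 \<and> t = 0"
        | "r = 0 \<and> s = 1 \<and> t = 0" | "r = 0 \<and> s = 0 \<and> t = 1"
        by linarith
      then show ?thesis
        using cf_subst_P_normal[OF N, of p q] by cases (simp_all add: F0 \<open>subst_P G = 0\<close>)
    next
      case False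
      then show ?thesis
        using N unfolding normal_forms_def by blast
    qed
    then have "F - G = 0"
      by (simp add: fps_eq_iff cP_def)
    then show "F \<in> relation_ideal"
      using G by simp
  qed
qed

lemma presentation_of_A:
  "\<exists>\<phi>\<in>ring_iso (ring_P Quot relation_ideal) (ring_A :: 'k::field fps2 ring).
     \<forall>F. \<phi> (relation_ideal +>\<^bsub>ring_P\<^esub> F) = subst_P F"
proof -
  interpret h: ring_hom_ring ring_P ring_A "subst_P :: 'k fps5 \<Rightarrow> 'k fps2"
    by (rule subst_P_hom)
  have "(\<lambda>Y. the_elem (subst_P ` Y)) \<in> ring_iso (ring_P Quot relation_ideal) (ring_A :: 'k fps2 ring)"
    using h.FactRing_iso_set_aux unfolding relation_ideal_eq_kernel by (simp add: ring_A_def)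
  moreover have "the_elem (subst_P ` (relation_ideal +>\<^bsub>ring_P\<^esub> F)) = subst_P F" for F :: "'k fps5"
    unfolding relation_ideal_eq_kernel by (rule h.the_elem_simp) simp
  ultimately show ?thesis
    by (intro bexI[of _ "\<lambda>Y. the_elem (subst_P ` Y)"] allI)
qed

section \<open>Weierstrass division and nilpotency modulo two elements\<close>

text \<open>Elimination without fractions: cross-multiplication with a pivot vector clears the last
  coordinate of the others, so the coefficients stay in the domain and induction on the number of
  coordinates applies.\<close>

lemma linear_dependence:
  fixes v :: "nat \<Rightarrow> nat \<Rightarrow> 'a::idom"
  assumes "finite S" "card S = Suc d"
  shows "\<exists>e. (\<exists>n\<in>S. e n \<noteq> 0) \<and> (\<forall>i<d. (\<Sum>n\<in>S. e n * v n i) = 0)"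
  using assms
proof (induction d arbitrary: S v)
  case 0
  then have "S \<noteq> {}"
    by auto
  then show ?case
    by (intro exI[of _ "\<lambda>_. 1"]) auto
next
  case (Suc d)
  show ?case
  proof (cases "\<forall>n\<in>S. v n d = 0")
    case True
    obtain p where p: "p \<in> S"
      using Suc.prems by fastforce
    have card: "card (S - {p}) = Suc d"
      using p Suc.prems by simp
    obtain e where e: "\<exists>n\<in>S - {p}. e n \<noteq> 0" "\<And>i. i < d \<Longrightarrow> (\<Sum>n\<in>S - {p}. e n * v n i) = 0"
      using Suc.IH[OF _ card, of v] Suc.prems by auto
    have "(\<Sum>n\<in>S. (if n = p then 0 else e n) * v n i) = (\<Sum>n\<in>S - {p}. e n * v n i)" for i
      by (rule sum.mono_neutral_cong_right) (use Suc.prems in auto)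
    then show ?thesis
      using e True by (intro exI[of _ "\<lambda>n. if n = p then 0 else e n"]) (auto simp: less_Suc_eq)
  next
    case False
    then obtain p where p: "p \<in> S" "v p d \<noteq> 0"
      by auto
    have card: "card (S - {p}) = Suc d" and fin: "finite (S - {p})"
      using p Suc.prems by simp_all
    obtain e where e: "\<exists>n\<in>S - {p}. e n \<noteq> 0"
      "\<And>i. i < d \<Longrightarrow> (\<Sum>n\<in>S - {p}. e n * (v p d * v n i - v n d * v p i)) = 0"
      using Suc.IH[OF fin card, of "\<lambda>n i. v p d * v n i - v n d * v p i"] by blast
    \<comment> \<open>The pivot receives the collected cross terms. In coordinate \<open>d\<close>
      the cross-multiplied entries are zero, so this coordinate vanishes as well.\<close>
    define e' where "e' n = (if n = p then - (\<Sum>n\<in>S - {p}. e n * v n d) else v p d * e n)" for n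
    have sum: "(\<Sum>n\<in>S. e' n * v n i) = (\<Sum>n\<in>S - {p}. e n * (v p d * v n i - v n d * v p i))" for i
    proof -
      have "(\<Sum>n\<in>S. e' n * v n i) = e' p * v p i + (\<Sum>n\<in>S - {p}. e' n * v n i)"
        using p Suc.prems by (simp add: sum.remove)
      also have "(\<Sum>n\<in>S - {p}. e' n * v n i) = (\<Sum>n\<in>S - {p}. v p d * e n * v n i)"
        by (rule sum.cong) (auto simp: e'_def)
      also have "e' p = - (\<Sum>n\<in>S - {p}. e n * v n d)"
        by (simp add: e'_def)
      finally show ?thesis
        by (simp only: sum_distrib_right right_diff_distrib sum_subtractf mult_minus_left) (simp add: ac_simps)
    qed
    have "(\<Sum>n\<in>S. e' n * v n i) = 0" if "i < Suc d" for i
      using e(2)[of i] that unfolding sum by (cases "i = d") (simp_all add: mult.commute)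
    moreover have "\<exists>n\<in>S. e' n \<noteq> 0"
      using e(1) p by (auto simp: e'_def)
    ultimately show ?thesis
      by blast
  qed
qed

lemma cf_cx_mult_y_power: "cf (cx \<alpha> * el_y ^ i) m j = (if j = i then fps_nth \<alpha> m else 0)"
  by (simp add: el_y_def cx_def fps_mult_right_const_nth)

text \<open>Weierstrass division makes \<open>R/f\<close> a finitely generated \<open>\<k>[[x]]\<close>-module when \<open>f(0,y) \<noteq> 0\<close>, so the powers of \<open>g\<close> satisfy
  a linear relation over \<open>\<k>[[x]]\<close> modulo \<open>f\<close>; the term of lowest degree in \<open>g\<close> is split off.\<close>

lemma power_relation:
  fixes f g :: "'k::field fps2"
  assumes "f \<noteq> 0"
  shows "\<exists>l e H q. g ^ l * (el_x ^ e + g * H) = f * q"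
proof -
  \<comment> \<open>Weierstrass division needs a divisor that does not vanish on the y-axis; the
    power of x split off here is multiplied back at the end.\<close>
  obtain k f' where f: "f = el_x ^ k * f'" and f': "ry f' \<noteq> 0"
    using fps2_factor_x[OF assms] by blast
  obtain d \<epsilon> where d: "ry f' = fps_X ^ d * \<epsilon>" "fps_nth \<epsilon> 0 \<noteq> 0"
    using fps_factor[OF f'] by blast
  obtain \<eta> where \<eta>: "\<epsilon> * \<eta> = 1" "fps_nth \<eta> 0 \<noteq> 0"
    by (rule fps_unit_inverse[OF d(2)])
  have "\<exists>q. \<beta> - (\<Sum>i<1::nat. fps_nth f' 0 * q i) \<in> {\<beta>. \<forall>j\<ge>d. fps_nth \<beta> j = 0}" for \<beta> :: "'k fps"
  proof -
    have "fps_nth f' 0 * (\<eta> * fps_shift d \<beta>) = (\<epsilon> * \<eta>) * (fps_X ^ d * fps_shift d \<beta>)"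
      using d(1) by (simp add: ry_def algebra_simps)
    then have eq: "fps_nth f' 0 * (\<eta> * fps_shift d \<beta>) = fps_X ^ d * fps_shift d \<beta>"
      by (simp only: \<eta> mult_1)
    have "fps_nth (\<beta> - (\<Sum>i<1::nat. fps_nth f' 0 * (\<eta> * fps_shift d \<beta>))) j = 0" if "j \<ge> d" for j
      using that by (simp add: eq fps_X_power_mult_nth)
    then show ?thesis
      by (intro exI[of _ "\<lambda>_. \<eta> * fps_shift d \<beta>"]) simp
  qed
  then have "\<exists>Q. \<forall>m. fps_nth (r - (\<Sum>i<1::nat. f' * Q i)) m \<in> {\<beta>. \<forall>j\<ge>d. fps_nth \<beta> j = 0}" for r
    by (rule fps_division)
  then have "\<exists>q. \<forall>m. \<forall>j\<ge>d. cf (r - f' * q) m j = 0" for r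
    by simp blast
  then have "\<exists>q. \<forall>n. \<forall>m. \<forall>j\<ge>d. cf (g ^ n - f' * q n) m j = 0"
    by (intro choice) blast
  then obtain q where q: "\<And>n m j. j \<ge> d \<Longrightarrow> cf (g ^ n - f' * q n) m j = 0"
    by blast
  define v where "v n i = Abs_fps (\<lambda>m. cf (g ^ n - f' * q n) m i)" for n i
  have rem: "g ^ n - f' * q n = (\<Sum>i<d. cx (v n i) * el_y ^ i)" for n
  proof (rule fps2_eqI)
    fix m j
    have "cf (\<Sum>i<d. cx (v n i) * el_y ^ i) m j = (\<Sum>i<d. if j = i then fps_nth (v n i) m else 0)"
      by (simp add: fps_sum_nth cf_cx_mult_y_power)
    also have "\<dots> = (if j < d then cf (g ^ n - f' * q n) m j else 0)"
      by (simp add: v_def)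
    also have "\<dots> = cf (g ^ n - f' * q n) m j"
      using q[of j n m] by (simp only: not_less split: if_split) auto
    finally show "cf (g ^ n - f' * q n) m j = cf (\<Sum>i<d. cx (v n i) * el_y ^ i) m j" ..
  qed
  \<comment> \<open>The d + 1 remainders of the powers of g with exponents 0 to d have d coordinates
    each over \<k>[[x]].\<close>
  obtain e where e: "\<exists>n\<in>{..d}. e n \<noteq> 0" "\<And>i. i < d \<Longrightarrow> (\<Sum>n\<le>d. e n * v n i) = 0"
    using linear_dependence[of "{..d}" d v] by auto
  have cx_sum: "cx (sum h S) = (\<Sum>n\<in>S. cx (h n))" for h :: "nat \<Rightarrow> 'k fps" and S
    by (induction S rule: infinite_finite_induct) simp_all
  have "(\<Sum>n\<le>d. cx (e n) * (g ^ n - f' * q n)) = (\<Sum>n\<le>d. \<Sum>i<d. cx (e n * v n i) * el_y ^ i)"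
    by (simp add: rem sum_distrib_left mult.assoc)
  also have "\<dots> = (\<Sum>i<d. cx (\<Sum>n\<le>d. e n * v n i) * el_y ^ i)"
    by (subst sum.swap) (simp only: cx_sum sum_distrib_right)
  also have "\<dots> = 0"
    by (simp add: e(2))
  finally have rel: "(\<Sum>n\<le>d. cx (e n) * g ^ n) = f' * (\<Sum>n\<le>d. cx (e n) * q n)"
    by (simp add: algebra_simps sum_subtractf sum_distrib_left)
  define l where "l = (LEAST n. n \<le> d \<and> e n \<noteq> 0)"
  have ex: "\<exists>n. n \<le> d \<and> e n \<noteq> 0"
    using e(1) by auto
  have l: "l \<le> d" "e l \<noteq> 0"
    using LeastI_ex[OF ex] by (auto simp: l_def)
  have less: "e n = 0" if "n < l" for n
    using not_less_Least[of n "\<lambda>n. n \<le> d \<and> e n \<noteq> 0"] that l by (auto simp: l_def)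
  define H where "H = (\<Sum>n\<in>{Suc l..d}. cx (e n) * g ^ (n - Suc l))"
  have "(\<Sum>n\<le>d. cx (e n) * g ^ n) = (\<Sum>n\<in>{l..d}. cx (e n) * g ^ n)"
    using less by (intro sum.mono_neutral_right) auto
  also have "\<dots> = cx (e l) * g ^ l + (\<Sum>n\<in>{Suc l..d}. cx (e n) * g ^ n)"
    using l(1) by (simp add: sum.atLeast_Suc_atMost)
  also have "(\<Sum>n\<in>{Suc l..d}. cx (e n) * g ^ n) = g ^ Suc l * H"
    unfolding H_def sum_distrib_left
  proof (rule sum.cong[OF refl])
    fix n
    assume "n \<in> {Suc l..d}"
    then have "g ^ n = g ^ Suc l * g ^ (n - Suc l)"
      by (simp flip: power_add power_Suc)
    then show "cx (e n) * g ^ n = g ^ Suc l * (cx (e n) * g ^ (n - Suc l))"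
      by (simp only: mult.left_commute)
  qed
  finally have rel': "g ^ l * (cx (e l) + g * H) = f' * (\<Sum>n\<le>d. cx (e n) * q n)"
    unfolding rel by (simp add: algebra_simps)
  obtain e0 \<delta> where \<delta>: "e l = fps_X ^ e0 * \<delta>" "fps_nth \<delta> 0 \<noteq> 0"
    using fps_factor[OF l(2)] by blast
  obtain \<zeta> where \<zeta>: "\<delta> * \<zeta> = 1" "fps_nth \<zeta> 0 \<noteq> 0"
    by (rule fps_unit_inverse[OF \<delta>(2)])
  have "cx (e l) * cx \<zeta> = el_x ^ e0 * cx (\<delta> * \<zeta>)"
    by (simp add: \<delta>(1))
  then have e\<zeta>: "cx (e l) * cx \<zeta> = el_x ^ e0"
    by (simp add: \<zeta> del: cx_hom(2))
  \<comment> \<open>The unit \<zeta> turns the lowest non-zero coefficient into a power of x, and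
    the factor \<open>el_x ^ k\<close> turns the multiple of \<open>f'\<close> into a multiple of
    \<open>f\<close>.\<close>
  have "g ^ l * (el_x ^ (e0 + k) + g * (el_x ^ k * cx \<zeta> * H)) = el_x ^ k * cx \<zeta> * (g ^ l * (cx (e l) + g * H))"
    unfolding power_add e\<zeta>[symmetric] by (simp add: algebra_simps)
  also have "\<dots> = f * (cx \<zeta> * (\<Sum>n\<le>d. cx (e n) * q n))"
    unfolding rel' by (simp add: f algebra_simps)
  finally show ?thesis
    by blast
qed

text \<open>The elements of \<open>A\<close> that are nilpotent modulo \<open>f\<close> and \<open>g\<close> and, up to a multiple of \<open>g\<close>, kill a power of \<open>g\<close> modulo
  \<open>f\<close>. For \<open>f \<noteq> 0\<close> this ideal is primary to the maximal ideal, which is all that is needed of the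
  dimension theory of \<open>A\<close>.\<close>

definition bset :: "'k::field fps2 \<Rightarrow> 'k fps2 \<Rightarrow> 'k fps2 set" where
  "bset f g = {s \<in> Mset even even. \<exists>l. \<exists>h\<in>Mset even even. \<exists>q\<in>Mset even even. g ^ l * (s + g * h) = f * q}"

lemma bsetI:
  "s \<in> Mset even even \<Longrightarrow> h \<in> Mset even even \<Longrightarrow> q \<in> Mset even even \<Longrightarrow> g ^ l * (s + g * h) = f * q \<Longrightarrow>
    s \<in> bset f g"
  by (auto simp: bset_def)

lemma bset_add:
  assumes "s \<in> bset f g" "t \<in> bset f g" and A: "f \<in> Mset even even" "g \<in> Mset even even"
  shows "s + t \<in> bset f g"
proof -
  obtain k h q l i r where s: "s \<in> Mset even even" "h \<in> Mset even even" "q \<in> Mset even even" "g ^ k * (s + g * h) = f * q"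
    and t: "t \<in> Mset even even" "i \<in> Mset even even" "r \<in> Mset even even" "g ^ l * (t + g * i) = f * r"
    using assms by (auto simp: bset_def)
  have "g ^ (k + l) * (s + t + g * (h + i)) = g ^ l * (g ^ k * (s + g * h)) + g ^ k * (g ^ l * (t + g * i))"
    by (simp add: power_add algebra_simps)
  also have "\<dots> = f * (g ^ l * q + g ^ k * r)"
    unfolding s(4) t(4) by (simp add: algebra_simps)
  finally show ?thesis
    by (rule bsetI[rotated 3]) (use s t A in auto)
qed

lemma bset_mult:
  assumes "s \<in> bset f g" "c \<in> Mset even even"
  shows "c * s \<in> bset f g"
proof -
  obtain k h q where s: "s \<in> Mset even even" "h \<in> Mset even even" "q \<in> Mset even even" "g ^ k * (s + g * h) = f * q"
    using assms by (auto simp: bset_def)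
  have "g ^ k * (c * s + g * (c * h)) = c * (g ^ k * (s + g * h))"
    by (simp add: algebra_simps)
  also have "\<dots> = f * (c * q)"
    unfolding s(4) by (simp add: algebra_simps)
  finally show ?thesis
    by (rule bsetI[rotated 3]) (use s assms in auto)
qed

lemma bset_left: "f \<in> Mset even even \<Longrightarrow> f \<in> bset f g"
  by (rule bsetI[of _ 0 1 _ 0]) auto

lemma bset_right: "g \<in> Mset even even \<Longrightarrow> g \<in> bset f g"
  by (rule bsetI[of _ "- 1" 0 _ 0]) auto

lemma bset_subset: "s \<in> bset f g \<Longrightarrow> s \<in> Mset even even"
  by (simp add: bset_def)

section \<open>Nilpotency of the non-units of A modulo two elements\<close>

lemma cx_in_A: "\<alpha> \<in> supp_on even \<Longrightarrow> cx \<alpha> \<in> Mset even even"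
  by (simp add: Mset_def)

lemma cy_in_A: "\<beta> \<in> supp_on even \<Longrightarrow> cy \<beta> \<in> Mset even even"
  by (simp add: Mset_def)

lemma axes_zero_in_Mset: "rx f = 0 \<Longrightarrow> ry f = 0 \<Longrightarrow> f \<in> Mset P Q"
  by (simp add: Mset_def)

text \<open>Multiplying the relation over R by \<open>el_w * el_x ^ e\<close> moves the cofactors
  into w R, hence into A, and makes the leading power of x a power of u.\<close>

lemma w_u_power_bset:
  assumes "f \<noteq> 0"
  shows "\<exists>N. el_w * el_u ^ N \<in> bset f g"
proof -
  obtain l e H q where "g ^ l * (el_x ^ e + g * H) = f * q"
    using power_relation[OF assms] by blast
  then have "el_w * el_x ^ e * (g ^ l * (el_x ^ e + g * H)) = f * (el_w * (el_x ^ e * q))"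
    by simp
  moreover have "el_w * el_x ^ e * (g ^ l * (el_x ^ e + g * H)) = g ^ l * (el_w * el_u ^ e + g * (el_w * (el_x ^ e * H)))"
    by (simp add: el_u_def power2_eq_square power_mult_distrib algebra_simps)
  ultimately have "el_w * el_u ^ e \<in> bset f g"
    by (intro bsetI[of _ "el_w * (el_x ^ e * H)" "el_w * (el_x ^ e * q)" _ l]) simp_all
  then show ?thesis ..
qed

lemma supp_on_even_factor:
  assumes "\<alpha> \<in> supp_on even" "\<alpha> \<noteq> 0"
  obtains j \<epsilon> \<eta> where "\<alpha> = fps_X ^ (2 * j) * \<epsilon>" "\<epsilon> * \<eta> = 1" "\<epsilon> \<in> supp_on even" "\<eta> \<in> supp_on even"
proof -
  obtain m \<epsilon> where m: "\<alpha> = fps_X ^ m * \<epsilon>" "fps_nth \<epsilon> 0 \<noteq> 0"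
    using fps_factor[OF assms(2)] by blast
  have "fps_nth \<alpha> m \<noteq> 0"
    using m by (simp add: fps_X_power_mult_nth)
  then have m_even: "even m"
    using assms by (auto simp: supp_on_def)
  then have \<epsilon>: "\<epsilon> \<in> supp_on even"
    using assms(1) unfolding m(1) by (simp only: supp_on_X_even_mult per2_simps)
  obtain \<eta> where \<eta>: "\<epsilon> * \<eta> = 1" "fps_nth \<eta> 0 \<noteq> 0"
    by (rule fps_unit_inverse[OF m(2)])
  have "\<alpha> = fps_X ^ (2 * (m div 2)) * \<epsilon>"
    using m(1) m_even by simp
  from this \<eta>(1) \<epsilon> supp_on_even_inverse[OF \<epsilon> \<eta>(1)] show thesis
    by (rule that)
qed

text \<open>Some member s' of \<open>bset f g\<close> restricts to an even power of z on the x-axis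
  and so agrees there with a power of u. The difference \<rho> is divisible by y, so
  \<open>el_u * \<rho> ^ 2\<close> is w times an element of w R, and \<open>w_u_power_bset\<close>
  disposes of it. The power of u is then recovered from s' and the square of \<rho>.\<close>

lemma u_power_bset:
  fixes f g :: "'k::field fps2"
  assumes f: "f \<noteq> 0" "f \<in> Mset even even" and g: "g \<in> Mset even even"
  shows "\<exists>N. el_u ^ N \<in> bset f g"
proof -
  have "\<exists>s\<in>bset f g. rx s \<noteq> 0"
  proof (cases "rx f = 0 \<and> rx g = 0")
    case True
    obtain m f' where f': "f = el_y ^ m * f'" "rx f' \<noteq> 0"
      using fps2_factor_y[OF f(1)] by blast
    obtain g' where g': "g = el_y * g'"
      using True by (auto simp: rx_zero_iff dvd_def)
    obtain j \<epsilon> where j: "rx f' = fps_X ^ j * \<epsilon>" "fps_nth \<epsilon> 0 \<noteq> 0"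
      using fps_factor[OF f'(2)] by blast
    obtain \<eta> where \<eta>: "\<epsilon> * \<eta> = 1" "fps_nth \<eta> 0 \<noteq> 0"
      by (rule fps_unit_inverse[OF j(2)])
    \<comment> \<open>The exponent j makes the order on the x-axis even. The extra 2 keeps it even,
      makes s vanish on the y-axis, and supplies the x which with a spare y from
      \<open>g' ^ Suc m\<close> forms the factor w of the cofactor, so that the cofactor is in
      A.\<close>
    define s where "s = el_x ^ (2 + j) * cx \<eta> * f'"
    have "rx s = fps_X ^ (2 + j + j) * (\<epsilon> * \<eta>)"
      unfolding s_def power_add by (simp add: j algebra_simps)
    then have rs: "rx s = fps_X ^ (2 + j + j)"
      by (simp add: \<eta>)
    moreover have "ry s = 0"
      by (simp add: s_def)
    ultimately have sA: "s \<in> Mset even even"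
      by (simp add: Mset_def del: power_Suc power_add)
    have "g ^ Suc m * (s + g * 0) = f * (el_w * (el_x ^ (1 + j) * cx \<eta> * g' ^ Suc m))"
      by (simp add: s_def f' g' el_w_def power_mult_distrib algebra_simps)
    then have "s \<in> bset f g"
      by (rule bsetI[rotated 3]) (simp_all add: sA)
    moreover have "rx s \<noteq> 0"
      by (simp add: rs)
    ultimately show ?thesis
      by blast
  qed (use bset_left[OF f(2)] bset_right[OF g] in blast)
  then obtain s where s: "s \<in> bset f g" "rx s \<noteq> 0"
    by blast
  have rs: "rx s \<in> supp_on even"
    using bset_subset[OF s(1)] by (simp add: Mset_def)
  obtain j \<epsilon> \<eta> where j: "rx s = fps_X ^ (2 * j) * \<epsilon>" "\<epsilon> * \<eta> = 1" "\<epsilon> \<in> supp_on even" "\<eta> \<in> supp_on even"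
    by (rule supp_on_even_factor[OF rs s(2)])
  define s' where "s' = cx \<eta> * s"
  have s': "s' \<in> bset f g"
    unfolding s'_def by (intro bset_mult s cx_in_A j)
  have "rx s' = fps_X ^ (2 * j) * (\<epsilon> * \<eta>)"
    by (simp add: s'_def j(1) algebra_simps)
  then have rs': "rx s' = fps_X ^ (2 * j)"
    by (simp add: j)
  define \<rho> where "\<rho> = el_u ^ j - s'"
  have \<rho>A: "\<rho> \<in> Mset even even"
    using bset_subset[OF s'] by (simp add: \<rho>_def A_closed)
  have "rx \<rho> = 0"
    by (simp add: \<rho>_def rs' el_u_def power_mult)
  then obtain r where r: "\<rho> = el_y * r"
    by (auto simp: rx_zero_iff dvd_def)
  obtain N where N: "el_w * el_u ^ N \<in> bset f g"
    using w_u_power_bset[OF f(1)] by blast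
  have "el_u ^ (2 * j + N + 1) = el_u ^ (N + 1) * (el_u ^ j * el_u ^ j)"
    by (simp add: power_add mult_2)
  also have "\<dots> = el_u ^ (N + 1) * ((el_u ^ j + \<rho>) * s' + \<rho> * \<rho>)"
    by (simp add: \<rho>_def algebra_simps)
  also have "\<dots> = (el_u ^ (N + 1) * (el_u ^ j + \<rho>)) * s' + el_u ^ N * (el_u * (\<rho> * \<rho>))"
    by (simp add: algebra_simps)
  also have "el_u * (\<rho> * \<rho>) = el_w * (el_w * (r * r))"
    by (simp add: r el_u_def el_w_def power2_eq_square)
  also have "el_u ^ N * (el_w * (el_w * (r * r))) = (el_w * (r * r)) * (el_w * el_u ^ N)"
    by (simp only: mult_ac)
  finally have "el_u ^ (2 * j + N + 1) \<in> bset f g"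
    using \<rho>A by (auto intro!: bset_add bset_mult s' N f g)
  then show ?thesis ..
qed

lemma sw_in_A [simp]: "sw f \<in> Mset even even \<longleftrightarrow> f \<in> Mset even even"
  by (rule sw_Mset)

lemma sw_u [simp]: "sw el_u = el_v"
  by (simp add: el_u_def el_v_def)

lemma bset_sw:
  assumes "s \<in> bset (sw f) (sw g)"
  shows "sw s \<in> bset f g"
proof -
  obtain k h q where s: "s \<in> Mset even even" "h \<in> Mset even even" "q \<in> Mset even even"
    "sw g ^ k * (s + sw g * h) = sw f * q"
    using assms by (auto simp: bset_def)
  have "sw (sw g ^ k * (s + sw g * h)) = g ^ k * (sw s + g * sw h)" "sw (sw f * q) = f * sw q"
    by simp_all
  then have "g ^ k * (sw s + g * sw h) = f * sw q"
    by (simp only: s(4))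
  then show ?thesis
    by (rule bsetI[rotated 3]) (use s in auto)
qed

lemma v_power_bset:
  assumes "f \<noteq> 0" "f \<in> Mset even even" "g \<in> Mset even even"
  shows "\<exists>N. el_v ^ N \<in> bset f g"
  using u_power_bset[of "sw f" "sw g"] assms bset_sw[of _ f g] by (metis sw_hom(4) sw_eq_0_iff sw_in_A sw_u)

lemma of_nat_in_A [simp]: "of_nat n \<in> Mset even even"
  by (induction n) auto

lemma supp_on_even_no_const:
  assumes "\<alpha> \<in> supp_on even" "fps_nth \<alpha> 0 = 0"
  obtains \<gamma> where "\<alpha> = fps_X ^ 2 * \<gamma>" "\<gamma> \<in> supp_on even"
proof -
  have "fps_nth \<alpha> 1 = 0"
    using assms(1) by (auto simp: supp_on_def)
  with assms(2) have "fps_nth \<alpha> n = fps_nth (fps_X ^ 2 * fps_shift 2 \<alpha>) n" for n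
    by (cases n; cases "n - 1") (simp_all add: fps_X_power_mult_nth del: fps_shift_nth, simp_all)
  then have eq: "\<alpha> = fps_X ^ 2 * fps_shift 2 \<alpha>"
    by (rule fps_ext)
  moreover have "fps_shift 2 \<alpha> \<in> supp_on even"
    using assms(1) by (subst (asm) eq) (simp only: supp_on_X_even_mult per2_simps even_numeral)
  ultimately show thesis
    by (rule that)
qed

text \<open>A non-unit is a combination of u and v over A plus w r with r in R. The mixed terms of
  the square are harmless since w r is in A, but the square of w r is u v times the square of r,
  where r need not be in A; this term must be split between u and v.\<close>

lemma square_in_uv:
  assumes f: "f \<in> Mset even even" "cf f 0 0 = 0"
  obtains \<alpha> \<beta> where "\<alpha> \<in> Mset even even" "\<beta> \<in> Mset even even" "f ^ 2 = el_u * \<alpha> + el_v * \<beta>"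
proof -
  obtain r where r: "f = cx (rx f) + cy (ry f) - cx (fps_const (cf f 0 0)) + el_w * r"
    by (rule axes_decomp)
  obtain \<gamma> where \<gamma>: "rx f = fps_X ^ 2 * \<gamma>" "\<gamma> \<in> supp_on even"
    using supp_on_even_no_const[of "rx f"] f by (auto simp: Mset_def)
  obtain \<delta> where \<delta>: "ry f = fps_X ^ 2 * \<delta>" "\<delta> \<in> supp_on even"
    using supp_on_even_no_const[of "ry f"] f by (auto simp: Mset_def)
  have f_eq: "f = el_u * cx \<gamma> + el_v * cy \<delta> + el_w * r"
    by (subst r) (simp add: \<gamma> \<delta> f el_u_def el_v_def cy_def el_y_def)
  \<comment> \<open>The square of r is split along its restriction to the y-axis. Subtracting that
    restriction makes \<open>a\<close> vanish on both axes, while the restriction itself, multiplied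
    by \<open>el_x ^ 2\<close>, is even on the x-axis and zero on the y-axis.\<close>
  define \<beta> where "\<beta> = ry (r ^ 2)"
  define b where "b = el_x ^ 2 * cy \<beta>"
  define a where "a = el_y ^ 2 * (r ^ 2 - cy \<beta>)"
  have ab: "a \<in> Mset even even" "b \<in> Mset even even"
    by (simp_all add: Mset_def a_def b_def \<beta>_def supp_on_X_even_mult)
  have w: "(el_w * r) ^ 2 = el_u * a + el_v * b"
    by (simp add: a_def b_def el_w_def el_u_def el_v_def power2_eq_square algebra_simps)
  have "f ^ 2 = el_u * (cx \<gamma> * (f + el_v * cy \<delta> + el_w * r)) + el_v * (cy \<delta> * (el_v * cy \<delta> + el_w * r + el_w * r)) + (el_w * r) ^ 2"
    by (subst (1) f_eq, subst f_eq) (simp add: power2_eq_square algebra_simps)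
  also have "\<dots> = el_u * (cx \<gamma> * (f + el_v * cy \<delta> + el_w * r) + a) +
      el_v * (cy \<delta> * (el_v * cy \<delta> + el_w * r + el_w * r) + b)"
    unfolding w by (simp add: algebra_simps)
  finally show thesis
    by (rule that[rotated 2]) (intro A_closed cx_in_A cy_in_A w_mult_Mset uvwab_in_A \<gamma> \<delta> ab f)+
qed

text \<open>Each term of the binomial expansion of the power N1 + N2 of
  \<open>el_u * \<alpha> + el_v * \<beta>\<close> contains the N1-th power of u or the N2-th power
  of v.\<close>

lemma power_in_bset:
  assumes f: "f \<noteq> 0" "f \<in> Mset even even" and g: "g \<in> Mset even even" and z: "z \<in> Mset even even" "cf z 0 0 = 0"
  shows "\<exists>N. z ^ N \<in> bset f g"
proof -
  obtain \<alpha> \<beta> where ab: "\<alpha> \<in> Mset even even" "\<beta> \<in> Mset even even" "z ^ 2 = el_u * \<alpha> + el_v * \<beta>"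
    by (rule square_in_uv[OF z])
  obtain N1 N2 where N: "el_u ^ N1 \<in> bset f g" "el_v ^ N2 \<in> bset f g"
    using u_power_bset[OF f g] v_power_bset[OF f g] by blast
  have sum: "sum h S \<in> bset f g" if "finite S" "S \<noteq> {}" "\<And>k. k \<in> S \<Longrightarrow> h k \<in> bset f g" for h and S :: "nat set"
    using that by (induction S rule: finite_ne_induct) (auto intro: bset_add f g)
  have "z ^ (2 * (N1 + N2)) = (el_u * \<alpha> + el_v * \<beta>) ^ (N1 + N2)"
    by (simp only: power_mult ab)
  also have "\<dots> = (\<Sum>k\<le>N1 + N2. of_nat (N1 + N2 choose k) * (el_u * \<alpha>) ^ k * (el_v * \<beta>) ^ (N1 + N2 - k))"
    by (rule binomial_ring)
  also have "\<dots> \<in> bset f g"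
  proof (rule sum)
    fix k
    assume "k \<in> {..N1 + N2}"
    show "of_nat (N1 + N2 choose k) * (el_u * \<alpha>) ^ k * (el_v * \<beta>) ^ (N1 + N2 - k) \<in> bset f g"
    proof (cases "N1 \<le> k")
      case True
      then have eq: "el_u ^ k = el_u ^ (k - N1) * el_u ^ N1"
        by (simp flip: power_add)
      have eq2: "of_nat (N1 + N2 choose k) * (el_u * \<alpha>) ^ k * (el_v * \<beta>) ^ (N1 + N2 - k) =
          (of_nat (N1 + N2 choose k) * el_u ^ (k - N1) * \<alpha> ^ k * (el_v * \<beta>) ^ (N1 + N2 - k)) * el_u ^ N1"
        by (simp only: power_mult_distrib eq mult_ac)
      show ?thesis
        unfolding eq2 by (intro bset_mult N A_closed A_power uvwab_in_A of_nat_in_A ab)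
    next
      case False
      then have eq: "el_v ^ (N1 + N2 - k) = el_v ^ (N1 - k) * el_v ^ N2"
        by (simp flip: power_add)
      have eq2: "of_nat (N1 + N2 choose k) * (el_u * \<alpha>) ^ k * (el_v * \<beta>) ^ (N1 + N2 - k) =
          (of_nat (N1 + N2 choose k) * el_v ^ (N1 - k) * \<beta> ^ (N1 + N2 - k) * (el_u * \<alpha>) ^ k) * el_v ^ N2"
        by (simp only: power_mult_distrib eq mult_ac)
      show ?thesis
        unfolding eq2 by (intro bset_mult N A_closed A_power uvwab_in_A of_nat_in_A ab)
    qed
  qed auto
  finally show ?thesis ..
qed

lemma Units_ring_A: "Units ring_A = {f \<in> Mset even even. cf f 0 0 \<noteq> 0}"
proof (intro equalityI subsetI)
  fix f :: "'a fps2"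
  assume "f \<in> Units ring_A"
  then obtain g where "f \<in> Mset even even" "f * g = 1"
    by (auto simp: Units_def)
  moreover from this have "cf (f * g) 0 0 = 1"
    by simp
  then have "cf f 0 0 \<noteq> 0"
    by (auto simp: cf_mult)
  ultimately show "f \<in> {f \<in> Mset even even. cf f 0 0 \<noteq> 0}"
    by simp
next
  fix f :: "'a fps2"
  assume f: "f \<in> {f \<in> Mset even even. cf f 0 0 \<noteq> 0}"
  then obtain g where g: "f * g = 1"
    by (auto elim: fps2_unit_inverse)
  then have "rx f * rx g = 1" "ry f * ry g = 1"
    by (simp_all flip: rx_hom(2) ry_hom(2))
  then have "g \<in> Mset even even"
    using f by (auto simp: Mset_def intro: supp_on_even_inverse)
  then show "f \<in> Units ring_A"
    using f g by (auto simp: Units_def mult.commute)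
qed

section \<open>Krull dimension and depth\<close>

definition prime_A :: "'k::field fps2 set \<Rightarrow> bool" where
  "prime_A p \<longleftrightarrow> p \<subseteq> Mset even even \<and> 0 \<in> p \<and> (\<forall>f\<in>p. \<forall>g\<in>p. f + g \<in> p) \<and>
     (\<forall>c\<in>Mset even even. \<forall>f\<in>p. c * f \<in> p) \<and> 1 \<notin> p \<and>
     (\<forall>f\<in>Mset even even. \<forall>g\<in>Mset even even. f * g \<in> p \<longrightarrow> f \<in> p \<or> g \<in> p)"

lemma prime_A_D:
  assumes "prime_A p"
  shows "f \<in> p \<Longrightarrow> f \<in> Mset even even" "0 \<in> p" "f \<in> p \<Longrightarrow> g \<in> p \<Longrightarrow> f + g \<in> p"
    "c \<in> Mset even even \<Longrightarrow> f \<in> p \<Longrightarrow> c * f \<in> p" "1 \<notin> p"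
    "c \<in> Mset even even \<Longrightarrow> g \<in> Mset even even \<Longrightarrow> c * g \<in> p \<Longrightarrow> c \<in> p \<or> g \<in> p"
  using assms unfolding prime_A_def by blast+

lemma primeideal_ring_A_iff: "primeideal p ring_A \<longleftrightarrow> prime_A p"
proof
  assume "primeideal p ring_A"
  then interpret primeideal p "ring_A :: 'a fps2 ring" .
  have sub: "p \<subseteq> Mset even even"
    using a_subset by simp
  have add: "f + g \<in> p" if "f \<in> p" "g \<in> p" for f g
    using additive_subgroup.a_closed[OF additive_subgroup_axioms that] by simp
  have mult: "c * f \<in> p" if "c \<in> Mset even even" "f \<in> p" for c f
    using I_l_closed[OF that(2), of c] that by simp
  have zero: "0 \<in> p"
    using additive_subgroup.zero_closed[OF additive_subgroup_axioms] by simp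
  have prime: "f \<in> p \<or> g \<in> p" if "f \<in> Mset even even" "g \<in> Mset even even" "f * g \<in> p" for f g
    using I_prime[of f g] that by simp
  have one: "1 \<notin> p"
  proof
    assume "1 \<in> p"
    then have "c \<in> p" if "c \<in> Mset even even" for c
      using mult[OF that, of 1] by simp
    then show False
      using sub I_notcarr by auto
  qed
  show "prime_A p"
    unfolding prime_A_def using prime by (intro conjI ballI impI sub zero add mult one) simp_all
next
  assume p: "prime_A p"
  show "primeideal p ring_A"
  proof (rule primeidealI)
    show "ideal p ring_A"
      by (rule ideal_ring_AI) (use p in \<open>auto simp: prime_A_def\<close>)
    show "carrier ring_A \<noteq> p"
      using p by (auto simp: prime_A_def)
  qed (use p cring_ring_A in \<open>auto simp: prime_A_def\<close>)
qed

definition max_A :: "'k::field fps2 set" where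
  "max_A = {f \<in> Mset even even. cf f 0 0 = 0}"

lemma prime_A_max_A: "prime_A max_A"
  using w_mult_Mset by (auto simp: prime_A_def max_A_def cf_mult)

lemma unit_in_A: "f \<in> Mset even even \<Longrightarrow> cf f 0 0 \<noteq> 0 \<Longrightarrow> \<exists>g\<in>Mset even even. g * f = 1"
  using Units_ring_A by (auto simp: Units_def set_eq_iff)

lemma prime_A_power: "prime_A p \<Longrightarrow> f \<in> Mset even even \<Longrightarrow> f ^ n \<in> p \<Longrightarrow> f \<in> p"
proof (induction n)
  case (Suc n)
  have "f ^ n \<in> Mset even even" "f * f ^ n \<in> p"
    using Suc.prems by auto
  then have "f \<in> p \<or> f ^ n \<in> p"
    using Suc.prems unfolding prime_A_def by blast
  then show ?case
    using Suc by blast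
qed (simp add: prime_A_def)

lemma prime_A_subset_max: "prime_A p \<Longrightarrow> p \<subseteq> max_A"
proof
  fix f
  assume p: "prime_A p" and f: "f \<in> p"
  have "\<not> (\<exists>g\<in>Mset even even. g * f = 1)"
    using p f unfolding prime_A_def by metis
  moreover have "f \<in> Mset even even"
    using prime_A_D(1)[OF p f] .
  ultimately show "f \<in> max_A"
    using unit_in_A[of f] unfolding max_A_def by blast
qed

lemma maximalideal_max_A: "maximalideal max_A (ring_A :: 'k::field fps2 ring)"
proof (rule maximalidealI)
  show id: "ideal max_A (ring_A :: 'k fps2 ring)"
    using prime_A_max_A primeideal_ring_A_iff primeideal.axioms(1) by blast
  show "carrier ring_A \<noteq> (max_A :: 'k fps2 set)"
    using prime_A_max_A by (auto simp: prime_A_def)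
  fix J :: "'k fps2 set"
  assume J: "ideal J ring_A" "max_A \<subseteq> J" "J \<subseteq> carrier ring_A"
  show "J = max_A \<or> J = carrier ring_A"
  proof (rule disjCI)
    assume "J \<noteq> carrier ring_A"
    have "f \<in> max_A" if "f \<in> J" for f
    proof (rule ccontr)
      assume "f \<notin> max_A"
      moreover have fA: "f \<in> Mset even even"
        using that J(3) by auto
      ultimately have "cf f 0 0 \<noteq> 0"
        by (simp add: max_A_def)
      then obtain g where g: "g \<in> Mset even even" "g * f = 1"
        using unit_in_A[OF fA] by blast
      have "c \<in> J" if "c \<in> carrier ring_A" for c
        using ideal.I_l_closed[OF J(1) \<open>f \<in> J\<close>, of "c * g"] that g by (simp add: A_closed mult.assoc)
      then show False
        using J \<open>J \<noteq> carrier ring_A\<close> by blast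
    qed
    then show "J = max_A"
      using J(2) by blast
  qed
qed

text \<open>Every non-unit of A has its square in the ideal generated by u and v, by
  \<open>square_in_uv\<close>.\<close>

lemma prime_A_eq_max:
  fixes p :: "'k::field fps2 set"
  assumes p: "prime_A p" and uv: "el_u \<in> p" "el_v \<in> p"
  shows "p = max_A"
proof
  show "max_A \<subseteq> p"
  proof
    fix f :: "'k fps2"
    assume f: "f \<in> max_A"
    then obtain \<alpha> \<beta> where "\<alpha> \<in> Mset even even" "\<beta> \<in> Mset even even" "f ^ 2 = el_u * \<alpha> + el_v * \<beta>"
      by (auto simp: max_A_def elim: square_in_uv)
    then have f2: "f ^ 2 = \<alpha> * el_u + \<beta> * el_v" and "\<alpha> * el_u \<in> p" "\<beta> * el_v \<in> p"
      using prime_A_D(4)[OF p _ uv(1), of \<alpha>] prime_A_D(4)[OF p _ uv(2), of \<beta>] by (simp_all add: mult.commute)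
    then have "f ^ 2 \<in> p"
      unfolding f2 by (intro prime_A_D(3)[OF p])
    then show "f \<in> p"
      using f prime_A_power[OF p] by (auto simp: max_A_def)
  qed
qed (rule prime_A_subset_max[OF p])

text \<open>Take f \<noteq> 0 in p and g in q outside p. A power of a non-unit z is in
  \<open>bset f g\<close>; since p is prime and does not contain g, \<open>z ^ N + g * h\<close> is
  in p, so z is in q. Thus a chain of primes has at most two steps.\<close>

lemma prime_A_chain:
  fixes p q :: "'k::field fps2 set"
  assumes p: "prime_A p" and q: "prime_A q" and pq: "p \<subset> q" and ne: "p \<noteq> {0}"
  shows "q = max_A"
proof
  obtain f where f: "f \<in> p" "f \<noteq> 0"
    using ne p by (auto simp: prime_A_def)
  obtain g where g: "g \<in> q" "g \<notin> p"
    using pq by blast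
  have A: "f \<in> Mset even even" "g \<in> Mset even even"
    using f g p q by (auto simp: prime_A_def)
  show "max_A \<subseteq> q"
  proof
    fix z :: "'k fps2"
    assume z: "z \<in> max_A"
    then obtain N where "z ^ N \<in> bset f g"
      using power_in_bset[of f g z] f A by (auto simp: max_A_def)
    then obtain l h r where z': "z ^ N \<in> Mset even even" "h \<in> Mset even even" "r \<in> Mset even even"
      "g ^ l * (z ^ N + g * h) = f * r"
      by (auto simp: bset_def)
    have "f * r \<in> p"
      using p f z'(3) by (auto simp: prime_A_def mult.commute)
    moreover have "g ^ l \<in> Mset even even" "z ^ N + g * h \<in> Mset even even"
      using z' A by auto
    ultimately have "g ^ l \<in> p \<or> z ^ N + g * h \<in> p"
      using prime_A_D(6)[OF p, of "g ^ l" "z ^ N + g * h"] unfolding z'(4) by blast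
    then have "z ^ N + g * h \<in> q"
      using prime_A_power[OF p A(2)] g pq by blast
    moreover have "(- h) * g \<in> q"
      using prime_A_D(4)[OF q, of "- h" g] g(1) z'(2) by blast
    ultimately have "(z ^ N + g * h) + (- h) * g \<in> q"
      by (rule prime_A_D(3)[OF q])
    then have "z ^ N \<in> q"
      by (simp add: mult.commute)
    then show "z \<in> q"
      using prime_A_power[OF q] z by (auto simp: max_A_def)
  qed
qed (rule prime_A_subset_max[OF q])

text \<open>The prime of series vanishing on the x-axis, the middle of a chain that shows that the
  dimension is at least two.\<close>

definition axis_prime :: "'k::field fps2 set" where
  "axis_prime = {f \<in> Mset even even. rx f = 0}"

lemma prime_A_axis_prime: "prime_A axis_prime"
  by (auto simp: prime_A_def axis_prime_def)

lemma axis_prime_psubset: "axis_prime \<subset> max_A"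
proof -
  have "cf f 0 0 = 0" if "rx f = 0" for f :: "'a fps2"
    using arg_cong[OF that, of "\<lambda>\<alpha>. fps_nth \<alpha> 0"] by simp
  moreover have "el_u \<in> (max_A :: 'a fps2 set)" "el_u \<notin> (axis_prime :: 'a fps2 set)"
    by (simp_all add: max_A_def axis_prime_def) (simp_all add: el_u_def, simp add: el_x_def)
  ultimately show ?thesis
    by (auto simp: max_A_def axis_prime_def)
qed

lemma krull_dim_ring_A: "krull_dim (ring_A :: 'k::field fps2 ring) = 2"
proof (rule antisym)
  show "krull_dim (ring_A :: 'k fps2 ring) \<le> 2"
    unfolding krull_dim_def
  proof (rule Sup_least, clarify)
    fix n and p :: "nat \<Rightarrow> 'k fps2 set"
    assume p: "\<forall>i\<le>n. primeideal (p i) ring_A" and c: "\<forall>i<n. p i \<subset> p (Suc i)"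
    have "n \<le> 2"
    proof (rule ccontr)
      assume "\<not> n \<le> 2"
      then have pr: "prime_A (p 0)" "prime_A (p 1)" "prime_A (p 2)" "prime_A (p 3)"
        and c: "p 0 \<subset> p 1" "p 1 \<subset> p 2" "p 2 \<subset> p 3"
        using p c by (auto simp: primeideal_ring_A_iff eval_nat_numeral)
      have "p 1 \<noteq> {0}"
        using pr(1) c(1) by (auto simp: prime_A_def)
      then have "p 2 = max_A"
        using prime_A_chain pr c by blast
      then show False
        using prime_A_subset_max[OF pr(4)] c by blast
    qed
    then show "enat n \<le> 2"
      by (simp add: numeral_eq_enat)
  qed
  have zero: "prime_A ({0} :: 'k fps2 set)"
    by (auto simp: prime_A_def)
  have u: "el_w \<in> (axis_prime :: 'k fps2 set)"
    by (simp add: axis_prime_def)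
  define p :: "nat \<Rightarrow> 'k fps2 set" where "p = (!) [{0}, axis_prime, max_A]"
  have "\<forall>i\<le>2. primeideal (p i) ring_A"
    unfolding p_def primeideal_ring_A_iff
    by (simp add: le_Suc_eq zero prime_A_axis_prime prime_A_max_A all_conj_distrib imp_conjL numeral_2_eq_2)
  moreover have "({0} :: 'k fps2 set) \<subset> axis_prime"
    using u prime_A_D(2)[OF prime_A_axis_prime] xy_nonzero(3) by (metis empty_subsetI insert_subset psubsetI singletonD)
  then have "\<forall>i<2. p i \<subset> p (Suc i)"
    using axis_prime_psubset unfolding p_def by (simp add: less_Suc_eq numeral_2_eq_2)
  ultimately have "enat 2 \<le> krull_dim (ring_A :: 'k fps2 ring)"
    unfolding krull_dim_def by (intro Sup_upper) blast
  then show "2 \<le> krull_dim (ring_A :: 'k fps2 ring)"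
    by (simp add: numeral_eq_enat)
qed

section \<open>Regular sequences and depth over A\<close>

context
  fixes M :: "('k::field fps2, 'm) module"
  assumes M: "module ring_A M"
begin

interpretation module ring_A M
  by (rule M)

lemma seq_submodule_Nil: "seq_submodule ring_A M [] = {\<zero>\<^bsub>M\<^esub>}"
  by (auto simp: seq_submodule_def)

lemma seq_submodule_one:
  assumes "f \<in> Mset even even"
  shows "seq_submodule ring_A M [f] = {f \<odot>\<^bsub>M\<^esub> m | m. m \<in> carrier M}"
proof (intro equalityI subsetI)
  fix z
  assume "z \<in> {f \<odot>\<^bsub>M\<^esub> m | m. m \<in> carrier M}"
  then obtain m where "m \<in> carrier M" "z = f \<odot>\<^bsub>M\<^esub> m"
    by blast
  then show "z \<in> seq_submodule ring_A M [f]"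
    using assms by (auto simp: seq_submodule_def lessThan_Suc intro!: exI[of _ "\<lambda>_. m"])
qed (use assms in \<open>auto simp: seq_submodule_def lessThan_Suc\<close>)

lemma seq_submodule_two:
  assumes fg: "f \<in> Mset even even" "g \<in> Mset even even"
  shows "seq_submodule ring_A M [f, g] = {f \<odot>\<^bsub>M\<^esub> m \<oplus>\<^bsub>M\<^esub> g \<odot>\<^bsub>M\<^esub> n | m n. m \<in> carrier M \<and> n \<in> carrier M}"
proof -
  have sum: "(\<Oplus>\<^bsub>M\<^esub>i\<in>{..<length [f, g]}. [f, g] ! i \<odot>\<^bsub>M\<^esub> h i) = f \<odot>\<^bsub>M\<^esub> h 0 \<oplus>\<^bsub>M\<^esub> g \<odot>\<^bsub>M\<^esub> h 1"
    if "h \<in> {..<length [f, g]} \<rightarrow> carrier M" for h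
    using that fg by (simp add: lessThan_Suc Pi_iff M.a_comm)
  show ?thesis
  proof (intro equalityI subsetI)
    fix z
    assume "z \<in> seq_submodule ring_A M [f, g]"
    then obtain h where h: "h \<in> {..<length [f, g]} \<rightarrow> carrier M"
      and z: "z = (\<Oplus>\<^bsub>M\<^esub>i\<in>{..<length [f, g]}. [f, g] ! i \<odot>\<^bsub>M\<^esub> h i)"
      by (auto simp only: seq_submodule_def mem_Collect_eq)
    show "z \<in> {f \<odot>\<^bsub>M\<^esub> m \<oplus>\<^bsub>M\<^esub> g \<odot>\<^bsub>M\<^esub> n | m n. m \<in> carrier M \<and> n \<in> carrier M}"
      using h unfolding z sum[OF h] by (auto simp: Pi_iff)
  next
    fix z
    assume "z \<in> {f \<odot>\<^bsub>M\<^esub> m \<oplus>\<^bsub>M\<^esub> g \<odot>\<^bsub>M\<^esub> n | m n. m \<in> carrier M \<and> n \<in> carrier M}"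
    then obtain m n where mn: "m \<in> carrier M" "n \<in> carrier M" "z = f \<odot>\<^bsub>M\<^esub> m \<oplus>\<^bsub>M\<^esub> g \<odot>\<^bsub>M\<^esub> n"
      by blast
    define h where "h i = (if i = (0::nat) then m else n)" for i
    have h: "h \<in> {..<length [f, g]} \<rightarrow> carrier M"
      using mn by (simp add: h_def)
    show "z \<in> seq_submodule ring_A M [f, g]"
      unfolding seq_submodule_def mem_Collect_eq using sum[OF h] h mn(3)
      by (intro exI[of _ h]) (simp add: h_def)
  qed
qed

lemma seq_submodule_take:
  assumes "set xs \<subseteq> Mset even even"
  shows "seq_submodule ring_A M (take k xs) \<subseteq> seq_submodule ring_A M xs"
proof
  fix z
  assume "z \<in> seq_submodule ring_A M (take k xs)"
  then obtain h where h: "h \<in> {..<length (take k xs)} \<rightarrow> carrier M"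
    and z: "z = (\<Oplus>\<^bsub>M\<^esub>i\<in>{..<length (take k xs)}. take k xs ! i \<odot>\<^bsub>M\<^esub> h i)"
    by (auto simp only: seq_submodule_def mem_Collect_eq)
  define h' where "h' i = (if i < length (take k xs) then h i else \<zero>\<^bsub>M\<^esub>)" for i
  have A: "xs ! i \<in> carrier ring_A" if "i < length xs" for i
    using assms that nth_mem by auto
  have h': "h' i \<in> carrier M" for i
    using h by (auto simp: h'_def Pi_iff)
  have "z = (\<Oplus>\<^bsub>M\<^esub>i\<in>{..<length xs}. xs ! i \<odot>\<^bsub>M\<^esub> h' i)"
    unfolding z using A h h'
    by (intro M.add.finprod_mono_neutral_cong_left) (auto simp: h'_def Pi_iff)
  then show "z \<in> seq_submodule ring_A M xs"
    using h' by (auto simp only: seq_submodule_def mem_Collect_eq Pi_iff intro!: exI[of _ h'])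
qed

lemma seq_submodule_subset:
  assumes "set xs \<subseteq> Mset even even"
  shows "seq_submodule ring_A M xs \<subseteq> carrier M"
proof -
  have A: "xs ! i \<in> carrier ring_A" if "i < length xs" for i
    using assms that nth_mem by auto
  then show ?thesis
    by (auto simp: seq_submodule_def Pi_iff intro!: M.finsum_closed smult_closed)
qed

lemma regular_power:
  assumes "\<And>m. m \<in> carrier M \<Longrightarrow> g \<odot>\<^bsub>M\<^esub> m \<in> S \<Longrightarrow> m \<in> S" "g \<in> Mset even even"
    and "m \<in> carrier M" "g ^ l \<odot>\<^bsub>M\<^esub> m \<in> S"
  shows "m \<in> S"
  using assms(4)
proof (induction l)
  case 0
  then show ?case
    using smult_one[OF assms(3)] by simp
next
  case (Suc l)
  have "g ^ Suc l \<odot>\<^bsub>M\<^esub> m = g \<odot>\<^bsub>M\<^esub> (g ^ l \<odot>\<^bsub>M\<^esub> m)"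
    using smult_assoc1[of g "g ^ l" m] assms by simp
  then have "g \<odot>\<^bsub>M\<^esub> (g ^ l \<odot>\<^bsub>M\<^esub> m) \<in> S"
    using Suc.prems by simp
  moreover have "g ^ l \<odot>\<^bsub>M\<^esub> m \<in> carrier M"
    using assms(2,3) by (intro smult_closed) simp_all
  ultimately have "g ^ l \<odot>\<^bsub>M\<^esub> m \<in> S"
    by (rule assms(1)[rotated])
  then show ?case
    by (rule Suc.IH)
qed

text \<open>For the first three members f, g, z, the relation from \<open>bset f g\<close> lets g be
  cancelled modulo f M, so a power of z sends M into (f, g) M. Regularity of z then gives (f, g) M =
  M, against properness. If f = 0, its regularity already makes M zero.\<close>

lemma regular_sequence_length:
  assumes reg: "regular_sequence ring_A M xs" and xs: "set xs \<subseteq> carrier ring_A - Units ring_A"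
  shows "length xs \<le> 2"
proof (rule ccontr)
  assume "\<not> length xs \<le> 2"
  then obtain f g z ys where xs_eq: "xs = f # g # z # ys"
    by (cases xs; cases "tl xs"; cases "tl (tl xs)") auto
  have A: "f \<in> Mset even even" "g \<in> Mset even even" "z \<in> Mset even even" "cf z 0 0 = 0"
    using xs by (auto simp: xs_eq Units_ring_A)
  have xsA: "set xs \<subseteq> Mset even even"
    using xs by auto
  have r: "m \<in> seq_submodule ring_A M (take i xs)"
    if "i < length xs" "m \<in> carrier M" "xs ! i \<odot>\<^bsub>M\<^esub> m \<in> seq_submodule ring_A M (take i xs)" for i m
    using reg that by (auto simp: regular_sequence_def)
  have ne: "seq_submodule ring_A M xs \<noteq> carrier M"
    using reg by (simp add: regular_sequence_def)
  have r0: "m = \<zero>\<^bsub>M\<^esub>" if "m \<in> carrier M" "f \<odot>\<^bsub>M\<^esub> m = \<zero>\<^bsub>M\<^esub>" for m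
    using r[of 0 m] that by (simp add: xs_eq seq_submodule_Nil)
  have r1: "m \<in> seq_submodule ring_A M [f]" if "m \<in> carrier M" "g \<odot>\<^bsub>M\<^esub> m \<in> seq_submodule ring_A M [f]" for m
    using r[of 1 m] that by (simp add: xs_eq)
  have r2: "m \<in> seq_submodule ring_A M [f, g]" if "m \<in> carrier M" "z \<odot>\<^bsub>M\<^esub> m \<in> seq_submodule ring_A M [f, g]" for m
    using r[of 2 m] that by (simp add: xs_eq eval_nat_numeral)
  have "carrier M \<subseteq> seq_submodule ring_A M [f, g]"
  proof
    fix m
    assume m: "m \<in> carrier M"
    show "m \<in> seq_submodule ring_A M [f, g]"
    proof (cases "f = 0")
      case True
      then have "m = \<zero>\<^bsub>M\<^esub>"
        using r0[OF m] smult_l_null[OF m] by simp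
      then show ?thesis
        using A by (auto simp: seq_submodule_two intro!: exI[of _ "\<zero>\<^bsub>M\<^esub>"])
    next
      case False
      then obtain N where "z ^ N \<in> bset f g"
        using power_in_bset A by blast
      then obtain l h q where h: "h \<in> Mset even even" "q \<in> Mset even even" "g ^ l * (z ^ N + g * h) = f * q"
        by (auto simp: bset_def)
      have zA: "z ^ N \<in> Mset even even" "z ^ N + g * h \<in> Mset even even" "g ^ l \<in> Mset even even"
        using A h by auto
      have "g ^ l \<odot>\<^bsub>M\<^esub> ((z ^ N + g * h) \<odot>\<^bsub>M\<^esub> m) = f \<odot>\<^bsub>M\<^esub> (q \<odot>\<^bsub>M\<^esub> m)"
        using smult_assoc1[of "g ^ l" "z ^ N + g * h" m] smult_assoc1[of f q m] zA A h m by simp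
      moreover have "q \<odot>\<^bsub>M\<^esub> m \<in> carrier M"
        using h m by (intro smult_closed) simp_all
      ultimately have gl: "g ^ l \<odot>\<^bsub>M\<^esub> ((z ^ N + g * h) \<odot>\<^bsub>M\<^esub> m) \<in> seq_submodule ring_A M [f]"
        unfolding seq_submodule_one[OF A(1)] by blast
      have cl: "(z ^ N + g * h) \<odot>\<^bsub>M\<^esub> m \<in> carrier M"
        using zA m by (intro smult_closed) simp_all
      have "(z ^ N + g * h) \<odot>\<^bsub>M\<^esub> m \<in> seq_submodule ring_A M [f]"
        by (rule regular_power[where g = g and l = l]; (erule (1) r1 | rule A(2) cl gl))
      then obtain m' where m': "m' \<in> carrier M" "(z ^ N + g * h) \<odot>\<^bsub>M\<^esub> m = f \<odot>\<^bsub>M\<^esub> m'"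
        using A by (auto simp: seq_submodule_one)
      have "z ^ N \<odot>\<^bsub>M\<^esub> m = ((z ^ N + g * h) + g * (- h)) \<odot>\<^bsub>M\<^esub> m"
        by simp
      then have "z ^ N \<odot>\<^bsub>M\<^esub> m = f \<odot>\<^bsub>M\<^esub> m' \<oplus>\<^bsub>M\<^esub> g \<odot>\<^bsub>M\<^esub> ((- h) \<odot>\<^bsub>M\<^esub> m)"
        using smult_l_distr[of "z ^ N + g * h" "g * (- h)" m] smult_assoc1[of g "- h" m] m' m A zA h
        by (simp add: A_closed del: mult_minus_right)
      moreover have "(- h) \<odot>\<^bsub>M\<^esub> m \<in> carrier M"
        using h m by (intro smult_closed) simp_all
      ultimately have zN: "z ^ N \<odot>\<^bsub>M\<^esub> m \<in> seq_submodule ring_A M [f, g]"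
        unfolding seq_submodule_two[OF A(1,2)] using m'(1) by blast
      show ?thesis
        by (rule regular_power[where g = z and l = N]; (erule (1) r2 | rule A(3) m zN))
    qed
  qed
  then have "carrier M \<subseteq> seq_submodule ring_A M xs"
    using seq_submodule_take[OF xsA, of 2] by (auto simp: xs_eq eval_nat_numeral)
  then show False
    using ne seq_submodule_subset[OF xsA] by blast
qed

lemma depth_le_2: "depth ring_A M \<le> 2"
  unfolding depth_def
proof (rule Sup_least, clarify)
  fix xs
  assume "regular_sequence ring_A M xs" "set xs \<subseteq> carrier ring_A - Units ring_A"
  then have "length xs \<le> 2"
    by (rule regular_sequence_length)
  then show "enat (length xs) \<le> 2"
    by (simp add: numeral_eq_enat)
qed

text \<open>The element e certifies that (f, g) M is proper, so f, g is a regular sequence, and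
  \<open>depth_le_2\<close> shows that its length attains the depth.\<close>

lemma maximal_CM_I:
  assumes fg: "finitely_generated_module ring_A M"
    and A: "f \<in> max_A" "g \<in> max_A"
    and f: "\<And>m. m \<in> carrier M \<Longrightarrow> f \<odot>\<^bsub>M\<^esub> m = \<zero>\<^bsub>M\<^esub> \<Longrightarrow> m = \<zero>\<^bsub>M\<^esub>"
    and g: "\<And>m n. m \<in> carrier M \<Longrightarrow> n \<in> carrier M \<Longrightarrow> g \<odot>\<^bsub>M\<^esub> m = f \<odot>\<^bsub>M\<^esub> n \<Longrightarrow> \<exists>k\<in>carrier M. m = f \<odot>\<^bsub>M\<^esub> k"
    and e: "e \<in> carrier M" "\<And>m n. m \<in> carrier M \<Longrightarrow> n \<in> carrier M \<Longrightarrow> e \<noteq> f \<odot>\<^bsub>M\<^esub> m \<oplus>\<^bsub>M\<^esub> g \<odot>\<^bsub>M\<^esub> n"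
  shows "maximal_CM ring_A M"
proof -
  have fgA: "f \<in> Mset even even" "g \<in> Mset even even"
    using A by (auto simp: max_A_def)
  have "e \<notin> seq_submodule ring_A M [f, g]"
    using e by (auto simp: seq_submodule_two fgA)
  moreover have "m \<in> seq_submodule ring_A M (take i [f, g])"
    if "i < 2" "m \<in> carrier M" "[f, g] ! i \<odot>\<^bsub>M\<^esub> m \<in> seq_submodule ring_A M (take i [f, g])" for i m
  proof -
    have "i = 0 \<or> i = 1"
      using that by linarith
    then show ?thesis
    proof
      assume "i = 0"
      then show ?thesis
        using that f[of m] by (simp add: seq_submodule_Nil)
    next
      assume "i = 1"
      then show ?thesis
        using that g[of m] by (fastforce simp: seq_submodule_one fgA)
    qed
  qed
  ultimately have "regular_sequence ring_A M [f, g]"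
    using e(1) fgA by (auto simp: regular_sequence_def)
  moreover have "set [f, g] \<subseteq> carrier ring_A - Units ring_A"
    using A by (auto simp: max_A_def Units_ring_A)
  ultimately have "enat (length [f, g]) \<le> depth ring_A M"
    unfolding depth_def by (intro Sup_upper) blast
  then have "depth ring_A M = 2"
    using depth_le_2 by (intro antisym) (simp_all add: numeral_eq_enat numeral_2_eq_2)
  then show ?thesis
    using fg M by (simp add: maximal_CM_def krull_dim_ring_A)
qed

lemma maximal_CM_D:
  assumes "maximal_CM ring_A M"
  obtains f g where "f \<in> max_A" "g \<in> max_A"
    "\<And>m. m \<in> carrier M \<Longrightarrow> f \<odot>\<^bsub>M\<^esub> m = \<zero>\<^bsub>M\<^esub> \<Longrightarrow> m = \<zero>\<^bsub>M\<^esub>"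
    "\<And>m n. m \<in> carrier M \<Longrightarrow> n \<in> carrier M \<Longrightarrow> g \<odot>\<^bsub>M\<^esub> m = f \<odot>\<^bsub>M\<^esub> n \<Longrightarrow> \<exists>k\<in>carrier M. m = f \<odot>\<^bsub>M\<^esub> k"
    "carrier M \<noteq> {\<zero>\<^bsub>M\<^esub>}"
proof -
  have "depth ring_A M = 2"
    using assms by (simp add: maximal_CM_def krull_dim_ring_A)
  then have "\<not> depth ring_A M \<le> enat 1"
    by (simp add: numeral_eq_enat)
  then obtain xs where xs: "regular_sequence ring_A M xs" "set xs \<subseteq> carrier ring_A - Units ring_A"
    "\<not> enat (length xs) \<le> enat 1"
    unfolding depth_def Sup_le_iff by blast
  then obtain f g ys where xs_eq: "xs = f # g # ys"
    by (cases xs; cases "tl xs") auto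
  have A: "f \<in> max_A" "g \<in> max_A" "set xs \<subseteq> Mset even even"
    using xs(2) by (auto simp: xs_eq Units_ring_A max_A_def)
  have fA: "f \<in> Mset even even"
    using A by (simp add: max_A_def)
  have r: "m \<in> seq_submodule ring_A M (take i xs)"
    if "i < length xs" "m \<in> carrier M" "xs ! i \<odot>\<^bsub>M\<^esub> m \<in> seq_submodule ring_A M (take i xs)" for i m
    using xs(1) that by (auto simp: regular_sequence_def)
  show thesis
  proof (rule that[OF A(1,2)])
    show "m = \<zero>\<^bsub>M\<^esub>" if "m \<in> carrier M" "f \<odot>\<^bsub>M\<^esub> m = \<zero>\<^bsub>M\<^esub>" for m
      using r[of 0 m] that by (simp add: xs_eq seq_submodule_Nil)
    show "\<exists>k\<in>carrier M. m = f \<odot>\<^bsub>M\<^esub> k" if "m \<in> carrier M" "n \<in> carrier M" "g \<odot>\<^bsub>M\<^esub> m = f \<odot>\<^bsub>M\<^esub> n" for m n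
      using r[of 1 m] that by (auto simp: xs_eq seq_submodule_one fA)
    have "\<zero>\<^bsub>M\<^esub> \<in> seq_submodule ring_A M xs"
      using seq_submodule_take[OF A(3), of 0] by (simp add: seq_submodule_Nil)
    moreover have "seq_submodule ring_A M xs \<noteq> carrier M"
      using xs(1) by (simp add: regular_sequence_def)
    ultimately show "carrier M \<noteq> {\<zero>\<^bsub>M\<^esub>}"
      using seq_submodule_subset[OF A(3)] by (metis empty_iff subset_singletonD)
  qed
qed

end

section \<open>Torsion in Cohen--Macaulay modules\<close>

definition lin_combs :: "('i \<Rightarrow> 'a) \<Rightarrow> 'i set \<Rightarrow> 'a::comm_ring_1 set" where
  "lin_combs g B = {\<Sum>b\<in>B. c b * g b | c. True}"

lemma lin_combsI: "(\<Sum>b\<in>B. c b * g b) \<in> lin_combs g B"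
  by (auto simp: lin_combs_def)

lemma lin_combs_add: "f \<in> lin_combs g B \<Longrightarrow> h \<in> lin_combs g B \<Longrightarrow> f + h \<in> lin_combs g B"
proof -
  assume "f \<in> lin_combs g B" "h \<in> lin_combs g B"
  then obtain c d where "f = (\<Sum>b\<in>B. c b * g b)" "h = (\<Sum>b\<in>B. d b * g b)"
    by (auto simp: lin_combs_def)
  then have "f + h = (\<Sum>b\<in>B. (c b + d b) * g b)"
    by (simp add: sum.distrib distrib_right)
  then show ?thesis
    by (simp add: lin_combsI)
qed

lemma lin_combs_mult: "f \<in> lin_combs g B \<Longrightarrow> a * f \<in> lin_combs g B"
proof -
  assume "f \<in> lin_combs g B"
  then obtain c where "f = (\<Sum>b\<in>B. c b * g b)"
    by (auto simp: lin_combs_def)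
  then have "a * f = (\<Sum>b\<in>B. (a * c b) * g b)"
    by (simp add: sum_distrib_left mult.assoc)
  then show ?thesis
    by (simp add: lin_combsI)
qed

lemma lin_combs_base: "finite B \<Longrightarrow> b \<in> B \<Longrightarrow> g b \<in> lin_combs g B"
proof -
  assume B: "finite B" "b \<in> B"
  have "(\<Sum>b'\<in>B. (if b' = b then 1 else 0) * g b') = (\<Sum>b'\<in>B. if b' = b then g b' else 0)"
    by (rule sum.cong) auto
  also have "\<dots> = g b"
    using B by simp
  finally show ?thesis
    using lin_combsI[of "\<lambda>b'. if b' = b then 1 else 0" g B] by simp
qed

definition ideal_set :: "'a::comm_ring_1 set \<Rightarrow> bool" where
  "ideal_set I \<longleftrightarrow> 0 \<in> I \<and> (\<forall>f\<in>I. \<forall>g\<in>I. f + g \<in> I) \<and> (\<forall>c. \<forall>f\<in>I. c * f \<in> I)"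

lemma ideal_setD:
  assumes "ideal_set I"
  shows "0 \<in> I" "f \<in> I \<Longrightarrow> g \<in> I \<Longrightarrow> f + g \<in> I" "f \<in> I \<Longrightarrow> c * f \<in> I" "f \<in> I \<Longrightarrow> g \<in> I \<Longrightarrow> f - g \<in> I"
proof -
  show "0 \<in> I" "f \<in> I \<Longrightarrow> g \<in> I \<Longrightarrow> f + g \<in> I" "f \<in> I \<Longrightarrow> c * f \<in> I"
    using assms unfolding ideal_set_def by blast+
  show "f \<in> I \<Longrightarrow> g \<in> I \<Longrightarrow> f - g \<in> I"
    using assms unfolding ideal_set_def by (metis diff_conv_add_uminus mult_minus1)
qed

definition noetherian :: "'a::comm_ring_1 itself \<Rightarrow> bool" where
  "noetherian _ \<longleftrightarrow> (\<forall>I :: 'a set. ideal_set I \<longrightarrow> (\<exists>B. finite B \<and> B \<subseteq> I \<and> I \<subseteq> lin_combs (\<lambda>b. b) B))"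

lemma noetherianD:
  fixes I :: "'a::comm_ring_1 set"
  assumes "noetherian TYPE('a)" "ideal_set I"
  obtains B where "finite B" "B \<subseteq> I" "I \<subseteq> lin_combs (\<lambda>b. b) B"
  using assms unfolding noetherian_def by blast

lemma noetherian_field: "noetherian TYPE('a::field)"
  unfolding noetherian_def
proof (intro allI impI)
  fix I :: "'a set"
  assume I: "ideal_set I"
  show "\<exists>B. finite B \<and> B \<subseteq> I \<and> I \<subseteq> lin_combs (\<lambda>b. b) B"
  proof (cases "I \<subseteq> {0}")
    case True
    then show ?thesis
      by (intro exI[of _ "{}"]) (auto simp: lin_combs_def)
  next
    case False
    then obtain a where a: "a \<in> I" "a \<noteq> 0"
      by auto
    have "c \<in> lin_combs (\<lambda>b. b) {a}" for c
      using lin_combs_mult[OF lin_combs_base[of "{a}" a "\<lambda>b. b"], of "c / a"] a by simp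
    then show ?thesis
      using a by (intro exI[of _ "{a}"]) auto
  qed
qed

text \<open>The standard proof of Hilbert's basis theorem for power series, with the ideals \<open>L i\<close> of leading coefficients in
  degree \<open>i\<close>.\<close>

lemma noetherian_fps:
  assumes "noetherian TYPE('a::comm_ring_1)"
  shows "noetherian TYPE('a fps)"
  unfolding noetherian_def
proof (intro allI impI)
  fix I :: "'a fps set"
  assume I: "ideal_set I"
  define low where "low i f \<longleftrightarrow> (\<forall>j<i. fps_nth f j = 0)" for i and f :: "'a fps"
  define L where "L i = {fps_nth f i | f. f \<in> I \<and> low i f}" for i
  have LI: "fps_nth f i \<in> L i" if "f \<in> I" "low i f" for f i
    using that by (auto simp: L_def)
  have L_ideal: "ideal_set (L i)" for i
    unfolding ideal_set_def
  proof (intro conjI ballI allI)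
    show "0 \<in> L i"
      using LI[of 0 i] ideal_setD(1)[OF I] by (simp add: low_def)
    fix a
    assume "a \<in> L i"
    then obtain f where f: "f \<in> I" "low i f" "a = fps_nth f i"
      by (auto simp: L_def)
    have "fps_const c * f \<in> I" "low i (fps_const c * f)" for c
      using f ideal_setD(3)[OF I] by (simp_all add: low_def)
    then show "c * a \<in> L i" for c
      using LI[of "fps_const c * f" i] f by simp
    fix b
    assume "b \<in> L i"
    then obtain g where g: "g \<in> I" "low i g" "b = fps_nth g i"
      by (auto simp: L_def)
    have "f + g \<in> I" "low i (f + g)"
      using f g ideal_setD(2)[OF I] by (simp_all add: low_def)
    then show "a + b \<in> L i"
      using LI[of "f + g" i] f g by simp
  qed
  have L_Suc: "L i \<subseteq> L (Suc i)" for i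
  proof
    fix a
    assume "a \<in> L i"
    then obtain f where f: "f \<in> I" "low i f" "a = fps_nth f i"
      by (auto simp: L_def)
    have "fps_X * f \<in> I" "low (Suc i) (fps_X * f)"
      using f ideal_setD(3)[OF I] by (auto simp: low_def)
    then show "a \<in> L (Suc i)"
      using LI[of "fps_X * f" "Suc i"] f by simp
  qed
  have L_mono: "L i \<subseteq> L j" if "i \<le> j" for i j
    using lift_Suc_mono_le[of L, OF L_Suc that] .
  have "ideal_set (\<Union>i. L i)"
    unfolding ideal_set_def
  proof (intro conjI ballI allI)
    fix a b c
    assume "a \<in> (\<Union>i. L i)"
    then obtain i where i: "a \<in> L i"
      by blast
    then show "c * a \<in> (\<Union>i. L i)"
      using ideal_setD(3)[OF L_ideal] by blast
    assume "b \<in> (\<Union>i. L i)"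
    then obtain j where "b \<in> L j"
      by blast
    then have "a \<in> L (i + j)" "b \<in> L (i + j)"
      using i L_mono[of i "i + j"] L_mono[of j "i + j"] by auto
    then show "a + b \<in> (\<Union>i. L i)"
      using ideal_setD(2)[OF L_ideal] by blast
  qed (use ideal_setD(1)[OF L_ideal] in blast)
  then obtain B where B: "finite B" "B \<subseteq> (\<Union>i. L i)" "(\<Union>i. L i) \<subseteq> lin_combs (\<lambda>b. b) B"
    by (rule noetherianD[OF assms])
  have "\<forall>b\<in>B. \<exists>i. b \<in> L i"
    using B(2) by auto
  then have "\<exists>n. \<forall>b\<in>B. b \<in> L (n b)"
    by (rule bchoice)
  then obtain n where n: "\<And>b. b \<in> B \<Longrightarrow> b \<in> L (n b)"
    by blast
  \<comment> \<open>Any common bound for the finitely many \<open>n b\<close> serves; from N on the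
    ideals of leading coefficients no longer grow.\<close>
  define N where "N = (\<Sum>b\<in>B. n b)"
  have "n b \<le> N" if "b \<in> B" for b
    unfolding N_def using B(1) that by (intro member_le_sum) auto
  then have BN: "B \<subseteq> L N"
    using n L_mono by blast
  have "\<exists>D. finite D \<and> D \<subseteq> L i \<and> L i \<subseteq> lin_combs (\<lambda>b. b) D" for i
    using noetherianD[OF assms L_ideal[of i]] by metis
  then obtain D where D: "\<And>i. finite (D i)" "\<And>i. D i \<subseteq> L i" "\<And>i. L i \<subseteq> lin_combs (\<lambda>b. b) (D i)"
    by metis
  define E where "E i = (if i < N then D i else B)" for i
  have E: "finite (E i)" "i \<le> N \<Longrightarrow> E i \<subseteq> L i" "L i \<subseteq> lin_combs (\<lambda>b. b) (E i)" for i
    using B D BN by (auto simp: E_def)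
  have "\<forall>z\<in>Sigma {..N} E. \<exists>f. f \<in> I \<and> low (fst z) f \<and> fps_nth f (fst z) = snd z"
    using E(2) by (fastforce simp: L_def)
  then obtain \<phi> where "\<forall>z\<in>Sigma {..N} E. \<phi> z \<in> I \<and> low (fst z) (\<phi> z) \<and> fps_nth (\<phi> z) (fst z) = snd z"
    using bchoice by metis
  then have \<phi>: "\<phi> (i, b) \<in> I" "low i (\<phi> (i, b))" "fps_nth (\<phi> (i, b)) i = b" if "i \<le> N" "b \<in> E i" for i b
    using that by force+
  define G where "G = \<phi> ` Sigma {..N} E"
  have G: "finite G" "G \<subseteq> I"
    using E(1) \<phi>(1) by (auto simp: G_def)
  let ?S = "lin_combs (\<lambda>b. b) G"
  have \<phi>S: "\<phi> (i, b) \<in> ?S" if "i \<le> N" "b \<in> E i" for i b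
    by (rule lin_combs_base[OF G(1), of _ "\<lambda>b. b"]) (use that in \<open>auto simp: G_def\<close>)
  have sumS: "(\<Sum>b\<in>T. q b * \<phi> (i, b)) \<in> ?S" if "i \<le> N" "T \<subseteq> E i" for q T i
    using that(2)
  proof (induction T rule: infinite_finite_induct)
    case empty
    show ?case
      using lin_combsI[of "\<lambda>_. 0" "\<lambda>b. b" G] by simp
  next
    case (infinite T)
    then show ?case
      using E(1) finite_subset by blast
  next
    case (insert b T)
    then show ?case
      using \<phi>S[OF that(1)] by (auto intro!: lin_combs_add lin_combs_mult)
  qed
  \<comment> \<open>Removes the coefficient in degree i. Above N the generators of degree N are
    shifted by the power i - N of \<open>fps_X\<close>, so finitely many generators serve all
    degrees; below N the shift is trivial.\<close>
  have step: "\<exists>c. f - (\<Sum>b\<in>E i. fps_const (c b) * fps_X ^ (i - min i N) * \<phi> (min i N, b)) \<in> I \<and>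
      low (Suc i) (f - (\<Sum>b\<in>E i. fps_const (c b) * fps_X ^ (i - min i N) * \<phi> (min i N, b)))"
    if f: "f \<in> I" "low i f" for f i
  proof -
    have Ei: "E (min i N) = E i"
      by (simp add: E_def min_def)
    obtain c where c: "fps_nth f i = (\<Sum>b\<in>E i. c b * b)"
      using LI[OF f] E(3) by (auto simp: lin_combs_def)
    let ?t = "\<lambda>b. fps_const (c b) * fps_X ^ (i - min i N) * \<phi> (min i N, b)"
    have t: "?t b \<in> I" "low i (?t b)" "fps_nth (?t b) i = c b * b" if "b \<in> E i" for b
    proof -
      have \<phi>b: "\<phi> (min i N, b) \<in> I" "low (min i N) (\<phi> (min i N, b))" "fps_nth (\<phi> (min i N, b)) (min i N) = b"
        using \<phi>[of "min i N" b] that unfolding Ei by simp_all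
      show "?t b \<in> I"
        using \<phi>b(1) by (intro ideal_setD(3)[OF I])
      have "fps_nth (?t b) j = 0" if "j < i" for j
      proof (cases "j < i - min i N")
        case False
        then have "j - (i - min i N) < min i N"
          using that by linarith
        then show ?thesis
          using \<phi>b(2) by (simp add: low_def mult.assoc fps_X_power_mult_nth)
      qed (simp add: mult.assoc fps_X_power_mult_nth)
      then show "low i (?t b)"
        by (simp add: low_def)
      show "fps_nth (?t b) i = c b * b"
        using \<phi>b(3) by (simp add: mult.assoc fps_X_power_mult_nth)
    qed
    have "(\<Sum>b\<in>T. ?t b) \<in> I" if "T \<subseteq> E i" for T
      using that
    proof (induction T rule: infinite_finite_induct)
      case (insert b T)
      then show ?case
        using ideal_setD(2)[OF I t(1)] by simp
    qed (simp_all add: ideal_setD(1)[OF I])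
    then have "(\<Sum>b\<in>E i. ?t b) \<in> I"
      by blast
    moreover have "fps_nth (\<Sum>b\<in>E i. ?t b) j = (if j = i then fps_nth f i else 0)" if "j \<le> i" for j
    proof -
      have "fps_nth (\<Sum>b\<in>E i. ?t b) j = (\<Sum>b\<in>E i. if j = i then c b * b else 0)"
        unfolding fps_sum_nth using t(2,3) that by (intro sum.cong) (auto simp: low_def)
      then show ?thesis
        by (simp add: c)
    qed
    ultimately show ?thesis
      using f ideal_setD(4)[OF I] by (intro exI[of _ c]) (auto simp: low_def less_Suc_eq)
  qed
  have high: "f \<in> ?S" if f: "f \<in> I" "low N f" for f
  proof -
    define good where "good g k c \<longleftrightarrow> g - (\<Sum>b\<in>B. fps_const (c b) * fps_X ^ k * \<phi> (N, b)) \<in> I \<and>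
        low (Suc (N + k)) (g - (\<Sum>b\<in>B. fps_const (c b) * fps_X ^ k * \<phi> (N, b)))" for g k c
    have good_ex: "\<exists>c. good g k c" if "g \<in> I \<and> low (N + k) g" for g k
      using step[of g "N + k"] that by (simp add: E_def good_def)
    define C where "C g k = (SOME c. good g k c)" for g k
    have C: "good g k (C g k)" if "g \<in> I \<and> low (N + k) g" for g k
      unfolding C_def by (rule someI_ex[OF good_ex[OF that]])
    \<comment> \<open>What remains after corrections in the degrees N to N + k - 1. The corrections
      made with a fixed b are collected in one series \<open>q b\<close>, which turns infinitely
      many corrections into a single linear combination.\<close>
    define F where "F = rec_nat f (\<lambda>k g. g - (\<Sum>b\<in>B. fps_const (C g k b) * fps_X ^ k * \<phi> (N, b)))"
    have F0: "F 0 = f" and FS: "F (Suc k) = F k - (\<Sum>b\<in>B. fps_const (C (F k) k b) * fps_X ^ k * \<phi> (N, b))" for k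
      by (simp_all add: F_def)
    have F: "F k \<in> I \<and> low (N + k) (F k)" for k
    proof (induction k)
      case 0
      then show ?case
        using f by (simp add: F0)
    next
      case (Suc k)
      then show ?case
        using C[OF Suc] by (simp add: FS good_def)
    qed
    define q where "q b = Abs_fps (\<lambda>k. C (F k) k b)" for b
    have FK: "f - F K = (\<Sum>b\<in>B. (\<Sum>k<K. fps_const (C (F k) k b) * fps_X ^ k) * \<phi> (N, b))" for K
    proof (induction K)
      case (Suc K)
      have "f - F (Suc K) = (f - F K) + (\<Sum>b\<in>B. fps_const (C (F K) K b) * fps_X ^ K * \<phi> (N, b))"
        by (simp add: FS)
      then show ?case
        unfolding Suc by (simp add: distrib_right flip: sum.distrib)
    qed (simp add: F0)
    have gen: "fps_nth (\<Sum>b\<in>B. p b * \<phi> (N, b)) m = fps_nth (\<Sum>b\<in>B. q b * \<phi> (N, b)) m"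
      if "\<And>b i. i \<le> m \<Longrightarrow> fps_nth (p b) i = fps_nth (q b) i" for p m
      unfolding fps_sum_nth fps_mult_nth using that by (intro sum.cong refl) auto
    have "fps_nth f m = fps_nth (\<Sum>b\<in>B. q b * \<phi> (N, b)) m" for m
    proof -
      have trunc: "fps_nth (\<Sum>k<Suc m. fps_const (C (F k) k b) * fps_X ^ k) i = fps_nth (q b) i" if "i \<le> m" for b i
      proof -
        have "fps_nth (\<Sum>k<Suc m. fps_const (C (F k) k b) * fps_X ^ k) i = (\<Sum>k<Suc m. if i = k then C (F k) k b else 0)"
          unfolding fps_sum_nth by (intro sum.cong) (simp_all add: fps_X_power_nth)
        then show ?thesis
          using that by (simp add: q_def)
      qed
      have "fps_nth f m = fps_nth (f - F (Suc m)) m"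
        using F[of "Suc m"] by (simp add: low_def)
      also have "\<dots> = fps_nth (\<Sum>b\<in>B. q b * \<phi> (N, b)) m"
        unfolding FK by (rule gen) (rule trunc)
      finally show ?thesis .
    qed
    then have "f = (\<Sum>b\<in>B. q b * \<phi> (N, b))"
      by (rule fps_ext)
    then show ?thesis
      using sumS[of N B q] by (simp add: E_def)
  qed
  have all: "f \<in> ?S" if "f \<in> I" "low (N - k) f" for f k
    using that
  proof (induction k arbitrary: f)
    case 0
    then show ?case
      by (intro high) simp_all
  next
    case (Suc k)
    show ?case
    proof (cases "k < N")
      case True
      define i where "i = N - Suc k"
      have i: "Suc i = N - k" "i < N"
        using True by (auto simp: i_def)
      obtain c where c: "f - (\<Sum>b\<in>E i. fps_const (c b) * fps_X ^ (i - min i N) * \<phi> (min i N, b)) \<in> I"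
        "low (Suc i) (f - (\<Sum>b\<in>E i. fps_const (c b) * fps_X ^ (i - min i N) * \<phi> (min i N, b)))"
        using step[of f i] Suc.prems by (auto simp: i_def)
      have "f - (\<Sum>b\<in>E i. fps_const (c b) * \<phi> (i, b)) \<in> ?S"
        using Suc.IH[OF c(1)] c(2) i by simp
      then have "f - (\<Sum>b\<in>E i. fps_const (c b) * \<phi> (i, b)) + (\<Sum>b\<in>E i. fps_const (c b) * \<phi> (i, b)) \<in> ?S"
        using i by (intro lin_combs_add sumS) auto
      then show ?thesis
        by simp
    next
      case False
      then show ?thesis
        using Suc by simp
    qed
  qed
  have "I \<subseteq> ?S"
    using all[of _ N] by (auto simp: low_def)
  with G show "\<exists>B. finite B \<and> B \<subseteq> I \<and> I \<subseteq> lin_combs (\<lambda>b. b) B"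
    by blast
qed

text \<open>Induction on r: the coordinates of index r of members supported up to r form an ideal,
  whose generators are lifted to K; subtracting a combination of the lifts clears this coordinate.
  Sequences vanishing from r on stand for vectors of length r, so that all ranks share one
  type.\<close>

lemma noetherian_free_module:
  fixes K :: "(nat \<Rightarrow> 'a::comm_ring_1) set"
  assumes noeth: "noetherian TYPE('a)"
    and K0: "(\<lambda>_. 0) \<in> K" and Kadd: "\<And>a b. a \<in> K \<Longrightarrow> b \<in> K \<Longrightarrow> (\<lambda>i. a i + b i) \<in> K"
    and Kmult: "\<And>a c. a \<in> K \<Longrightarrow> (\<lambda>i. c * a i) \<in> K"
  shows "\<exists>B. finite B \<and> B \<subseteq> K \<and> (\<forall>a\<in>K. (\<forall>i\<ge>r. a i = 0) \<longrightarrow> (\<exists>c. \<forall>i. a i = (\<Sum>b\<in>B. c b * b i)))"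
proof (induction r)
  case 0
  show ?case
    by (intro exI[of _ "{}"]) auto
next
  case (Suc r)
  obtain B where B: "finite B" "B \<subseteq> K"
    "\<And>a. a \<in> K \<Longrightarrow> \<forall>i\<ge>r. a i = 0 \<Longrightarrow> \<exists>c. \<forall>i. a i = (\<Sum>b\<in>B. c b * b i)"
    using Suc by blast
  define K' where "K' = {a \<in> K. \<forall>i\<ge>Suc r. a i = 0}"
  have K': "(\<lambda>_. 0) \<in> K'" "\<And>a b. a \<in> K' \<Longrightarrow> b \<in> K' \<Longrightarrow> (\<lambda>i. a i + b i) \<in> K'"
    "\<And>a c. a \<in> K' \<Longrightarrow> (\<lambda>i. c * a i) \<in> K'"
    using K0 Kadd Kmult by (auto simp: K'_def)
  have "ideal_set ((\<lambda>a. a r) ` K')"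
    unfolding ideal_set_def
  proof (intro conjI ballI allI)
    show "0 \<in> (\<lambda>a. a r) ` K'"
      using K'(1) by force
    fix x y c
    assume "x \<in> (\<lambda>a. a r) ` K'"
    then obtain a where a: "a \<in> K'" "x = a r"
      by blast
    then show "c * x \<in> (\<lambda>a. a r) ` K'"
      using K'(3)[OF a(1), of c] by force
    assume "y \<in> (\<lambda>a. a r) ` K'"
    then obtain b where b: "b \<in> K'" "y = b r"
      by blast
    then show "x + y \<in> (\<lambda>a. a r) ` K'"
      using K'(2)[OF a(1) b(1)] a by force
  qed
  then obtain D where D: "finite D" "D \<subseteq> (\<lambda>a. a r) ` K'" "(\<lambda>a. a r) ` K' \<subseteq> lin_combs (\<lambda>b. b) D"
    by (rule noetherianD[OF noeth])
  obtain \<phi> where \<phi>: "\<And>d. d \<in> D \<Longrightarrow> \<phi> d \<in> K' \<and> \<phi> d r = d"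
    using D(2) bchoice[of D "\<lambda>d a. a \<in> K' \<and> a r = d"] by auto
  have inj: "inj_on \<phi> D"
    using \<phi> by (metis inj_onI)
  have Ksum: "(\<lambda>i. \<Sum>d\<in>T. c d * \<phi> d i) \<in> K'" if "T \<subseteq> D" for c T
    using that by (induction T rule: infinite_finite_induct) (use K' \<phi> in auto)
  show ?case
  proof (intro exI[of _ "B \<union> \<phi> ` D"] conjI ballI impI)
    show "finite (B \<union> \<phi> ` D)" "B \<union> \<phi> ` D \<subseteq> K"
      using B D \<phi> by (auto simp: K'_def)
    fix a
    assume a: "a \<in> K" "\<forall>i\<ge>Suc r. a i = 0"
    then have "a r \<in> lin_combs (\<lambda>b. b) D"
      using D(3) by (auto simp: K'_def)
    then obtain c where c: "a r = (\<Sum>d\<in>D. c d * d)"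
      by (auto simp: lin_combs_def)
    define a' where "a' i = a i + (- 1) * (\<Sum>d\<in>D. c d * \<phi> d i)" for i
    have "a' \<in> K"
      unfolding a'_def using Ksum[OF order_refl, of c] a by (intro Kadd Kmult) (auto simp: K'_def)
    moreover have "\<phi> d i = 0" if "d \<in> D" "i > r" for d i
      using \<phi>[OF that(1)] that(2) by (auto simp: K'_def)
    then have "\<forall>i\<ge>r. a' i = 0"
      using a(2) c \<phi> by (auto simp: a'_def le_eq_less_or_eq[of r] Suc_le_eq)
    ultimately obtain c' where c': "\<And>i. a' i = (\<Sum>b\<in>B. c' b * b i)"
      using B(3) by blast
    define e where "e b = (if b \<in> B then c' b else 0) + (if b \<in> \<phi> ` D then c (the_inv_into D \<phi> b) else 0)" for b
    have "a i = (\<Sum>b\<in>B \<union> \<phi> ` D. e b * b i)" for i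
    proof -
      have "(\<Sum>b\<in>B \<union> \<phi> ` D. (if b \<in> B then c' b else 0) * b i) = (\<Sum>b\<in>B. c' b * b i)"
        using B D by (intro sum.mono_neutral_cong_right) auto
      moreover have "(\<Sum>b\<in>B \<union> \<phi> ` D. (if b \<in> \<phi> ` D then c (the_inv_into D \<phi> b) else 0) * b i) =
          (\<Sum>b\<in>\<phi> ` D. c (the_inv_into D \<phi> b) * b i)"
        using B D by (intro sum.mono_neutral_cong_right) auto
      moreover have "(\<Sum>b\<in>\<phi> ` D. c (the_inv_into D \<phi> b) * b i) = (\<Sum>d\<in>D. c d * \<phi> d i)"
        by (simp add: sum.reindex[OF inj] the_inv_into_f_f[OF inj])
      ultimately show ?thesis
        using c'[of i] by (simp add: e_def distrib_right sum.distrib a'_def algebra_simps)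
    qed
    then show "\<exists>c. \<forall>i. a i = (\<Sum>b\<in>B \<union> \<phi> ` D. c b * b i)"
      by blast
  qed
qed


section \<open>Infinitely divisible elements and torsion\<close>

context
  fixes M :: "('k::field fps2, 'm) module"
  assumes M: "module ring_A M"
begin

interpretation module ring_A M
  by (rule M)

text \<open>The submodules A t(n) increase, since t(n) is a multiple of t(n+1), and stop growing by
  the Noetherian property. At such an N, t(N+1) = d t(N) = d f t(N+1) with \<open>1 - d * f\<close>
  a unit, so t(N+1) = 0 and with it t(0). This is the part of Krull's intersection theorem that the
  torsion argument needs.\<close>

lemma divisible_sequence_zero:
  assumes fg: "finitely_generated_module ring_A M" and f: "f \<in> max_A"
    and t: "\<And>n. t n \<in> carrier M" "\<And>n. t n = f \<odot>\<^bsub>M\<^esub> t (Suc n)"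
  shows "t 0 = \<zero>\<^bsub>M\<^esub>"
proof -
  have fA: "f \<in> Mset even even"
    using f by (simp add: max_A_def)
  have step: "t n = f ^ k \<odot>\<^bsub>M\<^esub> t (n + k)" for n k
  proof (induction k)
    case 0
    then show ?case
      using smult_one[OF t(1)[of n]] by simp
  next
    case (Suc k)
    have "f ^ Suc k \<odot>\<^bsub>M\<^esub> t (n + Suc k) = f ^ k \<odot>\<^bsub>M\<^esub> (f \<odot>\<^bsub>M\<^esub> t (Suc (n + k)))"
      using smult_assoc1[of "f ^ k" f "t (Suc (n + k))"] fA t(1) by (simp add: mult.commute)
    then show ?case
      using Suc t(2)[of "n + k"] by simp
  qed
  obtain gs where gs: "set gs \<subseteq> carrier M"
    "\<And>m. m \<in> carrier M \<Longrightarrow> \<exists>c \<in> {..<length gs} \<rightarrow> carrier ring_A. m = (\<Oplus>\<^bsub>M\<^esub>i\<in>{..<length gs}. c i \<odot>\<^bsub>M\<^esub> gs ! i)"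
    using fg unfolding finitely_generated_module_def by blast
  define ev where "ev a = (\<Oplus>\<^bsub>M\<^esub>i\<in>{..<length gs}. subst_P (a i) \<odot>\<^bsub>M\<^esub> gs ! i)" for a :: "nat \<Rightarrow> 'k fps5"
  have gsM: "gs ! i \<in> carrier M" if "i < length gs" for i
    using gs(1) that nth_mem by blast
  have clm: "subst_P c \<odot>\<^bsub>M\<^esub> gs ! i \<in> carrier M" if "i < length gs" for c i
    using gsM[OF that] by (intro smult_closed) (simp_all add: subst_P_in_Mset)
  have cl: "(\<lambda>i. subst_P (a i) \<odot>\<^bsub>M\<^esub> gs ! i) \<in> {..<length gs} \<rightarrow> carrier M" for a :: "nat \<Rightarrow> 'k fps5"
    using clm by auto
  have ev_closed: "ev a \<in> carrier M" for a
    unfolding ev_def by (rule M.finsum_closed[OF cl])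
  have ev_add: "ev (\<lambda>i. a i + b i) = ev a \<oplus>\<^bsub>M\<^esub> ev b" for a b
  proof -
    have "ev (\<lambda>i. a i + b i) = (\<Oplus>\<^bsub>M\<^esub>i\<in>{..<length gs}. subst_P (a i) \<odot>\<^bsub>M\<^esub> gs ! i \<oplus>\<^bsub>M\<^esub> subst_P (b i) \<odot>\<^bsub>M\<^esub> gs ! i)"
      unfolding ev_def
    proof (rule M.finsum_cong')
      show "subst_P (a i + b i) \<odot>\<^bsub>M\<^esub> gs ! i = subst_P (a i) \<odot>\<^bsub>M\<^esub> gs ! i \<oplus>\<^bsub>M\<^esub> subst_P (b i) \<odot>\<^bsub>M\<^esub> gs ! i"
        if "i \<in> {..<length gs}" for i
        using that gsM smult_l_distr[of "subst_P (a i)" "subst_P (b i)" "gs ! i"] by (simp add: subst_P_in_Mset)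
    qed (use clm in \<open>auto intro!: M.a_closed\<close>)
    then show ?thesis
      unfolding ev_def using M.finsum_addf[OF cl cl] by simp
  qed
  have ev_mult: "ev (\<lambda>i. c * a i) = subst_P c \<odot>\<^bsub>M\<^esub> ev a" for a c
  proof -
    have "ev (\<lambda>i. c * a i) = (\<Oplus>\<^bsub>M\<^esub>i\<in>{..<length gs}. subst_P c \<odot>\<^bsub>M\<^esub> (subst_P (a i) \<odot>\<^bsub>M\<^esub> gs ! i))"
      unfolding ev_def
    proof (rule M.finsum_cong')
      show "subst_P (c * a i) \<odot>\<^bsub>M\<^esub> gs ! i = subst_P c \<odot>\<^bsub>M\<^esub> (subst_P (a i) \<odot>\<^bsub>M\<^esub> gs ! i)"
        if "i \<in> {..<length gs}" for i
        using that gsM smult_assoc1[of "subst_P c" "subst_P (a i)" "gs ! i"] by (simp add: subst_P_in_Mset)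
    qed (use clm in \<open>auto intro!: smult_closed simp: subst_P_in_Mset\<close>)
    moreover have "subst_P c \<odot>\<^bsub>M\<^esub> (\<Oplus>\<^bsub>M\<^esub>i\<in>{..<length gs}. subst_P (a i) \<odot>\<^bsub>M\<^esub> gs ! i) =
        (\<Oplus>\<^bsub>M\<^esub>i\<in>{..<length gs}. subst_P c \<odot>\<^bsub>M\<^esub> (subst_P (a i) \<odot>\<^bsub>M\<^esub> gs ! i))"
      by (rule finsum_smult_ldistr[OF finite_lessThan _ cl]) (simp add: subst_P_in_Mset)
    ultimately show ?thesis
      by (simp only: ev_def)
  qed
  \<comment> \<open>The preimage of the union of the submodules A t(n) under \<open>ev\<close>.
    Working with coefficients in the five-variable ring gives access to its Noetherian property
    through \<open>subst_P\<close>.\<close>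
  define K where "K = {a. \<exists>n. \<exists>c\<in>Mset even even. ev a = c \<odot>\<^bsub>M\<^esub> t n}"
  have up: "\<exists>d\<in>Mset even even. c \<odot>\<^bsub>M\<^esub> t n = d \<odot>\<^bsub>M\<^esub> t N" if "c \<in> Mset even even" "n \<le> N" for c n N
    using smult_assoc1[of c "f ^ (N - n)" "t N"] step[of n "N - n"] that fA t(1)
    by (intro bexI[of _ "c * f ^ (N - n)"]) simp_all
  have ev0: "ev (\<lambda>_. 0) = \<zero>\<^bsub>M\<^esub>"
    using ev_mult[of 0 "\<lambda>_. 0"] smult_l_null[OF ev_closed] by simp
  have "\<exists>B. finite B \<and> B \<subseteq> K \<and> (\<forall>a\<in>K. (\<forall>i\<ge>length gs. a i = 0) \<longrightarrow> (\<exists>c. \<forall>i. a i = (\<Sum>b\<in>B. c b * b i)))"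
  proof (rule noetherian_free_module)
    show "noetherian TYPE('k fps5)"
      by (intro noetherian_fps noetherian_field)
    have "\<zero>\<^bsub>M\<^esub> = 0 \<odot>\<^bsub>M\<^esub> t 0"
      using smult_l_null[OF t(1)] by simp
    then show "(\<lambda>_. 0) \<in> K"
      unfolding K_def ev0[symmetric] using A_closed(1) by blast
    fix a assume "a \<in> K"
    then obtain n c where a: "c \<in> Mset even even" "ev a = c \<odot>\<^bsub>M\<^esub> t n"
      by (auto simp: K_def)
    show "(\<lambda>i. d * a i) \<in> K" for d
      unfolding K_def using a smult_assoc1[of "subst_P d" c "t n"] t(1) subst_P_in_Mset[of d]
      by (auto simp: ev_mult intro!: exI[of _ n] bexI[of _ "subst_P d * c"])
    fix b assume "b \<in> K"
    then obtain n' c' where b: "c' \<in> Mset even even" "ev b = c' \<odot>\<^bsub>M\<^esub> t n'"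
      by (auto simp: K_def)
    obtain d d' where "d \<in> Mset even even" "d' \<in> Mset even even"
      "ev a = d \<odot>\<^bsub>M\<^esub> t (n + n')" "ev b = d' \<odot>\<^bsub>M\<^esub> t (n + n')"
      using up[OF a(1), of n "n + n'"] up[OF b(1), of n' "n + n'"] a b by auto
    then show "(\<lambda>i. a i + b i) \<in> K"
      unfolding K_def using smult_l_distr[of d d' "t (n + n')"] t(1)
      by (auto simp: ev_add intro!: exI[of _ "n + n'"] bexI[of _ "d + d'"])
  qed
  then obtain B where B: "finite B" "B \<subseteq> K"
    "\<And>a. a \<in> K \<Longrightarrow> (\<And>i. i \<ge> length gs \<Longrightarrow> a i = 0) \<Longrightarrow> \<exists>c. \<forall>i. a i = (\<Sum>b\<in>B. c b * b i)"
    by blast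
  have "\<forall>b\<in>B. \<exists>n. \<exists>c\<in>Mset even even. ev b = c \<odot>\<^bsub>M\<^esub> t n"
    using B(2) by (auto simp: K_def)
  then have "\<exists>n. \<forall>b\<in>B. \<exists>c\<in>Mset even even. ev b = c \<odot>\<^bsub>M\<^esub> t (n b)"
    by (rule bchoice)
  then obtain n where n: "\<And>b. b \<in> B \<Longrightarrow> \<exists>c\<in>Mset even even. ev b = c \<odot>\<^bsub>M\<^esub> t (n b)"
    by blast
  define N where "N = (\<Sum>b\<in>B. n b)"
  have nN: "n b \<le> N" if "b \<in> B" for b
    unfolding N_def using B(1) that by (intro member_le_sum) auto
  have evB: "\<exists>c\<in>Mset even even. ev b = c \<odot>\<^bsub>M\<^esub> t N" if "b \<in> B" for b
    using n[OF that] up[OF _ nN[OF that]] by metis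
  have evS: "\<exists>d\<in>Mset even even. ev (\<lambda>i. \<Sum>b\<in>T. c b * b i) = d \<odot>\<^bsub>M\<^esub> t N" if "T \<subseteq> B" for c T
    using that
  proof (induction T rule: infinite_finite_induct)
    case (infinite T)
    then show ?case
      using B(1) finite_subset by blast
  next
    case empty
    then show ?case
      using smult_l_null[OF t(1)] by (auto simp: ev0 intro!: bexI[of _ 0])
  next
    case (insert b T)
    then obtain d where d: "d \<in> Mset even even" "ev (\<lambda>i. \<Sum>b\<in>T. c b * b i) = d \<odot>\<^bsub>M\<^esub> t N"
      by auto
    obtain e where e: "e \<in> Mset even even" "ev b = e \<odot>\<^bsub>M\<^esub> t N"
      using evB insert.prems by auto
    have "ev (\<lambda>i. \<Sum>b\<in>insert b T. c b * b i) = ev (\<lambda>i. c b * b i + (\<Sum>b\<in>T. c b * b i))"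
      using insert.hyps by simp
    also have "\<dots> = (subst_P (c b) * e + d) \<odot>\<^bsub>M\<^esub> t N"
      unfolding ev_add ev_mult d(2) e(2) using d e subst_P_in_Mset[of "c b"] t(1)
        smult_l_distr[of "subst_P (c b) * e" d "t N"] smult_assoc1[of "subst_P (c b)" e "t N"]
      by simp
    finally show ?case
      using d e subst_P_in_Mset[of "c b"] by (intro bexI[of _ "subst_P (c b) * e + d"]) auto
  qed
  obtain c where c: "c \<in> {..<length gs} \<rightarrow> carrier ring_A" "t (Suc N) = (\<Oplus>\<^bsub>M\<^esub>i\<in>{..<length gs}. c i \<odot>\<^bsub>M\<^esub> gs ! i)"
    using gs(2)[OF t(1)] by blast
  have "\<forall>i\<in>{..<length gs}. \<exists>F. subst_P F = c i"
  proof
    fix i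
    assume "i \<in> {..<length gs}"
    then have "c i \<in> range subst_P"
      using c(1) unfolding ring_A_simps range_subst_P[symmetric] by (rule funcset_mem[rotated])
    then show "\<exists>F. subst_P F = c i"
      by (metis imageE)
  qed
  then have "\<exists>a. \<forall>i\<in>{..<length gs}. subst_P (a i) = c i"
    by (rule bchoice)
  then obtain a0 where a0: "\<And>i. i < length gs \<Longrightarrow> subst_P (a0 i) = c i"
    by auto
  define a where "a i = (if i < length gs then a0 i else 0)" for i
  have eva: "ev a = t (Suc N)"
    unfolding ev_def c(2) using c(1) gsM by (intro M.finsum_cong') (auto simp: a_def a0 Pi_iff)
  moreover have "t (Suc N) = 1 \<odot>\<^bsub>M\<^esub> t (Suc N)"
    using smult_one[OF t(1)] by simp
  ultimately have "a \<in> K"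
    unfolding K_def using A_closed(2) by auto
  then obtain c' where "\<And>i. a i = (\<Sum>b\<in>B. c' b * b i)"
    using B(3)[of a] by (auto simp: a_def)
  then have "a = (\<lambda>i. \<Sum>b\<in>B. c' b * b i)"
    by auto
  then obtain d where d: "d \<in> Mset even even" "t (Suc N) = d \<odot>\<^bsub>M\<^esub> t N"
    using evS[of B c'] eva by auto
  have tS: "t (Suc N) \<in> carrier M"
    by (rule t(1))
  have df: "d * f \<in> carrier ring_A" "1 - d * f \<in> carrier ring_A" "d \<in> carrier ring_A" "f \<in> carrier ring_A"
    using d(1) fA by auto
  have eq: "(d * f) \<odot>\<^bsub>M\<^esub> t (Suc N) = t (Suc N)"
    using smult_assoc1[OF df(3,4) tS] d(2) unfolding t(2)[of N] by simp
  have "(1 - d * f) \<odot>\<^bsub>M\<^esub> t (Suc N) \<oplus>\<^bsub>M\<^esub> (d * f) \<odot>\<^bsub>M\<^esub> t (Suc N) = t (Suc N)"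
    using smult_l_distr[OF df(2,1) tS] smult_one[OF tS] by simp
  then have zero: "(1 - d * f) \<odot>\<^bsub>M\<^esub> t (Suc N) = \<zero>\<^bsub>M\<^esub>"
    unfolding eq by (simp only: M.add.r_cancel_one smult_closed[OF df(2) tS] tS)
  have "cf (1 - d * f) 0 0 \<noteq> 0"
    using f by (simp add: max_A_def cf_mult)
  then obtain e where e: "e \<in> Mset even even" "e * (1 - d * f) = 1"
    using unit_in_A[of "1 - d * f"] d fA by auto
  have eA: "e \<in> carrier ring_A"
    using e(1) by simp
  have "t (Suc N) = e \<odot>\<^bsub>M\<^esub> ((1 - d * f) \<odot>\<^bsub>M\<^esub> t (Suc N))"
    using smult_assoc1[OF eA df(2) tS] smult_one[OF tS] e(2) by simp
  then have "t (Suc N) = \<zero>\<^bsub>M\<^esub>"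
    unfolding zero smult_r_null[OF eA] .
  then show ?thesis
    using step[of 0 "Suc N"] smult_r_null[of "f ^ Suc N"] fA by simp
qed

text \<open>Let f, g be a regular sequence and s t = 0. Since a power of g is in
  \<open>bset s f\<close>, it sends t into f M, so t = f t' by regularity of g modulo f, and s t' =
  0 by regularity of f. Iterating, t is infinitely divisible by f and hence zero.\<close>

lemma maximal_CM_torsion_free:
  assumes CM: "maximal_CM ring_A M" and s: "s \<in> Mset even even" "s \<noteq> 0"
    and t: "t \<in> carrier M" "s \<odot>\<^bsub>M\<^esub> t = \<zero>\<^bsub>M\<^esub>"
  shows "t = \<zero>\<^bsub>M\<^esub>"
proof -
  obtain f g where fg: "f \<in> max_A" "g \<in> max_A"
    and f: "\<And>m. m \<in> carrier M \<Longrightarrow> f \<odot>\<^bsub>M\<^esub> m = \<zero>\<^bsub>M\<^esub> \<Longrightarrow> m = \<zero>\<^bsub>M\<^esub>"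
    and g: "\<And>m n. m \<in> carrier M \<Longrightarrow> n \<in> carrier M \<Longrightarrow> g \<odot>\<^bsub>M\<^esub> m = f \<odot>\<^bsub>M\<^esub> n \<Longrightarrow> \<exists>k\<in>carrier M. m = f \<odot>\<^bsub>M\<^esub> k"
    and "carrier M \<noteq> {\<zero>\<^bsub>M\<^esub>}"
    by (rule maximal_CM_D[OF M CM]) blast
  have A: "f \<in> Mset even even" "g \<in> Mset even even" "cf g 0 0 = 0"
    using fg by (auto simp: max_A_def)
  obtain N where "g ^ N \<in> bset s f"
    using power_in_bset[OF s(2,1) A(1) A(2,3)] by blast
  then obtain l h q where h: "h \<in> Mset even even" "q \<in> Mset even even" "f ^ l * (g ^ N + f * h) = s * q"
    by (auto simp: bset_def)
  let ?T = "{t \<in> carrier M. s \<odot>\<^bsub>M\<^esub> t = \<zero>\<^bsub>M\<^esub>}"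
  have div: "\<exists>t'\<in>?T. t = f \<odot>\<^bsub>M\<^esub> t'" if "t \<in> ?T" for t
  proof -
    have t: "t \<in> carrier M" "s \<odot>\<^bsub>M\<^esub> t = \<zero>\<^bsub>M\<^esub>"
      using that by auto
    have sA: "f ^ l \<in> Mset even even" "g ^ N + f * h \<in> Mset even even" "g ^ N \<in> Mset even even"
      using A h by auto
    have "f ^ l \<odot>\<^bsub>M\<^esub> ((g ^ N + f * h) \<odot>\<^bsub>M\<^esub> t) = q \<odot>\<^bsub>M\<^esub> (s \<odot>\<^bsub>M\<^esub> t)"
      using smult_assoc1[of "f ^ l" "g ^ N + f * h" t] smult_assoc1[of q s t] sA t h s by (simp add: mult.commute)
    then have fl: "f ^ l \<odot>\<^bsub>M\<^esub> ((g ^ N + f * h) \<odot>\<^bsub>M\<^esub> t) \<in> {\<zero>\<^bsub>M\<^esub>}"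
      using t h by simp
    have cl: "(g ^ N + f * h) \<odot>\<^bsub>M\<^esub> t \<in> carrier M"
      using sA t by (intro smult_closed) simp_all
    have r: "m \<in> {\<zero>\<^bsub>M\<^esub>}" if "m \<in> carrier M" "f \<odot>\<^bsub>M\<^esub> m \<in> {\<zero>\<^bsub>M\<^esub>}" for m
      using f that by blast
    have "(g ^ N + f * h) \<odot>\<^bsub>M\<^esub> t \<in> {\<zero>\<^bsub>M\<^esub>}"
      by (rule regular_power[OF M, where g = f and l = l]; (erule (1) r | rule A(1) cl fl))
    then have z: "(g ^ N + f * h) \<odot>\<^bsub>M\<^esub> t = \<zero>\<^bsub>M\<^esub>"
      by simp
    have "g ^ N \<odot>\<^bsub>M\<^esub> t = ((g ^ N + f * h) + f * (- h)) \<odot>\<^bsub>M\<^esub> t"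
      by simp
    then have "g ^ N \<odot>\<^bsub>M\<^esub> t = f \<odot>\<^bsub>M\<^esub> ((- h) \<odot>\<^bsub>M\<^esub> t)"
      using smult_l_distr[of "g ^ N + f * h" "f * (- h)" t] smult_assoc1[of f "- h" t] t A sA h z
      by (simp add: A_closed del: mult_minus_right)
    moreover have "(- h) \<odot>\<^bsub>M\<^esub> t \<in> carrier M"
      using h t by (intro smult_closed) simp_all
    ultimately have gN: "g ^ N \<odot>\<^bsub>M\<^esub> t \<in> {f \<odot>\<^bsub>M\<^esub> m | m. m \<in> carrier M}"
      by blast
    have r': "m \<in> {f \<odot>\<^bsub>M\<^esub> m | m. m \<in> carrier M}"
      if "m \<in> carrier M" "g \<odot>\<^bsub>M\<^esub> m \<in> {f \<odot>\<^bsub>M\<^esub> m | m. m \<in> carrier M}" for m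
      using g that by blast
    have "t \<in> {f \<odot>\<^bsub>M\<^esub> m | m. m \<in> carrier M}"
      by (rule regular_power[OF M, where g = g and l = N]; (erule (1) r' | rule A(2) t(1) gN))
    then obtain t' where t': "t' \<in> carrier M" "t = f \<odot>\<^bsub>M\<^esub> t'"
      by blast
    have "f \<odot>\<^bsub>M\<^esub> (s \<odot>\<^bsub>M\<^esub> t') = s \<odot>\<^bsub>M\<^esub> t"
      using smult_assoc1[of f s t'] smult_assoc1[of s f t'] t' s A by (simp add: mult.commute)
    then have "s \<odot>\<^bsub>M\<^esub> t' = \<zero>\<^bsub>M\<^esub>"
      using f[of "s \<odot>\<^bsub>M\<^esub> t'"] t t' s by simp
    then show ?thesis
      using t' by blast
  qed
  define d where "d t = (SOME t'. t' \<in> ?T \<and> t = f \<odot>\<^bsub>M\<^esub> t')" for t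
  have d: "d t \<in> ?T \<and> t = f \<odot>\<^bsub>M\<^esub> d t" if "t \<in> ?T" for t
    unfolding d_def by (rule someI_ex) (use div[OF that] in blast)
  define u where "u n = (d ^^ n) t" for n
  have uT: "u n \<in> ?T" for n
  proof (induction n)
    case 0
    then show ?case
      using t by (simp add: u_def)
  next
    case (Suc n)
    have "u (Suc n) = d (u n)"
      by (simp add: u_def)
    then show ?case
      using d[OF Suc] by metis
  qed
  have "u 0 = \<zero>\<^bsub>M\<^esub>"
  proof (rule divisible_sequence_zero[OF _ fg(1)])
    show "finitely_generated_module ring_A M"
      using CM by (simp add: maximal_CM_def)
    show "u n \<in> carrier M" for n
      using uT by blast
    show "u n = f \<odot>\<^bsub>M\<^esub> u (Suc n)" for n
      using d[OF uT[of n]] by (simp add: u_def)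
  qed
  then show ?thesis
    by (simp add: u_def)
qed

end

section \<open>Tensor products\<close>

locale tensor =
  fixes A :: "('a, 'c) ring_scheme" and S :: "('s, 'd) ring_scheme" and h :: "'a \<Rightarrow> 's"
    and M :: "('a, 'm, 'e) module_scheme"
  assumes module_M: "module A M" and cring_S: "cring S" and hom_h: "h \<in> Ring.ring_hom A S"
begin

sublocale M: module A M
  by (rule module_M)

sublocale S: cring S
  by (rule cring_S)

abbreviation "Fr \<equiv> free_Abelian_group (carrier S \<times> carrier M)"
abbreviation "K \<equiv> tensor_kernel A S h M"
abbreviation "tc \<equiv> tensor_class A S h M"
abbreviation "T \<equiv> base_change A S h M"
abbreviation "pt \<equiv> pure_tensor A S h M"

lemma h_closed: "r \<in> carrier A \<Longrightarrow> h r \<in> carrier S"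
  using hom_h by (auto simp: Ring.ring_hom_def)

lemma relations_in: "tensor_relations A S h M \<subseteq> carrier Fr"
proof -
  have k: "Poly_Mapping.keys (frag_of x - frag_of y - frag_of z) \<subseteq> B" if "x \<in> B" "y \<in> B" "z \<in> B" for x y z :: "'s \<times> 'm" and B
    using that keys_diff[of "frag_of x - frag_of y" "frag_of z"] keys_diff[of "frag_of x" "frag_of y"] by auto
  have k2: "Poly_Mapping.keys (frag_of x - frag_of y) \<subseteq> B" if "x \<in> B" "y \<in> B" for x y :: "'s \<times> 'm" and B
    using that keys_diff[of "frag_of x" "frag_of y"] by auto
  show ?thesis
  proof
    fix p
    assume "p \<in> tensor_relations A S h M"
    then show "p \<in> carrier Fr"
      unfolding carrier_free_Abelian_group_iff tensor_relations_def
      by (elim UnE CollectE exE conjE; hypsubst; intro k k2) (auto intro: h_closed)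
  qed
qed

lemma K_subgroup: "subgroup K Fr"
  unfolding tensor_kernel_def by (rule group.generate_is_subgroup[OF group_free_Abelian_group relations_in])

lemma K_normal: "K \<lhd> Fr"
  by (rule comm_group.normal_iff_subgroup[OF abelian_free_Abelian_group, THEN iffD2, OF K_subgroup])

lemma K_closed:
  "0 \<in> K" "p \<in> K \<Longrightarrow> q \<in> K \<Longrightarrow> p + q \<in> K" "p \<in> K \<Longrightarrow> - p \<in> K" "p \<in> K \<Longrightarrow> q \<in> K \<Longrightarrow> p - q \<in> K"
  "p \<in> K \<Longrightarrow> Poly_Mapping.keys p \<subseteq> carrier S \<times> carrier M"
proof -
  interpret K: subgroup K Fr
    by (rule K_subgroup)
  show k: "p \<in> K \<Longrightarrow> Poly_Mapping.keys p \<subseteq> carrier S \<times> carrier M" for p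
    using K.mem_carrier by simp
  show "0 \<in> K" "p \<in> K \<Longrightarrow> q \<in> K \<Longrightarrow> p + q \<in> K"
    using K.one_closed K.m_closed by auto
  show m: "p \<in> K \<Longrightarrow> - p \<in> K" for p
    using K.m_inv_closed[of p] k[of p] by (simp add: inv_free_Abelian_group)
  show "p \<in> K \<Longrightarrow> q \<in> K \<Longrightarrow> p - q \<in> K"
    using K.m_closed[of p "- q"] m[of q] by simp
qed

lemma rel_in_K:
  "s \<in> carrier S \<Longrightarrow> t \<in> carrier S \<Longrightarrow> m \<in> carrier M \<Longrightarrow> frag_of (s \<oplus>\<^bsub>S\<^esub> t, m) - frag_of (s, m) - frag_of (t, m) \<in> K"
  "s \<in> carrier S \<Longrightarrow> m \<in> carrier M \<Longrightarrow> n \<in> carrier M \<Longrightarrow> frag_of (s, m \<oplus>\<^bsub>M\<^esub> n) - frag_of (s, m) - frag_of (s, n) \<in> K"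
  "s \<in> carrier S \<Longrightarrow> r \<in> carrier A \<Longrightarrow> m \<in> carrier M \<Longrightarrow> frag_of (s \<otimes>\<^bsub>S\<^esub> h r, m) - frag_of (s, r \<odot>\<^bsub>M\<^esub> m) \<in> K"
  unfolding tensor_kernel_def by (rule generate.incl; unfold tensor_relations_def; blast)+

lemma tc_eq: "tc p = {k + p | k. k \<in> K}"
  by (auto simp: tensor_class_def r_coset_def)

lemma tc_self: "p \<in> tc p"
  unfolding tc_eq using K_closed(1) by force

lemma tc_eq_iff: "tc p = tc q \<longleftrightarrow> p - q \<in> K"
proof
  assume "tc p = tc q"
  then have "p \<in> tc q"
    using tc_self[of p] by simp
  then show "p - q \<in> K"
    by (auto simp: tc_eq)
next
  assume pq: "p - q \<in> K"
  have "k + p \<in> tc q" "k + q \<in> tc p" if "k \<in> K" for k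
  proof -
    have "k + p = (k + (p - q)) + q" "k + q = (k - (p - q)) + p"
      by simp_all
    then show "k + p \<in> tc q" "k + q \<in> tc p"
      unfolding tc_eq using K_closed(2)[OF that pq] K_closed(4)[OF that pq] by blast+
  qed
  then show "tc p = tc q"
    by (auto simp: tc_eq)
qed

lemma carrier_T: "carrier T = {tc p | p. Poly_Mapping.keys p \<subseteq> carrier S \<times> carrier M}"
  by (auto simp: base_change_def Let_def carrier_FactGroup tensor_class_def)

lemma add_T: "Poly_Mapping.keys p \<subseteq> carrier S \<times> carrier M \<Longrightarrow> Poly_Mapping.keys q \<subseteq> carrier S \<times> carrier M \<Longrightarrow>
    tc p \<oplus>\<^bsub>T\<^esub> tc q = tc (p + q)"
  using normal.rcos_sum[OF K_normal, of p q] by (simp add: base_change_def Let_def tensor_class_def)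

lemma zero_T: "\<zero>\<^bsub>T\<^esub> = tc 0"
  by (simp add: base_change_def Let_def tc_eq)

text \<open>Multiplication by s on representatives in the free abelian group; it preserves the
  tensor relations and so induces the scalar multiplication of the tensor product.\<close>

definition sig :: "'s \<Rightarrow> ('s \<times> 'm \<Rightarrow>\<^sub>0 int) \<Rightarrow> ('s \<times> 'm \<Rightarrow>\<^sub>0 int)" where
  "sig s = frag_extend (\<lambda>(t, m). frag_of (s \<otimes>\<^bsub>S\<^esub> t, m))"

lemma sig_simps [simp]: "sig s 0 = 0" "sig s (p + q) = sig s p + sig s q" "sig s (- p) = - sig s p"
  "sig s (p - q) = sig s p - sig s q" "sig s (frag_of (t, m)) = frag_of (s \<otimes>\<^bsub>S\<^esub> t, m)"
  by (simp_all add: sig_def frag_extend_add frag_extend_diff frag_extend_minus)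

lemma sig_keys:
  assumes s: "s \<in> carrier S" and p: "Poly_Mapping.keys p \<subseteq> carrier S \<times> carrier M"
  shows "Poly_Mapping.keys (sig s p) \<subseteq> carrier S \<times> carrier M"
proof -
  have "Poly_Mapping.keys (frag_of (s \<otimes>\<^bsub>S\<^esub> t, m)) \<subseteq> carrier S \<times> carrier M" if "(t, m) \<in> Poly_Mapping.keys p" for t m
    using that s p by auto
  then show ?thesis
    unfolding sig_def using keys_frag_extend[of "\<lambda>(t, m). frag_of (s \<otimes>\<^bsub>S\<^esub> t, m)" p] by fastforce
qed

lemma sig_K:
  assumes s: "s \<in> carrier S" and p: "p \<in> K"
  shows "sig s p \<in> K"
  using p unfolding tensor_kernel_def
proof (induction p rule: generate.induct)
  case one
  then show ?case
    using generate.one[of Fr] by simp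
next
  case (incl p)
  then show ?case
    unfolding tensor_kernel_def[symmetric]
    by (auto simp: tensor_relations_def s S.r_distr S.m_assoc[symmetric] h_closed intro!: rel_in_K)
next
  case (inv p)
  then have "sig s p \<in> K"
    by (auto simp: tensor_relations_def s S.r_distr S.m_assoc[symmetric] h_closed intro!: rel_in_K)
  moreover have "inv\<^bsub>Fr\<^esub> p = - p"
    using subsetD[OF relations_in inv] by (intro inv_free_Abelian_group) (simp only: carrier_free_Abelian_group_iff)
  ultimately show ?case
    using K_closed(3) by (simp add: tensor_kernel_def)
next
  case (eng p q)
  then show ?case
    using K_closed(2) by (simp add: tensor_kernel_def)
qed

lemma smult_T:
  assumes s: "s \<in> carrier S"
  shows "s \<odot>\<^bsub>T\<^esub> tc p = tc (sig s p)"
proof -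
  have "s \<odot>\<^bsub>T\<^esub> tc p = (\<Union>q\<in>tc p. tc (sig s q))"
    by (simp add: base_change_def Let_def sig_def)
  also have "\<dots> = (\<Union>q\<in>tc p. tc (sig s p))"
  proof (rule SUP_cong[OF refl])
    fix q
    assume "q \<in> tc p"
    then have "sig s (q - p) \<in> K"
      using sig_K[OF s] by (auto simp: tc_eq)
    then show "tc (sig s q) = tc (sig s p)"
      by (simp add: tc_eq_iff)
  qed
  also have "\<dots> = tc (sig s p)"
    using tc_self by auto
  finally show ?thesis .
qed

lemma T_cases:
  assumes "Z \<in> carrier T"
  obtains p where "Z = tc p" "Poly_Mapping.keys p \<subseteq> carrier S \<times> carrier M"
  using assms by (auto simp: carrier_T)

lemma keys_pm: "Poly_Mapping.keys p \<subseteq> B \<Longrightarrow> Poly_Mapping.keys q \<subseteq> B \<Longrightarrow> Poly_Mapping.keys (p + q) \<subseteq> B"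
  "Poly_Mapping.keys p \<subseteq> B \<Longrightarrow> Poly_Mapping.keys q \<subseteq> B \<Longrightarrow> Poly_Mapping.keys (p - q) \<subseteq> B"
  "Poly_Mapping.keys p \<subseteq> B \<Longrightarrow> Poly_Mapping.keys (- p) \<subseteq> B" for p q :: "'x \<Rightarrow>\<^sub>0 int"
  using Poly_Mapping.keys_add[of p q] keys_diff[of p q] by auto

lemma tcI: "Poly_Mapping.keys p \<subseteq> carrier S \<times> carrier M \<Longrightarrow> tc p \<in> carrier T"
  by (auto simp: carrier_T)

lemma module_T: "module S T"
proof (rule moduleI[OF cring_S])
  show "abelian_group T"
  proof (rule abelian_groupI)
    fix Y Z W
    assume "Y \<in> carrier T" "Z \<in> carrier T" "W \<in> carrier T"
    then show "(Y \<oplus>\<^bsub>T\<^esub> Z) \<oplus>\<^bsub>T\<^esub> W = Y \<oplus>\<^bsub>T\<^esub> (Z \<oplus>\<^bsub>T\<^esub> W)"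
      by (elim T_cases) (simp add: add_T keys_pm add.assoc)
  next
    fix Y Z
    assume YZ: "Y \<in> carrier T" "Z \<in> carrier T"
    then show "Y \<oplus>\<^bsub>T\<^esub> Z \<in> carrier T" "Y \<oplus>\<^bsub>T\<^esub> Z = Z \<oplus>\<^bsub>T\<^esub> Y"
      by (elim T_cases; simp add: add_T keys_pm tcI add.commute)+
    show "\<exists>W\<in>carrier T. W \<oplus>\<^bsub>T\<^esub> Y = \<zero>\<^bsub>T\<^esub>"
    proof -
      obtain p where p: "Y = tc p" "Poly_Mapping.keys p \<subseteq> carrier S \<times> carrier M"
        using YZ(1) by (rule T_cases)
      then show ?thesis
        by (intro bexI[of _ "tc (- p)"]) (simp_all add: add_T keys_pm tcI zero_T)
    qed
    show "\<zero>\<^bsub>T\<^esub> \<oplus>\<^bsub>T\<^esub> Y = Y"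
      using YZ(1) by (elim T_cases) (simp add: zero_T add_T)
  qed (simp add: zero_T tcI)
  show "s \<odot>\<^bsub>T\<^esub> Y \<in> carrier T" if "s \<in> carrier S" "Y \<in> carrier T" for s Y
    using that(2,1) by (elim T_cases) (simp add: smult_T sig_keys tcI)
  show "s \<odot>\<^bsub>T\<^esub> (Y \<oplus>\<^bsub>T\<^esub> Z) = s \<odot>\<^bsub>T\<^esub> Y \<oplus>\<^bsub>T\<^esub> s \<odot>\<^bsub>T\<^esub> Z"
    if "s \<in> carrier S" "Y \<in> carrier T" "Z \<in> carrier T" for s Y Z
    using that(2,3,1) by (elim T_cases) (simp add: smult_T add_T sig_keys keys_pm)
  show "(s \<oplus>\<^bsub>S\<^esub> t) \<odot>\<^bsub>T\<^esub> Y = s \<odot>\<^bsub>T\<^esub> Y \<oplus>\<^bsub>T\<^esub> t \<odot>\<^bsub>T\<^esub> Y"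
    if s: "s \<in> carrier S" and t: "t \<in> carrier S" and Y: "Y \<in> carrier T" for s t Y
  proof -
    obtain p where p: "Y = tc p" "Poly_Mapping.keys p \<subseteq> carrier S \<times> carrier M"
      using Y by (rule T_cases)
    have "sig (s \<oplus>\<^bsub>S\<^esub> t) p - (sig s p + sig t p) \<in> K"
      using p(2)
    proof (induction p rule: frag_induction)
      case (one x)
      then show ?case
        using rel_in_K(1) s t by (cases x) (auto simp: S.l_distr diff_diff_eq)
    next
      case (diff p q)
      have eq: "sig (s \<oplus>\<^bsub>S\<^esub> t) (p - q) - (sig s (p - q) + sig t (p - q)) =
          (sig (s \<oplus>\<^bsub>S\<^esub> t) p - (sig s p + sig t p)) - (sig (s \<oplus>\<^bsub>S\<^esub> t) q - (sig s q + sig t q))"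
        by simp
      show ?case
        unfolding eq by (rule K_closed(4)[OF diff])
    qed (simp add: K_closed)
    then show ?thesis
      using s t p by (simp add: smult_T add_T sig_keys tc_eq_iff)
  qed
  show "(s \<otimes>\<^bsub>S\<^esub> t) \<odot>\<^bsub>T\<^esub> Y = s \<odot>\<^bsub>T\<^esub> (t \<odot>\<^bsub>T\<^esub> Y)"
    if s: "s \<in> carrier S" and t: "t \<in> carrier S" and Y: "Y \<in> carrier T" for s t Y
  proof -
    obtain p where p: "Y = tc p" "Poly_Mapping.keys p \<subseteq> carrier S \<times> carrier M"
      using Y by (rule T_cases)
    have "sig (s \<otimes>\<^bsub>S\<^esub> t) p = sig s (sig t p)"
      using p(2) by (induction p rule: frag_induction) (auto simp: S.m_assoc s t)
    then show ?thesis
      using s t p by (simp add: smult_T)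
  qed
  show "\<one>\<^bsub>S\<^esub> \<odot>\<^bsub>T\<^esub> Y = Y" if Y: "Y \<in> carrier T" for Y
  proof -
    obtain p where p: "Y = tc p" "Poly_Mapping.keys p \<subseteq> carrier S \<times> carrier M"
      using Y by (rule T_cases)
    have "sig \<one>\<^bsub>S\<^esub> p = p"
      using p(2) by (induction p rule: frag_induction) auto
    then show ?thesis
      using p by (simp add: smult_T)
  qed
qed

sublocale T: module S T
  by (rule module_T)

lemma pt_closed: "s \<in> carrier S \<Longrightarrow> m \<in> carrier M \<Longrightarrow> pt s m \<in> carrier T"
  by (simp add: pure_tensor_def tcI)

lemma smult_pt: "c \<in> carrier S \<Longrightarrow> s \<in> carrier S \<Longrightarrow> m \<in> carrier M \<Longrightarrow> c \<odot>\<^bsub>T\<^esub> pt s m = pt (c \<otimes>\<^bsub>S\<^esub> s) m"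
  by (simp add: pure_tensor_def smult_T)

lemma pt_add_left: "s \<in> carrier S \<Longrightarrow> t \<in> carrier S \<Longrightarrow> m \<in> carrier M \<Longrightarrow> pt (s \<oplus>\<^bsub>S\<^esub> t) m = pt s m \<oplus>\<^bsub>T\<^esub> pt t m"
  using rel_in_K(1)[of s t m] by (simp add: pure_tensor_def add_T tc_eq_iff diff_diff_eq)

lemma pt_add_right: "s \<in> carrier S \<Longrightarrow> m \<in> carrier M \<Longrightarrow> n \<in> carrier M \<Longrightarrow> pt s (m \<oplus>\<^bsub>M\<^esub> n) = pt s m \<oplus>\<^bsub>T\<^esub> pt s n"
  using rel_in_K(2)[of s m n] by (simp add: pure_tensor_def add_T tc_eq_iff diff_diff_eq)

lemma pt_balanced: "s \<in> carrier S \<Longrightarrow> r \<in> carrier A \<Longrightarrow> m \<in> carrier M \<Longrightarrow> pt s (r \<odot>\<^bsub>M\<^esub> m) = pt (s \<otimes>\<^bsub>S\<^esub> h r) m"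
  using rel_in_K(3)[of s r m] by (metis pure_tensor_def tc_eq_iff)

lemma T_induct [consumes 1, case_names pure add]:
  assumes Z: "Z \<in> carrier T"
    and pure: "\<And>s m. s \<in> carrier S \<Longrightarrow> m \<in> carrier M \<Longrightarrow> P (pt s m)"
    and add: "\<And>Y Z. Y \<in> carrier T \<Longrightarrow> Z \<in> carrier T \<Longrightarrow> P Y \<Longrightarrow> P Z \<Longrightarrow> P (Y \<oplus>\<^bsub>T\<^esub> Z)"
  shows "P Z"
proof -
  obtain p where p: "Z = tc p" "Poly_Mapping.keys p \<subseteq> carrier S \<times> carrier M"
    using Z by (rule T_cases)
  let ?B = "carrier S \<times> carrier M"
  have pt0: "pt \<zero>\<^bsub>S\<^esub> \<zero>\<^bsub>M\<^esub> = tc 0"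
    using smult_pt[of "\<zero>\<^bsub>S\<^esub>" "\<zero>\<^bsub>S\<^esub>" "\<zero>\<^bsub>M\<^esub>"] T.smult_l_null[OF pt_closed[of "\<zero>\<^bsub>S\<^esub>" "\<zero>\<^bsub>M\<^esub>"]] zero_T by simp
  \<comment> \<open>\<open>frag_induction\<close> proceeds by differences, so the claim is carried
    for p and -p together; the negative of a pure tensor is the pure tensor with the negated
    scalar.\<close>
  have "Poly_Mapping.keys p \<subseteq> ?B \<and> P (tc p) \<and> P (tc (- p))"
    using p(2)
  proof (induction p rule: frag_induction)
    case zero
    then show ?case
      using pure[of "\<zero>\<^bsub>S\<^esub>" "\<zero>\<^bsub>M\<^esub>"] by (simp add: pt0)
  next
    case (one x)
    obtain s m where x: "x = (s, m)" "s \<in> carrier S" "m \<in> carrier M"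
      using one by (cases x) auto
    have "pt (\<ominus>\<^bsub>S\<^esub> s) m \<oplus>\<^bsub>T\<^esub> pt s m = \<zero>\<^bsub>T\<^esub>"
      using pt_add_left[of "\<ominus>\<^bsub>S\<^esub> s" s m] x smult_pt[of "\<zero>\<^bsub>S\<^esub>" s m] T.smult_l_null[OF pt_closed[of s m]]
      by (simp add: S.l_neg)
    then have "tc (frag_of (\<ominus>\<^bsub>S\<^esub> s, m) + frag_of (s, m)) = tc 0"
      using x by (simp add: pure_tensor_def add_T zero_T)
    then have "tc (- frag_of x) = pt (\<ominus>\<^bsub>S\<^esub> s) m"
      using x by (simp add: pure_tensor_def tc_eq_iff K_closed(3)) (metis K_closed(3) add.commute minus_add_distrib uminus_add_conv_diff)
    then show ?case
      using pure[of s m] pure[of "\<ominus>\<^bsub>S\<^esub> s" m] x by (simp add: pure_tensor_def)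
  next
    case (diff p q)
    have "P (tc (p + - q))" "P (tc (- p + q))"
      using diff add[of "tc p" "tc (- q)"] add[of "tc (- p)" "tc q"] by (simp_all only: add_T keys_pm tcI)
    then show ?case
      using diff by (simp add: keys_pm add.commute)
  qed
  then show ?thesis
    by (simp add: p)
qed

lemma hom_unique:
  assumes N: "module S N" and f: "f \<in> module_hom S T N" and g: "g \<in> module_hom S T N"
    and eq: "\<And>s m. s \<in> carrier S \<Longrightarrow> m \<in> carrier M \<Longrightarrow> f (pt s m) = g (pt s m)" and Z: "Z \<in> carrier T"
  shows "f Z = g Z"
  using Z
proof (induction rule: T_induct)
  case (add Y Z)
  then show ?case
    using f g by (simp add: module_hom_def)
qed (rule eq)

lemma adjoint_exists:
  assumes N: "module S N"
    and \<beta>: "\<And>m. m \<in> carrier M \<Longrightarrow> \<beta> m \<in> carrier N"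
    and \<beta>_add: "\<And>m n. m \<in> carrier M \<Longrightarrow> n \<in> carrier M \<Longrightarrow> \<beta> (m \<oplus>\<^bsub>M\<^esub> n) = \<beta> m \<oplus>\<^bsub>N\<^esub> \<beta> n"
    and \<beta>_smult: "\<And>r m. r \<in> carrier A \<Longrightarrow> m \<in> carrier M \<Longrightarrow> \<beta> (r \<odot>\<^bsub>M\<^esub> m) = h r \<odot>\<^bsub>N\<^esub> \<beta> m"
  shows "\<exists>f\<in>module_hom S T N \<inter> extensional (carrier T). \<forall>s\<in>carrier S. \<forall>m\<in>carrier M. f (pt s m) = s \<odot>\<^bsub>N\<^esub> \<beta> m"
proof -
  interpret N: module S N
    by (rule N)
  obtain g where g: "g \<in> hom Fr (add_monoid N)"
    and g_of: "\<And>x. x \<in> carrier S \<times> carrier M \<Longrightarrow> g (frag_of x) = (\<lambda>(s, m). s \<odot>\<^bsub>N\<^esub> \<beta> m) x"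
    by (rule comm_group.free_Abelian_group_universal[OF N.a_comm_group, of "\<lambda>(s, m). s \<odot>\<^bsub>N\<^esub> \<beta> m" "carrier S \<times> carrier M"])
      (auto simp: \<beta>)
  let ?B = "carrier S \<times> carrier M"
  have g_closed: "g p \<in> carrier N" if "Poly_Mapping.keys p \<subseteq> ?B" for p
    using g that by (auto simp: hom_def)
  have g_add: "g (p + q) = g p \<oplus>\<^bsub>N\<^esub> g q" if "Poly_Mapping.keys p \<subseteq> ?B" "Poly_Mapping.keys q \<subseteq> ?B" for p q
    using hom_mult[OF g, of p q] that by simp
  have g_zero: "g 0 = \<zero>\<^bsub>N\<^esub>"
    using hom_one[OF g group_free_Abelian_group N.add.is_group] by simp
  have g_neg: "g (- p) = \<ominus>\<^bsub>N\<^esub> g p" if "Poly_Mapping.keys p \<subseteq> ?B" for p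
    using g_add[of "- p" p] that g_closed[of p] g_closed[of "- p"] g_zero by (intro N.minus_equality[symmetric]) (simp_all add: keys_pm)
  have g_diff: "g (p - q) = g p \<ominus>\<^bsub>N\<^esub> g q" if "Poly_Mapping.keys p \<subseteq> ?B" "Poly_Mapping.keys q \<subseteq> ?B" for p q
    using g_add[of p "- q"] g_neg[of q] that by (simp add: keys_pm N.minus_eq)
  have d1: "x = y \<oplus>\<^bsub>N\<^esub> z \<Longrightarrow> x \<ominus>\<^bsub>N\<^esub> y \<ominus>\<^bsub>N\<^esub> z = \<zero>\<^bsub>N\<^esub>" if "y \<in> carrier N" "z \<in> carrier N" for x y z
    using that N.r_neg[of "y \<oplus>\<^bsub>N\<^esub> z"] by (simp add: N.minus_eq N.minus_add N.a_assoc)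
  have g_rel: "g p = \<zero>\<^bsub>N\<^esub>" if p: "p \<in> tensor_relations A S h M" for p
  proof -
    have k: "Poly_Mapping.keys (frag_of x - frag_of y) \<subseteq> ?B" if "x \<in> ?B" "y \<in> ?B" for x y
      using that keys_diff[of "frag_of x" "frag_of y"] by auto
    consider (1) s t m where "p = frag_of (s \<oplus>\<^bsub>S\<^esub> t, m) - frag_of (s, m) - frag_of (t, m)" "s \<in> carrier S" "t \<in> carrier S" "m \<in> carrier M"
      | (2) s m n where "p = frag_of (s, m \<oplus>\<^bsub>M\<^esub> n) - frag_of (s, m) - frag_of (s, n)" "s \<in> carrier S" "m \<in> carrier M" "n \<in> carrier M"
      | (3) s r m where "p = frag_of (s \<otimes>\<^bsub>S\<^esub> h r, m) - frag_of (s, r \<odot>\<^bsub>M\<^esub> m)" "s \<in> carrier S" "r \<in> carrier A" "m \<in> carrier M"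
      using p unfolding tensor_relations_def by blast
    then show ?thesis
    proof cases
      case 1
      then show ?thesis
        by (simp add: g_diff k g_of \<beta> N.smult_l_distr d1)
    next
      case 2
      then show ?thesis
        by (simp add: g_diff k g_of \<beta> \<beta>_add N.smult_r_distr d1)
    next
      case 3
      then show ?thesis
        by (simp add: g_diff g_of \<beta> \<beta>_smult h_closed N.smult_assoc1 N.r_neg N.minus_eq)
    qed
  qed
  have g_K: "g p = \<zero>\<^bsub>N\<^esub>" if "p \<in> K" for p
    using that unfolding tensor_kernel_def
  proof (induction p rule: generate.induct)
    case one
    then show ?case
      by (simp add: g_zero)
  next
    case (incl p)
    then show ?case
      by (rule g_rel)
  next
    case (inv p)
    then show ?case
      using relations_in g_neg[of p] g_rel[of p] by (auto simp: subset_eq)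
  next
    case (eng p q)
    then have "p \<in> K" "q \<in> K"
      by (simp_all add: tensor_kernel_def)
    then show ?case
      using eng.IH g_add[of p q] K_closed(5) by simp
  qed
  have g_eq: "g p = g q" if "tc p = tc q" "Poly_Mapping.keys p \<subseteq> ?B" "Poly_Mapping.keys q \<subseteq> ?B" for p q
  proof -
    have "g ((p - q) + q) = g q"
      using g_add[of "p - q" q] that g_K[of "p - q"] g_closed[of q] by (simp add: tc_eq_iff keys_pm)
    then show ?thesis
      by simp
  qed
  define f where "f = (\<lambda>Z\<in>carrier T. g (SOME p. Z = tc p \<and> Poly_Mapping.keys p \<subseteq> ?B))"
  have f_tc: "f (tc p) = g p" if p: "Poly_Mapping.keys p \<subseteq> ?B" for p
  proof -
    define q where "q = (SOME q. tc p = tc q \<and> Poly_Mapping.keys q \<subseteq> ?B)"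
    have q: "tc p = tc q \<and> Poly_Mapping.keys q \<subseteq> ?B"
      unfolding q_def by (rule someI[of "\<lambda>q. tc p = tc q \<and> Poly_Mapping.keys q \<subseteq> ?B" p]) (use p in simp)
    have "f (tc p) = g q"
      unfolding f_def q_def restrict_apply' [OF tcI[OF p]] ..
    also have "\<dots> = g p"
      using q p by (intro g_eq) simp_all
    finally show ?thesis .
  qed
  have g_sig: "g (sig s p) = s \<odot>\<^bsub>N\<^esub> g p" if s: "s \<in> carrier S" and p: "Poly_Mapping.keys p \<subseteq> ?B" for s p
  proof -
    have "Poly_Mapping.keys p \<subseteq> ?B \<and> g (sig s p) = s \<odot>\<^bsub>N\<^esub> g p"
      using p
    proof (induction p rule: frag_induction)
      case zero
      then show ?case
        using s by (simp add: g_zero)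
    next
      case (one x)
      then show ?case
        using s by (cases x) (simp add: g_of \<beta> N.smult_assoc1)
    next
      case (diff p q)
      then show ?case
        using s by (simp add: g_diff keys_pm sig_keys g_closed N.minus_eq N.smult_r_distr N.smult_r_minus)
    qed
    then show ?thesis ..
  qed
  have "f \<in> module_hom S T N"
    unfolding module_hom_def
  proof (intro CollectI conjI ballI)
    show "f \<in> carrier T \<rightarrow> carrier N"
    proof
      fix Z
      assume "Z \<in> carrier T"
      then obtain p where "Z = tc p" "Poly_Mapping.keys p \<subseteq> ?B"
        by (rule T_cases)
      then show "f Z \<in> carrier N"
        by (simp only: f_tc g_closed)
    qed
    show "f (Y \<oplus>\<^bsub>T\<^esub> Z) = f Y \<oplus>\<^bsub>N\<^esub> f Z" if "Y \<in> carrier T" "Z \<in> carrier T" for Y Z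
      using that by (elim T_cases) (simp add: add_T f_tc keys_pm g_add)
    show "f (s \<odot>\<^bsub>T\<^esub> Y) = s \<odot>\<^bsub>N\<^esub> f Y" if "s \<in> carrier S" "Y \<in> carrier T" for s Y
      using that by (elim T_cases) (simp add: smult_T f_tc sig_keys g_sig)
  qed
  moreover have "f (pt s m) = s \<odot>\<^bsub>N\<^esub> \<beta> m" if "s \<in> carrier S" "m \<in> carrier M" for s m
    using that by (simp add: pure_tensor_def f_tc g_of)
  ultimately show ?thesis
    by (intro bexI[of _ f]) (auto simp: f_def)
qed

lemma adjoint:
  assumes N: "module S N"
    and "\<And>m. m \<in> carrier M \<Longrightarrow> \<beta> m \<in> carrier N"
    and "\<And>m n. m \<in> carrier M \<Longrightarrow> n \<in> carrier M \<Longrightarrow> \<beta> (m \<oplus>\<^bsub>M\<^esub> n) = \<beta> m \<oplus>\<^bsub>N\<^esub> \<beta> n"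
    and "\<And>r m. r \<in> carrier A \<Longrightarrow> m \<in> carrier M \<Longrightarrow> \<beta> (r \<odot>\<^bsub>M\<^esub> m) = h r \<odot>\<^bsub>N\<^esub> \<beta> m"
  shows "base_change_adjoint A S h M N \<beta> \<in> module_hom S T N"
    and "base_change_adjoint A S h M N \<beta> \<in> extensional (carrier T)"
    and "\<And>s m. s \<in> carrier S \<Longrightarrow> m \<in> carrier M \<Longrightarrow> base_change_adjoint A S h M N \<beta> (pt s m) = s \<odot>\<^bsub>N\<^esub> \<beta> m"
proof -
  let ?P = "\<lambda>f. f \<in> module_hom S T N \<inter> extensional (carrier T) \<and> (\<forall>s\<in>carrier S. \<forall>m\<in>carrier M. f (pt s m) = s \<odot>\<^bsub>N\<^esub> \<beta> m)"
  obtain f where f: "?P f"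
    using adjoint_exists[OF assms] by blast
  have "g = f" if g: "?P g" for g
  proof (rule extensionalityI[of _ "carrier T"])
    show "g Z = f Z" if "Z \<in> carrier T" for Z
      by (rule hom_unique[OF N _ _ _ that]) (use f g in auto)
  qed (use f g in auto)
  with f have "?P (THE f. ?P f)"
    by (intro theI[of ?P f])
  then have *: "?P (base_change_adjoint A S h M N \<beta>)"
    unfolding base_change_adjoint_def .
  then show "base_change_adjoint A S h M N \<beta> \<in> module_hom S T N"
    "base_change_adjoint A S h M N \<beta> \<in> extensional (carrier T)"
    "\<And>s m. s \<in> carrier S \<Longrightarrow> m \<in> carrier M \<Longrightarrow> base_change_adjoint A S h M N \<beta> (pt s m) = s \<odot>\<^bsub>N\<^esub> \<beta> m"
    by blast+
qed

end

lemma base_change_map_props: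
  assumes M: "tensor A S h M" and N: "tensor A S h N" and \<phi>: "\<phi> \<in> module_hom A M N"
  shows "base_change_map A S h M N \<phi> \<in> module_hom S (base_change A S h M) (base_change A S h N)"
    and "\<And>s m. s \<in> carrier S \<Longrightarrow> m \<in> carrier M \<Longrightarrow>
      base_change_map A S h M N \<phi> (pure_tensor A S h M s m) = pure_tensor A S h N s (\<phi> m)"
proof -
  interpret M: tensor A S h M
    by (rule M)
  interpret N: tensor A S h N
    by (rule N)
  have \<phi>: "\<And>m. m \<in> carrier M \<Longrightarrow> \<phi> m \<in> carrier N"
    "\<And>m n. m \<in> carrier M \<Longrightarrow> n \<in> carrier M \<Longrightarrow> \<phi> (m \<oplus>\<^bsub>M\<^esub> n) = \<phi> m \<oplus>\<^bsub>N\<^esub> \<phi> n"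
    "\<And>r m. r \<in> carrier A \<Longrightarrow> m \<in> carrier M \<Longrightarrow> \<phi> (r \<odot>\<^bsub>M\<^esub> m) = r \<odot>\<^bsub>N\<^esub> \<phi> m"
    using \<phi> by (auto simp: module_hom_def)
  note adj = M.adjoint[OF N.module_T, of "\<lambda>m. pure_tensor A S h N \<one>\<^bsub>S\<^esub> (\<phi> m)", folded base_change_map_def]
  have 1: "pure_tensor A S h N \<one>\<^bsub>S\<^esub> (\<phi> m) \<in> carrier (base_change A S h N)" if "m \<in> carrier M" for m
    by (rule N.pt_closed) (use that \<phi> in auto)
  have 2: "pure_tensor A S h N \<one>\<^bsub>S\<^esub> (\<phi> (m \<oplus>\<^bsub>M\<^esub> n)) =
      pure_tensor A S h N \<one>\<^bsub>S\<^esub> (\<phi> m) \<oplus>\<^bsub>base_change A S h N\<^esub> pure_tensor A S h N \<one>\<^bsub>S\<^esub> (\<phi> n)"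
    if "m \<in> carrier M" "n \<in> carrier M" for m n
    using N.pt_add_right[of "\<one>\<^bsub>S\<^esub>" "\<phi> m" "\<phi> n"] that \<phi> by simp
  have 3: "pure_tensor A S h N \<one>\<^bsub>S\<^esub> (\<phi> (r \<odot>\<^bsub>M\<^esub> m)) =
      h r \<odot>\<^bsub>base_change A S h N\<^esub> pure_tensor A S h N \<one>\<^bsub>S\<^esub> (\<phi> m)"
    if "r \<in> carrier A" "m \<in> carrier M" for r m
    using N.pt_balanced[of "\<one>\<^bsub>S\<^esub>" r "\<phi> m"] N.smult_pt[of "h r" "\<one>\<^bsub>S\<^esub>" "\<phi> m"] that \<phi> by (simp add: M.h_closed)
  show "base_change_map A S h M N \<phi> \<in> module_hom S (base_change A S h M) (base_change A S h N)"
    by (rule adj(1)) (fact 1 2 3)+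
  show "base_change_map A S h M N \<phi> (pure_tensor A S h M s m) = pure_tensor A S h N s (\<phi> m)"
    if "s \<in> carrier S" "m \<in> carrier M" for s m
    using adj(3)[OF 1 2 3 that] N.smult_pt[of s "\<one>\<^bsub>S\<^esub>" "\<phi> m"] that \<phi> by simp
qed

section \<open>The fractional ideals\<close>

definition kinds :: "(nat \<Rightarrow> bool) set" where
  "kinds = {even, odd, \<lambda>_. True}"

lemma kinds_per2: "P \<in> kinds \<Longrightarrow> per2 P"
  by (auto simp: kinds_def)

lemma kinds_ex: "P \<in> kinds \<Longrightarrow> P 1 \<or> P 2"
  by (auto simp: kinds_def)

lemma ideal_module_simps [simp]:
  "carrier (ideal_module R J) = J" "\<zero>\<^bsub>ideal_module R J\<^esub> = \<zero>\<^bsub>R\<^esub>" "add (ideal_module R J) = add R"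
  "module.smult (ideal_module R J) = monoid.mult R"
  by (simp_all add: ideal_module_def regular_module_def)

lemma regular_module_simps [simp]:
  "carrier (regular_module R) = carrier R" "\<zero>\<^bsub>regular_module R\<^esub> = \<zero>\<^bsub>R\<^esub>" "add (regular_module R) = add R"
  "module.smult (regular_module R) = monoid.mult R"
  by (simp_all add: regular_module_def)

lemma regular_module_is_module: "cring R \<Longrightarrow> module R (regular_module R)"
proof -
  assume "cring R"
  then interpret cring R .
  show ?thesis
  proof (rule moduleI[OF is_cring])
    show "abelian_group (regular_module R)"
    proof (rule abelian_groupI)
      show "\<exists>y\<in>carrier (regular_module R). y \<oplus>\<^bsub>regular_module R\<^esub> x = \<zero>\<^bsub>regular_module R\<^esub>"
        if "x \<in> carrier (regular_module R)" for x
        using that by (intro bexI[of _ "\<ominus>\<^bsub>R\<^esub> x"]) (auto simp: l_neg)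
    qed (auto simp: a_ac)
  qed (auto simp: l_distr r_distr m_assoc)
qed

definition A_submodule :: "'k::field fps2 set \<Rightarrow> bool" where
  "A_submodule G \<longleftrightarrow> 0 \<in> G \<and> (\<forall>f\<in>G. \<forall>g\<in>G. f + g \<in> G) \<and> (\<forall>c\<in>Mset even even. \<forall>f\<in>G. c * f \<in> G)"

lemma A_submoduleD:
  assumes "A_submodule G"
  shows "0 \<in> G" "f \<in> G \<Longrightarrow> g \<in> G \<Longrightarrow> f + g \<in> G" "c \<in> Mset even even \<Longrightarrow> f \<in> G \<Longrightarrow> c * f \<in> G"
    "f \<in> G \<Longrightarrow> - f \<in> G" "f \<in> G \<Longrightarrow> g \<in> G \<Longrightarrow> f - g \<in> G"
proof -
  show "0 \<in> G" and add: "f \<in> G \<Longrightarrow> g \<in> G \<Longrightarrow> f + g \<in> G"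
    and mult: "c \<in> Mset even even \<Longrightarrow> f \<in> G \<Longrightarrow> c * f \<in> G" for f g c
    using assms unfolding A_submodule_def by blast+
  show m: "f \<in> G \<Longrightarrow> - f \<in> G" for f
    using mult[of "- 1" f] by (simp add: A_closed)
  show "f \<in> G \<Longrightarrow> g \<in> G \<Longrightarrow> f - g \<in> G"
    using add[of f "- g"] m[of g] by simp
qed

lemma A_submodule_Mset: "per2 P \<Longrightarrow> per2 Q \<Longrightarrow> A_submodule (Mset P Q)"
  unfolding A_submodule_def by (simp add: Mset_0 Mset_add Mset_mult)

lemma module_ideal_module:
  assumes J: "A_submodule J"
  shows "module ring_A (ideal_module ring_A J)"
proof (rule moduleI[OF cring_ring_A])
  show "abelian_group (ideal_module ring_A J)"
  proof (rule abelian_groupI)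
    show "\<exists>g\<in>carrier (ideal_module ring_A J). g \<oplus>\<^bsub>ideal_module ring_A J\<^esub> f = \<zero>\<^bsub>ideal_module ring_A J\<^esub>"
      if "f \<in> carrier (ideal_module ring_A J)" for f
      using that A_submoduleD(4)[OF J] by (intro bexI[of _ "- f"]) auto
  qed (auto simp: A_submoduleD[OF J] algebra_simps)
qed (auto simp: A_submoduleD[OF J] algebra_simps)

text \<open>Evaluating \<phi> at \<open>el_w * m * el_w\<close> in two ways, with scalar
  \<open>el_w * m\<close> and with scalar \<open>el_w * el_w\<close>, gives
  \<open>m * h = el_w * \<phi> m\<close>. For m a power of x or of y this shows that h vanishes on
  both axes, so h = w r and w can be cancelled.\<close>

lemma hom_Mset_multiplication:
  fixes \<phi> :: "'k::field fps2 \<Rightarrow> 'k fps2"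
  assumes P: "P \<in> kinds" and Q: "Q \<in> kinds"
    and lin: "\<And>c m. c \<in> Mset even even \<Longrightarrow> m \<in> Mset P Q \<Longrightarrow> \<phi> (c * m) = c * \<phi> m"
  shows "\<exists>r. \<forall>m\<in>Mset P Q. \<phi> m = r * m"
proof -
  define h where "h = \<phi> el_w"
  have wM: "(el_w :: 'k fps2) \<in> Mset P Q"
    using w_mult_Mset[of 1] by simp
  have mh: "m * h = el_w * \<phi> m" if "m \<in> Mset P Q" for m
  proof -
    have "(el_w * m) * h = \<phi> ((el_w * m) * el_w)"
      unfolding h_def by (rule lin[symmetric]) (use wM in auto)
    also have "\<dots> = \<phi> ((el_w * el_w) * m)"
      by (simp add: mult_ac)
    also have "\<dots> = (el_w * el_w) * \<phi> m"
      by (rule lin) (use that in auto)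
    finally have "el_w * (m * h) = el_w * (el_w * \<phi> m)"
      by (simp add: mult_ac)
    then show ?thesis
      by simp
  qed
  obtain k where k: "(el_x :: 'k fps2) ^ k \<in> Mset P Q" "P k"
    using kinds_ex[OF P] by (auto simp: Mset_def intro: that[of 1] that[of 2])
  obtain l where l: "(el_y :: 'k fps2) ^ l \<in> Mset P Q" "Q l"
    using kinds_ex[OF Q] by (auto simp: Mset_def intro: that[of 1] that[of 2])
  have "rx (el_x ^ k * h) = 0" "ry (el_y ^ l * h) = 0"
    unfolding mh[OF k(1)] mh[OF l(1)] by simp_all
  then have "el_w dvd h"
    by (simp add: axes_zero_iff[symmetric])
  then obtain r where r: "h = el_w * r"
    by (auto simp: dvd_def)
  have "\<phi> m = r * m" if "m \<in> Mset P Q" for m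
  proof -
    have "el_w * \<phi> m = el_w * (r * m)"
      using mh[OF that] by (simp add: r mult_ac)
    then show ?thesis
      by simp
  qed
  then show ?thesis
    by blast
qed

section \<open>Generators of the fractional ideals\<close>

definition evp :: "'k::field fps \<Rightarrow> 'k fps" where
  "evp \<alpha> = Abs_fps (\<lambda>i. if even i then fps_nth \<alpha> i else 0)"

lemma evp_simps: "evp \<alpha> \<in> supp_on even" "\<alpha> - evp \<alpha> \<in> supp_on odd" "\<alpha> \<in> supp_on P \<Longrightarrow> evp \<alpha> \<in> supp_on P"
  "\<alpha> \<in> supp_on P \<Longrightarrow> \<alpha> - evp \<alpha> \<in> supp_on P" "fps_nth (evp \<alpha>) 0 = fps_nth \<alpha> 0"
  by (auto simp: evp_def supp_on_def)

lemma supp_on_odd_factor: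
  assumes "\<alpha> \<in> supp_on odd"
  obtains \<gamma> where "\<alpha> = fps_X * \<gamma>" "\<gamma> \<in> supp_on even"
proof (rule that)
  have "fps_nth \<alpha> 0 = 0"
    using assms by (auto simp: supp_on_def)
  then have "fps_nth \<alpha> i = fps_nth (fps_X * fps_shift 1 \<alpha>) i" for i
    by (cases i) simp_all
  then show "\<alpha> = fps_X * fps_shift 1 \<alpha>"
    by (rule fps_ext)
  show "fps_shift 1 \<alpha> \<in> supp_on even"
    using assms by (auto simp: supp_on_def)
qed

text \<open>The odd part of \<alpha> is an even multiple of x. The even part is an even multiple of
  1 or, if the constant term vanishes, of the square of x.\<close>

lemma cx_in_submodule:
  assumes G: "A_submodule G" and \<alpha>: "\<alpha> \<in> supp_on P"
    and "P 1 \<Longrightarrow> el_x \<in> G" and "P 0 \<or> P 2 \<Longrightarrow> 1 \<in> G \<or> el_x ^ 2 \<in> G \<and> fps_nth \<alpha> 0 = 0" and P: "per2 P"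
  shows "cx \<alpha> \<in> G"
proof -
  obtain \<gamma> where \<gamma>: "\<alpha> - evp \<alpha> = fps_X * \<gamma>" "\<gamma> \<in> supp_on even"
    by (rule supp_on_odd_factor[OF evp_simps(2)])
  have "cx (\<alpha> - evp \<alpha>) \<in> G"
  proof (cases "P 1")
    case True
    have "cx (\<alpha> - evp \<alpha>) = cx \<gamma> * el_x"
      by (simp only: \<gamma> cx_hom cx_X mult.commute)
    then show ?thesis
      using A_submoduleD(3)[OF G cx_in_A[OF \<gamma>(2)]] assms(3)[OF True] by simp
  next
    case False
    have "\<not> P i" if "odd i" for i
      using per2D[OF P, of "i - 1" 1] False that by (cases i) auto
    then have "\<alpha> - evp \<alpha> = 0"
      using \<alpha> by (auto simp: supp_on_def evp_def fps_eq_iff)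
    then show ?thesis
      using A_submoduleD(1)[OF G] by (simp only: cx_hom)
  qed
  moreover have "cx (evp \<alpha>) \<in> G"
  proof (cases "P 0 \<or> P 2")
    case True
    then consider "1 \<in> G" | "el_x ^ 2 \<in> G" "fps_nth \<alpha> 0 = 0"
      using assms(4) by blast
    then show ?thesis
    proof cases
      case 1
      then show ?thesis
        using A_submoduleD(3)[OF G cx_in_A[OF evp_simps(1)[of \<alpha>]] 1] by simp
    next
      case 2
      obtain \<gamma> where "evp \<alpha> = fps_X ^ 2 * \<gamma>" "\<gamma> \<in> supp_on even"
        by (rule supp_on_even_no_const[OF evp_simps(1)]) (use 2 in \<open>simp add: evp_simps\<close>)
      then show ?thesis
        using A_submoduleD(3)[OF G cx_in_A 2(1), of \<gamma>] by (simp add: mult.commute)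
    qed
  next
    case False
    have "\<not> P i" if "even i" for i
      using per2D[OF P, of i 0] False that by auto
    then have "evp \<alpha> = 0"
      using \<alpha> by (auto simp: supp_on_def evp_def fps_eq_iff)
    then show ?thesis
      using A_submoduleD(1)[OF G] by (simp only: cx_hom)
  qed
  ultimately have "cx (\<alpha> - evp \<alpha>) + cx (evp \<alpha>) \<in> G"
    by (rule A_submoduleD(2)[OF G])
  then show ?thesis
    by simp
qed

lemma sw_image_iff: "f \<in> sw ` G \<longleftrightarrow> sw f \<in> G"
  by (metis image_iff sw_sw)

lemma A_submodule_sw: "A_submodule G \<Longrightarrow> A_submodule (sw ` G)"
  unfolding A_submodule_def by (simp add: sw_image_iff Ball_def)

lemma sw_cx [simp]: "sw (cx \<alpha>) = cy \<alpha>"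
  by (rule fps2_eqI) (simp add: sw_def cx_def cy_def)

text \<open>Write r through its restriction \<gamma> to the y-axis. The product of y with r minus
  \<gamma> vanishes on both axes, so it is a scalar in A and multiplies x. The even part of \<gamma>
  multiplies w; the odd part becomes even after multiplication by y and multiplies x.\<close>

lemma w_mult_in_submodule:
  fixes r :: "'k::field fps2" and G :: "'k fps2 set"
  assumes G: "A_submodule G" and "el_x \<in> G" "el_w \<in> G"
  shows "el_w * r \<in> G"
proof -
  define \<gamma> where "\<gamma> = ry r"
  obtain \<delta> where \<delta>: "\<gamma> - evp \<gamma> = fps_X * \<delta>" "\<delta> \<in> supp_on even"
    by (rule supp_on_odd_factor[OF evp_simps(2)])
  have "el_y * (r - cy \<gamma>) \<in> Mset even even"
    by (intro axes_zero_in_Mset) (simp_all add: \<gamma>_def)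
  moreover have "cy (evp \<gamma>) \<in> Mset even even" "cy (fps_X * (\<gamma> - evp \<gamma>)) \<in> Mset even even"
  proof -
    show "cy (evp \<gamma>) \<in> Mset even even"
      by (rule cy_in_A) (rule evp_simps)
    have "fps_X * (\<gamma> - evp \<gamma>) = fps_X ^ 2 * \<delta>"
      by (simp add: \<delta>(1) power2_eq_square)
    then have "fps_X * (\<gamma> - evp \<gamma>) \<in> supp_on even"
      using \<delta>(2) by (simp only: supp_on_X_even_mult per2_simps even_numeral)
    then show "cy (fps_X * (\<gamma> - evp \<gamma>)) \<in> Mset even even"
      by (rule cy_in_A)
  qed
  ultimately have "el_y * (r - cy \<gamma>) * el_x + cy (evp \<gamma>) * el_w + cy (fps_X * (\<gamma> - evp \<gamma>)) * el_x \<in> G"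
    by (intro A_submoduleD[OF G] assms(2,3))
  also have "el_y * (r - cy \<gamma>) * el_x + cy (evp \<gamma>) * el_w + cy (fps_X * (\<gamma> - evp \<gamma>)) * el_x = el_w * r"
    by (simp add: el_w_def algebra_simps)
  finally show ?thesis .
qed

text \<open>By \<open>axes_decomp\<close>, an element consists of its parts on the axes, a constant
  and a multiple of w. Unless both conditions allow the exponent 0, the constant term vanishes, so 1
  can be replaced by the squares of x and y. The list serves for finite generation and for the
  generators of the nine ideals.\<close>

lemma Mset_subset_submodule:
  fixes G :: "'k::field fps2 set"
  assumes P: "P \<in> kinds" and Q: "Q \<in> kinds" and G: "A_submodule G"
    and one: "P 0 \<Longrightarrow> Q 0 \<Longrightarrow> 1 \<in> G" and xG: "P 1 \<Longrightarrow> el_x \<in> G" and yG: "Q 1 \<Longrightarrow> el_y \<in> G"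
    and x2G: "P 2 \<Longrightarrow> \<not> Q 0 \<Longrightarrow> el_x ^ 2 \<in> G" and y2G: "Q 2 \<Longrightarrow> \<not> P 0 \<Longrightarrow> el_y ^ 2 \<in> G"
    and wG: "\<not> (P 0 \<and> Q 0) \<Longrightarrow> el_w \<in> G"
  shows "Mset P Q \<subseteq> G"
proof
  fix f :: "'k fps2"
  assume f: "f \<in> Mset P Q"
  have sG: "A_submodule (sw ` G)"
    by (rule A_submodule_sw[OF G])
  obtain r where r: "f = cx (rx f) + cy (ry f) - cx (fps_const (cf f 0 0)) + el_w * r"
    by (rule axes_decomp)
  have P02: "P 0 \<longleftrightarrow> P 2" "Q 0 \<longleftrightarrow> Q 2"
    using P Q by (auto simp: kinds_def)
  have Podd: "\<not> P 0 \<Longrightarrow> P 1" "\<not> Q 0 \<Longrightarrow> Q 1"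
    using P Q by (auto simp: kinds_def)
  have c0: "cf f 0 0 = 0" if "\<not> (P 0 \<and> Q 0)"
  proof -
    have "fps_nth (rx f) 0 \<noteq> 0 \<longrightarrow> P 0" "fps_nth (ry f) 0 \<noteq> 0 \<longrightarrow> Q 0"
      using f by (auto simp: Mset_def supp_on_def)
    then show ?thesis
      using that by auto
  qed
  \<comment> \<open>If 1 is in G, then w r is one of its A-multiples. Otherwise one condition is
    \<open>odd\<close>, so x or y is in G and generates w R together with w.\<close>
  have wr: "el_w * r \<in> G"
  proof (cases "P 0 \<and> Q 0")
    case True
    then show ?thesis
      using A_submoduleD(3)[OF G, of "el_w * r" 1] one by simp
  next
    case False
    then consider "\<not> P 0" | "\<not> Q 0"
      by blast
    then show ?thesis
    proof cases
      case 1
      then show ?thesis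
        using w_mult_in_submodule[OF G] xG Podd wG by blast
    next
      case 2
      then have "el_w * sw r \<in> sw ` G"
        using yG Podd wG by (intro w_mult_in_submodule[OF sG]) (simp_all add: sw_image_iff)
      then show ?thesis
        by (simp add: sw_image_iff)
    qed
  qed
  have x: "cx (rx f) \<in> G"
  proof (rule cx_in_submodule[OF G _ xG])
    show "rx f \<in> supp_on P"
      using f by (simp add: Mset_def)
    show "1 \<in> G \<or> el_x ^ 2 \<in> G \<and> fps_nth (rx f) 0 = 0" if "P 0 \<or> P 2"
      using that P02 one x2G c0 by (cases "Q 0") auto
  qed (auto intro: kinds_per2 P)
  have "cx (ry f) \<in> sw ` G"
  proof (rule cx_in_submodule[OF sG])
    show "ry f \<in> supp_on Q"
      using f by (simp add: Mset_def)
    show "el_x \<in> sw ` G" if "Q 1"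
      using yG that by (simp add: sw_image_iff)
    show "1 \<in> sw ` G \<or> el_x ^ 2 \<in> sw ` G \<and> fps_nth (ry f) 0 = 0" if "Q 0 \<or> Q 2"
      using that P02 one y2G c0 by (cases "P 0") (auto simp: sw_image_iff)
  qed (rule kinds_per2[OF Q])
  then have y: "cy (ry f) \<in> G"
    by (simp add: sw_image_iff)
  have c: "cx (fps_const (cf f 0 0)) \<in> G"
  proof (cases "P 0 \<and> Q 0")
    case True
    then show ?thesis
      using A_submoduleD(3)[OF G cx_in_A one, of "fps_const (cf f 0 0)"] by simp
  next
    case False
    then show ?thesis
      using c0 A_submoduleD(1)[OF G] by simp
  qed
  show "f \<in> G"
    by (subst r) (intro A_submoduleD(2,5)[OF G] x y c wr)
qed

text \<open>The module is abstract and only identified with \<open>Mset P Q\<close>, so that the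
  results apply to the listed ideals, to A as a module over itself, and to an unknown
  Cohen--Macaulay module once it has been identified.\<close>

locale fractional =
  fixes N :: "('k::field fps2, 'm) module" and P Q :: "nat \<Rightarrow> bool" and \<iota> :: "'m \<Rightarrow> 'k fps2"
  assumes module_N: "module ring_A N" and kP: "P \<in> kinds" and kQ: "Q \<in> kinds"
    and iso: "\<iota> \<in> module_iso ring_A N (ideal_module ring_A (Mset P Q))"
begin

sublocale N: module ring_A N
  by (rule module_N)

lemma bij: "bij_betw \<iota> (carrier N) (Mset P Q)"
  using iso by (simp add: module_iso_def)

lemma iota_mem [simp]: "m \<in> carrier N \<Longrightarrow> \<iota> m \<in> Mset P Q"
  using bij by (auto simp: bij_betw_def)

lemma iota_add [simp]: "m \<in> carrier N \<Longrightarrow> n \<in> carrier N \<Longrightarrow> \<iota> (m \<oplus>\<^bsub>N\<^esub> n) = \<iota> m + \<iota> n"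
  using iso by (simp add: module_iso_def module_hom_def)

lemma iota_smult [simp]: "c \<in> Mset even even \<Longrightarrow> m \<in> carrier N \<Longrightarrow> \<iota> (c \<odot>\<^bsub>N\<^esub> m) = c * \<iota> m"
  using iso by (simp add: module_iso_def module_hom_def)

lemma iota_eq_iff: "m \<in> carrier N \<Longrightarrow> n \<in> carrier N \<Longrightarrow> \<iota> m = \<iota> n \<longleftrightarrow> m = n"
  using bij by (auto simp: bij_betw_def inj_on_def)

lemma iota_zero [simp]: "\<iota> \<zero>\<^bsub>N\<^esub> = 0"
proof -
  have "\<iota> \<zero>\<^bsub>N\<^esub> + \<iota> \<zero>\<^bsub>N\<^esub> = \<iota> \<zero>\<^bsub>N\<^esub> + 0"
    using iota_add[of "\<zero>\<^bsub>N\<^esub>" "\<zero>\<^bsub>N\<^esub>"] by (simp only: N.M.zero_closed N.M.l_zero add_0_right)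
  then show ?thesis
    by (simp only: add_left_cancel)
qed

lemma iota_surj:
  assumes "f \<in> Mset P Q"
  obtains m where "m \<in> carrier N" "\<iota> m = f"
  using assms bij that unfolding bij_betw_def by (metis imageE)

lemma finitely_generated: "finitely_generated_module ring_A N"
proof -
  \<comment> \<open>Preimages of those candidate generators from
    \<open>Mset_subset_submodule\<close> that belong to the given shape.\<close>
  define gs where "gs = map (the_inv_into (carrier N) \<iota>) (filter (\<lambda>f. f \<in> Mset P Q) [1, el_x, el_y, el_x ^ 2, el_y ^ 2, el_w])"
  have inv: "the_inv_into (carrier N) \<iota> f \<in> carrier N" "\<iota> (the_inv_into (carrier N) \<iota> f) = f" if "f \<in> Mset P Q" for f
    using that bij by (auto simp: bij_betw_def intro: the_inv_into_into f_the_inv_into_f)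
  have gsN: "set gs \<subseteq> carrier N"
    using inv(1) by (auto simp: gs_def)
  then have gsi: "gs ! i \<in> carrier N" if "i < length gs" for i
    using that nth_mem by blast
  define span where "span = {(\<Oplus>\<^bsub>N\<^esub>i\<in>{..<length gs}. c i \<odot>\<^bsub>N\<^esub> gs ! i) | c. c \<in> {..<length gs} \<rightarrow> Mset even even}"
  have cl: "(\<lambda>i. c i \<odot>\<^bsub>N\<^esub> gs ! i) \<in> {..<length gs} \<rightarrow> carrier N" if "c \<in> {..<length gs} \<rightarrow> Mset even even" for c
    using that gsi by (auto intro!: N.smult_closed simp: Pi_iff)
  have spanI: "(\<Oplus>\<^bsub>N\<^esub>i\<in>{..<length gs}. c i \<odot>\<^bsub>N\<^esub> gs ! i) \<in> span" if "c \<in> {..<length gs} \<rightarrow> Mset even even" for c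
    unfolding span_def mem_Collect_eq using that by (intro exI[of _ c] conjI refl)
  have spanE: "\<exists>c\<in>{..<length gs} \<rightarrow> Mset even even. m = (\<Oplus>\<^bsub>N\<^esub>i\<in>{..<length gs}. c i \<odot>\<^bsub>N\<^esub> gs ! i)"
    if "m \<in> span" for m
    using that unfolding span_def mem_Collect_eq by (elim exE conjE) (rule bexI)
  have span_sub: "m \<in> carrier N" if "m \<in> span" for m
    using spanE[OF that] cl by (elim bexE) (simp only: N.M.finsum_closed)
  have span_add: "m \<oplus>\<^bsub>N\<^esub> n \<in> span" if mn: "m \<in> span" "n \<in> span" for m n
  proof -
    obtain c where c: "c \<in> {..<length gs} \<rightarrow> Mset even even" "m = (\<Oplus>\<^bsub>N\<^esub>i\<in>{..<length gs}. c i \<odot>\<^bsub>N\<^esub> gs ! i)"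
      using spanE[OF mn(1)] by (elim bexE) (rule that)
    obtain d where d: "d \<in> {..<length gs} \<rightarrow> Mset even even" "n = (\<Oplus>\<^bsub>N\<^esub>i\<in>{..<length gs}. d i \<odot>\<^bsub>N\<^esub> gs ! i)"
      using spanE[OF mn(2)] by (elim bexE) (rule that)
    have "m \<oplus>\<^bsub>N\<^esub> n = (\<Oplus>\<^bsub>N\<^esub>i\<in>{..<length gs}. c i \<odot>\<^bsub>N\<^esub> gs ! i \<oplus>\<^bsub>N\<^esub> d i \<odot>\<^bsub>N\<^esub> gs ! i)"
      unfolding c(2) d(2) by (rule N.M.finsum_addf[OF cl[OF c(1)] cl[OF d(1)], symmetric])
    also have "\<dots> = (\<Oplus>\<^bsub>N\<^esub>i\<in>{..<length gs}. (c i + d i) \<odot>\<^bsub>N\<^esub> gs ! i)"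
    proof (rule N.M.finsum_cong')
      fix i
      assume "i \<in> {..<length gs}"
      then show "c i \<odot>\<^bsub>N\<^esub> gs ! i \<oplus>\<^bsub>N\<^esub> d i \<odot>\<^bsub>N\<^esub> gs ! i = (c i + d i) \<odot>\<^bsub>N\<^esub> gs ! i"
        using N.smult_l_distr[of "c i" "d i" "gs ! i"] gsi c(1) d(1) by (simp add: Pi_iff)
    qed (use cl[of "\<lambda>i. c i + d i"] c(1) d(1) in \<open>auto simp: Pi_iff\<close>)
    finally show ?thesis
      using spanI[of "\<lambda>i. c i + d i"] c(1) d(1) by (simp add: Pi_iff)
  qed
  have span_mult: "a \<odot>\<^bsub>N\<^esub> m \<in> span" if m: "m \<in> span" and a: "a \<in> Mset even even" for a m
  proof -
    obtain c where c: "c \<in> {..<length gs} \<rightarrow> Mset even even" "m = (\<Oplus>\<^bsub>N\<^esub>i\<in>{..<length gs}. c i \<odot>\<^bsub>N\<^esub> gs ! i)"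
      using spanE[OF m] by (elim bexE) (rule that)
    have "a \<odot>\<^bsub>N\<^esub> m = (\<Oplus>\<^bsub>N\<^esub>i\<in>{..<length gs}. a \<odot>\<^bsub>N\<^esub> (c i \<odot>\<^bsub>N\<^esub> gs ! i))"
      unfolding c(2) by (rule N.finsum_smult_ldistr[OF finite_lessThan _ cl[OF c(1)]]) (use a in simp)
    also have "\<dots> = (\<Oplus>\<^bsub>N\<^esub>i\<in>{..<length gs}. (a * c i) \<odot>\<^bsub>N\<^esub> gs ! i)"
    proof (rule N.M.finsum_cong')
      fix i
      assume "i \<in> {..<length gs}"
      then show "a \<odot>\<^bsub>N\<^esub> (c i \<odot>\<^bsub>N\<^esub> gs ! i) = (a * c i) \<odot>\<^bsub>N\<^esub> gs ! i"
        using N.smult_assoc1[of a "c i" "gs ! i"] gsi c(1) a by (simp add: Pi_iff)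
    qed (use cl[of "\<lambda>i. a * c i"] c(1) a in \<open>auto simp: Pi_iff\<close>)
    finally show ?thesis
      using spanI[of "\<lambda>i. a * c i"] c(1) a by (simp add: Pi_iff)
  qed
  have span_base: "gs ! j \<in> span" if j: "j < length gs" for j
  proof -
    let ?c = "\<lambda>i. if i = j then 1 else 0"
    have c: "?c \<in> {..<length gs} \<rightarrow> Mset even even"
      by simp
    have "(\<Oplus>\<^bsub>N\<^esub>i\<in>{..<length gs}. ?c i \<odot>\<^bsub>N\<^esub> gs ! i) = (\<Oplus>\<^bsub>N\<^esub>i\<in>{..<length gs}. if j = i then gs ! i else \<zero>\<^bsub>N\<^esub>)"
    proof (rule N.M.finsum_cong')
      fix i
      assume "i \<in> {..<length gs}"
      then show "?c i \<odot>\<^bsub>N\<^esub> gs ! i = (if j = i then gs ! i else \<zero>\<^bsub>N\<^esub>)"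
        using N.smult_one[OF gsi, of i] N.smult_l_null[OF gsi, of i] by auto
    qed (use gsi in auto)
    also have "\<dots> = gs ! j"
      by (rule N.M.finsum_singleton) (use j gsi in auto)
    finally show ?thesis
      using spanI[OF c] by simp
  qed
  have "A_submodule (\<iota> ` span)"
    unfolding A_submodule_def
  proof (intro conjI ballI)
    have "\<zero>\<^bsub>N\<^esub> \<in> span"
      using span_mult[of "gs ! (length gs - 1)" 0] span_base[of "length gs - 1"] N.smult_l_null[OF gsi[of "length gs - 1"]] spanI[of "\<lambda>_. 0"]
      by (cases "length gs = 0") auto
    then show "0 \<in> \<iota> ` span"
      using iota_zero by (metis imageI)
    fix f
    assume "f \<in> \<iota> ` span"
    then obtain m where m: "m \<in> span" "f = \<iota> m"
      by blast
    show "c * f \<in> \<iota> ` span" if "c \<in> Mset even even" for c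
      using span_mult[OF m(1) that] iota_smult[OF that span_sub[OF m(1)]] m(2) by (metis imageI)
    fix g
    assume "g \<in> \<iota> ` span"
    then obtain n where n: "n \<in> span" "g = \<iota> n"
      by blast
    show "f + g \<in> \<iota> ` span"
      using span_add[OF m(1) n(1)] iota_add[OF span_sub[OF m(1)] span_sub[OF n(1)]] m(2) n(2) by (metis imageI)
  qed
  moreover have base: "f \<in> \<iota> ` span" if "f \<in> {1, el_x, el_y, el_x ^ 2, el_y ^ 2, el_w}" "f \<in> Mset P Q" for f
  proof -
    have "the_inv_into (carrier N) \<iota> f \<in> set gs"
      using that by (auto simp: gs_def)
    then have "the_inv_into (carrier N) \<iota> f \<in> span"
      using span_base by (metis in_set_conv_nth)
    then show ?thesis
      using inv(2)[OF that(2)] by (metis imageI)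
  qed
  ultimately have "Mset P Q \<subseteq> \<iota> ` span"
    using w_mult_Mset[of 1 P Q]
    by (intro Mset_subset_submodule[OF kP kQ] base) (simp_all add: Mset_def)
  then have "m \<in> span" if "m \<in> carrier N" for m
    using iota_mem[OF that] iota_eq_iff[OF that span_sub] by blast
  then show ?thesis
    unfolding finitely_generated_module_def using gsN by (intro exI[of _ gs]) (auto simp: span_def)
qed

text \<open>The sequence u, v is regular: v m = u n makes m = u l and n = v l in R, and l inherits
  both parity conditions. It is proper because the monomial x y does not occur in any u m + v n,
  whereas w belongs to every shape.\<close>

lemma maximal_CM: "maximal_CM ring_A N"
proof -
  have wM: "el_w \<in> Mset P Q"
    using w_mult_Mset[of 1] by simp
  obtain e where e: "e \<in> carrier N" "\<iota> e = el_w"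
    by (rule iota_surj[OF wM])
  have u0: "el_u \<noteq> (0 :: 'k fps2)"
    by (simp add: el_u_def)
  show ?thesis
  proof (rule maximal_CM_I[OF module_N finitely_generated, of el_u el_v e])
    show "el_u \<in> max_A" "el_v \<in> max_A"
      by (simp_all add: max_A_def) (simp_all add: el_u_def el_v_def power2_eq_square cf_mult el_x_def el_y_def)
    show "m = \<zero>\<^bsub>N\<^esub>" if "m \<in> carrier N" "el_u \<odot>\<^bsub>N\<^esub> m = \<zero>\<^bsub>N\<^esub>" for m
    proof -
      have "el_u * \<iota> m = 0"
        using that iota_smult[of el_u m] by simp
      then have "\<iota> m = \<iota> \<zero>\<^bsub>N\<^esub>"
        using u0 by simp
      then show ?thesis
        using iota_eq_iff[of m "\<zero>\<^bsub>N\<^esub>"] that by simp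
    qed
    show "\<exists>k\<in>carrier N. m = el_u \<odot>\<^bsub>N\<^esub> k"
      if m: "m \<in> carrier N" and n: "n \<in> carrier N" and eq: "el_v \<odot>\<^bsub>N\<^esub> m = el_u \<odot>\<^bsub>N\<^esub> n" for m n
    proof -
      have eq': "el_v * \<iota> m = el_u * \<iota> n"
        using iota_smult[of el_v m] iota_smult[of el_u n] m n eq by simp
      then have "el_x dvd el_y * (el_y * \<iota> m)"
        by (simp add: el_u_def el_v_def power2_eq_square mult.assoc)
      then have "ry (\<iota> m) = 0"
        unfolding ry_zero_iff[symmetric] by simp
      then obtain k where k: "\<iota> m = el_x * k"
        by (auto simp: ry_zero_iff dvd_def)
      have "el_x * (el_v * k) = el_x * (el_x * \<iota> n)"
        using eq' by (simp add: k el_u_def power2_eq_square mult_ac)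
      then have "el_v * k = el_x * \<iota> n"
        by simp
      then have "ry (el_v * k) = 0"
        by simp
      then have "ry k = 0"
        by (simp add: el_v_def)
      then obtain l where l: "k = el_x * l"
        by (auto simp: ry_zero_iff dvd_def)
      have ml: "\<iota> m = el_u * l"
        by (simp add: k l el_u_def power2_eq_square mult.assoc)
      have "el_u * (el_v * l) = el_u * \<iota> n"
        using eq' by (simp add: ml mult_ac)
      then have nl: "\<iota> n = el_v * l"
        using u0 by simp
      \<comment> \<open>The condition on the x-axis is read off from m = u l, the one on the y-axis
        from n = v l.\<close>
      have "fps_X ^ 2 * rx l \<in> supp_on P" "fps_X ^ 2 * ry l \<in> supp_on Q"
        using iota_mem[OF m] iota_mem[OF n] unfolding ml nl by (simp_all add: Mset_def el_u_def el_v_def)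
      then have "l \<in> Mset P Q"
        unfolding supp_on_X_even_mult[OF kinds_per2[OF kP] even_numeral] supp_on_X_even_mult[OF kinds_per2[OF kQ] even_numeral]
        by (simp add: Mset_def)
      then obtain j where j: "j \<in> carrier N" "\<iota> j = l"
        by (rule iota_surj)
      have "\<iota> m = \<iota> (el_u \<odot>\<^bsub>N\<^esub> j)"
        using j by (simp add: ml)
      then show ?thesis
        using iota_eq_iff[of m "el_u \<odot>\<^bsub>N\<^esub> j"] N.smult_closed[of el_u j] m j by auto
    qed
    show "e \<noteq> el_u \<odot>\<^bsub>N\<^esub> m \<oplus>\<^bsub>N\<^esub> el_v \<odot>\<^bsub>N\<^esub> n" if m: "m \<in> carrier N" and n: "n \<in> carrier N" for m n
    proof
      assume "e = el_u \<odot>\<^bsub>N\<^esub> m \<oplus>\<^bsub>N\<^esub> el_v \<odot>\<^bsub>N\<^esub> n"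
      then have "el_w = el_u * \<iota> m + el_v * \<iota> n"
        using e(2) iota_add[of "el_u \<odot>\<^bsub>N\<^esub> m" "el_v \<odot>\<^bsub>N\<^esub> n"] iota_smult[of el_u m] iota_smult[of el_v n] m n
          N.smult_closed[of el_u m] N.smult_closed[of el_v n] by simp
      then have "cf el_w 1 1 = cf (el_u * \<iota> m + el_v * \<iota> n) 1 1"
        by simp
      then show False
        by (simp add: el_w_def el_u_def el_v_def el_x_def el_y_def power2_eq_square mult.assoc)
    qed
  qed (rule e)
qed

lemma hom_multiplication:
  assumes add: "\<And>m n. m \<in> carrier N \<Longrightarrow> n \<in> carrier N \<Longrightarrow> \<phi> (m \<oplus>\<^bsub>N\<^esub> n) = \<phi> m + \<phi> n"
    and smult: "\<And>c m. c \<in> Mset even even \<Longrightarrow> m \<in> carrier N \<Longrightarrow> \<phi> (c \<odot>\<^bsub>N\<^esub> m) = c * \<phi> m"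
  shows "\<exists>r. \<forall>m\<in>carrier N. \<phi> m = r * \<iota> m"
proof -
  let ?j = "the_inv_into (carrier N) \<iota>"
  have inv: "?j f \<in> carrier N" "\<iota> (?j f) = f" if "f \<in> Mset P Q" for f
    using that bij by (auto simp: bij_betw_def intro: the_inv_into_into f_the_inv_into_f)
  have ji: "?j (\<iota> m) = m" if "m \<in> carrier N" for m
    using that bij by (simp add: bij_betw_def the_inv_into_f_f)
  have "\<exists>r. \<forall>f\<in>Mset P Q. (\<phi> \<circ> ?j) f = r * f"
  proof (rule hom_Mset_multiplication[OF kP kQ])
    fix c f :: "'k fps2"
    assume c: "c \<in> Mset even even" and f: "f \<in> Mset P Q"
    have cf: "c * f \<in> Mset P Q"
      by (rule Mset_mult[OF kinds_per2[OF kP] kinds_per2[OF kQ] c f])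
    have "\<iota> (?j (c * f)) = \<iota> (c \<odot>\<^bsub>N\<^esub> ?j f)"
      unfolding inv(2)[OF cf] iota_smult[OF c inv(1)[OF f]] inv(2)[OF f] ..
    then have "?j (c * f) = c \<odot>\<^bsub>N\<^esub> ?j f"
      using iota_eq_iff[OF inv(1)[OF cf] N.smult_closed[of c "?j f"]] inv(1)[OF f] c by simp
    then show "(\<phi> \<circ> ?j) (c * f) = c * (\<phi> \<circ> ?j) f"
      using smult[OF c inv(1)[OF f]] by simp
  qed
  then obtain r where r: "\<And>f. f \<in> Mset P Q \<Longrightarrow> \<phi> (?j f) = r * f"
    by auto
  have "\<phi> m = r * \<iota> m" if "m \<in> carrier N" for m
    using r[OF iota_mem[OF that]] ji[OF that] by simp
  then show ?thesis
    by blast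
qed

end

section \<open>Rank\<close>

lemma dual_module_simps [simp]:
  "carrier (dual_module R M) = module_hom R M (regular_module R) \<inter> extensional (carrier M)"
  "\<zero>\<^bsub>dual_module R M\<^esub> = (\<lambda>m\<in>carrier M. \<zero>\<^bsub>R\<^esub>)"
  "f \<oplus>\<^bsub>dual_module R M\<^esub> g = (\<lambda>m\<in>carrier M. f m \<oplus>\<^bsub>R\<^esub> g m)"
  "r \<odot>\<^bsub>dual_module R M\<^esub> f = (\<lambda>m\<in>carrier M. r \<otimes>\<^bsub>R\<^esub> f m)"
  by (simp_all add: dual_module_def)

lemma module_dual_module:
  assumes "module R M"
  shows "module R (dual_module R M)"
proof -
  interpret module R M
    by (rule assms)
  have val: "f m \<in> carrier R" if "f \<in> module_hom R M (regular_module R)" "m \<in> carrier M" for f m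
    using that by (auto simp: module_hom_def)
  have lin: "f (m \<oplus>\<^bsub>M\<^esub> n) = f m \<oplus>\<^bsub>R\<^esub> f n" "r \<in> carrier R \<Longrightarrow> f (r \<odot>\<^bsub>M\<^esub> m) = r \<otimes>\<^bsub>R\<^esub> f m"
    if "f \<in> module_hom R M (regular_module R)" "m \<in> carrier M" "n \<in> carrier M" for f m n r
    using that by (auto simp: module_hom_def)
  have cl: "(\<lambda>m\<in>carrier M. \<zero>\<^bsub>R\<^esub>) \<in> module_hom R M (regular_module R)"
    "\<And>f g. f \<in> module_hom R M (regular_module R) \<Longrightarrow> g \<in> module_hom R M (regular_module R) \<Longrightarrow>
      (\<lambda>m\<in>carrier M. f m \<oplus>\<^bsub>R\<^esub> g m) \<in> module_hom R M (regular_module R)"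
    "\<And>r f. r \<in> carrier R \<Longrightarrow> f \<in> module_hom R M (regular_module R) \<Longrightarrow>
      (\<lambda>m\<in>carrier M. r \<otimes>\<^bsub>R\<^esub> f m) \<in> module_hom R M (regular_module R)"
    by (auto simp: module_hom_def R.a_ac R.r_distr R.m_lcomm Pi_iff)
  have ext: "f = g" if "f \<in> extensional (carrier M)" "g \<in> extensional (carrier M)" "\<And>m. m \<in> carrier M \<Longrightarrow> f m = g m" for f g :: "'c \<Rightarrow> 'a"
    using that by (rule extensionalityI)
  show ?thesis
  proof (rule moduleI)
    show "abelian_group (dual_module R M)"
    proof (rule abelian_groupI)
      fix f
      assume f: "f \<in> carrier (dual_module R M)"
      show "\<exists>g\<in>carrier (dual_module R M). g \<oplus>\<^bsub>dual_module R M\<^esub> f = \<zero>\<^bsub>dual_module R M\<^esub>"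
      proof (rule bexI[of _ "\<lambda>m\<in>carrier M. (\<ominus>\<^bsub>R\<^esub> \<one>\<^bsub>R\<^esub>) \<otimes>\<^bsub>R\<^esub> f m"])
        show "(\<lambda>m\<in>carrier M. (\<ominus>\<^bsub>R\<^esub> \<one>\<^bsub>R\<^esub>) \<otimes>\<^bsub>R\<^esub> f m) \<oplus>\<^bsub>dual_module R M\<^esub> f = \<zero>\<^bsub>dual_module R M\<^esub>"
          using f by (auto intro!: restrict_ext simp: val R.l_minus R.l_neg)
        show "(\<lambda>m\<in>carrier M. (\<ominus>\<^bsub>R\<^esub> \<one>\<^bsub>R\<^esub>) \<otimes>\<^bsub>R\<^esub> f m) \<in> carrier (dual_module R M)"
          using f cl(3)[of "\<ominus>\<^bsub>R\<^esub> \<one>\<^bsub>R\<^esub>" f] by simp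
      qed
    qed (auto intro!: cl ext simp: val R.a_ac)
  qed (auto intro!: cl ext R.is_cring simp: val R.l_distr R.r_distr R.m_assoc)
qed

lemma module_hom_regular_value:
  "f \<in> module_hom R M (regular_module R) \<Longrightarrow> m \<in> carrier M \<Longrightarrow> f m \<in> carrier R"
  by (auto simp: module_hom_def)

lemma bidual_map_hom:
  assumes "module R M"
  shows "bidual_map R M \<in> module_hom R M (bidual_module R M)"
proof -
  interpret module R M
    by (rule assms)
  interpret D: module R "dual_module R M"
    by (rule module_dual_module[OF assms])
  have val: "bidual_map R M m f = f m" if "f \<in> carrier (dual_module R M)" for m f
    using that by (simp only: bidual_map_def restrict_apply')
  have "bidual_map R M m \<in> carrier (bidual_module R M)" if m: "m \<in> carrier M" for m
    unfolding dual_module_simps(1)[of R "dual_module R M"]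
  proof
    show "bidual_map R M m \<in> module_hom R (dual_module R M) (regular_module R)"
      unfolding module_hom_def
    proof (intro CollectI conjI ballI)
      show "bidual_map R M m \<in> carrier (dual_module R M) \<rightarrow> carrier (regular_module R)"
        using m by (auto simp: bidual_map_def module_hom_regular_value)
      show "bidual_map R M m (f \<oplus>\<^bsub>dual_module R M\<^esub> g) =
          bidual_map R M m f \<oplus>\<^bsub>regular_module R\<^esub> bidual_map R M m g"
        if "f \<in> carrier (dual_module R M)" "g \<in> carrier (dual_module R M)" for f g
        unfolding val[OF that(1)] val[OF that(2)] val[OF D.M.a_closed[OF that]] using m by simp
      show "bidual_map R M m (r \<odot>\<^bsub>dual_module R M\<^esub> f) = r \<odot>\<^bsub>regular_module R\<^esub> bidual_map R M m f"
        if "r \<in> carrier R" "f \<in> carrier (dual_module R M)" for r f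
        unfolding val[OF that(2)] val[OF D.smult_closed[OF that]] using m by simp
    qed
  qed (simp add: bidual_map_def del: dual_module_simps)
  moreover have "bidual_map R M (m \<oplus>\<^bsub>M\<^esub> n) = bidual_map R M m \<oplus>\<^bsub>bidual_module R M\<^esub> bidual_map R M n"
    if "m \<in> carrier M" "n \<in> carrier M" for m n
    unfolding dual_module_simps(3)[of R "dual_module R M"]
    using that by (auto simp: bidual_map_def module_hom_def intro!: restrict_ext)
  moreover have "bidual_map R M (r \<odot>\<^bsub>M\<^esub> m) = r \<odot>\<^bsub>bidual_module R M\<^esub> bidual_map R M m"
    if "r \<in> carrier R" "m \<in> carrier M" for r m
    unfolding dual_module_simps(4)[of R "dual_module R M"]
    using that by (auto simp: bidual_map_def module_hom_def intro!: restrict_ext)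
  ultimately show ?thesis
    unfolding module_hom_def[of R M] by blast
qed

section \<open>The total quotient rings and Laurent series with prescribed exponents\<close>

lemma ring_QR_simps [simp]:
  "carrier ring_QR = UNIV" "x \<otimes>\<^bsub>ring_QR\<^esub> y = (fst x * fst y, snd x * snd y)"
  "x \<oplus>\<^bsub>ring_QR\<^esub> y = (fst x + fst y, snd x + snd y)" "\<one>\<^bsub>ring_QR\<^esub> = (1, 1)" "\<zero>\<^bsub>ring_QR\<^esub> = (0, 0)"
  by (auto simp: ring_QR_def RDirProd_def DirProd_def monoid.defs case_prod_beta)

lemma ring_QA_simps [simp]:
  "carrier ring_QA = field_L \<times> field_L" "x \<otimes>\<^bsub>ring_QA\<^esub> y = (fst x * fst y, snd x * snd y)"
  "x \<oplus>\<^bsub>ring_QA\<^esub> y = (fst x + fst y, snd x + snd y)" "\<one>\<^bsub>ring_QA\<^esub> = (1, 1)" "\<zero>\<^bsub>ring_QA\<^esub> = (0, 0)"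
  using ring_QR_simps by (simp_all add: ring_QA_def)

text \<open>Evaluating P at the residue modulo 2 extends a condition of period two to negative
  exponents.\<close>

definition Kset :: "(nat \<Rightarrow> bool) \<Rightarrow> 'k::field fls set" where
  "Kset P = {\<alpha>. \<forall>n. fls_nth \<alpha> n \<noteq> 0 \<longrightarrow> P (nat (n mod 2))}"

lemma field_L_Kset: "field_L = Kset even"
proof -
  have "even (nat (n mod 2)) \<longleftrightarrow> even n" for n :: int
    by (simp add: even_nat_iff even_mod_2_iff)
  then show ?thesis
    by (auto simp: field_L_def Kset_def)
qed

lemma per2_mod: "per2 P \<Longrightarrow> P (nat (int i mod 2)) = P i"
proof -
  assume P: "per2 P"
  have "P ((i - i mod 2) + i mod 2) = P (i mod 2)"
    by (rule per2D[OF P]) simp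
  then show ?thesis
    by (simp add: nat_mod_distrib)
qed

lemma shift_in_Kset:
  assumes P: "per2 P" and \<gamma>: "\<gamma> \<in> supp_on P"
  shows "fls_shift (2 * k) (fps_to_fls \<gamma>) \<in> Kset P"
  unfolding Kset_def
proof (intro CollectI allI impI)
  fix n
  assume "fls_nth (fls_shift (2 * k) (fps_to_fls \<gamma>)) n \<noteq> 0"
  then have n: "n + 2 * k \<ge> 0" "P (nat (n + 2 * k))"
    using \<gamma> by (auto simp: supp_on_def split: if_splits)
  then have "P (nat ((n + 2 * k) mod 2))"
    using per2_mod[OF P, of "nat (n + 2 * k)"] by simp
  then show "P (nat (n mod 2))"
    by simp
qed

lemma fps_in_Kset: "per2 P \<Longrightarrow> \<gamma> \<in> supp_on P \<Longrightarrow> fps_to_fls \<gamma> \<in> Kset P"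
  using shift_in_Kset[of P \<gamma> 0] by simp

text \<open>Every large n is allowed, so two series can be written over a common denominator. The
  zero constant term ensures that lifts to the two axes can be added without changing each other's
  restriction.\<close>

lemma Kset_cases:
  assumes P: "per2 P" and \<alpha>: "\<alpha> \<in> Kset P"
  obtains n0 where "\<And>n. n \<ge> n0 \<Longrightarrow> \<exists>\<gamma>\<in>supp_on P. fps_nth \<gamma> 0 = 0 \<and> \<alpha> = fls_shift (2 * int n) (fps_to_fls \<gamma>)"
proof (rule that)
  fix n
  assume n: "n \<ge> nat (1 - fls_subdegree \<alpha>)"
  obtain \<gamma> where \<gamma>: "\<alpha> = fls_shift (2 * int n) (fps_to_fls \<gamma>)"
    by (rule fls_as_fps[of \<alpha> "2 * int n"]) (use n in linarith)
  have nth: "fps_nth \<gamma> i = fls_nth \<alpha> (int i - 2 * int n)" for i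
    by (simp add: \<gamma>)
  have "\<gamma> \<in> supp_on P"
    unfolding supp_on_def
  proof (intro CollectI allI impI)
    fix i
    assume "fps_nth \<gamma> i \<noteq> 0"
    then have "P (nat ((int i - 2 * int n) mod 2))"
      using \<alpha> by (auto simp: nth Kset_def)
    moreover have "(int i - 2 * int n) mod 2 = int i mod 2"
      by presburger
    ultimately show "P i"
      using per2_mod[OF P] by simp
  qed
  moreover have "fps_nth \<gamma> 0 = 0"
    unfolding nth using n by (intro fls_eq0_below_subdegree) linarith
  ultimately show "\<exists>\<gamma>\<in>supp_on P. fps_nth \<gamma> 0 = 0 \<and> \<alpha> = fls_shift (2 * int n) (fps_to_fls \<gamma>)"
    using \<gamma> by blast
qed

lemma Kset_closed:
  "0 \<in> Kset P" "\<alpha> \<in> Kset P \<Longrightarrow> \<beta> \<in> Kset P \<Longrightarrow> \<alpha> + \<beta> \<in> Kset P" "\<alpha> \<in> Kset P \<Longrightarrow> - \<alpha> \<in> Kset P"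
  "per2 P \<Longrightarrow> \<alpha> \<in> Kset even \<Longrightarrow> \<beta> \<in> Kset P \<Longrightarrow> \<alpha> * \<beta> \<in> Kset P"
proof -
  show "0 \<in> Kset P" "\<alpha> \<in> Kset P \<Longrightarrow> - \<alpha> \<in> Kset P"
    by (auto simp: Kset_def)
  show "\<alpha> \<in> Kset P \<Longrightarrow> \<beta> \<in> Kset P \<Longrightarrow> \<alpha> + \<beta> \<in> Kset P"
    by (auto simp: Kset_def) (metis add_0)
  assume P: "per2 P" and \<alpha>: "\<alpha> \<in> Kset even" and \<beta>: "\<beta> \<in> Kset P"
  obtain m where "\<And>n. n \<ge> m \<Longrightarrow> \<exists>\<gamma>\<in>supp_on even. fps_nth \<gamma> 0 = 0 \<and> \<alpha> = fls_shift (2 * int n) (fps_to_fls \<gamma>)"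
    using Kset_cases[OF _ \<alpha>] by auto
  then obtain \<gamma> where \<gamma>: "\<gamma> \<in> supp_on even" "\<alpha> = fls_shift (2 * int m) (fps_to_fls \<gamma>)"
    by blast
  obtain l where "\<And>n. n \<ge> l \<Longrightarrow> \<exists>\<gamma>\<in>supp_on P. fps_nth \<gamma> 0 = 0 \<and> \<beta> = fls_shift (2 * int n) (fps_to_fls \<gamma>)"
    using Kset_cases[OF P \<beta>] by auto
  then obtain \<delta> where \<delta>: "\<delta> \<in> supp_on P" "\<beta> = fls_shift (2 * int l) (fps_to_fls \<delta>)"
    by blast
  have "\<alpha> * \<beta> = fls_shift (2 * (int m + int l)) (fps_to_fls (\<gamma> * \<delta>))"
    by (simp add: \<gamma> \<delta> fls_shifted_times_simps fls_times_fps_to_fls algebra_simps)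
  then show "\<alpha> * \<beta> \<in> Kset P"
    using shift_in_Kset[OF P supp_on_mult[OF P \<gamma>(1) \<delta>(1)], of "int m + int l"] by (simp only:)
qed

lemma one_field_L [simp]: "1 \<in> field_L"
  using fps_in_Kset[of even "1 :: 'a fps"] by (simp add: field_L_Kset)

lemma field_L_closed [simp]:
  "0 \<in> field_L" "\<alpha> \<in> field_L \<Longrightarrow> \<beta> \<in> field_L \<Longrightarrow> \<alpha> + \<beta> \<in> field_L" "\<alpha> \<in> field_L \<Longrightarrow> - \<alpha> \<in> field_L"
  "\<alpha> \<in> field_L \<Longrightarrow> \<beta> \<in> field_L \<Longrightarrow> \<alpha> * \<beta> \<in> field_L"
  by (simp_all add: field_L_Kset Kset_closed)

lemma cring_ring_QR: "cring (ring_QR :: ('k::field fls \<times> 'k fls) ring)"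
proof (rule cringI)
  show "abelian_group (ring_QR :: ('k fls \<times> 'k fls) ring)"
    by (rule abelian_groupI) (auto simp: algebra_simps intro: exI[of _ "- _"])
  show "comm_monoid (ring_QR :: ('k fls \<times> 'k fls) ring)"
    by (rule comm_monoidI) (auto simp: algebra_simps)
qed (auto simp: algebra_simps)

lemma cring_ring_QA: "cring (ring_QA :: ('k::field fls \<times> 'k fls) ring)"
proof (rule cringI)
  show "abelian_group (ring_QA :: ('k fls \<times> 'k fls) ring)"
  proof (rule abelian_groupI)
    show "\<exists>y\<in>carrier ring_QA. y \<oplus>\<^bsub>ring_QA\<^esub> x = \<zero>\<^bsub>ring_QA\<^esub>" if "x \<in> carrier ring_QA" for x :: "'k fls \<times> 'k fls"
      using that by (intro bexI[of _ "(- fst x, - snd x)"]) auto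
  qed (auto simp: algebra_simps)
  show "comm_monoid (ring_QA :: ('k fls \<times> 'k fls) ring)"
    by (rule comm_monoidI) (auto simp: algebra_simps)
qed (auto simp: algebra_simps)

lemma restr_axes_eq: "restr_axes f = (fps_to_fls (rx f), fps_to_fls (ry f))"
  by (simp add: restr_axes_def rx_def ry_def)

lemma restr_axes_A: "f \<in> Mset P Q \<Longrightarrow> per2 P \<Longrightarrow> per2 Q \<Longrightarrow> restr_axes f \<in> Kset P \<times> Kset Q"
  by (simp add: restr_axes_eq Mset_def fps_in_Kset)

lemma ring_homs:
  "(\<lambda>f. f) \<in> Ring.ring_hom ring_A ring_R"
  "restr_axes \<in> Ring.ring_hom ring_A ring_QA"
  "restr_axes \<in> Ring.ring_hom ring_R ring_QR"
  "(\<lambda>c. c) \<in> Ring.ring_hom ring_QA ring_QR"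
  by (auto simp: Ring.ring_hom_def restr_axes_eq fls_times_fps_to_fls field_L_Kset fps_in_Kset Mset_def)

lemma module_QA_of_QR: "module ring_QR W \<Longrightarrow> module ring_QA W"
proof -
  assume "module ring_QR W"
  then interpret module ring_QR W .
  show ?thesis
  proof (rule moduleI[OF cring_ring_QA])
    show "abelian_group W" ..
  qed (use smult_l_distr smult_r_distr smult_assoc1 smult_one in auto)
qed

lemma module_R1: "module ring_R (module_vec TYPE('k::field fps2) n)"
proof (rule moduleI)
  show "cring (ring_R :: 'k fps2 ring)"
    by (rule cring_from_type_algebra)
  show "abelian_group (module_vec TYPE('k fps2) n)"
  proof (rule abelian_groupI)
    show "\<exists>y\<in>carrier (module_vec TYPE('k fps2) n). y \<oplus>\<^bsub>module_vec TYPE('k fps2) n\<^esub> x = \<zero>\<^bsub>module_vec TYPE('k fps2) n\<^esub>"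
      if "x \<in> carrier (module_vec TYPE('k fps2) n)" for x
      using that by (intro bexI[of _ "- x"]) (auto simp: module_vec_simps)
  qed (auto simp: module_vec_simps intro: comm_add_vec)
qed (auto simp: module_vec_simps add_smult_distrib_vec smult_add_distrib_vec smult_smult_assoc)

section \<open>The reflexive hull of a fractional ideal\<close>

context fractional
begin

sublocale BR: tensor ring_A ring_R "\<lambda>f. f" N
  by (intro tensor.intro module_N cring_from_type_algebra ring_homs)

abbreviation "reg \<equiv> regular_module (ring_R :: 'k fps2 ring)"

lemma module_reg: "module (ring_R :: 'k fps2 ring) reg"
  by (intro regular_module_is_module cring_from_type_algebra)

text \<open>The functional that sends \<open>s \<otimes> m\<close> to
  \<open>s * r * \<iota> m\<close>. Since linear maps from N to R are multiples of \<iota>, these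
  are all functionals on the base change, and its dual is free on \<open>\<Phi> 1\<close>.\<close>

definition \<Phi> :: "'k fps2 \<Rightarrow> ('k fps2 \<times> 'm \<Rightarrow>\<^sub>0 int) set \<Rightarrow> 'k fps2" where
  "\<Phi> r = base_change_adjoint ring_A ring_R (\<lambda>f. f) N reg (\<lambda>m. r * \<iota> m)"

abbreviation "DD \<equiv> dual_module ring_R BR.T"
abbreviation "HH \<equiv> reflexive_hull N"

lemma HH_eq: "HH = dual_module ring_R DD"
  by (simp add: reflexive_hull_def)

lemma module_HH: "module ring_R HH"
  unfolding HH_eq by (intro module_dual_module BR.module_T)

lemma \<Phi>_props: "\<Phi> r \<in> carrier DD" "m \<in> carrier N \<Longrightarrow> \<Phi> r (BR.pt s m) = s * (r * \<iota> m)"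
proof -
  note adj = BR.adjoint[OF module_reg, of "\<lambda>m. r * \<iota> m", folded \<Phi>_def]
  show "\<Phi> r \<in> carrier DD"
    using adj(1,2) by (simp add: algebra_simps)
  show "m \<in> carrier N \<Longrightarrow> \<Phi> r (BR.pt s m) = s * (r * \<iota> m)"
    using adj(3)[of s m] by (simp add: algebra_simps)
qed

lemma DD_eqI:
  assumes "d \<in> carrier DD" "d' \<in> carrier DD" "\<And>s m. m \<in> carrier N \<Longrightarrow> d (BR.pt s m) = d' (BR.pt s m)"
  shows "d = d'"
proof (rule extensionalityI[of _ "carrier BR.T"])
  show "d Z = d' Z" if "Z \<in> carrier BR.T" for Z
    by (rule BR.hom_unique[OF module_reg _ _ _ that]) (use assms in auto)
qed (use assms in auto)

lemma DD_cases:
  assumes d: "d \<in> carrier DD"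
  obtains r where "d = \<Phi> r"
proof -
  have dh: "d \<in> module_hom ring_R BR.T reg"
    using d by simp
  have "\<exists>r. \<forall>m\<in>carrier N. d (BR.pt 1 m) = r * \<iota> m"
  proof (rule hom_multiplication)
    show "d (BR.pt 1 (m \<oplus>\<^bsub>N\<^esub> n)) = d (BR.pt 1 m) + d (BR.pt 1 n)" if "m \<in> carrier N" "n \<in> carrier N" for m n
      using BR.pt_add_right[of 1 m n] BR.pt_closed[of 1 m] BR.pt_closed[of 1 n] that dh by (simp add: module_hom_def)
    show "d (BR.pt 1 (c \<odot>\<^bsub>N\<^esub> m)) = c * d (BR.pt 1 m)" if "c \<in> Mset even even" "m \<in> carrier N" for c m
      using BR.pt_balanced[of 1 c m] BR.smult_pt[of c 1 m] BR.pt_closed[of 1 m] that dh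
      by (simp add: module_hom_def) (metis UNIV_I ring_of_type_algebra_simps(1,2))
  qed
  then obtain r where r: "\<And>m. m \<in> carrier N \<Longrightarrow> d (BR.pt 1 m) = r * \<iota> m"
    by blast
  have "d = \<Phi> r"
  proof (rule DD_eqI[OF d \<Phi>_props(1)])
    fix s m
    assume m: "m \<in> carrier N"
    have "d (s \<odot>\<^bsub>BR.T\<^esub> BR.pt 1 m) = s * d (BR.pt 1 m)"
      using dh BR.pt_closed[of 1 m] m by (simp add: module_hom_def)
    then show "d (BR.pt s m) = \<Phi> r (BR.pt s m)"
      using BR.smult_pt[of s 1 m] m by (simp add: r \<Phi>_props)
  qed
  then show thesis
    by (rule that)
qed

lemma \<Phi>_inj: "\<Phi> r = \<Phi> s \<longleftrightarrow> r = s"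
proof
  obtain m0 where m0: "m0 \<in> carrier N" "\<iota> m0 = el_w"
    using w_mult_Mset[of 1 P Q] by (auto elim: iota_surj)
  assume "\<Phi> r = \<Phi> s"
  then have "\<Phi> r (BR.pt 1 m0) = \<Phi> s (BR.pt 1 m0)"
    by simp
  then show "r = s"
    using m0 by (simp add: \<Phi>_props)
qed simp

lemma \<Phi>_lin: "\<Phi> r \<oplus>\<^bsub>DD\<^esub> \<Phi> s = \<Phi> (r + s)" "c \<odot>\<^bsub>DD\<^esub> \<Phi> r = \<Phi> (c * r)"
proof -
  interpret DD: module ring_R DD
    by (rule module_dual_module[OF BR.module_T])
  have a: "\<Phi> r \<oplus>\<^bsub>DD\<^esub> \<Phi> s \<in> carrier DD" "c \<odot>\<^bsub>DD\<^esub> \<Phi> r \<in> carrier DD"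
    using DD.M.a_closed[OF \<Phi>_props(1) \<Phi>_props(1)] DD.smult_closed[of c, OF _ \<Phi>_props(1)] by (simp_all del: dual_module_simps)
  show "\<Phi> r \<oplus>\<^bsub>DD\<^esub> \<Phi> s = \<Phi> (r + s)"
    by (rule DD_eqI[OF a(1) \<Phi>_props(1)]) (simp add: \<Phi>_props BR.pt_closed algebra_simps)
  show "c \<odot>\<^bsub>DD\<^esub> \<Phi> r = \<Phi> (c * r)"
    by (rule DD_eqI[OF a(2) \<Phi>_props(1)]) (simp add: \<Phi>_props BR.pt_closed algebra_simps)
qed

lemma HH_value: "\<delta> \<in> carrier HH \<Longrightarrow> \<delta> (\<Phi> r) = r * \<delta> (\<Phi> 1)"
proof -
  assume "\<delta> \<in> carrier HH"
  then have "\<delta> \<in> module_hom ring_R DD reg"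
    unfolding HH_eq dual_module_simps(1)[of _ DD] by blast
  then have "\<delta> (r \<odot>\<^bsub>DD\<^esub> \<Phi> 1) = r * \<delta> (\<Phi> 1)"
    using \<Phi>_props(1)[of 1] by (simp add: module_hom_def del: dual_module_simps)
  then show ?thesis
    by (simp add: \<Phi>_lin del: dual_module_simps)
qed

text \<open>The dual being free on \<open>\<Phi> 1\<close>, an element of the bidual is determined
  by its value there, and that value is arbitrary.\<close>

lemma HH_iso: "(\<lambda>\<delta>. vec 1 (\<lambda>_. \<delta> (\<Phi> 1))) \<in> module_iso ring_R HH (module_vec TYPE('k fps2) 1)"
  unfolding module_iso_def
proof (intro CollectI conjI)
  let ?f = "\<lambda>\<delta> :: (('k fps2 \<times> 'm \<Rightarrow>\<^sub>0 int) set \<Rightarrow> 'k fps2) \<Rightarrow> 'k fps2. vec 1 (\<lambda>_. \<delta> (\<Phi> 1))"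
  have \<Phi>1: "\<Phi> 1 \<in> carrier DD"
    by (rule \<Phi>_props)
  show "?f \<in> module_hom ring_R HH (module_vec TYPE('k fps2) 1)"
  proof -
    have add: "(\<delta> \<oplus>\<^bsub>HH\<^esub> \<delta>') (\<Phi> 1) = \<delta> (\<Phi> 1) + \<delta>' (\<Phi> 1)" for \<delta> \<delta>'
      unfolding HH_eq dual_module_simps(3)[of _ DD] restrict_apply'[OF \<Phi>1] by simp
    have smult: "(r \<odot>\<^bsub>HH\<^esub> \<delta>) (\<Phi> 1) = r * \<delta> (\<Phi> 1)" for r \<delta>
      unfolding HH_eq dual_module_simps(4)[where M = DD] restrict_apply'[OF \<Phi>1] by simp
    show ?thesis
      unfolding module_hom_def by (intro CollectI conjI ballI) (auto simp: module_vec_simps add smult)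
  qed
  show "bij_betw ?f (carrier HH) (carrier (module_vec TYPE('k fps2) 1))"
    unfolding bij_betw_def
  proof
    show "inj_on ?f (carrier HH)"
    proof (rule inj_onI)
      fix \<delta> \<delta>' assume d: "\<delta> \<in> carrier HH" "\<delta>' \<in> carrier HH" "?f \<delta> = ?f \<delta>'"
      have "vec_index (?f \<delta>) 0 = vec_index (?f \<delta>') 0"
        by (simp only: d(3))
      then have "\<delta> (\<Phi> 1) = \<delta>' (\<Phi> 1)"
        by simp
      then have eq: "\<delta> (\<Phi> r) = \<delta>' (\<Phi> r)" for r
        unfolding HH_value[OF d(1), of r] HH_value[OF d(2), of r] by (simp only:)
      show "\<delta> = \<delta>'"
      proof (rule extensionalityI[of _ "carrier DD"])
        show "\<delta> \<in> extensional (carrier DD)" "\<delta>' \<in> extensional (carrier DD)"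
          using d by (simp_all only: HH_eq dual_module_simps(1) Int_iff)
        show "\<delta> z = \<delta>' z" if "z \<in> carrier DD" for z
          by (rule DD_cases[OF that]) (simp only: eq)
      qed
    qed
    show "?f ` carrier HH = carrier (module_vec TYPE('k fps2) 1)"
    proof (intro equalityI subsetI)
      fix v
      assume v: "v \<in> carrier (module_vec TYPE('k fps2) 1)"
      define c where "c = vec_index v 0"
      \<comment> \<open>The functional with value c at \<open>\<Phi> 1\<close>; the description
        recovers r from \<open>\<Phi> r\<close> by injectivity.\<close>
      define \<delta> where "\<delta> = (\<lambda>d\<in>carrier DD. c * (THE r. d = \<Phi> r))"
      have the: "(THE r. \<Phi> s = \<Phi> r) = s" for s
        using \<Phi>_inj by auto
      have val: "\<delta> (\<Phi> s) = c * s" for s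
        using \<Phi>_props(1) unfolding \<delta>_def by (simp only: restrict_apply' the)
      have "\<delta> \<in> module_hom ring_R DD reg"
        unfolding module_hom_def
      proof (intro CollectI conjI ballI)
        show "\<delta> (d \<oplus>\<^bsub>DD\<^esub> d') = \<delta> d \<oplus>\<^bsub>reg\<^esub> \<delta> d'" if dd: "d \<in> carrier DD" "d' \<in> carrier DD" for d d'
        proof -
          obtain r where r: "d = \<Phi> r"
            by (rule DD_cases[OF dd(1)])
          obtain r' where r': "d' = \<Phi> r'"
            by (rule DD_cases[OF dd(2)])
          show ?thesis
            unfolding r r' \<Phi>_lin(1) val by (simp add: distrib_left)
        qed
        show "\<delta> (r \<odot>\<^bsub>DD\<^esub> d) = r \<odot>\<^bsub>reg\<^esub> \<delta> d" if dd: "d \<in> carrier DD" for r d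
        proof -
          obtain s where s: "d = \<Phi> s"
            by (rule DD_cases[OF dd])
          show ?thesis
            unfolding s \<Phi>_lin(2) val by (simp add: mult.left_commute)
        qed
      qed simp
      then have "\<delta> \<in> carrier HH"
        unfolding HH_eq dual_module_simps(1) \<delta>_def by blast
      moreover have "v = ?f \<delta>"
        using v by (auto simp: module_vec_simps val c_def)
      ultimately show "v \<in> ?f ` carrier HH"
        by blast
    qed (auto simp: module_vec_simps)
  qed
qed

lemma has_rank_1: "has_rank N 1"
  using HH_iso by (auto simp: has_rank_def module_isomorphic_def)

abbreviation "ev \<equiv> to_reflexive_hull N"

text \<open>In the coordinate given by \<open>HH_iso\<close>, the canonical map to the reflexive
  hull becomes \<iota>. This makes the gluing map of the triple explicit.\<close>

lemma ev_props:
  assumes "m \<in> carrier N"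
  shows "ev m \<in> carrier HH" "ev m (\<Phi> 1) = \<iota> m"
proof -
  have "BR.pt 1 m \<in> carrier BR.T"
    by (rule BR.pt_closed) (use assms in simp_all)
  then show "ev m \<in> carrier HH"
    using bidual_map_hom[OF BR.module_T] unfolding module_hom_def HH_eq to_reflexive_hull_def by blast
  show "ev m (\<Phi> 1) = \<iota> m"
    using \<Phi>_props(1)[of 1] \<Phi>_props(2)[OF assms, of 1 1]
    unfolding to_reflexive_hull_def bidual_map_def by (simp only: restrict_apply') simp
qed

end

lemma reflexive_hull_map_hom:
  assumes "module ring_A N"
  shows "module ring_R (reflexive_hull N)"
    and "\<And>m. m \<in> carrier N \<Longrightarrow> to_reflexive_hull N m \<in> carrier (reflexive_hull N)"
    and "\<And>m n. m \<in> carrier N \<Longrightarrow> n \<in> carrier N \<Longrightarrow>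
      to_reflexive_hull N (m \<oplus>\<^bsub>N\<^esub> n) = to_reflexive_hull N m \<oplus>\<^bsub>reflexive_hull N\<^esub> to_reflexive_hull N n"
    and "\<And>c m. c \<in> Mset even even \<Longrightarrow> m \<in> carrier N \<Longrightarrow>
      to_reflexive_hull N (c \<odot>\<^bsub>N\<^esub> m) = c \<odot>\<^bsub>reflexive_hull N\<^esub> to_reflexive_hull N m"
proof -
  interpret T: tensor ring_A ring_R "\<lambda>f. f" N
    by (intro tensor.intro assms cring_from_type_algebra ring_homs)
  have j: "bidual_map ring_R T.T \<in> module_hom ring_R T.T (reflexive_hull N)"
    unfolding reflexive_hull_def by (rule bidual_map_hom[OF T.module_T])
  show "module ring_R (reflexive_hull N)"
    unfolding reflexive_hull_def by (intro module_dual_module T.module_T)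
  have pt: "T.pt 1 m \<in> carrier T.T" if "m \<in> carrier N" for m
    by (rule T.pt_closed) (use that in simp_all)
  show "to_reflexive_hull N m \<in> carrier (reflexive_hull N)" if "m \<in> carrier N" for m
    using j pt[OF that] unfolding module_hom_def to_reflexive_hull_def by blast
  show "to_reflexive_hull N (m \<oplus>\<^bsub>N\<^esub> n) = to_reflexive_hull N m \<oplus>\<^bsub>reflexive_hull N\<^esub> to_reflexive_hull N n"
    if "m \<in> carrier N" "n \<in> carrier N" for m n
    using j pt[OF that(1)] pt[OF that(2)] T.pt_add_right[of 1 m n] that
    unfolding module_hom_def to_reflexive_hull_def by simp
  show "to_reflexive_hull N (c \<odot>\<^bsub>N\<^esub> m) = c \<odot>\<^bsub>reflexive_hull N\<^esub> to_reflexive_hull N m"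
    if "c \<in> Mset even even" "m \<in> carrier N" for c m
  proof -
    have "T.pt 1 (c \<odot>\<^bsub>N\<^esub> m) = c \<odot>\<^bsub>T.T\<^esub> T.pt 1 m"
      using T.pt_balanced[of 1 c m] T.smult_pt[of c 1 m] that by simp
    then show ?thesis
      using j pt[OF that(2)] unfolding module_hom_def to_reflexive_hull_def by simp
  qed
qed

section \<open>Gluing data\<close>

text \<open>The comparison of triples uses the gluing matrix only through this identification of the
  vectors over \<L> with a subspace of \<K>.\<close>

definition datum :: "(nat \<Rightarrow> bool) \<Rightarrow> 'k::field fls mat \<Rightarrow> bool" where
  "datum P \<Theta> \<longleftrightarrow> dim_row \<Theta> = 1 \<and>
     bij_betw (\<lambda>v. vec_index (\<Theta> *\<^sub>v v) 0) {v \<in> carrier_vec (dim_col \<Theta>). vec_set v \<subseteq> field_L} (Kset P)"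

lemma vec_set_subset_iff: "vec_set v \<subseteq> F \<longleftrightarrow> (\<forall>i<dim_vec v. vec_index v i \<in> F)"
  by (auto simp: vec_set_def)

lemma Kset_odd_iff: "\<alpha> \<in> Kset odd \<longleftrightarrow> (\<exists>\<beta>\<in>field_L. \<alpha> = fls_X * \<beta>)"
proof
  assume "\<alpha> \<in> Kset odd"
  then have "fls_shift 1 \<alpha> \<in> field_L"
    by (auto simp: Kset_def field_L_def even_nat_iff even_mod_2_iff)
  moreover have "\<alpha> = fls_X * fls_shift 1 \<alpha>"
    by (simp add: fls_X_times_conv_shift)
  ultimately show "\<exists>\<beta>\<in>field_L. \<alpha> = fls_X * \<beta>"
    by blast
next
  assume "\<exists>\<beta>\<in>field_L. \<alpha> = fls_X * \<beta>"
  then show "\<alpha> \<in> Kset odd"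
    by (auto simp: Kset_def field_L_def fls_X_times_conv_shift even_nat_iff even_mod_2_iff)
qed

lemma datum_1: "datum even (glue_1 :: 'k::field fls mat)"
proof -
  have idx: "vec_index (glue_1 *\<^sub>v v) 0 = vec_index v 0" if "v \<in> carrier_vec 1" for v :: "'k fls vec"
    using that by (simp add: mat_of_rows_list_def scalar_prod_def)
  show ?thesis
    unfolding datum_def
  proof
    show "bij_betw (\<lambda>v. vec_index (glue_1 *\<^sub>v v) 0) {v \<in> carrier_vec (dim_col glue_1). vec_set v \<subseteq> field_L} (Kset even :: 'k fls set)"
      by (rule bij_betw_byWitness[where f' = "\<lambda>\<alpha>. vec 1 (\<lambda>_. \<alpha>)"])
        (auto simp: mat_of_rows_list_def scalar_prod_def vec_set_subset_iff field_L_Kset intro!: eq_vecI)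
  qed (simp add: mat_of_rows_list_def)
qed

lemma datum_z: "datum odd (glue_z :: 'k::field fls mat)"
  unfolding datum_def
proof
  have X: "fls_shift 1 (fls_X * \<alpha>) = \<alpha>" "fls_X * fls_shift 1 \<alpha> = \<alpha>" for \<alpha> :: "'k fls"
    by (simp_all add: fls_X_times_conv_shift)
  have L: "fls_shift 1 \<alpha> \<in> field_L" if "\<alpha> \<in> Kset odd" for \<alpha> :: "'k fls"
    using that X unfolding Kset_odd_iff by auto
  show "bij_betw (\<lambda>v. vec_index (glue_z *\<^sub>v v) 0) {v \<in> carrier_vec (dim_col glue_z). vec_set v \<subseteq> field_L} (Kset odd :: 'k fls set)"
    by (rule bij_betw_byWitness[where f' = "\<lambda>\<alpha>. vec 1 (\<lambda>_. fls_shift 1 \<alpha>)"])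
      (auto simp: mat_of_rows_list_def scalar_prod_def vec_set_subset_iff X L Kset_odd_iff intro!: eq_vecI)
qed (simp add: mat_of_rows_list_def)

text \<open>The matrix expresses \<K> = \<L> + z \<L>; the two coordinates of a Laurent series are
  its even part and its odd part divided by z.\<close>

lemma datum_1z: "datum (\<lambda>_. True) (glue_1z :: 'k::field fls mat)"
  unfolding datum_def
proof
  let ?C = "{v \<in> carrier_vec (dim_col (glue_1z :: 'k fls mat)). vec_set v \<subseteq> (field_L :: 'k fls set)}"
  have C: "v \<in> ?C \<longleftrightarrow> dim_vec v = 2 \<and> vec_index v 0 \<in> field_L \<and> vec_index v 1 \<in> field_L" for v
  proof -
    have d: "dim_col (glue_1z :: 'k fls mat) = 2" "(\<forall>i<2. S i) \<longleftrightarrow> S 0 \<and> S (1 :: nat)" for S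
      by (auto simp: mat_of_rows_list_def less_2_cases_iff)
    show ?thesis
      unfolding mem_Collect_eq d(1) carrier_vec_def vec_set_subset_iff using d(2)[of "\<lambda>i. vec_index v i \<in> field_L"] by (cases "dim_vec v = 2") simp_all
  qed
  have idx: "vec_index (glue_1z *\<^sub>v v) 0 = vec_index v 0 + fls_X * vec_index v 1" if "v \<in> ?C" for v
    using that unfolding C by (simp add: mat_of_rows_list_def scalar_prod_def numeral_2_eq_2)
  have nth: "fls_nth (\<alpha> + fls_X * \<beta>) n = (if even n then fls_nth \<alpha> n else fls_nth \<beta> (n - 1))"
    if "\<alpha> \<in> field_L" "\<beta> \<in> field_L" for \<alpha> \<beta> :: "'k fls" and n
    using that by (auto simp: field_L_def fls_X_times_conv_shift)
  show "bij_betw (\<lambda>v. vec_index (glue_1z *\<^sub>v v) 0) ?C (Kset (\<lambda>_. True))"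
    unfolding bij_betw_def
  proof
    show "inj_on (\<lambda>v. vec_index (glue_1z *\<^sub>v v) 0) ?C"
    proof (rule inj_onI)
      fix v v'
      assume v: "v \<in> ?C" "v' \<in> ?C" and eq: "vec_index (glue_1z *\<^sub>v v) 0 = vec_index (glue_1z *\<^sub>v v') 0"
      have a: "vec_index v 0 \<in> field_L" "vec_index v 1 \<in> field_L" "vec_index v' 0 \<in> field_L" "vec_index v' 1 \<in> field_L"
        using v unfolding C by auto
      have n: "(if even n then fls_nth (vec_index v 0) n else fls_nth (vec_index v 1) (n - 1)) =
          (if even n then fls_nth (vec_index v' 0) n else fls_nth (vec_index v' 1) (n - 1))" for n
        using arg_cong[OF eq, of "\<lambda>f. fls_nth f n"] unfolding idx[OF v(1)] idx[OF v(2)] nth[OF a(1,2)] nth[OF a(3,4)] .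
      have "fls_nth (vec_index v 0) n = fls_nth (vec_index v' 0) n" for n
        using n[of n] a by (cases "even n") (auto simp: field_L_def)
      moreover have "fls_nth (vec_index v 1) n = fls_nth (vec_index v' 1) n" for n
        using n[of "n + 1"] a by (cases "even n") (auto simp: field_L_def)
      ultimately have "vec_index v 0 = vec_index v' 0" "vec_index v 1 = vec_index v' 1"
        by (auto intro: fls_eqI)
      then show "v = v'"
        using v unfolding C by (intro eq_vecI) (auto simp: less_2_cases_iff)
    qed
    show "(\<lambda>v. vec_index (glue_1z *\<^sub>v v) 0) ` ?C = Kset (\<lambda>_. True)"
    proof (intro equalityI subsetI)
      fix \<alpha> :: "'k fls"
      obtain n0 where n0: "\<And>n. n \<ge> n0 \<Longrightarrow> \<exists>\<gamma>\<in>supp_on (\<lambda>_. True). fps_nth \<gamma> 0 = 0 \<and> \<alpha> = fls_shift (2 * int n) (fps_to_fls \<gamma>)"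
        using Kset_cases[of "\<lambda>_. True" \<alpha>] by (auto simp: Kset_def)
      obtain \<gamma> where \<gamma>: "\<alpha> = fls_shift (2 * int n0) (fps_to_fls \<gamma>)"
        using n0[of n0] by blast
      obtain \<delta> where \<delta>: "\<gamma> - evp \<gamma> = fps_X * \<delta>" "\<delta> \<in> supp_on even"
        by (rule supp_on_odd_factor[OF evp_simps(2)])
      define v where "v = vec 2 (\<lambda>i. fls_shift (2 * int n0) (fps_to_fls (if i = 0 then evp \<gamma> else \<delta>)))"
      have v: "v \<in> ?C"
        unfolding C v_def using shift_in_Kset[of even, OF _ evp_simps(1)[of \<gamma>]] shift_in_Kset[of even, OF _ \<delta>(2)]
        by (simp add: field_L_Kset)
      have "fls_X * fps_to_fls \<delta> = fps_to_fls (fps_X * \<delta>)"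
        by (simp add: fls_times_fps_to_fls)
      then have "\<alpha> = vec_index (glue_1z *\<^sub>v v) 0"
        unfolding idx[OF v] by (simp add: v_def \<gamma> fls_shifted_times_simps flip: \<delta>(1))
      then show "\<alpha> \<in> (\<lambda>v. vec_index (glue_1z *\<^sub>v v) 0) ` ?C"
        using v by blast
    qed (simp add: Kset_def)
  qed
qed (simp add: mat_of_rows_list_def)

lemma L_space_simps [simp]:
  "carrier (L_space p q) = {v \<in> carrier_vec p. vec_set v \<subseteq> field_L} \<times> {v \<in> carrier_vec q. vec_set v \<subseteq> field_L}"
  "\<zero>\<^bsub>L_space p q\<^esub> = (0\<^sub>v p, 0\<^sub>v q)"
  "v \<oplus>\<^bsub>L_space p q\<^esub> w = (fst v + fst w, snd v + snd w)"
  "c \<odot>\<^bsub>L_space p q\<^esub> v = (fst c \<cdot>\<^sub>v fst v, snd c \<cdot>\<^sub>v snd v)"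
  by (simp_all add: L_space_def case_prod_beta)

lemma module_L_space: "module ring_QA (L_space p q :: ('k::field fls \<times> 'k fls, 'k fls vec \<times> 'k fls vec) module)"
proof (rule moduleI[OF cring_ring_QA])
  show "abelian_group (L_space p q :: ('k fls \<times> 'k fls, 'k fls vec \<times> 'k fls vec) module)"
  proof (rule abelian_groupI)
    show "\<exists>y\<in>carrier (L_space p q). y \<oplus>\<^bsub>L_space p q\<^esub> x = \<zero>\<^bsub>L_space p q\<^esub>" if "x \<in> carrier (L_space p q)" for x :: "'k fls vec \<times> 'k fls vec"
      using that by (intro bexI[of _ "(- fst x, - snd x)"]) (auto simp: vec_set_subset_iff)
  qed (auto simp: vec_set_subset_iff intro: comm_add_vec)
qed (auto simp: vec_set_subset_iff add_smult_distrib_vec smult_add_distrib_vec smult_smult_assoc)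

section \<open>The vector space of the triple and its image in \<K> \<times> \<K>\<close>

context fractional
begin

sublocale BV: tensor ring_A ring_QA restr_axes N
  by (intro tensor.intro module_N cring_ring_QA ring_homs)

lemma module_QR_reg: "module ring_QA (regular_module (ring_QR :: ('k fls \<times> 'k fls) ring))"
  by (intro module_QA_of_QR regular_module_is_module cring_ring_QR)

text \<open>The tensor product is compared with a concrete subspace through the restrictions of
  \<iota> to the axes; \<open>emb_bij\<close> shows that nothing is lost.\<close>

definition emb :: "(('k fls \<times> 'k fls) \<times> 'm \<Rightarrow>\<^sub>0 int) set \<Rightarrow> 'k fls \<times> 'k fls" where
  "emb = base_change_adjoint ring_A ring_QA restr_axes N (regular_module ring_QR) (\<lambda>m. restr_axes (\<iota> m))"

lemma emb_props:
  "emb \<in> module_hom ring_QA BV.T (regular_module ring_QR)"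
  "c \<in> field_L \<times> field_L \<Longrightarrow> m \<in> carrier N \<Longrightarrow> emb (BV.pt c m) = c \<otimes>\<^bsub>ring_QR\<^esub> restr_axes (\<iota> m)"
proof -
  note adj = BV.adjoint[OF module_QR_reg, of "\<lambda>m. restr_axes (\<iota> m)", folded emb_def]
  show "emb \<in> module_hom ring_QA BV.T (regular_module ring_QR)"
    by (rule adj(1)) (simp_all add: restr_axes_eq fls_times_fps_to_fls)
  show "c \<in> field_L \<times> field_L \<Longrightarrow> m \<in> carrier N \<Longrightarrow> emb (BV.pt c m) = c \<otimes>\<^bsub>ring_QR\<^esub> restr_axes (\<iota> m)"
    using adj(3)[of c m] by (simp add: restr_axes_eq fls_times_fps_to_fls)
qed

text \<open>The common denominator \<open>z^(-2 n)\<close> on both axes, inverse to the restriction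
  of \<open>(el_u + el_v) ^ n\<close>.\<close>

definition tn :: "nat \<Rightarrow> 'k fls \<times> 'k fls" where
  "tn n = (fls_shift (2 * int n) 1, fls_shift (2 * int n) 1)"

lemma tn_L [simp]: "tn n \<in> field_L \<times> field_L"
  using shift_in_Kset[of even "1 :: 'k fps" "int n"] by (simp add: tn_def field_L_Kset)

lemma uv_power: "(el_u + el_v) ^ k \<in> Mset even even" "rx ((el_u + el_v) ^ k) = fps_X ^ (2 * k)" "ry ((el_u + el_v) ^ k) = fps_X ^ (2 * k)"
proof -
  show "(el_u + el_v) ^ k \<in> Mset even even"
    by (intro A_power A_closed uvwab_in_A)
qed (simp_all add: el_u_def el_v_def power_mult)

lemma shift_X: "fls_shift (2 * int (n + k)) (fps_to_fls (fps_X ^ (2 * k))) = fls_shift (2 * int n) (1 :: 'k fls)"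
  by (simp add: fps_to_fls_power fls_X_power_conv_shift_1)

lemma tn_mult: "tn n = tn (n + k) \<otimes>\<^bsub>ring_QA\<^esub> restr_axes ((el_u + el_v) ^ k)"
  unfolding restr_axes_eq uv_power ring_QA_simps tn_def fst_conv snd_conv fls_shifted_times_simps mult_1
  by (simp only: shift_X)

lemma pt_tn: "m \<in> carrier N \<Longrightarrow> BV.pt (tn n) m = BV.pt (tn (n + k)) ((el_u + el_v) ^ k \<odot>\<^bsub>N\<^esub> m)"
  using BV.pt_balanced[of "tn (n + k)" "(el_u + el_v) ^ k" m] tn_mult[of n k] uv_power(1)[of k] tn_L[of "n + k"] by simp

text \<open>A scalar is a denominator \<open>tn n\<close> times the restriction of an element of A,
  which can be moved into N. Sums are brought over a common denominator with \<open>pt_tn\<close>,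
  so one pure tensor suffices.\<close>

lemma BV_cases:
  assumes "Z \<in> carrier BV.T"
  shows "\<exists>n. \<exists>m\<in>carrier N. Z = BV.pt (tn n) m"
  using assms
proof (induction rule: BV.T_induct)
  case (pure c m)
  have c: "fst c \<in> Kset even" "snd c \<in> Kset even"
    using pure(1) by (auto simp: field_L_Kset)
  obtain n1 where n1: "\<And>n. n \<ge> n1 \<Longrightarrow> \<exists>\<gamma>\<in>supp_on even. fps_nth \<gamma> 0 = 0 \<and> fst c = fls_shift (2 * int n) (fps_to_fls \<gamma>)"
    using Kset_cases[OF _ c(1)] by auto
  obtain n2 where n2: "\<And>n. n \<ge> n2 \<Longrightarrow> \<exists>\<gamma>\<in>supp_on even. fps_nth \<gamma> 0 = 0 \<and> snd c = fls_shift (2 * int n) (fps_to_fls \<gamma>)"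
    using Kset_cases[OF _ c(2)] by auto
  obtain \<gamma> \<delta> where \<gamma>: "\<gamma> \<in> supp_on even" "fps_nth \<gamma> 0 = 0" "fst c = fls_shift (2 * int (n1 + n2)) (fps_to_fls \<gamma>)"
    and \<delta>: "\<delta> \<in> supp_on even" "fps_nth \<delta> 0 = 0" "snd c = fls_shift (2 * int (n1 + n2)) (fps_to_fls \<delta>)"
    using n1[of "n1 + n2"] n2[of "n1 + n2"] by auto
  let ?a = "cx \<gamma> + cy \<delta>"
  have a: "?a \<in> Mset even even"
    by (intro A_closed cx_in_A cy_in_A \<gamma> \<delta>)
  have "c = tn (n1 + n2) \<otimes>\<^bsub>ring_QA\<^esub> restr_axes ?a"
    by (simp only: restr_axes_eq tn_def ring_QA_simps prod_eq_iff fst_conv snd_conv \<gamma>(3) \<delta>(3)) (simp add: \<gamma>(2) \<delta>(2) fls_shifted_times_simps)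
  then have "BV.pt c m = BV.pt (tn (n1 + n2)) (?a \<odot>\<^bsub>N\<^esub> m)"
    using BV.pt_balanced[of "tn (n1 + n2)" ?a m] a pure(2) by simp
  then show ?case
    using N.smult_closed[of ?a m] a pure(2) by (intro exI[of _ "n1 + n2"] bexI[of _ "?a \<odot>\<^bsub>N\<^esub> m"]) simp_all
next
  case (add Y Z)
  then obtain n m k m' where Y: "m \<in> carrier N" "Y = BV.pt (tn n) m" and Z: "m' \<in> carrier N" "Z = BV.pt (tn k) m'"
    by blast
  have uv: "(el_u + el_v) ^ j \<odot>\<^bsub>N\<^esub> i \<in> carrier N" if "i \<in> carrier N" for i j
    using uv_power(1)[of j] that by (intro N.smult_closed) simp_all
  have "Y \<oplus>\<^bsub>BV.T\<^esub> Z = BV.pt (tn (n + k)) ((el_u + el_v) ^ k \<odot>\<^bsub>N\<^esub> m) \<oplus>\<^bsub>BV.T\<^esub> BV.pt (tn (n + k)) ((el_u + el_v) ^ n \<odot>\<^bsub>N\<^esub> m')"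
    using pt_tn[OF Y(1), of n k] pt_tn[OF Z(1), of k n] Y(2) Z(2) by (simp add: add.commute)
  also have "\<dots> = BV.pt (tn (n + k)) ((el_u + el_v) ^ k \<odot>\<^bsub>N\<^esub> m \<oplus>\<^bsub>N\<^esub> (el_u + el_v) ^ n \<odot>\<^bsub>N\<^esub> m')"
    by (rule BV.pt_add_right[symmetric]) (use uv Y Z tn_L in simp_all)
  finally show ?case
    using N.M.a_closed[OF uv[OF Y(1), of k] uv[OF Z(1), of n]] by blast
qed

lemma pt_zero_left: "m \<in> carrier N \<Longrightarrow> BV.pt (0, 0) m = \<zero>\<^bsub>BV.T\<^esub>"
  using BV.smult_pt[of "(0, 0)" "(0, 0)" m] BV.T.smult_l_null[OF BV.pt_closed[of "(0, 0)" m]] by simp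

text \<open>The kernel of the projection of \<open>N\<close> to the axes is \<open>w R\<close>, which is not contained in \<open>I N\<close>, but becomes so after
  multiplication with \<open>u + v\<close>.\<close>

lemma emb_kernel:
  assumes Z: "Z \<in> carrier BV.T" and 0: "emb Z = (0, 0)"
  shows "Z = \<zero>\<^bsub>BV.T\<^esub>"
proof -
  obtain n m where m: "m \<in> carrier N" "Z = BV.pt (tn n) m"
    using BV_cases[OF Z] by blast
  have "tn n \<otimes>\<^bsub>ring_QR\<^esub> restr_axes (\<iota> m) = (0, 0)"
    using 0 emb_props(2)[of "tn n" m] m tn_L by simp
  then have "rx (\<iota> m) = 0 \<and> ry (\<iota> m) = 0"
    by (simp add: tn_def restr_axes_eq fls_shifted_times_simps fls_shift_eq0_iff)
  then obtain r where r: "\<iota> m = el_w * r"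
    unfolding axes_zero_iff by (auto simp: dvd_def)
  obtain k where k: "(el_x :: 'k fps2) ^ k \<in> Mset P Q" "k = 1 \<or> k = 2"
    using kinds_ex[OF kP] by (auto simp: Mset_def intro: that[of 1] that[of 2])
  obtain l where l: "(el_y :: 'k fps2) ^ l \<in> Mset P Q" "l = 1 \<or> l = 2"
    using kinds_ex[OF kQ] by (auto simp: Mset_def intro: that[of 1] that[of 2])
  obtain mx where mx: "mx \<in> carrier N" "\<iota> mx = el_x ^ k"
    by (rule iota_surj[OF k(1)])
  obtain my where my: "my \<in> carrier N" "\<iota> my = el_y ^ l"
    by (rule iota_surj[OF l(1)])
  \<comment> \<open>The exponents 2 - k and 2 - l complete the generators \<open>el_x ^ k\<close>
    and \<open>el_y ^ l\<close> of N to u and v. Thus u + v times w r is a combination of these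
    generators with coefficients in w R, which restrict to zero and annihilate the tensors.\<close>
  define ax where "ax = el_w * (el_x ^ (2 - k) * r)"
  define ay where "ay = el_w * (el_y ^ (2 - l) * r)"
  have A: "ax \<in> Mset even even" "ay \<in> Mset even even"
    by (simp_all add: ax_def ay_def)
  have xk: "el_x ^ (2 - k) * el_x ^ k = (el_u :: 'k fps2)" "el_y ^ (2 - l) * el_y ^ l = (el_v :: 'k fps2)"
    using k(2) l(2) by (auto simp: el_u_def el_v_def power2_eq_square)
  have uvA: "(el_u + el_v) ^ 1 \<in> Mset even even"
    by (rule uv_power)
  have "(el_u + el_v) ^ 1 * \<iota> m = ax * el_x ^ k + ay * el_y ^ l"
    unfolding ax_def ay_def r power_one_right distrib_right xk[symmetric] by (simp only: mult_ac)
  also have "\<dots> = \<iota> (ax \<odot>\<^bsub>N\<^esub> mx \<oplus>\<^bsub>N\<^esub> ay \<odot>\<^bsub>N\<^esub> my)"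
    using iota_add[of "ax \<odot>\<^bsub>N\<^esub> mx" "ay \<odot>\<^bsub>N\<^esub> my"] iota_smult[OF A(1) mx(1)] iota_smult[OF A(2) my(1)] mx my
      N.smult_closed[of ax mx] N.smult_closed[of ay my] A by simp
  finally have "\<iota> ((el_u + el_v) ^ 1 \<odot>\<^bsub>N\<^esub> m) = \<iota> (ax \<odot>\<^bsub>N\<^esub> mx \<oplus>\<^bsub>N\<^esub> ay \<odot>\<^bsub>N\<^esub> my)"
    unfolding iota_smult[OF uvA m(1)] .
  then have eq: "(el_u + el_v) ^ 1 \<odot>\<^bsub>N\<^esub> m = ax \<odot>\<^bsub>N\<^esub> mx \<oplus>\<^bsub>N\<^esub> ay \<odot>\<^bsub>N\<^esub> my"
    using iota_eq_iff[of "(el_u + el_v) ^ 1 \<odot>\<^bsub>N\<^esub> m" "ax \<odot>\<^bsub>N\<^esub> mx \<oplus>\<^bsub>N\<^esub> ay \<odot>\<^bsub>N\<^esub> my"] uvA A m mx my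
      N.smult_closed[of "(el_u + el_v) ^ 1" m] N.smult_closed[of ax mx] N.smult_closed[of ay my] by (simp del: power_one_right)
  have zero: "BV.pt (tn j) (b \<odot>\<^bsub>N\<^esub> i) = \<zero>\<^bsub>BV.T\<^esub>" if "restr_axes b = (0, 0)" "b \<in> Mset even even" "i \<in> carrier N" for b i j
    using BV.pt_balanced[of "tn j" b i] that tn_L[of j] pt_zero_left[OF that(3)] by simp
  have "Z = BV.pt (tn (n + 1)) (ax \<odot>\<^bsub>N\<^esub> mx \<oplus>\<^bsub>N\<^esub> ay \<odot>\<^bsub>N\<^esub> my)"
    unfolding m(2) eq[symmetric] by (rule pt_tn[OF m(1)])
  also have "\<dots> = BV.pt (tn (n + 1)) (ax \<odot>\<^bsub>N\<^esub> mx) \<oplus>\<^bsub>BV.T\<^esub> BV.pt (tn (n + 1)) (ay \<odot>\<^bsub>N\<^esub> my)"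
    by (rule BV.pt_add_right) (use A mx my tn_L N.smult_closed[of ax mx] N.smult_closed[of ay my] in simp_all)
  also have "\<dots> = \<zero>\<^bsub>BV.T\<^esub>"
    using zero[of ax mx "n + 1"] zero[of ay my "n + 1"] A mx my BV.T.M.zero_closed
    by (simp add: restr_axes_eq ax_def ay_def)
  finally show ?thesis .
qed

text \<open>Injectivity is \<open>emb_kernel\<close>. For surjectivity, a pair is written over a
  common denominator with numerators without constant term, and the sum of their lifts to the axes
  is an element of the shape.\<close>

lemma emb_bij: "bij_betw emb (carrier BV.T) (Kset P \<times> Kset Q)"
  unfolding bij_betw_def
proof
  have add: "emb (Y \<oplus>\<^bsub>BV.T\<^esub> Z) = (fst (emb Y) + fst (emb Z), snd (emb Y) + snd (emb Z))"
    if "Y \<in> carrier BV.T" "Z \<in> carrier BV.T" for Y Z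
    using emb_props(1) that by (simp add: module_hom_def)
  show "inj_on emb (carrier BV.T)"
  proof (rule inj_onI)
    fix Y Z
    assume YZ: "Y \<in> carrier BV.T" "Z \<in> carrier BV.T" "emb Y = emb Z"
    have mZ: "\<ominus>\<^bsub>BV.T\<^esub> Z \<in> carrier BV.T"
      using YZ by simp
    have z: "emb \<zero>\<^bsub>BV.T\<^esub> = (0, 0)"
    proof -
      have "fst (emb \<zero>\<^bsub>BV.T\<^esub>) + fst (emb \<zero>\<^bsub>BV.T\<^esub>) = fst (emb \<zero>\<^bsub>BV.T\<^esub>) + 0" "snd (emb \<zero>\<^bsub>BV.T\<^esub>) + snd (emb \<zero>\<^bsub>BV.T\<^esub>) = snd (emb \<zero>\<^bsub>BV.T\<^esub>) + 0"
        using add[OF BV.T.M.zero_closed BV.T.M.zero_closed] unfolding BV.T.M.l_zero[OF BV.T.M.zero_closed] prod_eq_iff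
        by (simp_all only: add_0_right fst_conv snd_conv)
      then show ?thesis
        by (simp only: add_left_cancel prod_eq_iff fst_conv snd_conv)
    qed
    have "emb (Y \<oplus>\<^bsub>BV.T\<^esub> (\<ominus>\<^bsub>BV.T\<^esub> Z)) = emb (Z \<oplus>\<^bsub>BV.T\<^esub> (\<ominus>\<^bsub>BV.T\<^esub> Z))"
      unfolding add[OF YZ(1) mZ] add[OF YZ(2) mZ] YZ(3) ..
    then have "emb (Y \<oplus>\<^bsub>BV.T\<^esub> (\<ominus>\<^bsub>BV.T\<^esub> Z)) = (0, 0)"
      using BV.T.M.r_neg[OF YZ(2)] z by simp
    then have "Y \<oplus>\<^bsub>BV.T\<^esub> (\<ominus>\<^bsub>BV.T\<^esub> Z) = \<zero>\<^bsub>BV.T\<^esub>"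
      using emb_kernel BV.T.M.a_closed[OF YZ(1) mZ] by blast
    then show "Y = Z"
      using BV.T.M.minus_equality[of Y "\<ominus>\<^bsub>BV.T\<^esub> Z"] YZ by simp
  qed
  show "emb ` carrier BV.T = Kset P \<times> Kset Q"
  proof (intro equalityI subsetI)
    fix z
    assume "z \<in> emb ` carrier BV.T"
    then obtain n m where "m \<in> carrier N" "z = emb (BV.pt (tn n) m)"
      using BV_cases by blast
    then have "z = tn n \<otimes>\<^bsub>ring_QR\<^esub> restr_axes (\<iota> m)" "restr_axes (\<iota> m) \<in> Kset P \<times> Kset Q"
      using emb_props(2) restr_axes_A[OF iota_mem kinds_per2[OF kP] kinds_per2[OF kQ]] tn_L by auto
    then show "z \<in> Kset P \<times> Kset Q"
      using tn_L[of n] Kset_closed(4)[OF kinds_per2[OF kP]] Kset_closed(4)[OF kinds_per2[OF kQ]]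
      by (auto simp: field_L_Kset)
  next
    fix z :: "'k fls \<times> 'k fls"
    assume "z \<in> Kset P \<times> Kset Q"
    then have z: "fst z \<in> Kset P" "snd z \<in> Kset Q"
      by auto
    obtain n1 where n1: "\<And>n. n \<ge> n1 \<Longrightarrow> \<exists>\<gamma>\<in>supp_on P. fps_nth \<gamma> 0 = 0 \<and> fst z = fls_shift (2 * int n) (fps_to_fls \<gamma>)"
      using Kset_cases[OF kinds_per2[OF kP] z(1)] by auto
    obtain n2 where n2: "\<And>n. n \<ge> n2 \<Longrightarrow> \<exists>\<gamma>\<in>supp_on Q. fps_nth \<gamma> 0 = 0 \<and> snd z = fls_shift (2 * int n) (fps_to_fls \<gamma>)"
      using Kset_cases[OF kinds_per2[OF kQ] z(2)] by auto
    obtain \<gamma> \<delta> where \<gamma>: "\<gamma> \<in> supp_on P" "fps_nth \<gamma> 0 = 0" "fst z = fls_shift (2 * int (n1 + n2)) (fps_to_fls \<gamma>)"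
      and \<delta>: "\<delta> \<in> supp_on Q" "fps_nth \<delta> 0 = 0" "snd z = fls_shift (2 * int (n1 + n2)) (fps_to_fls \<delta>)"
      using n1[of "n1 + n2"] n2[of "n1 + n2"] by auto
    have "cx \<gamma> + cy \<delta> \<in> Mset P Q"
      using \<gamma> \<delta> by (simp add: Mset_def)
    then obtain m where m: "m \<in> carrier N" "\<iota> m = cx \<gamma> + cy \<delta>"
      by (rule iota_surj)
    have "emb (BV.pt (tn (n1 + n2)) m) = z"
      unfolding emb_props(2)[OF tn_L m(1)] m(2)
      by (simp only: restr_axes_eq tn_def ring_QR_simps prod_eq_iff fst_conv snd_conv \<gamma>(3) \<delta>(3)) (simp add: \<gamma>(2) \<delta>(2) fls_shifted_times_simps)
    then show "z \<in> emb ` carrier BV.T"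
      using BV.pt_closed[of "tn (n1 + n2)" m] tn_L m(1) by (metis imageI ring_QA_simps(1))
  qed
qed

text \<open>The isomorphism of reflexive hulls is evaluation at \<open>\<Phi> 1\<close>, and that of
  vector spaces is \<open>emb\<close> followed by the inverse of the matrix map \<open>E\<close>.
  Both routes around the square then describe restriction of \<iota> to the axes.\<close>

theorem has_gluing_datum:
  fixes \<Theta>1 \<Theta>2 :: "'k fls mat"
  assumes d1: "datum P \<Theta>1" and d2: "datum Q \<Theta>2"
  shows "has_gluing_datum N \<Theta>1 \<Theta>2"
proof -
  let ?p = "dim_col \<Theta>1" and ?q = "dim_col \<Theta>2"
  define LS where "LS = (L_space ?p ?q :: ('k fls \<times> 'k fls, 'k fls vec \<times> 'k fls vec) module)"
  define F where "F = module_vec TYPE('k fps2) 1"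
  have LS: "module ring_QA LS"
    unfolding LS_def by (rule module_L_space)
  have F: "module ring_R F"
    unfolding F_def by (rule module_R1)
  interpret LS: module ring_QA LS
    by (rule LS)
  interpret QH: tensor ring_R ring_QR restr_axes HH
    by (intro tensor.intro module_HH cring_ring_QR ring_homs)
  interpret QF: tensor ring_R ring_QR restr_axes F
    by (intro tensor.intro F cring_ring_QR ring_homs)
  interpret QV: tensor ring_QA ring_QR "\<lambda>c. c" BV.T
    by (intro tensor.intro BV.module_T cring_ring_QR ring_homs)
  interpret QL: tensor ring_QA ring_QR "\<lambda>c. c" LS
    by (intro tensor.intro LS cring_ring_QR ring_homs)
  have rows: "dim_row \<Theta>1 = 1" "dim_row \<Theta>2 = 1"
    using d1 d2 by (simp_all add: datum_def)
  define E where "E v = (vec_index (\<Theta>1 *\<^sub>v fst v) 0, vec_index (\<Theta>2 *\<^sub>v snd v) 0)" for v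
  have E_bij: "bij_betw E (carrier LS) (Kset P \<times> Kset Q)"
  proof -
    have "E = map_prod (\<lambda>v. vec_index (\<Theta>1 *\<^sub>v v) 0) (\<lambda>v. vec_index (\<Theta>2 *\<^sub>v v) 0)"
      by (auto simp: E_def fun_eq_iff)
    then show ?thesis
      unfolding LS_def L_space_simps
      by (simp only:) (rule bij_betw_map_prod[OF conjunct2[OF d1[unfolded datum_def]] conjunct2[OF d2[unfolded datum_def]]])
  qed
  have E_add: "E (v \<oplus>\<^bsub>LS\<^esub> w) = E v \<oplus>\<^bsub>ring_QR\<^esub> E w" if "v \<in> carrier LS" "w \<in> carrier LS" for v w
  proof -
    have "\<Theta>1 *\<^sub>v (fst v + fst w) = \<Theta>1 *\<^sub>v fst v + \<Theta>1 *\<^sub>v fst w" "\<Theta>2 *\<^sub>v (snd v + snd w) = \<Theta>2 *\<^sub>v snd v + \<Theta>2 *\<^sub>v snd w"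
      using that by (auto simp: LS_def intro!: mult_add_distrib_mat_vec)
    then show ?thesis
      using rows by (simp add: E_def LS_def)
  qed
  have E_smult: "E (c \<odot>\<^bsub>LS\<^esub> v) = c \<otimes>\<^bsub>ring_QR\<^esub> E v" if "v \<in> carrier LS" for c v
  proof -
    have "\<Theta>1 *\<^sub>v (fst c \<cdot>\<^sub>v fst v) = fst c \<cdot>\<^sub>v (\<Theta>1 *\<^sub>v fst v)" "\<Theta>2 *\<^sub>v (snd c \<cdot>\<^sub>v snd v) = snd c \<cdot>\<^sub>v (\<Theta>2 *\<^sub>v snd v)"
      using that by (auto simp: LS_def intro!: mult_mat_vec)
    then show ?thesis
      using rows by (simp add: E_def LS_def)
  qed
  define \<psi> where "\<psi> Z = the_inv_into (carrier LS) E (emb Z)" for Z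
  have \<psi>: "\<psi> Z \<in> carrier LS" "E (\<psi> Z) = emb Z" if "Z \<in> carrier BV.T" for Z
  proof -
    have "emb Z \<in> E ` carrier LS"
      using E_bij emb_bij that by (auto simp: bij_betw_def)
    then show "\<psi> Z \<in> carrier LS" "E (\<psi> Z) = emb Z"
      using E_bij unfolding \<psi>_def bij_betw_def by (auto intro: the_inv_into_into f_the_inv_into_f)
  qed
  have E_inj: "v = w" if "v \<in> carrier LS" "w \<in> carrier LS" "E v = E w" for v w
    using E_bij that by (auto simp: bij_betw_def inj_on_def)
  have emb_lin: "emb (Y \<oplus>\<^bsub>BV.T\<^esub> Z) = emb Y \<oplus>\<^bsub>ring_QR\<^esub> emb Z" "c \<in> field_L \<times> field_L \<Longrightarrow> emb (c \<odot>\<^bsub>BV.T\<^esub> Y) = c \<otimes>\<^bsub>ring_QR\<^esub> emb Y"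
    if "Y \<in> carrier BV.T" "Z \<in> carrier BV.T" for Y Z c
    using emb_props(1) that by (auto simp: module_hom_def)
  have \<psi>_hom: "\<psi> \<in> module_hom ring_QA BV.T LS"
    unfolding module_hom_def
  proof (intro CollectI conjI ballI)
    show "\<psi> \<in> carrier BV.T \<rightarrow> carrier LS"
      using \<psi>(1) by blast
    show "\<psi> (Y \<oplus>\<^bsub>BV.T\<^esub> Z) = \<psi> Y \<oplus>\<^bsub>LS\<^esub> \<psi> Z" if "Y \<in> carrier BV.T" "Z \<in> carrier BV.T" for Y Z
      by (rule E_inj[OF \<psi>(1)[OF BV.T.M.a_closed[OF that]] LS.M.a_closed[OF \<psi>(1)[OF that(1)] \<psi>(1)[OF that(2)]]])
        (simp only: \<psi>(2)[OF BV.T.M.a_closed[OF that]] E_add[OF \<psi>(1)[OF that(1)] \<psi>(1)[OF that(2)]]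
          \<psi>(2)[OF that(1)] \<psi>(2)[OF that(2)] emb_lin(1)[OF that])
    show "\<psi> (c \<odot>\<^bsub>BV.T\<^esub> Y) = c \<odot>\<^bsub>LS\<^esub> \<psi> Y" if "c \<in> carrier ring_QA" "Y \<in> carrier BV.T" for c Y
      by (rule E_inj[OF \<psi>(1)[OF BV.T.smult_closed[OF that]] LS.smult_closed[OF that(1) \<psi>(1)[OF that(2)]]])
        (use that in \<open>simp only: \<psi>(2)[OF BV.T.smult_closed[OF that]] E_smult[OF \<psi>(1)[OF that(2)]]
          \<psi>(2)[OF that(2)] emb_lin(2)[OF that(2) that(2)] ring_QA_simps(1)\<close>)
  qed
  have \<psi>_iso: "\<psi> \<in> module_iso ring_QA BV.T LS"
  proof -
    have "bij_betw (the_inv_into (carrier LS) E \<circ> emb) (carrier BV.T) (carrier LS)"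
      by (rule bij_betw_trans[OF emb_bij bij_betw_the_inv_into[OF E_bij]])
    then have "bij_betw \<psi> (carrier BV.T) (carrier LS)"
      by (rule iffD1[OF bij_betw_cong, rotated]) (simp add: \<psi>_def)
    then show ?thesis
      using \<psi>_hom by (simp add: module_iso_def)
  qed
  define \<phi> where "\<phi> = (\<lambda>\<delta> :: (('k fps2 \<times> 'm \<Rightarrow>\<^sub>0 int) set \<Rightarrow> 'k fps2) \<Rightarrow> 'k fps2. vec 1 (\<lambda>_. \<delta> (\<Phi> 1)))"
  have \<phi>_iso: "\<phi> \<in> module_iso ring_R HH F"
    unfolding \<phi>_def F_def by (rule HH_iso)
  then have \<phi>_hom: "\<phi> \<in> module_hom ring_R HH F"
    by (simp add: module_iso_def)
  define e0 where "e0 = (unit_vec 1 0 :: 'k fps2 vec)"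
  have e0: "e0 \<in> carrier F"
    by (simp add: e0_def F_def module_vec_simps)
  have \<phi>_ev: "\<phi> (ev m) = \<iota> m \<odot>\<^bsub>F\<^esub> e0" if "m \<in> carrier N" for m
    using ev_props[OF that] by (auto simp: \<phi>_def F_def e0_def module_vec_simps intro!: eq_vecI)
  define \<gamma>0 where "\<gamma>0 m = QH.pt (1, 1) (ev m)" for m
  define \<gamma> where "\<gamma> = base_change_adjoint ring_A ring_QA restr_axes N QH.T \<gamma>0"
  define \<theta> where "\<theta> = base_change_adjoint ring_QA ring_QR (\<lambda>c. c) BV.T QH.T \<gamma>"
  have triple: "triple_of_module N = (HH, BV.T, \<theta>)"
    by (simp add: triple_of_module_def Let_def \<theta>_def \<gamma>_def \<gamma>0_def[abs_def])
  have \<gamma>0: "\<gamma>0 m \<in> carrier QH.T" "\<gamma>0 (m \<oplus>\<^bsub>N\<^esub> n) = \<gamma>0 m \<oplus>\<^bsub>QH.T\<^esub> \<gamma>0 n"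
    "r \<in> carrier ring_A \<Longrightarrow> \<gamma>0 (r \<odot>\<^bsub>N\<^esub> m) = restr_axes r \<odot>\<^bsub>QH.T\<^esub> \<gamma>0 m"
    if "m \<in> carrier N" "n \<in> carrier N" for m n r
  proof -
    note h = reflexive_hull_map_hom[OF module_N]
    show "\<gamma>0 m \<in> carrier QH.T"
      unfolding \<gamma>0_def by (rule QH.pt_closed) (use h(2)[OF that(1)] in simp_all)
    show "\<gamma>0 (m \<oplus>\<^bsub>N\<^esub> n) = \<gamma>0 m \<oplus>\<^bsub>QH.T\<^esub> \<gamma>0 n"
      unfolding \<gamma>0_def h(3)[OF that] by (rule QH.pt_add_right) (use h(2)[OF that(1)] h(2)[OF that(2)] in simp_all)
    show "\<gamma>0 (r \<odot>\<^bsub>N\<^esub> m) = restr_axes r \<odot>\<^bsub>QH.T\<^esub> \<gamma>0 m" if "r \<in> carrier ring_A"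
      using h(4)[of r m] that \<open>m \<in> carrier N\<close> QH.pt_balanced[of "(1, 1)" r "ev m"] QH.smult_pt[of "restr_axes r" "(1, 1)" "ev m"]
        h(2)[OF \<open>m \<in> carrier N\<close>] by (simp add: \<gamma>0_def)
  qed
  note \<gamma>_adj = BV.adjoint[OF module_QA_of_QR[OF QH.module_T], of \<gamma>0, OF \<gamma>0, folded \<gamma>_def]
  have \<gamma>_lin: "\<gamma> Y \<in> carrier QH.T" "\<gamma> (Y \<oplus>\<^bsub>BV.T\<^esub> Z) = \<gamma> Y \<oplus>\<^bsub>QH.T\<^esub> \<gamma> Z"
    "c \<in> carrier ring_QA \<Longrightarrow> \<gamma> (c \<odot>\<^bsub>BV.T\<^esub> Y) = c \<odot>\<^bsub>QH.T\<^esub> \<gamma> Y"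
    if "Y \<in> carrier BV.T" "Z \<in> carrier BV.T" for Y Z c
    using \<gamma>_adj(1) that unfolding module_hom_def by blast+
  note \<theta>_adj = QV.adjoint[OF QH.module_T, of \<gamma>, OF \<gamma>_lin, folded \<theta>_def]
  define g where "g = (\<lambda>(v1, v2). \<Oplus>\<^bsub>QF.T\<^esub>i\<in>{..<1::nat}. QF.pt (vec_index (\<Theta>1 *\<^sub>v v1) i, vec_index (\<Theta>2 *\<^sub>v v2) i) (unit_vec 1 i))"
  define \<theta>' where "\<theta>' = base_change_adjoint ring_QA ring_QR (\<lambda>c. c) LS QF.T g"
  have triple': "matrix_triple \<Theta>1 \<Theta>2 = (F, LS, \<theta>')"
    unfolding matrix_triple_def Let_def rows \<theta>'_def g_def LS_def F_def ..
  have g_eq: "g v = QF.pt (E v) e0" for v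
  proof -
    have "QF.pt (E v) e0 \<in> carrier QF.T"
      by (rule QF.pt_closed) (use e0 in simp_all)
    then show ?thesis
      by (simp add: g_def E_def e0_def case_prod_beta lessThan_Suc)
  qed
  have g: "g v \<in> carrier QF.T" "g (v \<oplus>\<^bsub>LS\<^esub> w) = g v \<oplus>\<^bsub>QF.T\<^esub> g w"
    "c \<in> carrier ring_QA \<Longrightarrow> g (c \<odot>\<^bsub>LS\<^esub> v) = c \<odot>\<^bsub>QF.T\<^esub> g v"
    if "v \<in> carrier LS" "w \<in> carrier LS" for v w c
  proof -
    show "g v \<in> carrier QF.T"
      unfolding g_eq by (rule QF.pt_closed) (use e0 in simp_all)
    show "g (v \<oplus>\<^bsub>LS\<^esub> w) = g v \<oplus>\<^bsub>QF.T\<^esub> g w"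
      unfolding g_eq E_add[OF that] by (rule QF.pt_add_left) (use e0 in simp_all)
    show "g (c \<odot>\<^bsub>LS\<^esub> v) = c \<odot>\<^bsub>QF.T\<^esub> g v"
      unfolding g_eq E_smult[OF that(1)] by (rule QF.smult_pt[symmetric]) (use e0 in simp_all)
  qed
  note \<theta>'_adj = QL.adjoint[OF QF.module_T, of g, OF g, folded \<theta>'_def]
  note b\<phi> = base_change_map_props[OF QH.tensor_axioms QF.tensor_axioms \<phi>_hom]
  note b\<psi> = base_change_map_props[OF QV.tensor_axioms QL.tensor_axioms \<psi>_hom]
  let ?b\<phi> = "base_change_map ring_R ring_QR restr_axes HH F \<phi>"
  let ?b\<psi> = "base_change_map ring_QA ring_QR (\<lambda>c. c) BV.T LS \<psi>"
  have hom_simp: "f Y \<in> carrier W" "f (Y \<oplus>\<^bsub>U\<^esub> Z) = f Y \<oplus>\<^bsub>W\<^esub> f Z" "c \<in> carrier ring_QR \<Longrightarrow> f (c \<odot>\<^bsub>U\<^esub> Y) = c \<odot>\<^bsub>W\<^esub> f Y"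
    if "f \<in> module_hom ring_QR U W" "Y \<in> carrier U" "Z \<in> carrier U"
    for f and U :: "('k fls \<times> 'k fls, 'u) module" and W :: "('k fls \<times> 'k fls, 'w) module" and Y Z c
    using that unfolding module_hom_def by blast+
  have comp_hom: "(\<lambda>Z. g' (f Z)) \<in> module_hom ring_QR U W"
    if "f \<in> module_hom ring_QR U V" "g' \<in> module_hom ring_QR V W"
    for f g' and U :: "('k fls \<times> 'k fls, 'u) module" and V :: "('k fls \<times> 'k fls, 'v) module" and W :: "('k fls \<times> 'k fls, 'w) module"
    using that unfolding module_hom_def by (auto simp: Pi_iff)
  \<comment> \<open>On a pure tensor of d and m, both sides are the tensor of d times the
    restriction of \<open>\<iota> m\<close> with the basis vector \<open>e0\<close>.\<close>
  have pure: "?b\<phi> (\<gamma> Y) = g (\<psi> Y)" if "Y \<in> carrier BV.T" for Y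
    using that
  proof (induction rule: BV.T_induct)
    case (pure d m)
    have m: "ev m \<in> carrier HH"
      using ev_props[OF pure(2)] by simp
    have d: "d \<in> carrier ring_QR"
      by simp
    have "?b\<phi> (\<gamma> (BV.pt d m)) = ?b\<phi> (d \<odot>\<^bsub>QH.T\<^esub> \<gamma>0 m)"
      using \<gamma>_adj(3)[OF _ _ _ _ _ _ _ pure] by simp
    also have "\<gamma>0 m = QH.pt (1, 1) (ev m)"
      by (simp add: \<gamma>0_def)
    also have "d \<odot>\<^bsub>QH.T\<^esub> QH.pt (1, 1) (ev m) = QH.pt d (ev m)"
      using QH.smult_pt[OF d _ m, of "(1, 1)"] by simp
    also have "?b\<phi> (QH.pt d (ev m)) = QF.pt d (\<iota> m \<odot>\<^bsub>F\<^esub> e0)"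
      unfolding b\<phi>(2)[OF d m] \<phi>_ev[OF pure(2)] ..
    also have "\<dots> = QF.pt (d \<otimes>\<^bsub>ring_QR\<^esub> restr_axes (\<iota> m)) e0"
      by (rule QF.pt_balanced[OF d _ e0]) simp
    also have "\<dots> = g (\<psi> (BV.pt d m))"
      unfolding g_eq \<psi>(2)[OF BV.pt_closed[OF pure]] using emb_props(2)[of d m] pure by simp
    finally show ?case .
  next
    case (add Y Z)
    have "?b\<phi> (\<gamma> (Y \<oplus>\<^bsub>BV.T\<^esub> Z)) = ?b\<phi> (\<gamma> Y) \<oplus>\<^bsub>QF.T\<^esub> ?b\<phi> (\<gamma> Z)"
      unfolding \<gamma>_lin(2)[OF add(1,2)] by (rule hom_simp(2)[OF b\<phi>(1) \<gamma>_lin(1)[OF add(1,1)] \<gamma>_lin(1)[OF add(2,2)]])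
    also have "\<dots> = g (\<psi> Y) \<oplus>\<^bsub>QF.T\<^esub> g (\<psi> Z)"
      using add by simp
    also have "\<dots> = g (\<psi> Y \<oplus>\<^bsub>LS\<^esub> \<psi> Z)"
      by (rule g(2)[symmetric]) (use \<psi> add in simp_all)
    also have "\<psi> Y \<oplus>\<^bsub>LS\<^esub> \<psi> Z = \<psi> (Y \<oplus>\<^bsub>BV.T\<^esub> Z)"
      using \<psi>_hom add(1,2) by (simp add: module_hom_def)
    finally show ?case .
  qed
  have "?b\<phi> (\<theta> Z) = \<theta>' (?b\<psi> Z)" if Z: "Z \<in> carrier QV.T" for Z
  proof (rule QV.hom_unique[OF QF.module_T _ _ _ Z])
    show "(\<lambda>Z. ?b\<phi> (\<theta> Z)) \<in> module_hom ring_QR QV.T QF.T"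
      by (rule comp_hom[OF \<theta>_adj(1) b\<phi>(1)])
    show "(\<lambda>Z. \<theta>' (?b\<psi> Z)) \<in> module_hom ring_QR QV.T QF.T"
      by (rule comp_hom[OF b\<psi>(1) \<theta>'_adj(1)])
    fix c :: "'k fls \<times> 'k fls" and Y
    assume c: "c \<in> carrier ring_QR" and Y: "Y \<in> carrier BV.T"
    have "?b\<phi> (\<theta> (QV.pt c Y)) = ?b\<phi> (c \<odot>\<^bsub>QH.T\<^esub> \<gamma> Y)"
      by (subst \<theta>_adj(3)[OF _ _ _ _ _ _ _ c Y]) simp_all
    also have "\<dots> = c \<odot>\<^bsub>QF.T\<^esub> ?b\<phi> (\<gamma> Y)"
      by (rule hom_simp(3)[OF b\<phi>(1) \<gamma>_lin(1)[OF Y Y] \<gamma>_lin(1)[OF Y Y] c])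
    also have "\<dots> = c \<odot>\<^bsub>QF.T\<^esub> g (\<psi> Y)"
      unfolding pure[OF Y] ..
    also have "\<dots> = \<theta>' (QL.pt c (\<psi> Y))"
      by (subst \<theta>'_adj(3)[OF _ _ _ _ _ _ _ c \<psi>(1)[OF Y]]) simp_all
    also have "\<dots> = \<theta>' (?b\<psi> (QV.pt c Y))"
      unfolding b\<psi>(2)[OF c Y] ..
    finally show "?b\<phi> (\<theta> (QV.pt c Y)) = \<theta>' (?b\<psi> (QV.pt c Y))" .
  qed
  then show ?thesis
    unfolding has_gluing_datum_def triple_isomorphic_def triple triple' prod.case
    using \<phi>_iso \<psi>_iso by blast
qed

end

section \<open>The nine ideals\<close>

text \<open>The elements f with w f in the generated ideal form an A-submodule of R. Since a, b, u
  w, v w and the square of w are w times x, y, their squares and w, this submodule contains the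
  generators from \<open>Mset_subset_submodule\<close>.\<close>

lemma Idl_eq_w_Mset:
  fixes gens :: "'k::field fps2 set"
  assumes P: "P \<in> kinds" and Q: "Q \<in> kinds" and sub: "gens \<subseteq> (*) el_w ` Mset P Q"
    and one: "P 0 \<Longrightarrow> Q 0 \<Longrightarrow> el_w \<in> gens" and xG: "P 1 \<Longrightarrow> el_a \<in> gens" and yG: "Q 1 \<Longrightarrow> el_b \<in> gens"
    and x2G: "P 2 \<Longrightarrow> \<not> Q 0 \<Longrightarrow> el_u * el_w \<in> gens" and y2G: "Q 2 \<Longrightarrow> \<not> P 0 \<Longrightarrow> el_v * el_w \<in> gens"
    and wG: "\<not> (P 0 \<and> Q 0) \<Longrightarrow> el_w ^ 2 \<in> gens"
  shows "Idl\<^bsub>ring_A\<^esub> gens = (*) el_w ` Mset P Q \<and> ideal ((*) (el_w :: 'k fps2) ` Mset P Q) ring_A"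
proof -
  interpret cring "ring_A :: 'k fps2 ring"
    by (rule cring_ring_A)
  have id: "ideal ((*) (el_w :: 'k fps2) ` Mset P Q) ring_A"
  proof (rule ideal_ring_AI)
    show "f + g \<in> (*) el_w ` Mset P Q" if "f \<in> (*) el_w ` Mset P Q" "g \<in> (*) el_w ` Mset P Q" for f g :: "'k fps2"
      using that by (auto simp flip: distrib_left intro!: imageI Mset_add)
    show "c * f \<in> (*) el_w ` Mset P Q" if "c \<in> Mset even even" "f \<in> (*) el_w ` Mset P Q" for c f
      using that(2) Mset_mult[OF kinds_per2[OF P] kinds_per2[OF Q] that(1)] by (auto simp: mult.left_commute[of c])
  qed (use Mset_0[of P Q] in auto)
  have gA: "gens \<subseteq> carrier ring_A"
    using sub by auto
  interpret I: ideal "Idl\<^bsub>ring_A\<^esub> gens" "ring_A :: 'k fps2 ring"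
    by (rule genideal_ideal[OF gA])
  have gI: "f \<in> Idl\<^bsub>ring_A\<^esub> gens" if "f \<in> gens" for f
    using genideal_self[OF gA] that by blast
  define G where "G = {f. el_w * f \<in> Idl\<^bsub>ring_A\<^esub> gens}"
  have memG: "f \<in> G \<longleftrightarrow> el_w * f \<in> Idl\<^bsub>ring_A\<^esub> gens" for f
    by (simp add: G_def)
  have G: "A_submodule G"
    unfolding A_submodule_def
  proof (intro conjI ballI)
    show "0 \<in> G"
      using I.zero_closed by (simp add: memG)
    show "f + g \<in> G" if "f \<in> G" "g \<in> G" for f g
      using I.a_closed[of "el_w * f" "el_w * g"] that by (simp add: memG distrib_left)
    show "c * f \<in> G" if "c \<in> Mset even even" "f \<in> G" for c f
      using I.I_l_closed[of "el_w * f" c] that by (simp add: memG mult.left_commute[of c])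
  qed
  have "Mset P Q \<subseteq> G"
  proof (rule Mset_subset_submodule[OF P Q G])
    show "1 \<in> G" if "P 0" "Q 0"
      using gI[OF one[OF that]] by (simp add: G_def)
    show "el_x \<in> G" if "P 1"
      using gI[OF xG[OF that]] by (simp add: G_def el_a_def el_w_def power2_eq_square mult_ac)
    show "el_y \<in> G" if "Q 1"
      using gI[OF yG[OF that]] by (simp add: G_def el_b_def el_w_def power2_eq_square mult_ac)
    show "el_x ^ 2 \<in> G" if "P 2" "\<not> Q 0"
      using gI[OF x2G[OF that]] by (simp add: G_def el_u_def mult.commute)
    show "el_y ^ 2 \<in> G" if "Q 2" "\<not> P 0"
      using gI[OF y2G[OF that]] by (simp add: G_def el_v_def mult.commute)
    show "el_w \<in> G" if "\<not> (P 0 \<and> Q 0)"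
      using gI[OF wG[OF that]] by (simp add: G_def power2_eq_square)
  qed
  then have "(*) el_w ` Mset P Q \<subseteq> Idl\<^bsub>ring_A\<^esub> gens"
    by (auto simp: G_def)
  moreover have "Idl\<^bsub>ring_A\<^esub> gens \<subseteq> (*) el_w ` Mset P Q"
    by (rule genideal_minimal[OF id sub])
  ultimately have "Idl\<^bsub>ring_A\<^esub> gens = (*) el_w ` Mset P Q"
    by (rule equalityI[rotated])
  then show ?thesis
    using id by (rule conjI)
qed

text \<open>For c in the conductor, both c and c x are even on the x-axis, which forces the
  restriction of c to vanish; likewise with y on the other axis.\<close>

lemma conductor_A_eq: "conductor_A = (*) el_w ` (UNIV :: 'k::field fps2 set)"
proof (intro equalityI subsetI)
  fix c :: "'k fps2"
  assume "c \<in> conductor_A"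
  then have c: "c \<in> Mset even even" "c * el_x \<in> Mset even even" "c * el_y \<in> Mset even even"
    by (auto simp: conductor_A_def)
  have "rx c = 0"
  proof (rule fps_ext)
    fix i
    have "rx c \<in> supp_on even" "rx c * fps_X \<in> supp_on even"
      using c by (simp_all add: Mset_def)
    then have "fps_nth (rx c) i = 0 \<or> even i" "fps_nth (rx c * fps_X) (Suc i) = 0 \<or> even (Suc i)"
      unfolding supp_on_def by blast+
    then show "fps_nth (rx c) i = fps_nth 0 i"
      by auto
  qed
  moreover have "ry c = 0"
  proof (rule fps_ext)
    fix i
    have "ry c \<in> supp_on even" "ry c * fps_X \<in> supp_on even"
      using c by (simp_all add: Mset_def)
    then have "fps_nth (ry c) i = 0 \<or> even i" "fps_nth (ry c * fps_X) (Suc i) = 0 \<or> even (Suc i)"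
      unfolding supp_on_def by blast+
    then show "fps_nth (ry c) i = fps_nth 0 i"
      by auto
  qed
  ultimately show "c \<in> (*) el_w ` UNIV"
    unfolding image_def using axes_zero_iff[of c] by (auto simp: dvd_def)
qed (auto simp: conductor_A_def mult.assoc)

lemma fractional_scaled:
  fixes c :: "'k::field fps2"
  assumes P: "P \<in> kinds" and Q: "Q \<in> kinds" and c: "c \<noteq> 0"
  shows "(*) c \<in> module_iso ring_A (ideal_module ring_A (Mset P Q)) (ideal_module ring_A ((*) c ` Mset P Q))"
    "fractional (ideal_module ring_A ((*) c ` Mset P Q)) P Q (the_inv_into (Mset P Q) ((*) c))"
proof -
  let ?j = "the_inv_into (Mset P Q) ((*) c)"
  have inj: "inj_on ((*) c) (Mset P Q)"
    using c by (auto simp: inj_on_def)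
  note cl = A_submoduleD[OF A_submodule_Mset[OF kinds_per2[OF P] kinds_per2[OF Q]]]
  have sub: "A_submodule ((*) c ` Mset P Q)"
    unfolding A_submodule_def
  proof (intro conjI ballI)
    show "0 \<in> (*) c ` Mset P Q"
      using cl(1) by force
    fix f
    assume f: "f \<in> (*) c ` Mset P Q"
    show "f + g \<in> (*) c ` Mset P Q" if "g \<in> (*) c ` Mset P Q" for g
      using f that by (auto simp flip: distrib_left intro!: imageI cl(2))
    show "d * f \<in> (*) c ` Mset P Q" if "d \<in> Mset even even" for d
      using f cl(3)[OF that] by (auto simp: mult.left_commute[of d])
  qed
  show "(*) c \<in> module_iso ring_A (ideal_module ring_A (Mset P Q)) (ideal_module ring_A ((*) c ` Mset P Q))"
    unfolding module_iso_def module_hom_def using inj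
    by (auto simp: distrib_left mult.left_commute bij_betw_def)
  have j: "?j (c * f) = f" if "f \<in> Mset P Q" for f
    by (rule the_inv_into_f_f[OF inj that])
  have "?j \<in> module_iso ring_A (ideal_module ring_A ((*) c ` Mset P Q)) (ideal_module ring_A (Mset P Q))"
    unfolding module_iso_def module_hom_def mem_Collect_eq
  proof (intro conjI ballI)
    show "bij_betw ?j (carrier (ideal_module ring_A ((*) c ` Mset P Q))) (carrier (ideal_module ring_A (Mset P Q)))"
      using bij_betw_the_inv_into[of "(*) c" "Mset P Q" "(*) c ` Mset P Q"] inj by (simp add: bij_betw_def)
    show "?j \<in> carrier (ideal_module ring_A ((*) c ` Mset P Q)) \<rightarrow> carrier (ideal_module ring_A (Mset P Q))"
      using j by auto
    fix f
    assume "f \<in> carrier (ideal_module ring_A ((*) c ` Mset P Q))"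
    then obtain f' where f: "f' \<in> Mset P Q" "f = c * f'"
      by auto
    show "?j (f \<oplus>\<^bsub>ideal_module ring_A ((*) c ` Mset P Q)\<^esub> g) = ?j f \<oplus>\<^bsub>ideal_module ring_A (Mset P Q)\<^esub> ?j g"
      if g0: "g \<in> carrier (ideal_module ring_A ((*) c ` Mset P Q))" for g
    proof -
      obtain g' where g: "g' \<in> Mset P Q" "g = c * g'"
        using g0 by auto
      show ?thesis
        using j[OF cl(2)[OF f(1) g(1)]] j[OF f(1)] j[OF g(1)] by (simp add: f g distrib_left)
    qed
    show "?j (d \<odot>\<^bsub>ideal_module ring_A ((*) c ` Mset P Q)\<^esub> f) = d \<odot>\<^bsub>ideal_module ring_A (Mset P Q)\<^esub> ?j f"
      if "d \<in> carrier ring_A" for d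
      using j[OF cl(3)[of d f', OF _ f(1)]] j[OF f(1)] that by (simp add: f mult.left_commute)
  qed
  then show "fractional (ideal_module ring_A ((*) c ` Mset P Q)) P Q ?j"
    by (intro fractional.intro module_ideal_module sub P Q)
qed

text \<open>The factor is 1 for A itself and \<open>el_w\<close> for the other eight ideals; it
  moves the fractional ideal into A without changing its isomorphism class.\<close>

definition list_entry :: "(nat \<Rightarrow> bool) \<times> (nat \<Rightarrow> bool) \<Rightarrow> 'k::field fls mat \<times> 'k fls mat \<times> 'k fps2 set \<Rightarrow> bool" where
  "list_entry = (\<lambda>(P, Q) (\<Theta>1, \<Theta>2, J). P \<in> kinds \<and> Q \<in> kinds \<and> datum P \<Theta>1 \<and> datum Q \<Theta>2 \<and> ideal J ring_A \<and>
     (\<exists>c\<in>{1, el_w}. J = (*) c ` Mset P Q))"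

definition upper_shapes :: "((nat \<Rightarrow> bool) \<times> (nat \<Rightarrow> bool)) list" where
  "upper_shapes = [(even, even), (odd, odd), (odd, even), (even, odd)]"

definition lower_shapes :: "((nat \<Rightarrow> bool) \<times> (nat \<Rightarrow> bool)) list" where
  "lower_shapes = [(\<lambda>_. True, \<lambda>_. True), (even, \<lambda>_. True), (\<lambda>_. True, even), (odd, \<lambda>_. True), (\<lambda>_. True, odd)]"

lemma kinds_mem [simp]: "even \<in> kinds" "odd \<in> kinds" "(\<lambda>_. True) \<in> kinds"
  by (auto simp: kinds_def)

lemma kinds_distinct: "even \<noteq> (odd :: nat \<Rightarrow> bool)" "even \<noteq> (\<lambda>_ :: nat. True)" "odd \<noteq> (\<lambda>_ :: nat. True)"
  by (auto dest: fun_cong[of _ _ 0] fun_cong[of _ _ 1])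

lemma w_gens:
  shows
  "(el_w :: 'k::field fps2) \<in> (*) el_w ` Mset P Q \<longleftrightarrow> P 0 \<and> Q 0" "(el_a :: 'k::field fps2) \<in> (*) el_w ` Mset P Q \<longleftrightarrow> P 1" "(el_b :: 'k::field fps2) \<in> (*) el_w ` Mset P Q \<longleftrightarrow> Q 1"
  "(el_u :: 'k::field fps2) * el_w \<in> (*) el_w ` Mset P Q \<longleftrightarrow> P 2" "(el_v :: 'k::field fps2) * el_w \<in> (*) el_w ` Mset P Q \<longleftrightarrow> Q 2" "(el_w :: 'k::field fps2) ^ 2 \<in> (*) el_w ` Mset P Q"
proof -
  have w: "el_w * f \<in> (*) el_w ` Mset P Q \<longleftrightarrow> f \<in> Mset P Q" for f :: "'k fps2"
    by auto
  have one: "(1 :: 'k fps) \<in> supp_on R \<longleftrightarrow> R 0" for R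
    by (auto simp: supp_on_def)
  have eqs: "(el_a :: 'k fps2) = el_w * el_x" "(el_b :: 'k fps2) = el_w * el_y" "(el_u :: 'k fps2) * el_w = el_w * el_x ^ 2"
    "(el_v :: 'k fps2) * el_w = el_w * el_y ^ 2" "(el_w :: 'k fps2) ^ 2 = el_w * el_w"
    by (simp_all add: el_a_def el_b_def el_w_def el_u_def el_v_def power2_eq_square mult_ac)
  show "(el_a :: 'k fps2) \<in> (*) el_w ` Mset P Q \<longleftrightarrow> P 1" "(el_b :: 'k fps2) \<in> (*) el_w ` Mset P Q \<longleftrightarrow> Q 1"
    "(el_u :: 'k fps2) * el_w \<in> (*) el_w ` Mset P Q \<longleftrightarrow> P 2" "(el_v :: 'k fps2) * el_w \<in> (*) el_w ` Mset P Q \<longleftrightarrow> Q 2"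
    by (simp_all only: eqs(1-4) w) (simp_all add: Mset_def)
  show "(el_w :: 'k fps2) ^ 2 \<in> (*) el_w ` Mset P Q"
    unfolding eqs(5) w using w_mult_Mset[of 1 P Q] by simp
  show "(el_w :: 'k fps2) \<in> (*) el_w ` Mset P Q \<longleftrightarrow> P 0 \<and> Q 0"
    using w[of 1] by (simp add: Mset_def one)
qed

lemma list_entry_w:
  fixes gens :: "'k::field fps2 set"
  assumes "P \<in> kinds" "Q \<in> kinds" "datum P (\<Theta>1 :: 'k fls mat)" "datum Q \<Theta>2"
    and "gens \<subseteq> (*) el_w ` Mset P Q"
    and "P 0 \<Longrightarrow> Q 0 \<Longrightarrow> el_w \<in> gens" "P 1 \<Longrightarrow> el_a \<in> gens" "Q 1 \<Longrightarrow> el_b \<in> gens"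
    and "P 2 \<Longrightarrow> \<not> Q 0 \<Longrightarrow> el_u * el_w \<in> gens" "Q 2 \<Longrightarrow> \<not> P 0 \<Longrightarrow> el_v * el_w \<in> gens"
    and "\<not> (P 0 \<and> Q 0) \<Longrightarrow> el_w ^ 2 \<in> gens"
  shows "list_entry (P, Q) (\<Theta>1, \<Theta>2, Idl\<^bsub>ring_A\<^esub> gens)"
proof -
  have "Idl\<^bsub>ring_A\<^esub> gens = (*) el_w ` Mset P Q \<and> ideal ((*) (el_w :: 'k fps2) ` Mset P Q) ring_A"
    by (rule Idl_eq_w_Mset) (use assms in blast)+
  then show ?thesis
    using assms(1-4) by (auto simp: list_entry_def)
qed

lemma list_entries:
  "list_all2 list_entry upper_shapes (upper_part :: ('k::field fls mat \<times> 'k fls mat \<times> 'k fps2 set) list)"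
  "list_all2 list_entry lower_shapes (lower_part :: ('k fls mat \<times> 'k fls mat \<times> 'k fps2 set) list)"
proof -
  have A: "ideal (Mset even even) (ring_A :: 'k fps2 ring)"
    by (rule ideal_ring_AI) auto
  have entry_A: "list_entry (even, even) (glue_1, glue_1, carrier (ring_A :: 'k fps2 ring))"
    using A datum_1 by (auto simp: list_entry_def)
  show "list_all2 list_entry upper_shapes (upper_part :: ('k fls mat \<times> 'k fls mat \<times> 'k fps2 set) list)"
    unfolding upper_shapes_def upper_part_def list_all2_Cons list_all2_Nil
    by (intro conjI entry_A list_entry_w datum_1 datum_z kinds_mem TrueI) (simp_all add: w_gens)
  have I: "ideal conductor_A (ring_A :: 'k fps2 ring)"
  proof (rule ideal_ring_AI)
    show "conductor_A \<noteq> ({} :: 'k fps2 set)"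
      by (auto simp: conductor_A_eq)
  qed (auto simp: conductor_A_def distrib_right mult.assoc)
  have entry_I: "list_entry (\<lambda>_. True, \<lambda>_. True) (glue_1z, glue_1z, conductor_A :: 'k fps2 set)"
    using I datum_1z by (auto simp: list_entry_def conductor_A_eq)
  show "list_all2 list_entry lower_shapes (lower_part :: ('k fls mat \<times> 'k fls mat \<times> 'k fps2 set) list)"
    unfolding lower_shapes_def lower_part_def list_all2_Cons list_all2_Nil
    by (intro conjI entry_I list_entry_w datum_1 datum_z datum_1z kinds_mem TrueI) (simp_all add: w_gens)
qed

lemma list_entry_fractional:
  assumes "list_entry (P, Q) (\<Theta>1, \<Theta>2, J)"
  obtains \<iota> where "fractional (ideal_module ring_A J) P Q \<iota>"
  using assms fractional_scaled(2)[of P Q 1] fractional_scaled(2)[of P Q el_w] by (auto simp: list_entry_def)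

lemma shapes_complete: "P \<in> kinds \<Longrightarrow> Q \<in> kinds \<Longrightarrow> (P, Q) \<in> set (upper_shapes @ lower_shapes)"
  by (auto simp: kinds_def upper_shapes_def lower_shapes_def)

lemma shapes_distinct: "distinct (upper_shapes @ lower_shapes)"
  using kinds_distinct by (auto simp: upper_shapes_def lower_shapes_def)

text \<open>Multiplication by a unit preserves the order on each axis, so the exponent i must be
  allowed by the target. For positive i, the i-th power of x vanishes on the y-axis, so its
  membership in the shape depends on P alone.\<close>

lemma unit_mult_shape:
  fixes r :: "'k::field fps2"
  assumes r: "cf r 0 0 \<noteq> 0" and sub: "\<And>f. f \<in> Mset P Q \<Longrightarrow> r * f \<in> Mset P' Q'"
  shows "i > 0 \<Longrightarrow> P i \<Longrightarrow> P' i" "i > 0 \<Longrightarrow> Q i \<Longrightarrow> Q' i"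
proof -
  assume i: "i > 0"
  show "P i \<Longrightarrow> P' i"
  proof -
    assume "P i"
    then have "(el_x :: 'k fps2) ^ i \<in> Mset P Q"
      using i by (simp add: Mset_def zero_power)
    then have "rx (r * el_x ^ i) \<in> supp_on P'"
      using sub unfolding Mset_def by blast
    moreover have "fps_nth (rx (r * el_x ^ i)) i \<noteq> 0"
      using r by (simp add: mult.commute[of _ "fps_X ^ i"] fps_X_power_mult_nth del: nth_rx) simp
    ultimately show "P' i"
      unfolding supp_on_def by blast
  qed
  show "Q i \<Longrightarrow> Q' i"
  proof -
    assume "Q i"
    then have "(el_y :: 'k fps2) ^ i \<in> Mset P Q"
      using i by (simp add: Mset_def zero_power)
    then have "ry (r * el_y ^ i) \<in> supp_on Q'"
      using sub unfolding Mset_def by blast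
    moreover have "fps_nth (ry (r * el_y ^ i)) i \<noteq> 0"
      using r by (simp add: mult.commute[of _ "fps_X ^ i"] fps_X_power_mult_nth del: nth_ry) simp
    ultimately show "Q' i"
      unfolding supp_on_def by blast
  qed
qed

text \<open>Exponent 0 is compared through exponent 2, because \<open>unit_mult_shape\<close> covers
  only positive exponents.\<close>

lemma kinds_eqI:
  assumes "P \<in> kinds" "P' \<in> kinds" "\<And>i. i > 0 \<Longrightarrow> P i \<longleftrightarrow> P' i"
  shows "P = P'"
proof
  fix i
  show "P i = P' i"
    using assms(3)[of "i + 2"] kinds_per2[OF assms(1)] kinds_per2[OF assms(2)] by (simp add: per2_def)
qed

text \<open>An isomorphism and its inverse are multiplications by r and r' in R. Following the
  element w shows r r' = 1, so both are units and preserve the shapes in either direction.\<close>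

theorem fractional_shape_unique:
  assumes "fractional N P Q \<iota>" "fractional N' P' Q' \<iota>'"
    and "module_isomorphic ring_A (N :: ('k::field fps2, 'm) module) (N' :: ('k fps2, 'n) module)"
  shows "P = P' \<and> Q = Q'"
proof -
  interpret N: fractional N P Q \<iota>
    by fact
  interpret N': fractional N' P' Q' \<iota>'
    by fact
  obtain \<phi> where \<phi>: "\<phi> \<in> module_hom ring_A N N'" "bij_betw \<phi> (carrier N) (carrier N')"
    using assms(3) by (auto simp: module_isomorphic_def module_iso_def)
  have \<phi>h: "\<phi> m \<in> carrier N'" "\<phi> (m \<oplus>\<^bsub>N\<^esub> n) = \<phi> m \<oplus>\<^bsub>N'\<^esub> \<phi> n" "c \<in> Mset even even \<Longrightarrow> \<phi> (c \<odot>\<^bsub>N\<^esub> m) = c \<odot>\<^bsub>N'\<^esub> \<phi> m"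
    if "m \<in> carrier N" "n \<in> carrier N" for m n c
    using \<phi>(1) that by (auto simp: module_hom_def)
  have "\<exists>r. \<forall>m\<in>carrier N. \<iota>' (\<phi> m) = r * \<iota> m"
    by (rule N.hom_multiplication) (use \<phi>h in simp_all)
  then obtain r where r: "\<And>m. m \<in> carrier N \<Longrightarrow> \<iota>' (\<phi> m) = r * \<iota> m"
    by blast
  define \<psi> where "\<psi> = the_inv_into (carrier N) \<phi>"
  have \<psi>: "\<psi> n \<in> carrier N" "\<phi> (\<psi> n) = n" if "n \<in> carrier N'" for n
    using \<phi>(2) that unfolding \<psi>_def bij_betw_def by (auto intro: the_inv_into_into f_the_inv_into_f)
  have \<phi>_inj: "m = n" if "m \<in> carrier N" "n \<in> carrier N" "\<phi> m = \<phi> n" for m n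
    using \<phi>(2) that by (auto simp: bij_betw_def inj_on_def)
  have \<psi>h: "\<psi> (m \<oplus>\<^bsub>N'\<^esub> n) = \<psi> m \<oplus>\<^bsub>N\<^esub> \<psi> n" "c \<in> Mset even even \<Longrightarrow> \<psi> (c \<odot>\<^bsub>N'\<^esub> m) = c \<odot>\<^bsub>N\<^esub> \<psi> m"
    if m: "m \<in> carrier N'" and n: "n \<in> carrier N'" for m n c
  proof -
    show "\<psi> (m \<oplus>\<^bsub>N'\<^esub> n) = \<psi> m \<oplus>\<^bsub>N\<^esub> \<psi> n"
      by (rule \<phi>_inj) (use \<psi>[OF m] \<psi>[OF n] \<psi>[OF N'.N.M.a_closed[OF m n]] \<phi>h(2) in simp_all)
    show "\<psi> (c \<odot>\<^bsub>N'\<^esub> m) = c \<odot>\<^bsub>N\<^esub> \<psi> m" if "c \<in> Mset even even"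
      by (rule \<phi>_inj) (use that \<psi>[OF m] \<psi>[OF N'.N.smult_closed[of c m]] m N.N.smult_closed[of c "\<psi> m"] \<phi>h(3)[of "\<psi> m"] in simp_all)
  qed
  have "\<exists>r. \<forall>n\<in>carrier N'. \<iota> (\<psi> n) = r * \<iota>' n"
    by (rule N'.hom_multiplication) (use \<psi>h \<psi>(1) in simp_all)
  then obtain r' where r': "\<And>n. n \<in> carrier N' \<Longrightarrow> \<iota> (\<psi> n) = r' * \<iota>' n"
    by blast
  obtain e where e: "e \<in> carrier N'" "\<iota>' e = el_w"
    using N'.iota_surj[of el_w] w_mult_Mset[of 1] by auto
  have "el_w = (r * r') * el_w"
    using r[OF \<psi>(1)[OF e(1)]] r'[OF e(1)] \<psi>(2)[OF e(1)] e(2) by (simp add: mult.assoc)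
  then have rr: "r * r' = 1"
    by (metis mult_cancel_right2 xy_nonzero(3))
  have "cf r 0 0 * cf r' 0 0 = 1"
    using arg_cong[OF rr, of "\<lambda>f. cf f 0 0"] by simp
  then have u: "cf r 0 0 \<noteq> 0" "cf r' 0 0 \<noteq> 0"
    by auto
  have sub: "r * f \<in> Mset P' Q'" if f: "f \<in> Mset P Q" for f
  proof -
    obtain m where m: "m \<in> carrier N" "\<iota> m = f"
      by (rule N.iota_surj[OF f])
    show ?thesis
      using N'.iota_mem[OF \<phi>h(1)[OF m(1) m(1)]] r[OF m(1)] m(2) by simp
  qed
  have sub': "r' * f \<in> Mset P Q" if f: "f \<in> Mset P' Q'" for f
  proof -
    obtain m where m: "m \<in> carrier N'" "\<iota>' m = f"
      by (rule N'.iota_surj[OF f])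
    show ?thesis
      using N.iota_mem[OF \<psi>(1)[OF m(1)]] r'[OF m(1)] m(2) by simp
  qed
  note s = unit_mult_shape[OF u(1) sub] unit_mult_shape[OF u(2) sub']
  show ?thesis
  proof
    show "P = P'"
      by (rule kinds_eqI[OF N.kP N'.kP]) (rule iffI; rule s(1,3); assumption)
    show "Q = Q'"
      by (rule kinds_eqI[OF N.kQ N'.kQ]) (rule iffI; rule s(2,4); assumption)
  qed
qed

section \<open>Localization\<close>

lemma UN_UN_const:
  assumes "Y \<noteq> {}" "Z \<noteq> {}" "\<And>m s n t. (m, s) \<in> Y \<Longrightarrow> (n, t) \<in> Z \<Longrightarrow> f m s n t = F"
  shows "(\<Union>(m, s)\<in>Y. \<Union>(n, t)\<in>Z. f m s n t) = F"
proof -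
  obtain m s n t where "(m, s) \<in> Y" "(n, t) \<in> Z"
    using assms(1,2) by fast
  then show ?thesis
    using assms(3) by fastforce
qed

lemma fractional_regular: "fractional (regular_module (ring_A :: 'k::field fps2 ring)) even even id"
proof (rule fractional.intro)
  show "module (ring_A :: 'k fps2 ring) (regular_module ring_A)"
    by (rule regular_module_is_module[OF cring_ring_A])
  show "id \<in> module_iso (ring_A :: 'k fps2 ring) (regular_module ring_A) (ideal_module ring_A (Mset even even))"
    by (auto simp: module_iso_def module_hom_def)
qed simp_all

locale localization = fractional N P Q \<iota>
  for N :: "('k::field fps2, 'm) module" and P Q and \<iota> :: "'m \<Rightarrow> 'k fps2" +
  fixes p :: "'k fps2 set"
  assumes prime: "prime_A p"
begin

abbreviation (input) S :: "'k fps2 set" where "S \<equiv> Mset even even - p"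
abbreviation "lfrac \<equiv> loc_frac ring_A S N"
abbreviation "LM \<equiv> localized_module ring_A S N"

lemma S_simps: "1 \<in> S" "s \<in> S \<Longrightarrow> t \<in> S \<Longrightarrow> s * t \<in> S" "s \<in> S \<Longrightarrow> s \<in> Mset even even" "s \<in> S \<Longrightarrow> s \<noteq> 0"
  using prime_A_D(2,5)[OF prime] prime_A_D(6)[OF prime, of s t] by auto

text \<open>N embeds in the domain R and S consists of non-zero elements, so the auxiliary factor in
  the equality of fractions cancels.\<close>

lemma lfrac_eq_set:
  assumes m: "m \<in> carrier N" and s: "s \<in> S"
  shows "lfrac m s = {(n, t). n \<in> carrier N \<and> t \<in> S \<and> t * \<iota> m = s * \<iota> n}"
proof -
  have "(\<exists>u\<in>S. u \<odot>\<^bsub>N\<^esub> (t \<odot>\<^bsub>N\<^esub> m) = u \<odot>\<^bsub>N\<^esub> (s \<odot>\<^bsub>N\<^esub> n)) \<longleftrightarrow> t * \<iota> m = s * \<iota> n"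
    if n: "n \<in> carrier N" and t: "t \<in> S" for n t
  proof
    have tm: "t \<odot>\<^bsub>N\<^esub> m \<in> carrier N" "s \<odot>\<^bsub>N\<^esub> n \<in> carrier N"
      using N.smult_closed[of t m] N.smult_closed[of s n] m n s t by simp_all
    show "t * \<iota> m = s * \<iota> n" if u0: "\<exists>u\<in>S. u \<odot>\<^bsub>N\<^esub> (t \<odot>\<^bsub>N\<^esub> m) = u \<odot>\<^bsub>N\<^esub> (s \<odot>\<^bsub>N\<^esub> n)"
    proof -
      obtain u where u: "u \<in> S" "u \<odot>\<^bsub>N\<^esub> (t \<odot>\<^bsub>N\<^esub> m) = u \<odot>\<^bsub>N\<^esub> (s \<odot>\<^bsub>N\<^esub> n)"
        using u0 by (rule bexE)
      have "u * (t * \<iota> m) = u * (s * \<iota> n)"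
        using iota_smult[of u "t \<odot>\<^bsub>N\<^esub> m"] iota_smult[of u "s \<odot>\<^bsub>N\<^esub> n"] u tm m n s t by auto
      then show ?thesis
        using S_simps(4)[OF u(1)] by simp
    qed
    show "\<exists>u\<in>S. u \<odot>\<^bsub>N\<^esub> (t \<odot>\<^bsub>N\<^esub> m) = u \<odot>\<^bsub>N\<^esub> (s \<odot>\<^bsub>N\<^esub> n)" if eq: "t * \<iota> m = s * \<iota> n"
    proof (rule bexI[OF _ S_simps(1)])
      have "t \<odot>\<^bsub>N\<^esub> m = s \<odot>\<^bsub>N\<^esub> n"
        using iota_eq_iff[OF tm] eq m n s t by simp
      then show "1 \<odot>\<^bsub>N\<^esub> (t \<odot>\<^bsub>N\<^esub> m) = 1 \<odot>\<^bsub>N\<^esub> (s \<odot>\<^bsub>N\<^esub> n)"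
        by simp
    qed
  qed
  then show ?thesis
    using m s unfolding loc_frac_def loc_rel_def by auto
qed

lemma lfrac_eq_iff:
  assumes "m \<in> carrier N" "n \<in> carrier N" "s \<in> S" "t \<in> S"
  shows "lfrac m s = lfrac n t \<longleftrightarrow> t * \<iota> m = s * \<iota> n"
proof
  assume eq: "lfrac m s = lfrac n t"
  have "(n, t) \<in> lfrac n t"
    using assms by (simp add: lfrac_eq_set)
  then have "(n, t) \<in> lfrac m s"
    by (simp only: eq)
  then show "t * \<iota> m = s * \<iota> n"
    using assms by (simp add: lfrac_eq_set)
next
  assume eq: "t * \<iota> m = s * \<iota> n"
  have "r * \<iota> m = s * \<iota> k \<longleftrightarrow> r * \<iota> n = t * \<iota> k" for r k
  proof -
    have "r * \<iota> m = s * \<iota> k \<longleftrightarrow> t * (r * \<iota> m) = t * (s * \<iota> k)"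
      using S_simps(4)[OF assms(4)] by simp
    also have "t * (r * \<iota> m) = s * (r * \<iota> n)"
      using eq by (simp add: mult.left_commute)
    also have "s * (r * \<iota> n) = t * (s * \<iota> k) \<longleftrightarrow> s * (r * \<iota> n) = s * (t * \<iota> k)"
      by (simp only: mult.left_commute)
    also have "\<dots> \<longleftrightarrow> r * \<iota> n = t * \<iota> k"
      using S_simps(4)[OF assms(3)] by simp
    finally show ?thesis .
  qed
  then show "lfrac m s = lfrac n t"
    using assms by (simp add: lfrac_eq_set)
qed

lemma lfrac_nonempty: "m \<in> carrier N \<Longrightarrow> s \<in> S \<Longrightarrow> lfrac m s \<noteq> {}"
  by (auto simp: lfrac_eq_set)

lemma LM_carrier: "carrier LM = {lfrac m s | m s. m \<in> carrier N \<and> s \<in> S}"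
  by (auto simp: localized_module_def Let_def quotient_def loc_frac_def)

lemma LM_zero: "\<zero>\<^bsub>LM\<^esub> = lfrac \<zero>\<^bsub>N\<^esub> 1"
  by (simp add: localized_module_def Let_def)

lemma LM_closed: "m \<in> carrier N \<Longrightarrow> s \<in> S \<Longrightarrow> lfrac m s \<in> carrier LM"
  unfolding LM_carrier by blast

lemma LM_cases:
  assumes "z \<in> carrier LM"
  obtains m s where "m \<in> carrier N" "s \<in> S" "z = lfrac m s"
  using assms unfolding LM_carrier by blast

lemma lin_closed: "m \<in> carrier N \<Longrightarrow> n \<in> carrier N \<Longrightarrow> s \<in> S \<Longrightarrow> t \<in> S \<Longrightarrow> t \<odot>\<^bsub>N\<^esub> m \<oplus>\<^bsub>N\<^esub> s \<odot>\<^bsub>N\<^esub> n \<in> carrier N"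
  using N.smult_closed[of t m] N.smult_closed[of s n] by simp

lemma iota_lin: "m \<in> carrier N \<Longrightarrow> n \<in> carrier N \<Longrightarrow> s \<in> S \<Longrightarrow> t \<in> S \<Longrightarrow> \<iota> (t \<odot>\<^bsub>N\<^esub> m \<oplus>\<^bsub>N\<^esub> s \<odot>\<^bsub>N\<^esub> n) = t * \<iota> m + s * \<iota> n"
  using N.smult_closed[of t m] N.smult_closed[of s n] by simp

lemma LM_add:
  assumes "m \<in> carrier N" "n \<in> carrier N" "s \<in> S" "t \<in> S"
  shows "lfrac m s \<oplus>\<^bsub>LM\<^esub> lfrac n t = lfrac (t \<odot>\<^bsub>N\<^esub> m \<oplus>\<^bsub>N\<^esub> s \<odot>\<^bsub>N\<^esub> n) (s * t)"
proof -
  have "lfrac m s \<oplus>\<^bsub>LM\<^esub> lfrac n t =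
      (\<Union>(m', s')\<in>lfrac m s. \<Union>(n', t')\<in>lfrac n t. lfrac (t' \<odot>\<^bsub>N\<^esub> m' \<oplus>\<^bsub>N\<^esub> s' \<odot>\<^bsub>N\<^esub> n') (s' * t'))"
    by (simp add: localized_module_def Let_def)
  also have "\<dots> = lfrac (t \<odot>\<^bsub>N\<^esub> m \<oplus>\<^bsub>N\<^esub> s \<odot>\<^bsub>N\<^esub> n) (s * t)"
  proof (rule UN_UN_const)
    fix m' s' n' t'
    assume "(m', s') \<in> lfrac m s" "(n', t') \<in> lfrac n t"
    then have *: "m' \<in> carrier N" "s' \<in> S" "s' * \<iota> m = s * \<iota> m'" "n' \<in> carrier N" "t' \<in> S" "t' * \<iota> n = t * \<iota> n'"
      using assms by (auto simp: lfrac_eq_set)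
    have "(s * t) * (t' * \<iota> m' + s' * \<iota> n') = t * t' * (s * \<iota> m') + s * s' * (t * \<iota> n')"
      by (simp add: algebra_simps)
    also have "\<dots> = (s' * t') * (t * \<iota> m + s * \<iota> n)"
      unfolding *(3,6)[symmetric] by (simp add: algebra_simps)
    finally show "lfrac (t' \<odot>\<^bsub>N\<^esub> m' \<oplus>\<^bsub>N\<^esub> s' \<odot>\<^bsub>N\<^esub> n') (s' * t') = lfrac (t \<odot>\<^bsub>N\<^esub> m \<oplus>\<^bsub>N\<^esub> s \<odot>\<^bsub>N\<^esub> n) (s * t)"
      unfolding lfrac_eq_iff[OF lin_closed[OF *(1,4,2,5)] lin_closed[OF assms] S_simps(2)[OF *(2,5)] S_simps(2)[OF assms(3,4)]]
        iota_lin[OF assms] iota_lin[OF *(1,4,2,5)] .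
  qed (use assms lfrac_nonempty in auto)
  finally show ?thesis .
qed

lemma abelian_monoid_LM: "abelian_monoid LM"
proof (rule abelian_monoidI)
  note cl = S_simps lin_closed N.M.zero_closed
  show "\<zero>\<^bsub>LM\<^esub> \<in> carrier LM"
    unfolding LM_zero by (rule LM_closed[OF N.M.zero_closed S_simps(1)])
  fix Y assume "Y \<in> carrier LM"
  then obtain m s where Y: "m \<in> carrier N" "s \<in> S" "Y = lfrac m s"
    by (rule LM_cases)
  have eq: "(1 * s) * \<iota> m = s * (s * \<iota> \<zero>\<^bsub>N\<^esub> + 1 * \<iota> m)"
    by simp
  show "\<zero>\<^bsub>LM\<^esub> \<oplus>\<^bsub>LM\<^esub> Y = Y"
    unfolding LM_zero Y(3) LM_add[OF N.M.zero_closed Y(1) S_simps(1) Y(2)]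
      lfrac_eq_iff[OF lin_closed[OF N.M.zero_closed Y(1) S_simps(1) Y(2)] Y(1) S_simps(2)[OF S_simps(1) Y(2)] Y(2)]
      iota_lin[OF N.M.zero_closed Y(1) S_simps(1) Y(2)] by (simp add: algebra_simps)
  fix Z assume "Z \<in> carrier LM"
  then obtain n t where Z: "n \<in> carrier N" "t \<in> S" "Z = lfrac n t"
    by (rule LM_cases)
  note mn = Y(1) Z(1) Y(2) Z(2) and nm = Z(1) Y(1) Z(2) Y(2)
  show "Y \<oplus>\<^bsub>LM\<^esub> Z \<in> carrier LM"
    unfolding Y(3) Z(3) LM_add[OF mn] by (rule LM_closed[OF lin_closed[OF mn] S_simps(2)[OF Y(2) Z(2)]])
  show "Y \<oplus>\<^bsub>LM\<^esub> Z = Z \<oplus>\<^bsub>LM\<^esub> Y"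
    unfolding Y(3) Z(3) LM_add[OF mn] LM_add[OF nm]
      lfrac_eq_iff[OF lin_closed[OF mn] lin_closed[OF nm] S_simps(2)[OF Y(2) Z(2)] S_simps(2)[OF Z(2) Y(2)]] iota_lin[OF mn] iota_lin[OF nm]
    by (simp add: algebra_simps)
  fix W assume "W \<in> carrier LM"
  then obtain k r where W: "k \<in> carrier N" "r \<in> S" "W = lfrac k r"
    by (rule LM_cases)
  note st = S_simps(2)[OF Y(2) Z(2)] and tr = S_simps(2)[OF Z(2) W(2)] and nk = Z(1) W(1) Z(2) W(2)
  note a = lin_closed[OF mn] W(1) st W(2) and b = Y(1) lin_closed[OF nk] Y(2) tr
  show "(Y \<oplus>\<^bsub>LM\<^esub> Z) \<oplus>\<^bsub>LM\<^esub> W = Y \<oplus>\<^bsub>LM\<^esub> (Z \<oplus>\<^bsub>LM\<^esub> W)"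
    unfolding Y(3) Z(3) W(3) LM_add[OF mn] LM_add[OF nk] LM_add[OF a] LM_add[OF b]
      lfrac_eq_iff[OF lin_closed[OF a] lin_closed[OF b] S_simps(2)[OF st W(2)] S_simps(2)[OF Y(2) tr]]
      iota_lin[OF a] iota_lin[OF b] iota_lin[OF mn] iota_lin[OF nk]
    by (simp add: algebra_simps)
qed

end

section \<open>Freeness of the localization in terms of a single generator\<close>

context localization
begin

interpretation RA: localization "regular_module ring_A" even even id p
  by (intro localization.intro fractional_regular localization_axioms.intro prime)

interpretation LM: abelian_monoid LM
  by (rule abelian_monoid_LM)

abbreviation "LR \<equiv> localized_ring ring_A S"
abbreviation "rfrac \<equiv> loc_frac ring_A S (regular_module ring_A)"

text \<open>Fractions of ring elements coincide with fractions of the regular module, so the results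
  on localized fractional ideals apply to the localized ring.\<close>

lemma LR_simps: "carrier LR = carrier RA.LM" "\<zero>\<^bsub>LR\<^esub> = rfrac 0 1"
  by (simp_all add: localized_ring_def localized_module_def Let_def)

lemma LR_cases:
  assumes "z \<in> carrier LR"
  obtains f s where "f \<in> Mset even even" "s \<in> S" "z = rfrac f s"
  using assms RA.LM_cases[of z] unfolding LR_simps by auto

lemma LR_closed: "f \<in> Mset even even \<Longrightarrow> s \<in> S \<Longrightarrow> rfrac f s \<in> carrier LR"
  using RA.LM_closed[of f s] unfolding LR_simps by simp

lemma rfrac_eq_iff: "f \<in> Mset even even \<Longrightarrow> g \<in> Mset even even \<Longrightarrow> s \<in> S \<Longrightarrow> t \<in> S \<Longrightarrow> rfrac f s = rfrac g t \<longleftrightarrow> t * f = s * g"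
  using RA.lfrac_eq_iff[of f g s t] by simp

lemma LM_smult:
  assumes "f \<in> Mset even even" "n \<in> carrier N" "s \<in> S" "t \<in> S"
  shows "rfrac f s \<odot>\<^bsub>LM\<^esub> lfrac n t = lfrac (f \<odot>\<^bsub>N\<^esub> n) (s * t)"
proof -
  have sm: "g \<odot>\<^bsub>N\<^esub> m \<in> carrier N" if "g \<in> Mset even even" "m \<in> carrier N" for g m
    using N.smult_closed[of g m] that by simp
  have "rfrac f s \<odot>\<^bsub>LM\<^esub> lfrac n t = (\<Union>(f', s')\<in>rfrac f s. \<Union>(n', t')\<in>lfrac n t. lfrac (f' \<odot>\<^bsub>N\<^esub> n') (s' * t'))"
    by (simp add: localized_module_def Let_def)
  also have "\<dots> = lfrac (f \<odot>\<^bsub>N\<^esub> n) (s * t)"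
  proof (rule UN_UN_const)
    fix f' s' n' t'
    assume a: "(f', s') \<in> rfrac f s" "(n', t') \<in> lfrac n t"
    have *: "f' \<in> Mset even even" "s' \<in> S" "s' * f = s * f'"
      using a(1) RA.lfrac_eq_set[of f s] assms by auto
    have **: "n' \<in> carrier N" "t' \<in> S" "t' * \<iota> n = t * \<iota> n'"
      using a(2) assms by (auto simp: lfrac_eq_set)
    have "(s * t) * (f' * \<iota> n') = (s * f') * (t * \<iota> n')"
      by (simp add: mult_ac)
    also have "\<dots> = (s' * t') * (f * \<iota> n)"
      unfolding *(3)[symmetric] **(3)[symmetric] by (simp add: mult_ac)
    finally show "lfrac (f' \<odot>\<^bsub>N\<^esub> n') (s' * t') = lfrac (f \<odot>\<^bsub>N\<^esub> n) (s * t)"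
      unfolding lfrac_eq_iff[OF sm[OF *(1) **(1)] sm[OF assms(1,2)] S_simps(2)[OF *(2) **(2)] S_simps(2)[OF assms(3,4)]]
        iota_smult[OF *(1) **(1)] iota_smult[OF assms(1,2)] .
  next
    show "rfrac f s \<noteq> {}"
      using RA.lfrac_nonempty[of f s] assms by simp
    show "lfrac n t \<noteq> {}"
      by (rule lfrac_nonempty[OF assms(2,4)])
  qed
  finally show ?thesis .
qed

lemma LM_smult_closed:
  assumes "r \<in> carrier LR" "z \<in> carrier LM"
  shows "r \<odot>\<^bsub>LM\<^esub> z \<in> carrier LM"
proof -
  obtain f s where r: "f \<in> Mset even even" "s \<in> S" "r = rfrac f s"
    using assms(1) by (rule LR_cases)
  obtain n t where z: "n \<in> carrier N" "t \<in> S" "z = lfrac n t"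
    using assms(2) by (rule LM_cases)
  show ?thesis
    unfolding r(3) z(3) LM_smult[OF r(1) z(1) r(2) z(2)]
    using LM_closed[OF N.smult_closed[of f n] S_simps(2)[OF r(2) z(2)]] r z by simp
qed

lemma LM_smult_zero:
  assumes "z \<in> carrier LM"
  shows "\<zero>\<^bsub>LR\<^esub> \<odot>\<^bsub>LM\<^esub> z = \<zero>\<^bsub>LM\<^esub>"
proof -
  obtain n t where z: "n \<in> carrier N" "t \<in> S" "z = lfrac n t"
    using assms(1) by (rule LM_cases)
  show ?thesis
    using LM_smult[of 0 n 1 t] lfrac_eq_iff[of "0 \<odot>\<^bsub>N\<^esub> n" "\<zero>\<^bsub>N\<^esub>" "1 * t" 1] N.smult_closed[of 0 n] z S_simps(1)
    by (simp add: LR_simps(2) LM_zero)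
qed

lemma single_sum:
  assumes b: "b \<in> carrier LM" and r: "r \<in> carrier LR"
  defines "c \<equiv> \<lambda>x. if x = b then r else \<zero>\<^bsub>LR\<^esub>"
  shows "(\<Oplus>\<^bsub>LM\<^esub>x\<in>{x. c x \<noteq> \<zero>\<^bsub>LR\<^esub>}. c x \<odot>\<^bsub>LM\<^esub> x) = r \<odot>\<^bsub>LM\<^esub> b"
proof (cases "r = \<zero>\<^bsub>LR\<^esub>")
  case True
  then have "{x. c x \<noteq> \<zero>\<^bsub>LR\<^esub>} = {}"
    by (auto simp: c_def)
  then show ?thesis
    using LM_smult_zero[OF b] True by simp
next
  case False
  then have "{x. c x \<noteq> \<zero>\<^bsub>LR\<^esub>} = {b}"
    by (auto simp: c_def)
  then show ?thesis
    using LM_smult_closed[OF r b] by (simp add: c_def)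
qed

lemma free_I:
  assumes b: "b \<in> carrier LM" and ex: "\<And>z. z \<in> carrier LM \<Longrightarrow> \<exists>r\<in>carrier LR. z = r \<odot>\<^bsub>LM\<^esub> b"
    and uniq: "\<And>r r'. r \<in> carrier LR \<Longrightarrow> r' \<in> carrier LR \<Longrightarrow> r \<odot>\<^bsub>LM\<^esub> b = r' \<odot>\<^bsub>LM\<^esub> b \<Longrightarrow> r = r'"
  shows "free_module LR LM"
  unfolding free_module_def
proof (intro exI[of _ "{b}"] conjI ballI)
  show "{b} \<subseteq> carrier LM"
    using b by simp
  fix z
  assume "z \<in> carrier LM"
  then obtain r where r: "r \<in> carrier LR" "z = r \<odot>\<^bsub>LM\<^esub> b"
    using ex by blast
  have z0: "\<zero>\<^bsub>LR\<^esub> \<in> carrier LR"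
    unfolding LR_simps(2) by (rule LR_closed) (use S_simps in auto)
  let ?c = "\<lambda>x. if x = b then r else \<zero>\<^bsub>LR\<^esub>"
  show "\<exists>!c. (\<forall>x. c x \<in> carrier LR) \<and> (\<forall>x. x \<notin> {b} \<longrightarrow> c x = \<zero>\<^bsub>LR\<^esub>) \<and> finite {x. c x \<noteq> \<zero>\<^bsub>LR\<^esub>} \<and>
      z = (\<Oplus>\<^bsub>LM\<^esub>x\<in>{x. c x \<noteq> \<zero>\<^bsub>LR\<^esub>}. c x \<odot>\<^bsub>LM\<^esub> x)"
  proof (rule ex1I[of _ ?c])
    have "finite {x. ?c x \<noteq> \<zero>\<^bsub>LR\<^esub>}"
      by (rule finite_subset[of _ "{b}"]) auto
    then show "(\<forall>x. ?c x \<in> carrier LR) \<and> (\<forall>x. x \<notin> {b} \<longrightarrow> ?c x = \<zero>\<^bsub>LR\<^esub>) \<and> finite {x. ?c x \<noteq> \<zero>\<^bsub>LR\<^esub>} \<and>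
      z = (\<Oplus>\<^bsub>LM\<^esub>x\<in>{x. ?c x \<noteq> \<zero>\<^bsub>LR\<^esub>}. ?c x \<odot>\<^bsub>LM\<^esub> x)"
      using r z0 single_sum[OF b r(1)] by simp
    fix c
    assume c: "(\<forall>x. c x \<in> carrier LR) \<and> (\<forall>x. x \<notin> {b} \<longrightarrow> c x = \<zero>\<^bsub>LR\<^esub>) \<and> finite {x. c x \<noteq> \<zero>\<^bsub>LR\<^esub>} \<and>
      z = (\<Oplus>\<^bsub>LM\<^esub>x\<in>{x. c x \<noteq> \<zero>\<^bsub>LR\<^esub>}. c x \<odot>\<^bsub>LM\<^esub> x)"
    then have ceq: "c = (\<lambda>x. if x = b then c b else \<zero>\<^bsub>LR\<^esub>)" and cb: "c b \<in> carrier LR"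
      by (auto simp: fun_eq_iff)
    have "z = (\<Oplus>\<^bsub>LM\<^esub>x\<in>{x. c x \<noteq> \<zero>\<^bsub>LR\<^esub>}. c x \<odot>\<^bsub>LM\<^esub> x)"
      using c by blast
    also have "\<dots> = c b \<odot>\<^bsub>LM\<^esub> b"
      by (subst (1 2) ceq) (rule single_sum[OF b cb])
    finally have rc: "r = c b"
      using uniq[OF r(1) cb] r(2) by simp
    show "c = ?c"
      unfolding rc by (rule ceq)
  qed
qed

text \<open>A basis cannot have two elements: any two fractions of N become equal after
  multiplication by suitable ring elements, which contradicts uniqueness of coefficients. If the
  basis is empty, the zero element serves as generator.\<close>

lemma free_D:
  assumes free: "free_module LR LM"
  shows "\<exists>b\<in>carrier LM. \<forall>z\<in>carrier LM. \<exists>r\<in>carrier LR. z = r \<odot>\<^bsub>LM\<^esub> b"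
proof -
  define rep where "rep B z c \<longleftrightarrow> (\<forall>x. c x \<in> carrier LR) \<and> (\<forall>x. x \<notin> B \<longrightarrow> c x = \<zero>\<^bsub>LR\<^esub>) \<and> finite {x. c x \<noteq> \<zero>\<^bsub>LR\<^esub>} \<and>
      z = (\<Oplus>\<^bsub>LM\<^esub>x\<in>{x. c x \<noteq> \<zero>\<^bsub>LR\<^esub>}. c x \<odot>\<^bsub>LM\<^esub> x)" for B z c
  have "\<exists>B. B \<subseteq> carrier LM \<and> (\<forall>z\<in>carrier LM. \<exists>!c. rep B z c)"
    using free unfolding free_module_def rep_def .
  then obtain B where B: "B \<subseteq> carrier LM" "\<And>z. z \<in> carrier LM \<Longrightarrow> \<exists>!c. rep B z c"
    by (metis (no_types, lifting))
  have z0: "\<zero>\<^bsub>LR\<^esub> \<in> carrier LR"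
    unfolding LR_simps(2) by (rule LR_closed) (use S_simps in auto)
  have single: "rep B (r \<odot>\<^bsub>LM\<^esub> b) (\<lambda>x. if x = b then r else \<zero>\<^bsub>LR\<^esub>)" if b: "b \<in> B" and r: "r \<in> carrier LR" for b r
  proof -
    have "finite {x. (if x = b then r else \<zero>\<^bsub>LR\<^esub>) \<noteq> \<zero>\<^bsub>LR\<^esub>}"
      by (rule finite_subset[of _ "{b}"]) auto
    moreover have "\<forall>x. (if x = b then r else \<zero>\<^bsub>LR\<^esub>) \<in> carrier LR" "\<forall>x. x \<notin> B \<longrightarrow> (if x = b then r else \<zero>\<^bsub>LR\<^esub>) = \<zero>\<^bsub>LR\<^esub>"
      using b r z0 by auto
    ultimately show ?thesis
      unfolding rep_def single_sum[OF subsetD[OF B(1) b] r] by (intro conjI refl)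
  qed
  have B1: "b1 = b2" if b1: "b1 \<in> B" and b2: "b2 \<in> B" for b1 b2
  proof (rule ccontr)
    assume ne: "b1 \<noteq> b2"
    obtain g1 s1 where 1: "g1 \<in> carrier N" "s1 \<in> S" "b1 = lfrac g1 s1"
      using subsetD[OF B(1) b1] by (rule LM_cases)
    obtain g2 s2 where 2: "g2 \<in> carrier N" "s2 \<in> S" "b2 = lfrac g2 s2"
      using subsetD[OF B(1) b2] by (rule LM_cases)
    \<comment> \<open>Cross-multiplication makes the two products agree; the factor w moves the
      coefficients, which a priori are only in R, into A.\<close>
    let ?f1 = "el_w * (\<iota> g2 * s1)" and ?f2 = "el_w * (\<iota> g1 * s2)"
    let ?r1 = "rfrac ?f1 1" and ?r2 = "rfrac ?f2 1"
    have A: "?f1 \<in> Mset even even" "?f2 \<in> Mset even even"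
      by simp_all
    have r: "?r1 \<in> carrier LR" "?r2 \<in> carrier LR"
      using LR_closed[OF A(1) S_simps(1)] LR_closed[OF A(2) S_simps(1)] .
    have "?f1 \<odot>\<^bsub>N\<^esub> g1 \<in> carrier N" "?f2 \<odot>\<^bsub>N\<^esub> g2 \<in> carrier N"
      using N.smult_closed[of ?f1 g1] N.smult_closed[of ?f2 g2] 1 2 by simp_all
    then have "?r1 \<odot>\<^bsub>LM\<^esub> b1 = ?r2 \<odot>\<^bsub>LM\<^esub> b2"
      unfolding 1(3) 2(3) LM_smult[OF A(1) 1(1) S_simps(1) 1(2)] LM_smult[OF A(2) 2(1) S_simps(1) 2(2)]
      using 1 2 iota_smult[OF A(1) 1(1)] iota_smult[OF A(2) 2(1)] by (subst lfrac_eq_iff) (auto simp: mult_ac)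
    moreover have "r \<odot>\<^bsub>LM\<^esub> b1 \<in> carrier LM" if "r \<in> carrier LR" for r
      by (rule LM_smult_closed[OF that subsetD[OF B(1) b1]])
    ultimately have "(\<lambda>x. if x = b1 then ?r1 else \<zero>\<^bsub>LR\<^esub>) = (\<lambda>x. if x = b2 then ?r2 else \<zero>\<^bsub>LR\<^esub>)"
      using single[OF b1 r(1)] single[OF b2 r(2)] B(2)[of "?r1 \<odot>\<^bsub>LM\<^esub> b1"] r(1) by metis
    then have "?r1 = \<zero>\<^bsub>LR\<^esub>" "?r2 = \<zero>\<^bsub>LR\<^esub>"
      using ne by (metis (full_types))+
    then have "\<iota> g1 = 0" "\<iota> g2 = 0"
      using rfrac_eq_iff[OF A(1) _ S_simps(1) S_simps(1), of 0] rfrac_eq_iff[OF A(2) _ S_simps(1) S_simps(1), of 0] 1(2) 2(2) S_simps(4)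
      by (auto simp: LR_simps(2))
    then show False
      using lfrac_eq_iff[OF 1(1) 2(1) 1(2) 2(2)] ne 1(3) 2(3) by simp
  qed
  obtain b where b: "b \<in> carrier LM" "B \<subseteq> {b}"
  proof (cases "B = {}")
    case True
    then show ?thesis
      using that[OF LM.zero_closed] by simp
  next
    case False
    then obtain b where "b \<in> B"
      by blast
    then show ?thesis
      using that[of b] B1 B(1) by blast
  qed
  have "\<exists>r\<in>carrier LR. z = r \<odot>\<^bsub>LM\<^esub> b" if z: "z \<in> carrier LM" for z
  proof -
    obtain c where c: "rep B z c"
      using B(2)[OF z] by blast
    then have ceq: "c = (\<lambda>x. if x = b then c b else \<zero>\<^bsub>LR\<^esub>)" and cb: "c b \<in> carrier LR"
      using b(2) unfolding rep_def by (auto simp: fun_eq_iff)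
    have "z = (\<Oplus>\<^bsub>LM\<^esub>x\<in>{x. c x \<noteq> \<zero>\<^bsub>LR\<^esub>}. c x \<odot>\<^bsub>LM\<^esub> x)"
      using c by (simp only: rep_def)
    also have "\<dots> = c b \<odot>\<^bsub>LM\<^esub> b"
      by (subst (1 2) ceq) (rule single_sum[OF b(1) cb])
    finally show ?thesis
      using cb by blast
  qed
  then show ?thesis
    using b(1) by blast
qed

text \<open>The fraction of g over 1 is a basis: s makes every element of N a multiple of g, and
  coefficients are unique because R is a domain.\<close>

lemma free_of_generator:
  assumes g: "g \<in> carrier N" "\<iota> g \<noteq> 0" and s: "s \<in> S"
    and gen: "\<And>f. f \<in> Mset P Q \<Longrightarrow> \<exists>c\<in>Mset even even. s * f = c * \<iota> g"
  shows "free_module LR LM"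
proof (rule free_I[of "lfrac g 1"])
  show "lfrac g 1 \<in> carrier LM"
    by (rule LM_closed[OF g(1) S_simps(1)])
  have cg: "c \<odot>\<^bsub>N\<^esub> g \<in> carrier N" if "c \<in> Mset even even" for c
    using N.smult_closed[of c g] that g by simp
  fix z
  assume "z \<in> carrier LM"
  then obtain n t where z: "n \<in> carrier N" "t \<in> S" "z = lfrac n t"
    by (rule LM_cases)
  obtain c where c: "c \<in> Mset even even" "s * \<iota> n = c * \<iota> g"
    using gen[OF iota_mem[OF z(1)]] by blast
  have "lfrac n t = lfrac (c \<odot>\<^bsub>N\<^esub> g) (s * t * 1)"
    using lfrac_eq_iff[OF z(1) cg[OF c(1)] z(2), of "s * t * 1"] S_simps(2)[OF s z(2)] iota_smult[OF c(1) g(1)]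
    by (simp add: c(2)[symmetric] mult_ac)
  then have "z = rfrac c (s * t) \<odot>\<^bsub>LM\<^esub> lfrac g 1"
    unfolding z(3) LM_smult[OF c(1) g(1) S_simps(2)[OF s z(2)] S_simps(1)] .
  then show "\<exists>r\<in>carrier LR. z = r \<odot>\<^bsub>LM\<^esub> lfrac g 1"
    using LR_closed[OF c(1) S_simps(2)[OF s z(2)]] by blast
next
  fix r r'
  assume r: "r \<in> carrier LR" "r' \<in> carrier LR" and eq: "r \<odot>\<^bsub>LM\<^esub> lfrac g 1 = r' \<odot>\<^bsub>LM\<^esub> lfrac g 1"
  obtain c t where c: "c \<in> Mset even even" "t \<in> S" "r = rfrac c t"
    using r(1) by (rule LR_cases)
  obtain d l where d: "d \<in> Mset even even" "l \<in> S" "r' = rfrac d l"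
    using r(2) by (rule LR_cases)
  have cg: "c \<odot>\<^bsub>N\<^esub> g \<in> carrier N" if "c \<in> Mset even even" for c
    using N.smult_closed[of c g] that g by simp
  have "(l * 1) * (c * \<iota> g) = (t * 1) * (d * \<iota> g)"
    using eq unfolding c(3) d(3) LM_smult[OF c(1) g(1) c(2) S_simps(1)] LM_smult[OF d(1) g(1) d(2) S_simps(1)]
      lfrac_eq_iff[OF cg[OF c(1)] cg[OF d(1)] S_simps(2)[OF c(2) S_simps(1)] S_simps(2)[OF d(2) S_simps(1)]]
      iota_smult[OF c(1) g(1)] iota_smult[OF d(1) g(1)] .
  then have "l * c * \<iota> g = t * d * \<iota> g"
    by (simp add: mult.assoc)
  then have "l * c = t * d"
    using g(2) by (simp only: mult_cancel_right) simp
  then show "r = r'"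
    unfolding c(3) d(3) using rfrac_eq_iff[OF c(1) d(1) c(2) d(2)] by simp
qed

lemma free_generator:
  assumes "free_module LR LM"
  shows "\<exists>g. \<forall>f\<in>Mset P Q. \<exists>s\<in>S. \<exists>c\<in>Mset even even. s * f = c * g"
proof -
  obtain b where b: "b \<in> carrier LM" "\<And>z. z \<in> carrier LM \<Longrightarrow> \<exists>r\<in>carrier LR. z = r \<odot>\<^bsub>LM\<^esub> b"
    using free_D[OF assms] by blast
  obtain g t where g: "g \<in> carrier N" "t \<in> S" "b = lfrac g t"
    using b(1) by (rule LM_cases)
  have "\<exists>s\<in>S. \<exists>c\<in>Mset even even. s * f = c * \<iota> g" if f: "f \<in> Mset P Q" for f
  proof -
    obtain m where m: "m \<in> carrier N" "\<iota> m = f"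
      by (rule iota_surj[OF f])
    obtain r where r: "r \<in> carrier LR" "lfrac m 1 = r \<odot>\<^bsub>LM\<^esub> b"
      using b(2)[OF LM_closed[OF m(1) S_simps(1)]] by blast
    obtain c s where c: "c \<in> Mset even even" "s \<in> S" "r = rfrac c s"
      using r(1) by (rule LR_cases)
    have cg: "c \<odot>\<^bsub>N\<^esub> g \<in> carrier N"
      using N.smult_closed[of c g] c(1) g(1) by simp
    have "(s * t) * f = 1 * (c * \<iota> g)"
      using r(2) unfolding c(3) g(3) LM_smult[OF c(1) g(1) c(2) g(2)]
        lfrac_eq_iff[OF m(1) cg S_simps(1) S_simps(2)[OF c(2) g(2)]] iota_smult[OF c(1) g(1)] m(2) .
    then show ?thesis
      using S_simps(2)[OF c(2) g(2)] c(1) by (intro bexI[of _ "s * t"] bexI[of _ c]) simp_all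
  qed
  then show ?thesis
    by blast
qed

end

text \<open>If w is not in p, it generates: the square of w times f is w f, an element of A, times
  w. Otherwise u or v is outside p. On the corresponding axis all exponents of the shape have one
  parity, so a suitable monomial generates after multiplication by the square of u or v.\<close>

lemma upper_shape_generator:
  fixes p :: "'k::field fps2 set"
  assumes P: "P \<in> {even, odd}" and Q: "Q \<in> {even, odd}" and p: "prime_A p" "p \<noteq> max_A"
  shows "\<exists>g\<in>Mset P Q. g \<noteq> 0 \<and> (\<exists>s\<in>Mset even even - p. \<forall>f\<in>Mset P Q. \<exists>c\<in>Mset even even. s * f = c * g)"
proof (cases "el_w \<in> p")
  case False
  have "(el_w :: 'k fps2) ^ 2 \<in> Mset even even - p"
    using False prime_A_power[OF p(1), of el_w 2] by auto
  moreover have "\<exists>c\<in>Mset even even. el_w ^ 2 * f = c * el_w" for f :: "'k fps2"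
    by (intro bexI[of _ "el_w * f"]) (simp_all add: power2_eq_square mult_ac)
  moreover have "el_w \<in> Mset P Q"
    using w_mult_Mset[of 1 P Q] by simp
  ultimately show ?thesis
    using xy_nonzero(3) by blast
next
  case True
  consider "el_u \<notin> p" | "el_v \<notin> p"
    using prime_A_eq_max[OF p(1)] p(2) by blast
  then show ?thesis
  proof cases
    case 1
    \<comment> \<open>The least positive exponent allowed by P. It is 2 rather than 0 for even
      exponents so that the generator vanishes on the y-axis, whatever Q is; the complementary
      exponent 4 - k is positive too and makes the coefficient vanish there.\<close>
    define k :: nat where "k = (if P 1 then 1 else 2)"
    have k: "P k" "k > 0" "k < 4" "k + (4 - k) = 4"
      using P by (auto simp: k_def)
    have par: "even (4 - k + i)" if "P i" for i
      using P that by (auto simp: k_def split: if_splits)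
    have "(el_x :: 'k fps2) ^ 4 = el_u ^ 2"
      by (simp add: el_u_def flip: power_mult)
    then have "(el_x :: 'k fps2) ^ 4 \<in> Mset even even - p"
      using 1 prime_A_power[OF p(1) uvwab_in_A(1), of 2] A_power[OF uvwab_in_A(1), of 2] by (metis DiffI)
    moreover have "\<exists>c\<in>Mset even even. el_x ^ 4 * f = c * el_x ^ k" if f: "f \<in> Mset P Q" for f :: "'k fps2"
    proof (rule bexI)
      have "el_x ^ 4 = (el_x :: 'k fps2) ^ k * el_x ^ (4 - k)"
        unfolding power_add[symmetric] k(4) ..
      then show "el_x ^ 4 * f = (el_x ^ (4 - k) * f) * el_x ^ k"
        by (simp add: mult_ac)
      have "rx f \<in> supp_on P"
        using f by (simp add: Mset_def)
      then have "rx f \<in> supp_on (\<lambda>i. even (i + (4 - k)))"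
        using par unfolding supp_on_def by (auto simp: add.commute)
      then show "el_x ^ (4 - k) * f \<in> Mset even even"
        using k(3) by (simp add: Mset_def supp_on_X_power_mult zero_power)
    qed
    moreover have "(el_x :: 'k fps2) ^ k \<in> Mset P Q" "(el_x :: 'k fps2) ^ k \<noteq> 0"
      using k by (simp_all add: Mset_def zero_power)
    ultimately show ?thesis
      by blast
  next
    case 2
    define k :: nat where "k = (if Q 1 then 1 else 2)"
    have k: "Q k" "k > 0" "k < 4" "k + (4 - k) = 4"
      using Q by (auto simp: k_def)
    have par: "even (4 - k + i)" if "Q i" for i
      using Q that by (auto simp: k_def split: if_splits)
    have "(el_y :: 'k fps2) ^ 4 = el_v ^ 2"
      by (simp add: el_v_def flip: power_mult)
    then have "(el_y :: 'k fps2) ^ 4 \<in> Mset even even - p"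
      using 2 prime_A_power[OF p(1) uvwab_in_A(2), of 2] A_power[OF uvwab_in_A(2), of 2] by (metis DiffI)
    moreover have "\<exists>c\<in>Mset even even. el_y ^ 4 * f = c * el_y ^ k" if f: "f \<in> Mset P Q" for f :: "'k fps2"
    proof (rule bexI)
      have "el_y ^ 4 = (el_y :: 'k fps2) ^ k * el_y ^ (4 - k)"
        unfolding power_add[symmetric] k(4) ..
      then show "el_y ^ 4 * f = (el_y ^ (4 - k) * f) * el_y ^ k"
        by (simp add: mult_ac)
      have "ry f \<in> supp_on Q"
        using f by (simp add: Mset_def)
      then have "ry f \<in> supp_on (\<lambda>i. even (i + (4 - k)))"
        using par unfolding supp_on_def by (auto simp: add.commute)
      then show "el_y ^ (4 - k) * f \<in> Mset even even"
        using k(3) by (simp add: Mset_def supp_on_X_power_mult zero_power)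
    qed
    moreover have "(el_y :: 'k fps2) ^ k \<in> Mset P Q" "(el_y :: 'k fps2) ^ k \<noteq> 0"
      using k by (simp_all add: Mset_def zero_power)
    ultimately show ?thesis
      by blast
  qed
qed

theorem upper_locally_free:
  fixes N :: "('k::field fps2, 'm) module"
  assumes "fractional N P Q \<iota>" and PQ: "P \<in> {even, odd}" "Q \<in> {even, odd}"
  shows "locally_free_on_punctured_spectrum ring_A N"
  unfolding locally_free_on_punctured_spectrum_def
proof (intro allI impI)
  interpret fractional N P Q \<iota>
    by fact
  fix p :: "'k fps2 set"
  assume p0: "primeideal p ring_A \<and> \<not> maximalideal p ring_A"
  have p: "prime_A p" "p \<noteq> max_A"
    using p0 maximalideal_max_A by (auto simp: primeideal_ring_A_iff)
  interpret localization N P Q \<iota> p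
    by unfold_locales (rule p)
  obtain g s where g: "g \<in> Mset P Q" "g \<noteq> 0" "s \<in> Mset even even - p" "\<forall>f\<in>Mset P Q. \<exists>c\<in>Mset even even. s * f = c * g"
    using upper_shape_generator[OF PQ p] by blast
  obtain m where m: "m \<in> carrier N" "\<iota> m = g"
    by (rule iota_surj[OF g(1)])
  have "free_module (localized_ring ring_A (Mset even even - p)) (localized_module ring_A (Mset even even - p) N)"
    by (rule free_of_generator[OF m(1) _ g(3)]) (use m(2) g in auto)
  then show "free_module (localized_ring ring_A (carrier ring_A - p)) (localized_module ring_A (carrier ring_A - p) N)"
    by simp
qed

lemma parity_zero:
  fixes \<alpha> \<beta> :: "'k::field fps"
  assumes "\<alpha> \<in> supp_on even" "\<beta> \<in> supp_on even" "fps_X * \<alpha> = \<beta>"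
  shows "\<alpha> = 0"
proof (rule fps_ext)
  fix i
  have "fps_nth \<beta> (Suc i) = fps_nth \<alpha> i"
    unfolding assms(3)[symmetric] by simp
  then show "fps_nth \<alpha> i = fps_nth 0 i"
    using assms(1,2) unfolding supp_on_def mem_Collect_eq by (cases "even i") (metis even_Suc fps_zero_nth)+
qed

text \<open>Localize at the kernel of the restriction h to one axis. In a free localization, the
  square and the cube of t would both be multiples of one generator up to denominators. Under h the
  coefficients and denominators are even, while the ratio of the two monomials is z, which is
  odd.\<close>

lemma not_locally_free:
  fixes N :: "('k::field fps2, 'm) module" and h :: "'k fps2 \<Rightarrow> 'k fps" and t :: "'k fps2"
  assumes "fractional N P Q \<iota>"
    and h: "\<And>f g. h (f + g) = h f + h g" "\<And>f g. h (f * g) = h f * h g" "h 0 = 0" "h 1 = 1" "h t = fps_X" "\<And>f. f \<in> Mset even even \<Longrightarrow> h f \<in> supp_on even"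
    and t: "t ^ 2 \<in> Mset P Q" "t ^ 3 \<in> Mset P Q" "t ^ 2 \<in> max_A" "t \<noteq> 0"
  shows "\<not> locally_free_on_punctured_spectrum ring_A N"
proof
  assume free: "locally_free_on_punctured_spectrum ring_A N"
  interpret fractional N P Q \<iota>
    by fact
  define p where "p = {f \<in> Mset even even. h f = 0}"
  have p: "prime_A p"
    unfolding prime_A_def p_def by (auto simp: h)
  have hpow: "h (t ^ n) = fps_X ^ n" for n
    by (induction n) (simp_all add: h)
  have "\<not> maximalideal p ring_A"
  proof
    assume "maximalideal p ring_A"
    then have "max_A = p \<or> (max_A :: 'k fps2 set) = carrier ring_A"
      by (rule maximalideal.I_maximal[OF _ maximalideal.axioms(1)[OF maximalideal_max_A] prime_A_subset_max[OF p]]) (auto simp: max_A_def)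
    moreover have "t ^ 2 \<notin> p" "(1 :: 'k fps2) \<notin> max_A"
      using hpow[of 2] by (auto simp: p_def max_A_def)
    ultimately show False
      using t(3) by auto
  qed
  then have fr: "free_module (localized_ring ring_A (Mset even even - p)) (localized_module ring_A (Mset even even - p) N)"
    using free p by (simp add: locally_free_on_punctured_spectrum_def primeideal_ring_A_iff)
  interpret localization N P Q \<iota> p
    by unfold_locales (rule p)
  obtain g where g: "\<And>f. f \<in> Mset P Q \<Longrightarrow> \<exists>s\<in>Mset even even - p. \<exists>c\<in>Mset even even. s * f = c * g"
    using free_generator[OF fr] by metis
  obtain s2 c2 where 2: "s2 \<in> Mset even even" "h s2 \<noteq> 0" "c2 \<in> Mset even even" "s2 * t ^ 2 = c2 * g"
    using g[OF t(1)] by (auto simp: p_def)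
  obtain s3 c3 where 3: "s3 \<in> Mset even even" "h s3 \<noteq> 0" "c3 \<in> Mset even even" "s3 * t ^ 3 = c3 * g"
    using g[OF t(2)] by (auto simp: p_def)
  \<comment> \<open>The generator is eliminated from the two relations.\<close>
  have "t ^ 2 * (t * (s3 * c2)) = c2 * (s3 * t ^ 3)"
    by (simp add: power2_eq_square power3_eq_cube mult_ac)
  also have "\<dots> = c3 * (s2 * t ^ 2)"
    unfolding 2(4) 3(4) by (simp add: mult_ac)
  also have "\<dots> = t ^ 2 * (s2 * c3)"
    by (simp add: mult_ac)
  finally have "t * (s3 * c2) = s2 * c3"
    using t(4) by simp
  then have "fps_X * (h s3 * h c2) = h s2 * h c3"
    using h(2,5) by metis
  then have "h s3 * h c2 = 0"
    by (rule parity_zero[rotated 2]) (intro supp_on_mult per2_simps h(6) 2 3)+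
  then have "h c2 = 0"
    using 3(2) by simp
  then have "h (s2 * t ^ 2) = 0"
    unfolding 2(4) h(2) by simp
  then show False
    unfolding h(2) hpow using 2(2) by simp
qed

theorem lower_not_locally_free:
  fixes N :: "('k::field fps2, 'm) module"
  assumes N: "fractional N P Q \<iota>" and PQ: "P = (\<lambda>_. True) \<or> Q = (\<lambda>_. True)"
  shows "\<not> locally_free_on_punctured_spectrum ring_A N"
proof -
  have m: "(el_x :: 'k fps2) ^ 2 \<in> max_A" "(el_y :: 'k fps2) ^ 2 \<in> max_A"
    by (simp_all add: max_A_def Mset_def) (simp_all add: el_x_def el_y_def power2_eq_square)
  from PQ show ?thesis
  proof
    assume "P = (\<lambda>_. True)"
    then show ?thesis
      by (intro not_locally_free[OF N, of rx el_x]) (simp_all add: Mset_def m zero_power)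
  next
    assume "Q = (\<lambda>_. True)"
    then show ?thesis
      by (intro not_locally_free[OF N, of ry el_y]) (simp_all add: Mset_def m zero_power)
  qed
qed

section \<open>Divisorial fractional ideals\<close>

text \<open>The odd part divided by z, the second coordinate in the basis 1, z over even series;
  \<open>evp\<close> is the first.\<close>

definition odp :: "'k::field fps \<Rightarrow> 'k fps" where
  "odp \<alpha> = Abs_fps (\<lambda>i. if even i then fps_nth \<alpha> (Suc i) else 0)"

lemma odp_even: "odp \<alpha> \<in> supp_on even"
  by (auto simp: odp_def supp_on_def)

lemma parity_decomp: "\<alpha> = evp \<alpha> + fps_X * odp \<alpha>"
proof (rule fps_ext)
  fix i
  show "fps_nth \<alpha> i = fps_nth (evp \<alpha> + fps_X * odp \<alpha>) i"
    by (cases i) (auto simp: evp_def odp_def)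
qed

text \<open>A submodule of \<open>\<k>[[z]]\<close> over \<open>\<k>[[z\<^sup>2]]\<close> that is closed under division by \<open>z\<^sup>2\<close>. With respect to the basis
  \<open>1, z\<close>, the determinant of two elements \<open>\<alpha>\<close>, \<open>\<gamma>\<close> gives the elements \<open>D\<close> and \<open>D z\<close> below; \<open>D\<close> is even, so it is zero
  when all orders of elements have the same parity.\<close>

lemma saturated_lattice:
  fixes W :: "'k::field fps set"
  assumes add: "\<And>\<alpha> \<beta>. \<alpha> \<in> W \<Longrightarrow> \<beta> \<in> W \<Longrightarrow> \<alpha> - \<beta> \<in> W"
    and mult: "\<And>\<alpha> c. \<alpha> \<in> W \<Longrightarrow> c \<in> supp_on even \<Longrightarrow> c * \<alpha> \<in> W"
    and sat: "\<And>\<alpha>. fps_X ^ 2 * \<alpha> \<in> W \<Longrightarrow> \<alpha> \<in> W"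
    and nz: "\<exists>\<alpha>\<in>W. \<alpha> \<noteq> 0"
  shows "\<exists>P\<in>kinds. \<exists>\<epsilon>. fps_nth \<epsilon> 0 = 1 \<and> (\<forall>\<alpha>. \<epsilon> * \<alpha> \<in> W \<longleftrightarrow> \<alpha> \<in> supp_on P)"
proof -
  have sat': "\<alpha> \<in> W" if "fps_X ^ (2 * n) * \<alpha> \<in> W" for \<alpha> n
    using that
  proof (induction n)
    case (Suc n)
    have "fps_X ^ 2 * (fps_X ^ (2 * n) * \<alpha>) \<in> W"
      using Suc.prems by (simp add: power2_eq_square mult.assoc)
    then show ?case
      using Suc.IH sat by blast
  qed simp
  have det: "evp \<alpha> * \<gamma> - evp \<gamma> * \<alpha> = fps_X * (evp \<alpha> * odp \<gamma> - odp \<alpha> * evp \<gamma>)" for \<alpha> \<gamma> :: "'k fps"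
  proof -
    have "evp \<alpha> * \<gamma> - evp \<gamma> * \<alpha> = evp \<alpha> * (evp \<gamma> + fps_X * odp \<gamma>) - evp \<gamma> * (evp \<alpha> + fps_X * odp \<alpha>)"
      by (simp only: parity_decomp[symmetric])
    then show ?thesis
      by (simp add: algebra_simps)
  qed
  have det': "odp \<gamma> * \<alpha> - odp \<alpha> * \<gamma> = evp \<alpha> * odp \<gamma> - odp \<alpha> * evp \<gamma>" for \<alpha> \<gamma> :: "'k fps"
  proof -
    have "odp \<gamma> * \<alpha> - odp \<alpha> * \<gamma> = odp \<gamma> * (evp \<alpha> + fps_X * odp \<alpha>) - odp \<alpha> * (evp \<gamma> + fps_X * odp \<gamma>)"
      by (simp only: parity_decomp[symmetric])
    then show ?thesis
      by (simp add: algebra_simps)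
  qed
  define D where "D \<alpha> \<gamma> = evp \<alpha> * odp \<gamma> - odp \<alpha> * evp \<gamma>" for \<alpha> \<gamma> :: "'k fps"
  have D_even: "D \<alpha> \<gamma> \<in> supp_on even" for \<alpha> \<gamma>
    unfolding D_def by (intro supp_on_simps supp_on_mult per2_simps evp_simps odp_even)
  have DW: "fps_X * D \<alpha> \<gamma> \<in> W" "D \<alpha> \<gamma> \<in> W" if "\<alpha> \<in> W" "\<gamma> \<in> W" for \<alpha> \<gamma>
  proof -
    show "fps_X * D \<alpha> \<gamma> \<in> W"
      unfolding D_def det[symmetric] by (intro add mult that evp_simps)
    show "D \<alpha> \<gamma> \<in> W"
      unfolding D_def det'[symmetric] by (intro add mult that odp_even)
  qed
  have unit: "\<exists>\<theta>\<in>supp_on even. \<theta> * \<eta> = 1" if \<eta>: "\<eta> \<in> supp_on even" "fps_nth \<eta> 0 \<noteq> 0" for \<eta> :: "'k fps"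
  proof -
    obtain \<theta> where "\<eta> * \<theta> = 1"
      using fps_unit_inverse[OF \<eta>(2)] .
    then show ?thesis
      using supp_on_even_inverse[OF \<eta>(1), of \<theta>] by (auto simp: mult.commute)
  qed
  have one: "1 \<in> W" if \<delta>: "\<delta> \<in> W" "\<delta> \<in> supp_on even" "\<delta> \<noteq> 0" for \<delta>
  proof -
    obtain j \<epsilon> \<eta> where *: "\<delta> = fps_X ^ (2 * j) * \<epsilon>" "\<epsilon> * \<eta> = 1" "\<eta> \<in> supp_on even"
      using supp_on_even_factor[OF \<delta>(2,3)] by metis
    have "\<epsilon> \<in> W"
      using sat' \<delta>(1) *(1) by blast
    then show ?thesis
      using mult[of \<epsilon> \<eta>] *(2,3) by (simp add: mult.commute)
  qed
  have X: "fps_X \<in> W" if \<delta>: "fps_X * \<delta> \<in> W" "\<delta> \<in> supp_on even" "\<delta> \<noteq> 0" for \<delta>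
  proof -
    obtain j \<epsilon> \<eta> where *: "\<delta> = fps_X ^ (2 * j) * \<epsilon>" "\<epsilon> * \<eta> = 1" "\<eta> \<in> supp_on even"
      using supp_on_even_factor[OF \<delta>(2,3)] by metis
    have "fps_X ^ (2 * j) * (fps_X * \<epsilon>) \<in> W"
      using \<delta>(1) *(1) by (simp add: mult_ac)
    then have "\<eta> * (fps_X * \<epsilon>) \<in> W"
      using sat' mult *(3) by blast
    moreover have "\<eta> * (fps_X * \<epsilon>) = fps_X * (\<epsilon> * \<eta>)"
      by (simp add: mult_ac)
    ultimately show ?thesis
      using *(2) by simp
  qed
  have full: ?thesis if "1 \<in> W" "fps_X \<in> W"
  proof -
    have "\<alpha> \<in> W" for \<alpha>
    proof -
      have "0 - (0 - evp \<alpha> * 1 - odp \<alpha> * fps_X) \<in> W"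
        using add[OF that(1) that(1)] by (intro add mult that evp_simps odp_even) simp_all
      also have "0 - (0 - evp \<alpha> * 1 - odp \<alpha> * fps_X) = evp \<alpha> + fps_X * odp \<alpha>"
        by (simp add: mult.commute)
      also have "\<dots> = \<alpha>"
        by (rule parity_decomp[symmetric])
      finally show ?thesis .
    qed
    then show ?thesis
      by (intro bexI[of _ "\<lambda>_. True"] exI[of _ 1]) simp_all
  qed
  show ?thesis
  proof (cases "1 \<in> W \<and> fps_X \<in> W")
    case True
    then show ?thesis
      using full by blast
  next
    case False
    obtain \<alpha>0 where \<alpha>0: "\<alpha>0 \<in> W" "\<alpha>0 \<noteq> 0"
      using nz by blast
    obtain n \<epsilon>0 where n: "\<alpha>0 = fps_X ^ n * \<epsilon>0" "fps_nth \<epsilon>0 0 \<noteq> 0"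
      using fps_factor[OF \<alpha>0(2)] .
    \<comment> \<open>Only the parity of the order of \<open>\<alpha>0\<close> matters, because W is
      closed under division by the square of z. The unit factor is normalized to constant term 1, so
      that units found on the two axes can later be glued.\<close>
    define b where "b = n mod 2"
    define \<epsilon> where "\<epsilon> = fps_const (inverse (fps_nth \<epsilon>0 0)) * \<epsilon>0"
    have eq: "fps_X ^ n = fps_X ^ (2 * (n div 2)) * (fps_X ^ b :: 'k fps)"
      unfolding b_def power_add[symmetric] by simp
    have "fps_X ^ (2 * (n div 2)) * (fps_X ^ b * \<epsilon>0) = \<alpha>0"
      unfolding n(1) eq by (simp only: mult.assoc)
    then have "fps_X ^ (2 * (n div 2)) * (fps_X ^ b * \<epsilon>0) \<in> W"
      using \<alpha>0(1) by (simp only:)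
    then have "fps_X ^ b * \<epsilon>0 \<in> W"
      by (rule sat')
    then have "fps_const (inverse (fps_nth \<epsilon>0 0)) * (fps_X ^ b * \<epsilon>0) \<in> W"
      by (rule mult) simp
    then have \<alpha>: "fps_X ^ b * \<epsilon> \<in> W"
      by (simp add: \<epsilon>_def mult.left_commute)
    have \<epsilon>0: "fps_nth \<epsilon> 0 = 1"
      using n(2) by (simp add: \<epsilon>_def)
    \<comment> \<open>A non-zero determinant D is even, and D and z D in W would yield both 1 and z
      in W, the case already settled.\<close>
    have D0: "D \<gamma> \<gamma>' = 0" if "\<gamma> \<in> W" "\<gamma>' \<in> W" for \<gamma> \<gamma>'
      using False one[OF DW(2)[OF that] D_even] X[OF DW(1)[OF that] D_even] by blast
    let ?\<alpha> = "fps_X ^ b * \<epsilon>"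
    \<comment> \<open>Since the determinant with \<open>?\<alpha>\<close> vanishes, \<gamma> is
      proportional to \<open>?\<alpha>\<close>. The coordinate of \<open>?\<alpha>\<close> belonging
      to the parity b is an even unit, so the factor of proportionality is an even series.\<close>
    have mul: "\<exists>c\<in>supp_on even. \<gamma> = c * ?\<alpha>" if \<gamma>: "\<gamma> \<in> W" for \<gamma>
    proof (cases "b = 0")
      case True
      have "fps_nth (evp ?\<alpha>) 0 \<noteq> 0"
        using True \<epsilon>0 by (simp add: evp_simps)
      then obtain \<theta> where \<theta>: "\<theta> \<in> supp_on even" "\<theta> * evp ?\<alpha> = 1"
        using unit[OF evp_simps(1)] by blast
      have "evp ?\<alpha> * \<gamma> = evp \<gamma> * ?\<alpha>"
        using det[of ?\<alpha> \<gamma>] D0[OF \<alpha> \<gamma>] by (simp add: D_def)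
      then have "\<theta> * (evp ?\<alpha> * \<gamma>) = \<theta> * (evp \<gamma> * ?\<alpha>)"
        by simp
      then have "\<gamma> = (\<theta> * evp \<gamma>) * ?\<alpha>"
        using \<theta>(2) by (simp flip: mult.assoc)
      moreover have "\<theta> * evp \<gamma> \<in> supp_on even"
        by (intro supp_on_mult per2_simps \<theta>(1) evp_simps)
      ultimately show ?thesis
        by blast
    next
      case False
      then have b: "b = 1"
        by (simp add: b_def)
      have "fps_nth (odp ?\<alpha>) 0 \<noteq> 0"
        using b \<epsilon>0 by (simp add: odp_def)
      then obtain \<theta> where \<theta>: "\<theta> \<in> supp_on even" "\<theta> * odp ?\<alpha> = 1"
        using unit[OF odp_even] by blast
      have "odp ?\<alpha> * \<gamma> = odp \<gamma> * ?\<alpha>"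
        using det'[of \<gamma> ?\<alpha>] D0[OF \<alpha> \<gamma>] by (simp add: D_def algebra_simps)
      then have "\<theta> * (odp ?\<alpha> * \<gamma>) = \<theta> * (odp \<gamma> * ?\<alpha>)"
        by simp
      then have "\<gamma> = (\<theta> * odp \<gamma>) * ?\<alpha>"
        using \<theta>(2) by (simp flip: mult.assoc)
      moreover have "\<theta> * odp \<gamma> \<in> supp_on even"
        by (intro supp_on_mult per2_simps \<theta>(1) odp_even)
      ultimately show ?thesis
        by blast
    qed
    define P :: "nat \<Rightarrow> bool" where "P = (\<lambda>i. even (i + b))"
    have b01: "b = 0 \<or> b = 1"
      by (auto simp: b_def)
    then have P: "P \<in> kinds"
      by (auto simp: P_def kinds_def)
    have P_iff: "\<beta> \<in> supp_on P \<longleftrightarrow> (\<exists>c\<in>supp_on even. \<beta> = fps_X ^ b * c)" for \<beta> :: "'k fps"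
    proof
      assume \<beta>: "\<beta> \<in> supp_on P"
      show "\<exists>c\<in>supp_on even. \<beta> = fps_X ^ b * c"
      proof (cases "b = 0")
        case True
        then show ?thesis
          using \<beta> by (auto simp: P_def)
      next
        case False
        then have "\<beta> \<in> supp_on odd" "b = 1"
          using b01 \<beta> by (auto simp: P_def supp_on_def)
        then show ?thesis
          using supp_on_odd_factor[of \<beta>] by auto
      qed
    next
      assume "\<exists>c\<in>supp_on even. \<beta> = fps_X ^ b * c"
      then show "\<beta> \<in> supp_on P"
        by (auto simp: supp_on_X_power_mult) (auto simp: supp_on_def P_def)
    qed
    have "\<epsilon> * \<beta> \<in> W \<longleftrightarrow> \<beta> \<in> supp_on P" for \<beta>
    proof
      assume "\<epsilon> * \<beta> \<in> W"
      then obtain c where c: "c \<in> supp_on even" "\<epsilon> * \<beta> = c * ?\<alpha>"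
        using mul by blast
      then have "\<epsilon> * \<beta> = \<epsilon> * (fps_X ^ b * c)"
        by (simp add: mult_ac)
      then have "\<epsilon> = 0 \<or> \<beta> = fps_X ^ b * c"
        unfolding mult_cancel_left .
      then have "\<beta> = fps_X ^ b * c"
        using \<epsilon>0 by auto
      then show "\<beta> \<in> supp_on P"
        using c(1) P_iff by blast
    next
      assume "\<beta> \<in> supp_on P"
      then obtain c where c: "c \<in> supp_on even" "\<beta> = fps_X ^ b * c"
        using P_iff by blast
      have eq: "\<epsilon> * \<beta> = c * ?\<alpha>"
        unfolding c(2) by (simp only: mult_ac)
      show "\<epsilon> * \<beta> \<in> W"
        unfolding eq by (rule mult[OF \<alpha> c(1)])
    qed
    then show ?thesis
      using P \<epsilon>0 by blast
  qed
qed

text \<open>The properties retained from the image of a Cohen--Macaulay module of rank one: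
  \<open>colon\<close> says that the fractions multiplying V into R are those of R, written without
  a quotient field, and \<open>sat\<close> is the consequence of depth two. In \<open>fin\<close>,
  generation is expressed by minimality among submodules.\<close>

locale divisorial =
  fixes V :: "'k::field fps2 set"
  assumes sub: "A_submodule V"
    and fin: "\<exists>G. finite G \<and> G \<subseteq> V \<and> (\<forall>H. A_submodule H \<longrightarrow> G \<subseteq> H \<longrightarrow> V \<subseteq> H)"
    and colon: "f \<noteq> 0 \<Longrightarrow> (\<And>v. v \<in> V \<Longrightarrow> f dvd h * v) \<Longrightarrow> f dvd h"
    and sat: "(\<And>c. c \<in> max_A \<Longrightarrow> c * r \<in> V) \<Longrightarrow> r \<in> V"
begin

lemmas V_closed = A_submoduleD[OF sub]

lemma nonzero: "\<exists>f\<in>V. f \<noteq> 0"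
proof (rule ccontr)
  assume n: "\<not> (\<exists>f\<in>V. f \<noteq> 0)"
  have "el_x dvd 1 * v" if "v \<in> V" for v
    using n that by (metis dvd_0_right mult_zero_right)
  then have "el_x dvd (1 :: 'k fps2)"
    by (rule colon[OF xy_nonzero(1)])
  then have "ry (1 :: 'k fps2) = 0"
    by (simp only: ry_zero_iff)
  then show False
    by simp
qed

text \<open>An ideal of R that contains V; the aim is to show that it contains 1, that is, w R
  \<subseteq> V.\<close>

definition IV :: "'k fps2 set" where
  "IV = {z. \<forall>r. el_w * (z * r) \<in> V}"

lemma IV_add: "y \<in> IV \<Longrightarrow> z \<in> IV \<Longrightarrow> y + z \<in> IV"
  unfolding IV_def mem_Collect_eq distrib_right distrib_left by (intro allI V_closed(2)) simp_all

lemma IV_mult: "z \<in> IV \<Longrightarrow> z * c \<in> IV"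
  by (simp add: IV_def mult.assoc)

lemma V_subset_IV: "v \<in> V \<Longrightarrow> v \<in> IV"
proof -
  assume v: "v \<in> V"
  have "el_w * (v * r) \<in> V" for r
    using V_closed(3)[of "el_w * r" v, OF _ v] by (simp add: mult_ac)
  then show "v \<in> IV"
    by (simp add: IV_def)
qed

text \<open>Let \<open>G\<close> generate \<open>V\<close>, and suppose that every \<open>g \<in> G\<close> satisfies \<open>g\<^sup>l (t\<^sup>e + g H) \<in> f R\<close>. The product \<open>h\<close> of the
  factors \<open>t\<^sup>e + g H\<close> lies in \<open>f R\<close>: otherwise a monomial multiple of \<open>h\<close> of maximal degree outside \<open>f R\<close> contradicts
  \<open>colon\<close>. Since \<open>h\<close> is congruent to a power of \<open>t\<close> modulo \<open>V R\<close>, so is zero.\<close>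

lemma power_in_IV:
  fixes t :: "'k fps2"
  assumes rel: "\<And>f g. f \<noteq> 0 \<Longrightarrow> \<exists>l e H q. g ^ l * (t ^ e + g * H) = f * q"
  shows "\<exists>K. t ^ K \<in> IV"
proof -
  obtain G where G: "finite G" "G \<subseteq> V" and gen: "\<And>H. A_submodule H \<Longrightarrow> G \<subseteq> H \<Longrightarrow> V \<subseteq> H"
    using fin by blast
  obtain f where f: "f \<in> V" "f \<noteq> 0"
    using nonzero by blast
  have "\<forall>g. \<exists>l e H q. g ^ l * (t ^ e + g * H) = f * q"
    using rel[OF f(2)] by blast
  then obtain l e H q where lq: "\<And>g. g ^ l g * (t ^ e g + g * H g) = f * q g"
    by metis
  define h where "h = (\<Prod>g\<in>G. t ^ e g + g * H g)"
  have "\<exists>i\<in>IV. (\<Prod>g\<in>F. t ^ e g + g * H g) = t ^ (\<Sum>g\<in>F. e g) + i" if "finite F" "F \<subseteq> V" for F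
    using that
  proof (induction F rule: finite_induct)
    case empty
    show ?case
      using V_subset_IV[OF V_closed(1)] by (intro bexI[of _ 0]) simp_all
  next
    case (insert g F)
    then obtain i where i: "i \<in> IV" "(\<Prod>g\<in>F. t ^ e g + g * H g) = t ^ (\<Sum>g\<in>F. e g) + i"
      by auto
    have "i * (t ^ e g + g * H g) + g * (H g * t ^ (\<Sum>g\<in>F. e g)) \<in> IV"
      using insert.prems by (intro IV_add IV_mult i V_subset_IV) simp
    moreover have "(\<Prod>g\<in>insert g F. t ^ e g + g * H g) =
        t ^ (\<Sum>g\<in>insert g F. e g) + (i * (t ^ e g + g * H g) + g * (H g * t ^ (\<Sum>g\<in>F. e g)))"
      unfolding prod.insert[OF insert.hyps] sum.insert[OF insert.hyps] i(2) power_add by (simp add: algebra_simps)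
    ultimately show ?case
      by blast
  qed
  then obtain i where i: "i \<in> IV" "h = t ^ (\<Sum>g\<in>G. e g) + i"
    using G unfolding h_def by blast
  \<comment> \<open>Induction on the total amount by which the exponents \<open>k\<close> fall short
    of \<open>l\<close>. Once one exponent reaches its \<open>l g\<close>, the relation for g gives
    divisibility; until then \<open>colon\<close> reduces to raising an exponent.\<close>
  have "f dvd h * (\<Prod>g\<in>G. g ^ k g)" for k
  proof (induction "\<Sum>g\<in>G. l g - k g" arbitrary: k rule: less_induct)
    case less
    show ?case
    proof (cases "\<exists>g\<in>G. l g \<le> k g")
      case True
      then obtain g where g: "g \<in> G" "l g \<le> k g"
        by blast
      have d1: "f dvd (t ^ e g + g * H g) * g ^ l g"
        using lq[of g] by (simp add: mult.commute)
      have d2: "(t ^ e g + g * H g) dvd h"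
        unfolding h_def by (rule dvd_prodI[OF G(1) g(1)])
      have d3: "g ^ l g dvd (\<Prod>g\<in>G. g ^ k g)"
        by (rule dvd_trans[OF le_imp_power_dvd[OF g(2)] dvd_prodI[OF G(1) g(1), of "\<lambda>g. g ^ k g"]])
      show ?thesis
        by (rule dvd_trans[OF d1 mult_dvd_mono[OF d2 d3]])
    next
      case False
      show ?thesis
      proof (rule colon[OF f(2)])
        fix v
        assume "v \<in> V"
        let ?H = "{v. f dvd h * (\<Prod>g\<in>G. g ^ k g) * v}"
        have "A_submodule ?H"
          unfolding A_submodule_def by (auto simp: distrib_left mult.left_commute intro: dvd_mult)
        moreover have "G \<subseteq> ?H"
        proof
          fix g
          assume g: "g \<in> G"
          let ?k = "k(g := Suc (k g))"
          have "(\<Sum>g\<in>G. l g - ?k g) < (\<Sum>g\<in>G. l g - k g)"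
          proof (rule sum_strict_mono_ex1[OF G(1)])
            show "\<exists>a\<in>G. l a - ?k a < l a - k a"
              using False g by (intro bexI[of _ g]) (auto simp: not_le)
          qed auto
          then have "f dvd h * (\<Prod>g\<in>G. g ^ ?k g)"
            by (rule less)
          moreover have "(\<Prod>g\<in>G. g ^ ?k g) = (\<Prod>g\<in>G. g ^ k g) * g"
          proof -
            have "(\<Prod>a\<in>G - {g}. a ^ ?k a) = (\<Prod>a\<in>G - {g}. a ^ k a)"
              by (rule prod.cong) auto
            then show ?thesis
              using prod.remove[OF G(1) g, of "\<lambda>a. a ^ ?k a"] prod.remove[OF G(1) g, of "\<lambda>a. a ^ k a"]
              by (simp add: mult_ac)
          qed
          ultimately show "g \<in> ?H"
            by (simp add: mult.assoc)
        qed
        ultimately show "f dvd h * (\<Prod>g\<in>G. g ^ k g) * v"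
          using gen[of ?H] \<open>v \<in> V\<close> by blast
      qed
    qed
  qed
  from this[of "\<lambda>_. 0"] have "f dvd h"
    by simp
  then obtain z where "h = f * z" ..
  then have "h \<in> IV"
    using IV_mult[OF V_subset_IV[OF f(1)]] by simp
  moreover have "t ^ (\<Sum>g\<in>G. e g) = h + i * (- 1)"
    by (simp add: i(2))
  ultimately show ?thesis
    using IV_add[of h "i * (- 1)"] IV_mult[OF i(1), of "- 1"] by metis
qed

lemma xy_power_in_IV: "\<exists>K. el_x ^ K \<in> IV" "\<exists>K. el_y ^ K \<in> IV"
proof -
  show "\<exists>K. el_x ^ K \<in> IV"
    by (rule power_in_IV) (rule power_relation)
  show "\<exists>K. el_y ^ K \<in> IV"
  proof (rule power_in_IV)
    fix f g :: "'k fps2"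
    assume "f \<noteq> 0"
    then obtain l e H q where "sw g ^ l * (el_x ^ e + sw g * H) = sw f * q"
      using power_relation[of "sw f" "sw g"] by auto
    then have "sw (sw g ^ l * (el_x ^ e + sw g * H)) = sw (sw f * q)"
      by simp
    then show "\<exists>l e H q. g ^ l * (el_y ^ e + g * H) = f * q"
      unfolding sw_hom sw_sw sw_xy by blast
  qed
qed

lemma max_A_decomp:
  fixes c :: "'k fps2"
  assumes "cf c 0 0 = 0"
  obtains \<alpha> \<beta> where "c = el_x * \<alpha> + el_y * \<beta>"
proof -
  have "el_x dvd c - cy (ry c)"
    by (simp flip: ry_zero_iff)
  moreover have "el_y dvd cy (ry c)"
    using assms by (simp flip: rx_zero_iff)
  ultimately obtain \<alpha> \<beta> where "c - cy (ry c) = el_x * \<alpha>" "cy (ry c) = el_y * \<beta>"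
    by (auto simp: dvd_def)
  then have "c = el_x * \<alpha> + el_y * \<beta>"
    by (simp add: algebra_simps)
  then show thesis
    by (rule that)
qed

lemma IV_sat: "(\<And>c. c \<in> max_A \<Longrightarrow> c * z \<in> IV) \<Longrightarrow> z \<in> IV"
proof -
  assume c: "\<And>c. c \<in> max_A \<Longrightarrow> c * z \<in> IV"
  have "el_w * (z * r) \<in> V" for r
  proof (rule sat)
    fix c :: "'k fps2"
    assume "c \<in> max_A"
    then have "el_w * (c * z * r) \<in> V"
      using c by (simp add: IV_def)
    then show "c * (el_w * (z * r)) \<in> V"
      by (simp add: mult_ac)
  qed
  then show "z \<in> IV"
    by (simp add: IV_def)
qed

text \<open>All monomials of degree at least K + L are in \<open>IV\<close>. A non-unit of A is a
  combination of x and y over R, so it sends a monomial into the ideal of those one degree higher,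
  and saturation lowers the degree step by step down to 1. The number n bounds the distance still to
  go.\<close>

lemma w_mult_in_V: "el_w * r \<in> V"
proof -
  obtain K where K: "el_x ^ K \<in> IV"
    using xy_power_in_IV(1) by blast
  obtain L where L: "el_y ^ L \<in> IV"
    using xy_power_in_IV(2) by blast
  have "el_x ^ i * el_y ^ j \<in> IV" if "K + L \<le> i + j + n" for i j n
    using that
  proof (induction n arbitrary: i j)
    case 0
    then consider "K \<le> i" | "L \<le> j"
      by linarith
    then show ?case
    proof cases
      case 1
      then have eq: "el_x ^ K * (el_x ^ (i - K) * el_y ^ j) = (el_x ^ i * el_y ^ j :: 'k fps2)"
        by (simp flip: mult.assoc power_add)
      show ?thesis
        using IV_mult[OF K, of "el_x ^ (i - K) * el_y ^ j"] unfolding eq .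
    next
      case 2
      then have eq: "el_y ^ L * (el_y ^ (j - L) * el_x ^ i) = (el_x ^ i * el_y ^ j :: 'k fps2)"
        unfolding mult.assoc[symmetric] power_add[symmetric] by (simp add: mult.commute)
      show ?thesis
        using IV_mult[OF L, of "el_y ^ (j - L) * el_x ^ i"] unfolding eq .
    qed
  next
    case (Suc n)
    show ?case
    proof (rule IV_sat)
      fix c :: "'k fps2"
      assume "c \<in> max_A"
      then obtain \<alpha> \<beta> where c: "c = el_x * \<alpha> + el_y * \<beta>"
        by (auto simp: max_A_def elim: max_A_decomp)
      have "el_x ^ Suc i * el_y ^ j * \<alpha> + el_x ^ i * el_y ^ Suc j * \<beta> \<in> IV"
        using Suc.prems by (intro IV_add IV_mult Suc.IH) simp_all
      then show "c * (el_x ^ i * el_y ^ j) \<in> IV"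
        by (simp add: c algebra_simps)
    qed
  qed
  from this[of 0 0 "K + L"] have "(1 :: 'k fps2) \<in> IV"
    by simp
  then show ?thesis
    by (simp add: IV_def)
qed

lemma V_axes:
  assumes "f \<in> V" "rx g = rx f" "ry g = ry f"
  shows "g \<in> V"
proof -
  have "el_w dvd g - f"
    using assms(2,3) by (simp flip: axes_zero_iff)
  then obtain r where "g = f + el_w * r"
    by (auto simp: dvd_def algebra_simps)
  then show ?thesis
    using V_closed(2)[OF assms(1) w_mult_in_V] by simp
qed

text \<open>With the factor \<open>fps_X ^ 2\<close> the lift vanishes on the other axis, so that
  the two axes decouple. The set may exceed the restrictions of V: for V =
  \<open>Mset even odd\<close> it contains 1, although elements of V have no constant term.\<close>

definition Wx :: "'k fps set" where "Wx = {\<alpha>. cx (fps_X ^ 2 * \<alpha>) \<in> V}"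
definition Wy :: "'k fps set" where "Wy = {\<beta>. cy (fps_X ^ 2 * \<beta>) \<in> V}"

lemma max_A_axes:
  fixes c :: "'k fps2"
  assumes "c \<in> max_A"
  obtains \<gamma> \<delta> where "rx c = fps_X ^ 2 * \<gamma>" "ry c = fps_X ^ 2 * \<delta>" "\<gamma> \<in> supp_on even" "\<delta> \<in> supp_on even"
proof -
  have c: "rx c \<in> supp_on even" "fps_nth (rx c) 0 = 0" "ry c \<in> supp_on even" "fps_nth (ry c) 0 = 0"
    using assms by (simp_all add: max_A_def Mset_def)
  obtain \<gamma> where \<gamma>: "rx c = fps_X ^ 2 * \<gamma>" "\<gamma> \<in> supp_on even"
    using supp_on_even_no_const[OF c(1,2)] .
  obtain \<delta> where \<delta>: "ry c = fps_X ^ 2 * \<delta>" "\<delta> \<in> supp_on even"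
    using supp_on_even_no_const[OF c(3,4)] .
  show thesis
    by (rule that[OF \<gamma>(1) \<delta>(1) \<gamma>(2) \<delta>(2)])
qed

lemma X2_nth_0: "fps_nth (fps_X ^ 2 * (\<alpha> :: 'k fps)) 0 = 0"
  by (simp add: power2_eq_square mult.assoc)

text \<open>If f is in V, then u f and v f have the restrictions of the lifts that define
  \<open>Wx\<close> and \<open>Wy\<close>. Conversely, each non-unit c of A restricts to even
  multiples of the square of z, so c f agrees on the axes with a combination of the lifts and is in
  V; saturation then gives f.\<close>

lemma V_iff: "f \<in> V \<longleftrightarrow> rx f \<in> Wx \<and> ry f \<in> Wy"
proof
  assume f: "f \<in> V"
  have "rx (cx (fps_X ^ 2 * rx f)) = rx (el_u * f)" "ry (cx (fps_X ^ 2 * rx f)) = ry (el_u * f)"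
    "rx (cy (fps_X ^ 2 * ry f)) = rx (el_v * f)" "ry (cy (fps_X ^ 2 * ry f)) = ry (el_v * f)"
    by (simp_all only: rx_cx ry_cx rx_cy ry_cy X2_nth_0) (simp_all add: el_u_def el_v_def)
  then show "rx f \<in> Wx \<and> ry f \<in> Wy"
    unfolding Wx_def Wy_def mem_Collect_eq
    using V_axes[OF V_closed(3)[OF uvwab_in_A(1) f]] V_axes[OF V_closed(3)[OF uvwab_in_A(2) f]] by blast
next
  assume W: "rx f \<in> Wx \<and> ry f \<in> Wy"
  show "f \<in> V"
  proof (rule sat)
    fix c :: "'k fps2"
    assume "c \<in> max_A"
    then obtain \<gamma> \<delta> where c: "rx c = fps_X ^ 2 * \<gamma>" "ry c = fps_X ^ 2 * \<delta>" "\<gamma> \<in> supp_on even" "\<delta> \<in> supp_on even"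
      by (rule max_A_axes)
    let ?g = "cx \<gamma> * cx (fps_X ^ 2 * rx f) + cy \<delta> * cy (fps_X ^ 2 * ry f)"
    have "?g \<in> V"
      using W unfolding Wx_def Wy_def mem_Collect_eq by (intro V_closed(2,3) cx_in_A cy_in_A c) blast+
    then show "c * f \<in> V"
    proof (rule V_axes)
      show "rx (c * f) = rx ?g" "ry (c * f) = ry ?g"
        by (simp_all only: rx_hom ry_hom rx_cx ry_cx rx_cy ry_cy X2_nth_0 c) (simp_all add: mult_ac)
    qed
  qed
qed

lemma Wx_sat: "fps_X ^ 2 * \<alpha> \<in> Wx \<Longrightarrow> \<alpha> \<in> Wx"
  and Wy_sat: "fps_X ^ 2 * \<alpha> \<in> Wy \<Longrightarrow> \<alpha> \<in> Wy"
proof -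
  have 0: "(0 :: 'k fps) \<in> Wx" "(0 :: 'k fps) \<in> Wy"
    using V_closed(1) by (simp_all add: Wx_def Wy_def)
  show "\<alpha> \<in> Wx" if "fps_X ^ 2 * \<alpha> \<in> Wx"
  proof -
    have "cx (fps_X ^ 2 * \<alpha>) \<in> V"
      unfolding V_iff rx_cx ry_cx X2_nth_0 using that 0 by simp
    then show ?thesis
      by (simp add: Wx_def)
  qed
  show "\<alpha> \<in> Wy" if "fps_X ^ 2 * \<alpha> \<in> Wy"
  proof -
    have "cy (fps_X ^ 2 * \<alpha>) \<in> V"
      unfolding V_iff rx_cy ry_cy X2_nth_0 using that 0 by simp
    then show ?thesis
      by (simp add: Wy_def)
  qed
qed

text \<open>If all elements of V vanished on an axis, they would share the factor y or x, and
  \<open>colon\<close> would make this factor divide 1.\<close>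

lemma Wx_nonzero: "\<exists>\<alpha>\<in>Wx. \<alpha> \<noteq> 0" and Wy_nonzero: "\<exists>\<alpha>\<in>Wy. \<alpha> \<noteq> 0"
proof -
  show "\<exists>\<alpha>\<in>Wx. \<alpha> \<noteq> 0"
  proof (rule ccontr)
    assume n: "\<not> (\<exists>\<alpha>\<in>Wx. \<alpha> \<noteq> 0)"
    have "el_y dvd 1 * v" if "v \<in> V" for v
    proof -
      have "rx v = 0"
        using n that unfolding V_iff by blast
      then show ?thesis
        by (simp add: rx_zero_iff)
    qed
    then have "el_y dvd (1 :: 'k fps2)"
      by (rule colon[OF xy_nonzero(2)])
    then have "rx (1 :: 'k fps2) = 0"
      by (simp only: rx_zero_iff)
    then show False
      by simp
  qed
  show "\<exists>\<alpha>\<in>Wy. \<alpha> \<noteq> 0"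
  proof (rule ccontr)
    assume n: "\<not> (\<exists>\<alpha>\<in>Wy. \<alpha> \<noteq> 0)"
    have "el_x dvd 1 * v" if "v \<in> V" for v
    proof -
      have "ry v = 0"
        using n that unfolding V_iff by blast
      then show ?thesis
        by (simp add: ry_zero_iff)
    qed
    then have "el_x dvd (1 :: 'k fps2)"
      by (rule colon[OF xy_nonzero(1)])
    then have "ry (1 :: 'k fps2) = 0"
      by (simp only: ry_zero_iff)
    then show False
      by simp
  qed
qed

theorem shape:
  obtains P Q q where "P \<in> kinds" "Q \<in> kinds" "cf q 0 0 = 1" "\<And>f. q * f \<in> V \<longleftrightarrow> f \<in> Mset P Q"
proof -
  have "\<exists>P\<in>kinds. \<exists>\<epsilon>. fps_nth \<epsilon> 0 = 1 \<and> (\<forall>\<alpha>. \<epsilon> * \<alpha> \<in> Wx \<longleftrightarrow> \<alpha> \<in> supp_on P)"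
  proof (rule saturated_lattice[OF _ _ Wx_sat Wx_nonzero])
    show "\<alpha> - \<beta> \<in> Wx" if "\<alpha> \<in> Wx" "\<beta> \<in> Wx" for \<alpha> \<beta>
      using that V_closed(5) by (simp add: Wx_def right_diff_distrib)
    show "c * \<alpha> \<in> Wx" if "\<alpha> \<in> Wx" "c \<in> supp_on even" for \<alpha> c
      using V_closed(3)[OF cx_in_A[OF that(2)], of "cx (fps_X ^ 2 * \<alpha>)"] that(1) unfolding Wx_def by (simp add: mult.left_commute[of "cx c"])
  qed
  then obtain P \<epsilon> where P: "P \<in> kinds" "fps_nth \<epsilon> 0 = 1" "\<And>\<alpha>. \<epsilon> * \<alpha> \<in> Wx \<longleftrightarrow> \<alpha> \<in> supp_on P"
    by blast
  have "\<exists>Q\<in>kinds. \<exists>\<epsilon>. fps_nth \<epsilon> 0 = 1 \<and> (\<forall>\<alpha>. \<epsilon> * \<alpha> \<in> Wy \<longleftrightarrow> \<alpha> \<in> supp_on Q)"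
  proof (rule saturated_lattice[OF _ _ Wy_sat Wy_nonzero])
    show "\<alpha> - \<beta> \<in> Wy" if "\<alpha> \<in> Wy" "\<beta> \<in> Wy" for \<alpha> \<beta>
      using that V_closed(5) by (simp add: Wy_def right_diff_distrib)
    show "c * \<alpha> \<in> Wy" if "\<alpha> \<in> Wy" "c \<in> supp_on even" for \<alpha> c
      using V_closed(3)[OF cy_in_A[OF that(2)], of "cy (fps_X ^ 2 * \<alpha>)"] that(1) unfolding Wy_def by (simp add: mult.left_commute[of "cy c"])
  qed
  then obtain Q \<epsilon>' where Q: "Q \<in> kinds" "fps_nth \<epsilon>' 0 = 1" "\<And>\<alpha>. \<epsilon>' * \<alpha> \<in> Wy \<longleftrightarrow> \<alpha> \<in> supp_on Q"
    by blast
  \<comment> \<open>A unit of R with the prescribed restrictions \<epsilon> and \<epsilon>'; it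
    exists because both have constant term 1.\<close>
  define q where "q = cx \<epsilon> + cy \<epsilon>' - 1"
  have q: "rx q = \<epsilon>" "ry q = \<epsilon>'"
    using P(2) Q(2) by (simp_all add: q_def)
  show thesis
  proof (rule that[OF P(1) Q(1)])
    show "cf q 0 0 = 1"
      using nth_rx[of q 0] q(1) P(2) by simp
    show "q * f \<in> V \<longleftrightarrow> f \<in> Mset P Q" for f
      by (simp add: V_iff q P(3) Q(3) Mset_def)
  qed
qed

end

section \<open>Classification\<close>

definition A_linear :: "('k::field fps2, 'm) module \<Rightarrow> ('m \<Rightarrow> 'k fps2) \<Rightarrow> bool" where
  "A_linear M \<phi> \<longleftrightarrow> (\<forall>m\<in>carrier M. \<forall>n\<in>carrier M. \<phi> (m \<oplus>\<^bsub>M\<^esub> n) = \<phi> m + \<phi> n) \<and>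
     (\<forall>c\<in>Mset even even. \<forall>m\<in>carrier M. \<phi> (c \<odot>\<^bsub>M\<^esub> m) = c * \<phi> m)"

lemma A_linearD:
  assumes "A_linear M \<phi>"
  shows "m \<in> carrier M \<Longrightarrow> n \<in> carrier M \<Longrightarrow> \<phi> (m \<oplus>\<^bsub>M\<^esub> n) = \<phi> m + \<phi> n"
    "c \<in> Mset even even \<Longrightarrow> m \<in> carrier M \<Longrightarrow> \<phi> (c \<odot>\<^bsub>M\<^esub> m) = c * \<phi> m"
  using assms by (simp_all add: A_linear_def)

text \<open>If the reflexive hull \<open>H\<close> is free on \<open>\<delta>\<^sub>0\<close>, then \<open>M \<rightarrow> H\<close> is \<open>m \<mapsto> j(m) \<delta>\<^sub>0\<close>, and evaluating at the functional induced by
  \<open>\<phi>: M \<rightarrow> R\<close> shows that \<open>\<phi>\<close> is a multiple of \<open>j\<close>.\<close>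

lemma rank_one_map:
  fixes M :: "('k::field fps2, 'm) module"
  assumes M: "module ring_A M" and rk: "has_rank M 1"
  shows "\<exists>j. A_linear M j \<and> (\<forall>\<phi>. A_linear M \<phi> \<longrightarrow> (\<exists>r. \<forall>m\<in>carrier M. \<phi> m = r * j m))"
proof -
  interpret T: tensor ring_A ring_R "\<lambda>f. f" M
    by (intro tensor.intro M cring_from_type_algebra ring_homs)
  define reg where "reg = regular_module (ring_R :: 'k fps2 ring)"
  have module_reg: "module (ring_R :: 'k fps2 ring) reg"
    unfolding reg_def by (intro regular_module_is_module cring_from_type_algebra)
  define HH where "HH = reflexive_hull M"
  note h = reflexive_hull_map_hom[OF M, folded HH_def]
  interpret H: module ring_R HH
    by (rule h(1))
  obtain \<Psi> where \<Psi>: "\<Psi> \<in> module_hom ring_R HH (module_vec TYPE('k fps2) 1)"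
    and bij: "bij_betw \<Psi> (carrier HH) (carrier (module_vec TYPE('k fps2) 1))"
    using rk unfolding has_rank_def module_isomorphic_def module_iso_def HH_def by blast
  have \<Psi>h: "\<Psi> \<delta> \<in> carrier_vec 1" "\<Psi> (\<delta> \<oplus>\<^bsub>HH\<^esub> \<delta>') = \<Psi> \<delta> + \<Psi> \<delta>'" "\<Psi> (c \<odot>\<^bsub>HH\<^esub> \<delta>) = c \<cdot>\<^sub>v \<Psi> \<delta>"
    if "\<delta> \<in> carrier HH" "\<delta>' \<in> carrier HH" for \<delta> \<delta>' c
    using \<Psi> that by (auto simp: module_hom_def module_vec_simps)
  define j where "j m = vec_index (\<Psi> (to_reflexive_hull M m)) 0" for m
  have j: "A_linear M j"
    unfolding A_linear_def
  proof (intro conjI ballI)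
    show "j (m \<oplus>\<^bsub>M\<^esub> n) = j m + j n" if "m \<in> carrier M" "n \<in> carrier M" for m n
      using \<Psi>h(1)[OF h(2)[OF that(1)] h(2)[OF that(1)]] \<Psi>h(1)[OF h(2)[OF that(2)] h(2)[OF that(2)]]
      unfolding j_def h(3)[OF that] \<Psi>h(2)[OF h(2)[OF that(1)] h(2)[OF that(2)]] by simp
    show "j (c \<odot>\<^bsub>M\<^esub> m) = c * j m" if "c \<in> Mset even even" "m \<in> carrier M" for c m
      using \<Psi>h(1)[OF h(2)[OF that(2)] h(2)[OF that(2)]]
      unfolding j_def h(4)[OF that] \<Psi>h(3)[OF h(2)[OF that(2)] h(2)[OF that(2)]] by simp
  qed
  have "unit_vec 1 0 \<in> \<Psi> ` carrier HH"
    using bij by (simp add: bij_betw_def module_vec_simps)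
  then obtain \<delta>0 where "unit_vec 1 0 = \<Psi> \<delta>0" "\<delta>0 \<in> carrier HH"
    by (rule imageE)
  then have \<delta>0: "\<delta>0 \<in> carrier HH" "\<Psi> \<delta>0 = unit_vec 1 0"
    by (simp_all only:)
  have ev: "to_reflexive_hull M m = j m \<odot>\<^bsub>HH\<^esub> \<delta>0" if m: "m \<in> carrier M" for m
  proof -
    have c: "j m \<odot>\<^bsub>HH\<^esub> \<delta>0 \<in> carrier HH"
      by (rule H.smult_closed[OF _ \<delta>0(1)]) simp
    have eq: "\<Psi> (to_reflexive_hull M m) = \<Psi> (j m \<odot>\<^bsub>HH\<^esub> \<delta>0)"
      unfolding \<Psi>h(3)[OF \<delta>0(1) \<delta>0(1)] \<delta>0(2) using \<Psi>h(1)[OF h(2)[OF m] h(2)[OF m]]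
      by (intro eq_vecI) (auto simp: j_def)
    show ?thesis
      by (rule inj_onD[OF bij_betw_imp_inj_on[OF bij] eq h(2)[OF m] c])
  qed
  have "\<exists>r. \<forall>m\<in>carrier M. \<phi> m = r * j m" if \<phi>: "A_linear M \<phi>" for \<phi>
  proof -
    define \<phi>t where "\<phi>t = base_change_adjoint ring_A ring_R (\<lambda>f. f) M reg \<phi>"
    note adj = T.adjoint[OF module_reg, of \<phi>, folded \<phi>t_def]
    have 1: "\<phi>t \<in> module_hom ring_R T.T reg"
      by (rule adj(1)) (simp_all add: reg_def A_linearD[OF \<phi>])
    have 2: "\<phi>t \<in> extensional (carrier T.T)"
      by (rule adj(2)) (simp_all add: reg_def A_linearD[OF \<phi>])
    have 3: "\<phi>t (T.pt 1 m) = \<phi> m" if "m \<in> carrier M" for m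
      using adj(3)[of 1 m] that by (simp add: reg_def A_linearD[OF \<phi>])
    have D: "\<phi>t \<in> carrier (dual_module ring_R T.T)"
      using 1 2 by (simp add: reg_def)
    have "\<phi> m = \<delta>0 \<phi>t * j m" if m: "m \<in> carrier M" for m
    proof -
      have "\<phi> m = to_reflexive_hull M m \<phi>t"
        unfolding to_reflexive_hull_def bidual_map_def restrict_apply'[OF D] by (rule 3[OF m, symmetric])
      also have "\<dots> = j m * \<delta>0 \<phi>t"
        unfolding ev[OF m] HH_def reflexive_hull_def dual_module_simps(4) restrict_apply'[OF D] by simp
      finally show ?thesis
        by (simp only: mult.commute)
    qed
    then show ?thesis
      by blast
  qed
  then show ?thesis
    using j by blast
qed

section \<open>Functionals on finitely generated torsion-free modules\<close>

lemma finitely_generated_induct: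
  assumes M: "module ring_A M" and fg: "finitely_generated_module ring_A M"
  obtains gs where "set gs \<subseteq> carrier M"
    and "\<forall>Pr. Pr \<zero>\<^bsub>M\<^esub> \<and> (\<forall>m\<in>carrier M. \<forall>n\<in>carrier M. Pr m \<longrightarrow> Pr n \<longrightarrow> Pr (m \<oplus>\<^bsub>M\<^esub> n)) \<and>
      (\<forall>c\<in>Mset even even. \<forall>m\<in>carrier M. Pr m \<longrightarrow> Pr (c \<odot>\<^bsub>M\<^esub> m)) \<and> (\<forall>g\<in>set gs. Pr g) \<longrightarrow> (\<forall>m\<in>carrier M. Pr m)"
proof -
  interpret module ring_A M
    by (rule M)
  obtain gs where gs0: "set gs \<subseteq> carrier M \<and>
    (\<forall>m\<in>carrier M. \<exists>c \<in> {..<length gs} \<rightarrow> Mset even even. m = (\<Oplus>\<^bsub>M\<^esub>i\<in>{..<length gs}. c i \<odot>\<^bsub>M\<^esub> gs ! i))"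
    using fg unfolding finitely_generated_module_def ring_A_simps by (rule exE)
  note gs = conjunct1[OF gs0] bspec[OF conjunct2[OF gs0]]
  have ind: "Pr m"
    if 0: "Pr \<zero>\<^bsub>M\<^esub>" and add: "\<And>m n. m \<in> carrier M \<Longrightarrow> n \<in> carrier M \<Longrightarrow> Pr m \<Longrightarrow> Pr n \<Longrightarrow> Pr (m \<oplus>\<^bsub>M\<^esub> n)"
      and smult: "\<And>c m. c \<in> Mset even even \<Longrightarrow> m \<in> carrier M \<Longrightarrow> Pr m \<Longrightarrow> Pr (c \<odot>\<^bsub>M\<^esub> m)"
      and g: "\<And>g. g \<in> set gs \<Longrightarrow> Pr g" and m: "m \<in> carrier M" for Pr m
  proof -
    obtain c where c: "c \<in> {..<length gs} \<rightarrow> Mset even even" "m = (\<Oplus>\<^bsub>M\<^esub>i\<in>{..<length gs}. c i \<odot>\<^bsub>M\<^esub> gs ! i)"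
      using gs(2)[OF m] by (rule bexE)
    have ci: "c i \<odot>\<^bsub>M\<^esub> gs ! i \<in> carrier M \<and> Pr (c i \<odot>\<^bsub>M\<^esub> gs ! i)" if "i < length gs" for i
    proof -
      have "c i \<in> Mset even even" "gs ! i \<in> carrier M" "Pr (gs ! i)"
        using c(1) gs(1) g nth_mem[OF that] that by (auto simp: Pi_iff)
      then show ?thesis
        using smult smult_closed[of "c i" "gs ! i"] by simp
    qed
    have "Pr (\<Oplus>\<^bsub>M\<^esub>i\<in>F. c i \<odot>\<^bsub>M\<^esub> gs ! i) \<and> (\<Oplus>\<^bsub>M\<^esub>i\<in>F. c i \<odot>\<^bsub>M\<^esub> gs ! i) \<in> carrier M"
      if "finite F" "F \<subseteq> {..<length gs}" for F
      using that
    proof (induction F rule: finite_induct)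
      case empty
      then show ?case
        using 0 by simp
    next
      case (insert i F)
      have i: "c i \<odot>\<^bsub>M\<^esub> gs ! i \<in> carrier M" "Pr (c i \<odot>\<^bsub>M\<^esub> gs ! i)"
        using ci[of i] insert.prems by auto
      have F: "(\<lambda>i. c i \<odot>\<^bsub>M\<^esub> gs ! i) \<in> F \<rightarrow> carrier M"
        using ci insert.prems by auto
      have IH: "Pr (\<Oplus>\<^bsub>M\<^esub>i\<in>F. c i \<odot>\<^bsub>M\<^esub> gs ! i)" "(\<Oplus>\<^bsub>M\<^esub>i\<in>F. c i \<odot>\<^bsub>M\<^esub> gs ! i) \<in> carrier M"
        using insert.IH insert.prems by auto
      show ?case
        unfolding M.finsum_insert[OF insert.hyps F i(1)] using add[OF i(1) IH(2) i(2) IH(1)] M.a_closed[OF i(1) IH(2)] by simp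
    qed
    from this[of "{..<length gs}"] show ?thesis
      by (simp add: c(2))
  qed
  show thesis
  proof (rule that[OF gs(1)], intro allI impI ballI, elim conjE)
    fix Pr m
    assume 0: "Pr \<zero>\<^bsub>M\<^esub>" and add: "\<forall>m\<in>carrier M. \<forall>n\<in>carrier M. Pr m \<longrightarrow> Pr n \<longrightarrow> Pr (m \<oplus>\<^bsub>M\<^esub> n)"
      and smult: "\<forall>c\<in>Mset even even. \<forall>m\<in>carrier M. Pr m \<longrightarrow> Pr (c \<odot>\<^bsub>M\<^esub> m)" and g: "\<forall>g\<in>set gs. Pr g" and m: "m \<in> carrier M"
    show "Pr m"
      by (rule ind[of Pr, OF 0 add[rule_format] smult[rule_format] g[rule_format] m])
  qed
qed

definition partial_linear :: "('k::field fps2, 'm) module \<Rightarrow> 'm set \<Rightarrow> ('m \<Rightarrow> 'k fps2) \<Rightarrow> bool" where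
  "partial_linear M H \<phi> \<longleftrightarrow> H \<subseteq> carrier M \<and> \<zero>\<^bsub>M\<^esub> \<in> H \<and> A_linear (M\<lparr>carrier := H\<rparr>) \<phi> \<and>
     (\<forall>x\<in>H. \<forall>y\<in>H. x \<oplus>\<^bsub>M\<^esub> y \<in> H) \<and> (\<forall>c\<in>Mset even even. \<forall>x\<in>H. c \<odot>\<^bsub>M\<^esub> x \<in> H)"

lemma partial_linear_extend:
  fixes M :: "('k::field fps2, 'm) module"
  assumes M: "module ring_A M" and pl: "partial_linear M H \<phi>" and g: "g \<in> carrier M"
  shows "\<exists>H' \<phi>'. partial_linear M H' \<phi>' \<and> H \<subseteq> H' \<and> g \<in> H' \<and> (\<exists>s. s \<noteq> 0 \<and> (\<forall>h\<in>H. \<phi>' h = s * \<phi> h)) \<and>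
    ((\<forall>s\<in>Mset even even. s \<noteq> 0 \<longrightarrow> s \<odot>\<^bsub>M\<^esub> g \<notin> H) \<longrightarrow> \<phi>' g \<noteq> 0)"
proof -
  interpret module ring_A M
    by (rule M)
  have H: "\<And>x. x \<in> H \<Longrightarrow> x \<in> carrier M" "\<zero>\<^bsub>M\<^esub> \<in> H" "\<And>x y. x \<in> H \<Longrightarrow> y \<in> H \<Longrightarrow> x \<oplus>\<^bsub>M\<^esub> y \<in> H"
    "\<And>c x. c \<in> Mset even even \<Longrightarrow> x \<in> H \<Longrightarrow> c \<odot>\<^bsub>M\<^esub> x \<in> H"
    and lin: "\<And>x y. x \<in> H \<Longrightarrow> y \<in> H \<Longrightarrow> \<phi> (x \<oplus>\<^bsub>M\<^esub> y) = \<phi> x + \<phi> y"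
    "\<And>c x. c \<in> Mset even even \<Longrightarrow> x \<in> H \<Longrightarrow> \<phi> (c \<odot>\<^bsub>M\<^esub> x) = c * \<phi> x"
    using pl unfolding partial_linear_def A_linear_def by auto
  have sm: "c \<odot>\<^bsub>M\<^esub> x \<in> carrier M" if "c \<in> Mset even even" "x \<in> carrier M" for c x
    using smult_closed[of c x] that by simp
  have ld: "(c + d) \<odot>\<^bsub>M\<^esub> x = c \<odot>\<^bsub>M\<^esub> x \<oplus>\<^bsub>M\<^esub> d \<odot>\<^bsub>M\<^esub> x" if "c \<in> Mset even even" "d \<in> Mset even even" "x \<in> carrier M" for c d x
    using smult_l_distr[of c d x] that by simp
  have rd: "c \<odot>\<^bsub>M\<^esub> (x \<oplus>\<^bsub>M\<^esub> y) = c \<odot>\<^bsub>M\<^esub> x \<oplus>\<^bsub>M\<^esub> c \<odot>\<^bsub>M\<^esub> y" if "c \<in> Mset even even" "x \<in> carrier M" "y \<in> carrier M" for c x y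
    using smult_r_distr[of c x y] that by simp
  have as: "c \<odot>\<^bsub>M\<^esub> (d \<odot>\<^bsub>M\<^esub> x) = (c * d) \<odot>\<^bsub>M\<^esub> x" if "c \<in> Mset even even" "d \<in> Mset even even" "x \<in> carrier M" for c d x
    using smult_assoc1[of c d x] that by simp
  have null: "0 \<odot>\<^bsub>M\<^esub> x = \<zero>\<^bsub>M\<^esub>" "1 \<odot>\<^bsub>M\<^esub> x = x" if "x \<in> carrier M" for x
    using smult_l_null[OF that] smult_one[OF that] by simp_all
  define H' where "H' = {h \<oplus>\<^bsub>M\<^esub> a \<odot>\<^bsub>M\<^esub> g | h a. h \<in> H \<and> a \<in> Mset even even}"
  have H'I: "h \<oplus>\<^bsub>M\<^esub> a \<odot>\<^bsub>M\<^esub> g \<in> H'" if "h \<in> H" "a \<in> Mset even even" for h a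
    using that unfolding H'_def by blast
  have H'E: "\<exists>h\<in>H. \<exists>a\<in>Mset even even. x = h \<oplus>\<^bsub>M\<^esub> a \<odot>\<^bsub>M\<^esub> g" if "x \<in> H'" for x
    using that unfolding H'_def by blast
  have comb_add: "(h \<oplus>\<^bsub>M\<^esub> a \<odot>\<^bsub>M\<^esub> g) \<oplus>\<^bsub>M\<^esub> (h' \<oplus>\<^bsub>M\<^esub> a' \<odot>\<^bsub>M\<^esub> g) = (h \<oplus>\<^bsub>M\<^esub> h') \<oplus>\<^bsub>M\<^esub> (a + a') \<odot>\<^bsub>M\<^esub> g"
    if "h \<in> H" "h' \<in> H" "a \<in> Mset even even" "a' \<in> Mset even even" for h h' a a'
    using that ld[OF that(3,4) g] H(1)[OF that(1)] H(1)[OF that(2)] sm[OF that(3) g] sm[OF that(4) g]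
    by (simp add: M.a_ac)
  have comb_smult: "c \<odot>\<^bsub>M\<^esub> (h \<oplus>\<^bsub>M\<^esub> a \<odot>\<^bsub>M\<^esub> g) = (c \<odot>\<^bsub>M\<^esub> h) \<oplus>\<^bsub>M\<^esub> (c * a) \<odot>\<^bsub>M\<^esub> g"
    if "h \<in> H" "a \<in> Mset even even" "c \<in> Mset even even" for h a c
    using rd[OF that(3) H(1)[OF that(1)] sm[OF that(2) g]] as[OF that(3,2) g] by simp
  have sub: "H' \<subseteq> carrier M" "H \<subseteq> H'" "g \<in> H'" "\<zero>\<^bsub>M\<^esub> \<in> H'"
    and H'add: "\<And>x y. x \<in> H' \<Longrightarrow> y \<in> H' \<Longrightarrow> x \<oplus>\<^bsub>M\<^esub> y \<in> H'"
    and H'smult: "\<And>c x. c \<in> Mset even even \<Longrightarrow> x \<in> H' \<Longrightarrow> c \<odot>\<^bsub>M\<^esub> x \<in> H'"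
  proof -
    show "H' \<subseteq> carrier M"
      using H'E H(1) sm[OF _ g] by (metis M.a_closed subsetI)
    show HH': "H \<subseteq> H'"
    proof
      fix h
      assume h: "h \<in> H"
      show "h \<in> H'"
        using H'I[OF h, of 0] null(1)[OF g] H(1)[OF h] by simp
    qed
    show "g \<in> H'"
      using H'I[OF H(2), of 1] null(2)[OF g] g by simp
    show "\<zero>\<^bsub>M\<^esub> \<in> H'"
      using HH' H(2) by blast
    fix x
    assume "x \<in> H'"
    then obtain h a where x: "h \<in> H" "a \<in> Mset even even" "x = h \<oplus>\<^bsub>M\<^esub> a \<odot>\<^bsub>M\<^esub> g"
      using H'E by blast
    show "c \<odot>\<^bsub>M\<^esub> x \<in> H'" if "c \<in> Mset even even" for c
      unfolding x(3) comb_smult[OF x(1,2) that] by (rule H'I[OF H(4)[OF that x(1)] A_closed(6)[OF that x(2)]])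
    fix y
    assume "y \<in> H'"
    then obtain h' a' where y: "h' \<in> H" "a' \<in> Mset even even" "y = h' \<oplus>\<^bsub>M\<^esub> a' \<odot>\<^bsub>M\<^esub> g"
      using H'E by blast
    show "x \<oplus>\<^bsub>M\<^esub> y \<in> H'"
      unfolding x(3) y(3) comb_add[OF x(1) y(1) x(2) y(2)]
      by (rule H'I[OF H(3)[OF x(1) y(1)] A_closed(3)[OF x(2) y(2)]])
  qed
  have H'c: "x \<in> carrier M" if "x \<in> H'" for x
    using sub(1) that by blast
  show ?thesis
  proof (cases "\<exists>s\<in>Mset even even. s \<noteq> 0 \<and> s \<odot>\<^bsub>M\<^esub> g \<in> H")
    case True
    then obtain s where s: "s \<in> Mset even even" "s \<noteq> 0" "s \<odot>\<^bsub>M\<^esub> g \<in> H"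
      by blast
    have sH: "s \<odot>\<^bsub>M\<^esub> x \<in> H" if xH': "x \<in> H'" for x
    proof -
      obtain h a where x: "h \<in> H" "a \<in> Mset even even" "x = h \<oplus>\<^bsub>M\<^esub> a \<odot>\<^bsub>M\<^esub> g"
        using H'E[OF xH'] by blast
      have "s \<odot>\<^bsub>M\<^esub> x = s \<odot>\<^bsub>M\<^esub> h \<oplus>\<^bsub>M\<^esub> a \<odot>\<^bsub>M\<^esub> (s \<odot>\<^bsub>M\<^esub> g)"
        unfolding x(3) comb_smult[OF x(1,2) s(1)] as[OF x(2) s(1) g] by (simp only: mult.commute)
      then show ?thesis
        using H(3)[OF H(4)[OF s(1) x(1)] H(4)[OF x(2) s(3)]] by simp
    qed
    have "A_linear (M\<lparr>carrier := H'\<rparr>) (\<lambda>x. \<phi> (s \<odot>\<^bsub>M\<^esub> x))"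
      unfolding A_linear_def
    proof (intro conjI ballI)
      show "\<phi> (s \<odot>\<^bsub>M\<^esub> (x \<oplus>\<^bsub>M\<lparr>carrier := H'\<rparr>\<^esub> y)) = \<phi> (s \<odot>\<^bsub>M\<^esub> x) + \<phi> (s \<odot>\<^bsub>M\<^esub> y)"
        if "x \<in> carrier (M\<lparr>carrier := H'\<rparr>)" "y \<in> carrier (M\<lparr>carrier := H'\<rparr>)" for x y
        using that rd[OF s(1) H'c H'c, of x y] lin(1)[OF sH sH, of x y] by simp
      show "\<phi> (s \<odot>\<^bsub>M\<^esub> (c \<odot>\<^bsub>M\<lparr>carrier := H'\<rparr>\<^esub> x)) = c * \<phi> (s \<odot>\<^bsub>M\<^esub> x)"
        if "c \<in> Mset even even" "x \<in> carrier (M\<lparr>carrier := H'\<rparr>)" for c x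
        using that as[OF s(1) that(1) H'c, of x] as[OF that(1) s(1) H'c, of x] lin(2)[OF that(1) sH, of x] by (simp add: mult.commute)
    qed
    then have "partial_linear M H' (\<lambda>x. \<phi> (s \<odot>\<^bsub>M\<^esub> x))"
      unfolding partial_linear_def using sub H'add H'smult by blast
    moreover have "\<forall>h\<in>H. \<phi> (s \<odot>\<^bsub>M\<^esub> h) = s * \<phi> h"
      using lin(2)[OF s(1)] by blast
    ultimately show ?thesis
      using sub s by (intro exI[of _ H'] exI[of _ "\<lambda>x. \<phi> (s \<odot>\<^bsub>M\<^esub> x)"]) blast
  next
    case False
    have uniq: "a = a' \<and> h = h'"
      if h: "h \<in> H" "h' \<in> H" and a: "a \<in> Mset even even" "a' \<in> Mset even even" and eq: "h \<oplus>\<^bsub>M\<^esub> a \<odot>\<^bsub>M\<^esub> g = h' \<oplus>\<^bsub>M\<^esub> a' \<odot>\<^bsub>M\<^esub> g"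
      for h h' a a'
    proof -
      have m1: "- 1 \<in> Mset even even" "- a' \<in> Mset even even" "a + - a' \<in> Mset even even"
        using a by (auto simp del: add_uminus_conv_diff)
      have hM: "h \<in> carrier M" "h' \<in> carrier M" "(- 1) \<odot>\<^bsub>M\<^esub> h \<in> carrier M"
        "a \<odot>\<^bsub>M\<^esub> g \<in> carrier M" "a' \<odot>\<^bsub>M\<^esub> g \<in> carrier M" "(- a') \<odot>\<^bsub>M\<^esub> g \<in> carrier M"
        using h H(1) m1 a g by (auto intro: sm)
      have n1: "(- 1) \<odot>\<^bsub>M\<^esub> h \<oplus>\<^bsub>M\<^esub> h = \<zero>\<^bsub>M\<^esub>"
        using ld[OF m1(1) A_closed(2) hM(1)] null[OF hM(1)] by simp
      have n2: "a' \<odot>\<^bsub>M\<^esub> g \<oplus>\<^bsub>M\<^esub> (- a') \<odot>\<^bsub>M\<^esub> g = \<zero>\<^bsub>M\<^esub>"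
        using ld[OF a(2) m1(2) g] null(1)[OF g] by simp
      have "(a + - a') \<odot>\<^bsub>M\<^esub> g = ((- 1) \<odot>\<^bsub>M\<^esub> h \<oplus>\<^bsub>M\<^esub> h) \<oplus>\<^bsub>M\<^esub> (a \<odot>\<^bsub>M\<^esub> g \<oplus>\<^bsub>M\<^esub> (- a') \<odot>\<^bsub>M\<^esub> g)"
        unfolding n1 ld[OF a(1) m1(2) g] using hM by simp
      also have "\<dots> = (- 1) \<odot>\<^bsub>M\<^esub> h \<oplus>\<^bsub>M\<^esub> (h \<oplus>\<^bsub>M\<^esub> a \<odot>\<^bsub>M\<^esub> g) \<oplus>\<^bsub>M\<^esub> (- a') \<odot>\<^bsub>M\<^esub> g"
        using hM by (simp add: M.a_assoc)
      also have "\<dots> = ((- 1) \<odot>\<^bsub>M\<^esub> h \<oplus>\<^bsub>M\<^esub> h') \<oplus>\<^bsub>M\<^esub> (a' \<odot>\<^bsub>M\<^esub> g \<oplus>\<^bsub>M\<^esub> (- a') \<odot>\<^bsub>M\<^esub> g)"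
        unfolding eq using hM by (simp add: M.a_assoc)
      also have "\<dots> = (- 1) \<odot>\<^bsub>M\<^esub> h \<oplus>\<^bsub>M\<^esub> h'"
        unfolding n2 using hM by simp
      finally have "(a + - a') \<odot>\<^bsub>M\<^esub> g \<in> H"
        using H(3)[OF H(4)[OF m1(1) h(1)] h(2)] by simp
      then have "a + - a' = 0"
        using False m1(3) by blast
      then have aa: "a = a'"
        by simp
      then show ?thesis
        using eq hM by simp
    qed
    \<comment> \<open>The value is independent of the representation because the sum is direct, as
      shown by \<open>uniq\<close>.\<close>
    define \<phi>' where "\<phi>' x = (SOME y. \<exists>h\<in>H. \<exists>a\<in>Mset even even. x = h \<oplus>\<^bsub>M\<^esub> a \<odot>\<^bsub>M\<^esub> g \<and> y = \<phi> h + a)" for x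
    have \<phi>': "\<phi>' (h \<oplus>\<^bsub>M\<^esub> a \<odot>\<^bsub>M\<^esub> g) = \<phi> h + a" if ha: "h \<in> H" "a \<in> Mset even even" for h a
      unfolding \<phi>'_def
    proof (rule some_equality)
      show "\<exists>h'\<in>H. \<exists>a'\<in>Mset even even. h \<oplus>\<^bsub>M\<^esub> a \<odot>\<^bsub>M\<^esub> g = h' \<oplus>\<^bsub>M\<^esub> a' \<odot>\<^bsub>M\<^esub> g \<and> \<phi> h + a = \<phi> h' + a'"
        using ha by blast
      fix y
      assume "\<exists>h'\<in>H. \<exists>a'\<in>Mset even even. h \<oplus>\<^bsub>M\<^esub> a \<odot>\<^bsub>M\<^esub> g = h' \<oplus>\<^bsub>M\<^esub> a' \<odot>\<^bsub>M\<^esub> g \<and> y = \<phi> h' + a'"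
      then show "y = \<phi> h + a"
        using uniq[OF ha(1) _ ha(2)] by blast
    qed
    have "A_linear (M\<lparr>carrier := H'\<rparr>) \<phi>'"
      unfolding A_linear_def
    proof (intro conjI ballI)
      fix x
      assume "x \<in> carrier (M\<lparr>carrier := H'\<rparr>)"
      then have "x \<in> H'"
        by simp
      then obtain h a where x: "h \<in> H" "a \<in> Mset even even" "x = h \<oplus>\<^bsub>M\<^esub> a \<odot>\<^bsub>M\<^esub> g"
        using H'E by blast
      show "\<phi>' (x \<oplus>\<^bsub>M\<lparr>carrier := H'\<rparr>\<^esub> y) = \<phi>' x + \<phi>' y" if yH: "y \<in> carrier (M\<lparr>carrier := H'\<rparr>)" for y
      proof -
        have "y \<in> H'"
          using yH by simp
        then obtain h' a' where y: "h' \<in> H" "a' \<in> Mset even even" "y = h' \<oplus>\<^bsub>M\<^esub> a' \<odot>\<^bsub>M\<^esub> g"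
          using H'E by blast
        have "\<phi>' (x \<oplus>\<^bsub>M\<^esub> y) = \<phi> (h \<oplus>\<^bsub>M\<^esub> h') + (a + a')"
          unfolding x(3) y(3) comb_add[OF x(1) y(1) x(2) y(2)] by (rule \<phi>'[OF H(3)[OF x(1) y(1)] A_closed(3)[OF x(2) y(2)]])
        then show ?thesis
          unfolding x(3) y(3) \<phi>'[OF x(1,2)] \<phi>'[OF y(1,2)] using lin(1)[OF x(1) y(1)] by simp
      qed
      show "\<phi>' (c \<odot>\<^bsub>M\<lparr>carrier := H'\<rparr>\<^esub> x) = c * \<phi>' x" if c: "c \<in> Mset even even" for c
      proof -
        have "\<phi>' (c \<odot>\<^bsub>M\<^esub> x) = \<phi> (c \<odot>\<^bsub>M\<^esub> h) + c * a"
          unfolding x(3) comb_smult[OF x(1,2) c] by (rule \<phi>'[OF H(4)[OF c x(1)] A_closed(6)[OF c x(2)]])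
        then show ?thesis
          unfolding x(3) \<phi>'[OF x(1,2)] using lin(2)[OF c x(1)] by (simp add: distrib_left)
      qed
    qed
    then have "partial_linear M H' \<phi>'"
      unfolding partial_linear_def using sub H'add H'smult by blast
    moreover have "\<phi>' h = 1 * \<phi> h" if "h \<in> H" for h
      using \<phi>'[OF that, of 0] null(1)[OF g] H(1)[OF that] by simp
    moreover have "\<phi>' g \<noteq> 0"
    proof -
      have "\<phi> \<zero>\<^bsub>M\<^esub> = 0"
        using lin(2)[of 0, OF _ H(2)] null(1)[OF M.zero_closed] by simp
      then show ?thesis
        using \<phi>'[OF H(2), of 1] null(2)[OF g] g by simp
    qed
    ultimately show ?thesis
      using sub by (intro exI[of _ H'] exI[of _ \<phi>'] conjI exI[of _ 1]) simp_all
  qed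
qed

text \<open>The map is first extended from zero to the multiples of m, where torsion-freeness allows
  a non-zero value, and then to the finitely many generators. Each extension multiplies the value at
  m by a non-zero factor.\<close>

lemma separating_functional:
  fixes M :: "('k::field fps2, 'm) module"
  assumes M: "module ring_A M" and fg: "finitely_generated_module ring_A M"
    and tf: "\<And>s t. s \<in> Mset even even \<Longrightarrow> s \<noteq> 0 \<Longrightarrow> t \<in> carrier M \<Longrightarrow> s \<odot>\<^bsub>M\<^esub> t = \<zero>\<^bsub>M\<^esub> \<Longrightarrow> t = \<zero>\<^bsub>M\<^esub>"
    and m: "m \<in> carrier M" "m \<noteq> \<zero>\<^bsub>M\<^esub>"
  shows "\<exists>\<phi>. A_linear M \<phi> \<and> \<phi> m \<noteq> 0"
proof -
  interpret module ring_A M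
    by (rule M)
  obtain gs where gs: "set gs \<subseteq> carrier M"
    and gen: "\<forall>Pr. Pr \<zero>\<^bsub>M\<^esub> \<and> (\<forall>m\<in>carrier M. \<forall>n\<in>carrier M. Pr m \<longrightarrow> Pr n \<longrightarrow> Pr (m \<oplus>\<^bsub>M\<^esub> n)) \<and>
      (\<forall>c\<in>Mset even even. \<forall>m\<in>carrier M. Pr m \<longrightarrow> Pr (c \<odot>\<^bsub>M\<^esub> m)) \<and> (\<forall>g\<in>set gs. Pr g) \<longrightarrow> (\<forall>m\<in>carrier M. Pr m)"
    by (rule finitely_generated_induct[OF M fg])
  have base: "partial_linear M {\<zero>\<^bsub>M\<^esub>} (\<lambda>_. 0)"
    using smult_r_null by (simp add: partial_linear_def A_linear_def)
  \<comment> \<open>Starting from the zero submodule, the condition that no non-zero scalar sends m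
    into it is exactly torsion-freeness at m.\<close>
  obtain H0 \<phi>0 where 0: "partial_linear M H0 \<phi>0" "m \<in> H0"
    "(\<forall>s\<in>Mset even even. s \<noteq> 0 \<longrightarrow> s \<odot>\<^bsub>M\<^esub> m \<notin> {\<zero>\<^bsub>M\<^esub>}) \<longrightarrow> \<phi>0 m \<noteq> 0"
    using partial_linear_extend[OF M base m(1)] by (elim exE conjE) (rule that)
  have "\<forall>s\<in>Mset even even. s \<noteq> 0 \<longrightarrow> s \<odot>\<^bsub>M\<^esub> m \<notin> {\<zero>\<^bsub>M\<^esub>}"
    using tf[OF _ _ m(1)] m(2) by auto
  then have \<phi>0: "\<phi>0 m \<noteq> 0"
    by (rule mp[OF 0(3)])
  have "\<exists>H \<phi>. partial_linear M H \<phi> \<and> m \<in> H \<and> set xs \<subseteq> H \<and> \<phi> m \<noteq> 0" if "set xs \<subseteq> carrier M" for xs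
    using that
  proof (induction xs)
    case Nil
    then show ?case
      using 0(1,2) \<phi>0 by auto
  next
    case (Cons g xs)
    then obtain H \<phi> where H: "partial_linear M H \<phi>" "m \<in> H" "set xs \<subseteq> H" "\<phi> m \<noteq> 0"
      by auto
    have "g \<in> carrier M"
      using Cons.prems by simp
    then obtain H' \<phi>' s where H': "partial_linear M H' \<phi>'" "H \<subseteq> H'" "g \<in> H'" "s \<noteq> 0" "\<forall>h\<in>H. \<phi>' h = s * \<phi> h"
      using partial_linear_extend[OF M H(1) \<open>g \<in> carrier M\<close>] by (elim exE conjE) (rule that)
    have "\<phi>' m \<noteq> 0"
      using H'(4,5) H(2,4) by simp
    moreover have "m \<in> H'" "set (g # xs) \<subseteq> H'"
      using H'(2,3) H(2,3) by auto
    ultimately show ?case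
      using H'(1) by blast
  qed
  from this[OF gs] obtain H \<phi> where H: "partial_linear M H \<phi>" "set gs \<subseteq> H" "\<phi> m \<noteq> 0"
    by blast
  have "\<forall>m\<in>carrier M. m \<in> H"
    by (rule gen[THEN spec, of "\<lambda>m. m \<in> H", THEN mp]) (use H(1,2) in \<open>auto simp: partial_linear_def\<close>)
  then have "H = carrier M"
    using H(1) unfolding partial_linear_def by blast
  then have "A_linear M \<phi>"
    using H(1) by (simp add: partial_linear_def)
  then show ?thesis
    using H(3) by blast
qed

text \<open>An element killed by j is killed by every functional, each being a multiple of j, and is
  zero because functionals separate elements. So j embeds M, its image is divisorial in the sense of
  the locale, and dividing by the unit q from \<open>shape\<close> identifies M with one of the nine
  shapes.\<close>

theorem maximal_CM_rank_one:
  fixes M :: "('k::field fps2, 'm) module"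
  assumes CM: "maximal_CM ring_A M" and rk: "has_rank M 1"
  obtains P Q \<iota> where "fractional M P Q \<iota>"
proof -
  have M: "module ring_A M" and fg: "finitely_generated_module ring_A M"
    using CM by (simp_all add: maximal_CM_def)
  interpret module ring_A M
    by (rule M)
  obtain j where j: "A_linear M j" and hom: "\<And>\<phi>. A_linear M \<phi> \<Longrightarrow> \<exists>r. \<forall>m\<in>carrier M. \<phi> m = r * j m"
    using rank_one_map[OF M rk] by blast
  note jD = A_linearD[OF j]
  have j0: "m = \<zero>\<^bsub>M\<^esub>" if mj: "m \<in> carrier M" "j m = 0" for m
  proof (rule ccontr)
    assume "m \<noteq> \<zero>\<^bsub>M\<^esub>"
    then have "\<exists>\<phi>. A_linear M \<phi> \<and> \<phi> m \<noteq> 0"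
      by (rule separating_functional[OF M fg _ mj(1), rotated]) (rule maximal_CM_torsion_free[OF M CM])
    then obtain \<phi> where "A_linear M \<phi>" "\<phi> m \<noteq> 0"
      by (elim exE conjE) (rule that)
    then show False
      using hom[of \<phi>] mj by auto
  qed
  have jz: "j \<zero>\<^bsub>M\<^esub> = 0"
    using jD(2)[of 0 "\<zero>\<^bsub>M\<^esub>"] smult_l_null[OF M.zero_closed] by simp
  have j_inj: "m = n" if mn: "m \<in> carrier M" "n \<in> carrier M" "j m = j n" for m n
  proof -
    have n': "(- 1) \<odot>\<^bsub>M\<^esub> n \<in> carrier M"
      using smult_closed[of "- 1" n] mn(2) by simp
    have e1: "n \<oplus>\<^bsub>M\<^esub> (- 1) \<odot>\<^bsub>M\<^esub> n = \<zero>\<^bsub>M\<^esub>"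
      by (rule j0) (use n' mn(2) jD(1)[OF mn(2) n'] jD(2)[of "- 1" n] in simp_all)
    have e2: "m \<oplus>\<^bsub>M\<^esub> (- 1) \<odot>\<^bsub>M\<^esub> n = \<zero>\<^bsub>M\<^esub>"
      by (rule j0) (use n' mn jD(1)[OF mn(1) n'] jD(2)[of "- 1" n] in simp_all)
    have "m = m \<oplus>\<^bsub>M\<^esub> ((- 1) \<odot>\<^bsub>M\<^esub> n \<oplus>\<^bsub>M\<^esub> n)"
      unfolding M.a_comm[OF n' mn(2)] e1 by (rule M.r_zero[OF mn(1), symmetric])
    also have "\<dots> = (m \<oplus>\<^bsub>M\<^esub> (- 1) \<odot>\<^bsub>M\<^esub> n) \<oplus>\<^bsub>M\<^esub> n"
      by (rule M.a_assoc[OF mn(1) n' mn(2), symmetric])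
    also have "\<dots> = n"
      unfolding e2 by (rule M.l_zero[OF mn(2)])
    finally show ?thesis .
  qed
  obtain f g where fg_CM: "f \<in> max_A" "g \<in> max_A"
    "\<And>m. m \<in> carrier M \<Longrightarrow> f \<odot>\<^bsub>M\<^esub> m = \<zero>\<^bsub>M\<^esub> \<Longrightarrow> m = \<zero>\<^bsub>M\<^esub>"
    "\<And>m n. m \<in> carrier M \<Longrightarrow> n \<in> carrier M \<Longrightarrow> g \<odot>\<^bsub>M\<^esub> m = f \<odot>\<^bsub>M\<^esub> n \<Longrightarrow> \<exists>k\<in>carrier M. m = f \<odot>\<^bsub>M\<^esub> k"
    "carrier M \<noteq> {\<zero>\<^bsub>M\<^esub>}"
    by (rule maximal_CM_D[OF M CM]) blast
  obtain m0 where m0: "m0 \<in> carrier M" "j m0 \<noteq> 0"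
    using fg_CM(5) j0 M.zero_closed by blast
  have fA: "f \<in> Mset even even" "g \<in> Mset even even"
    using fg_CM(1,2) by (simp_all add: max_A_def)
  have f0: "f \<noteq> 0"
    using fg_CM(3)[OF m0(1)] smult_l_null[OF m0(1)] m0(2) jz by auto
  define V where "V = j ` carrier M"
  interpret divisorial V
  proof
    show "A_submodule V"
      unfolding A_submodule_def
    proof (intro conjI ballI)
      show "0 \<in> V"
        using jz M.zero_closed unfolding V_def by (metis imageI)
      fix a
      assume "a \<in> V"
      then obtain m where m: "m \<in> carrier M" "a = j m"
        unfolding V_def by blast
      show "c * a \<in> V" if "c \<in> Mset even even" for c
        unfolding m(2) jD(2)[OF that m(1), symmetric] V_def using smult_closed[of c m] that m(1) by simp
      fix b
      assume "b \<in> V"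
      then obtain n where n: "n \<in> carrier M" "b = j n"
        unfolding V_def by blast
      show "a + b \<in> V"
        unfolding m(2) n(2) jD(1)[OF m(1) n(1), symmetric] V_def using m n by simp
    qed
    obtain gs where gs: "set gs \<subseteq> carrier M"
      and gen: "\<forall>Pr. Pr \<zero>\<^bsub>M\<^esub> \<and> (\<forall>m\<in>carrier M. \<forall>n\<in>carrier M. Pr m \<longrightarrow> Pr n \<longrightarrow> Pr (m \<oplus>\<^bsub>M\<^esub> n)) \<and>
        (\<forall>c\<in>Mset even even. \<forall>m\<in>carrier M. Pr m \<longrightarrow> Pr (c \<odot>\<^bsub>M\<^esub> m)) \<and> (\<forall>g\<in>set gs. Pr g) \<longrightarrow> (\<forall>m\<in>carrier M. Pr m)"
      by (rule finitely_generated_induct[OF M fg])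
    show "\<exists>G. finite G \<and> G \<subseteq> V \<and> (\<forall>H. A_submodule H \<longrightarrow> G \<subseteq> H \<longrightarrow> V \<subseteq> H)"
    proof (intro exI[of _ "j ` set gs"] conjI allI impI)
      show "j ` set gs \<subseteq> V"
        using gs by (auto simp: V_def)
      fix H
      assume H: "A_submodule H" "j ` set gs \<subseteq> H"
      have "\<forall>m\<in>carrier M. j m \<in> H"
        by (rule gen[THEN spec, of "\<lambda>m. j m \<in> H", THEN mp]) (use H in \<open>auto simp: jz jD A_submoduleD(1-3)[OF H(1)]\<close>)
      then show "V \<subseteq> H"
        by (auto simp: V_def)
    qed simp
    \<comment> \<open>If a divides h j(m) for all m, the quotient is again a linear functional on M,
      hence r j for some r, and h = a r.\<close>
    fix a h :: "'k fps2"
    assume a: "a \<noteq> 0" and dvd: "\<And>v. v \<in> V \<Longrightarrow> a dvd h * v"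
    define \<phi> where "\<phi> m = (SOME q. h * j m = a * q)" for m
    have \<phi>: "h * j m = a * \<phi> m" if "m \<in> carrier M" for m
      unfolding \<phi>_def using dvd[of "j m"] that by (intro someI_ex[of "\<lambda>q. h * j m = a * q"]) (auto simp: V_def dvd_def)
    have "A_linear M \<phi>"
      unfolding A_linear_def
    proof (intro conjI ballI)
      fix m
      assume m: "m \<in> carrier M"
      show "\<phi> (m \<oplus>\<^bsub>M\<^esub> n) = \<phi> m + \<phi> n" if n: "n \<in> carrier M" for n
      proof -
        have "a * \<phi> (m \<oplus>\<^bsub>M\<^esub> n) = a * (\<phi> m + \<phi> n)"
          using \<phi>[OF M.a_closed[OF m n]] \<phi>[OF m] \<phi>[OF n] jD(1)[OF m n] by (simp add: distrib_left)
        then show ?thesis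
          using a by simp
      qed
      show "\<phi> (c \<odot>\<^bsub>M\<^esub> m) = c * \<phi> m" if c: "c \<in> Mset even even" for c
      proof -
        have "c \<odot>\<^bsub>M\<^esub> m \<in> carrier M"
          using smult_closed[of c m] c m by simp
        then have "a * \<phi> (c \<odot>\<^bsub>M\<^esub> m) = a * (c * \<phi> m)"
          using \<phi>[of "c \<odot>\<^bsub>M\<^esub> m"] \<phi>[OF m] jD(2)[OF c m] by (auto simp: mult.left_commute)
        then show ?thesis
          using a by simp
      qed
    qed
    then obtain r where "\<forall>m\<in>carrier M. \<phi> m = r * j m"
      using hom by blast
    then have "h * j m0 = (a * r) * j m0"
      using \<phi>[OF m0(1)] m0(1) by (simp add: mult.assoc)
    then show "a dvd h"
      using m0(2) by simp
  next
    \<comment> \<open>Only the two members of the regular sequence are tested. If f r = j(m) and g r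
      = j(n), then g m = f n, so m = f k by regularity and r = j(k).\<close>
    fix r :: "'k fps2"
    assume c: "\<And>c. c \<in> max_A \<Longrightarrow> c * r \<in> V"
    obtain m n where m: "m \<in> carrier M" "f * r = j m" and n: "n \<in> carrier M" "g * r = j n"
      using c[OF fg_CM(1)] c[OF fg_CM(2)] unfolding V_def by blast
    have sm: "g \<odot>\<^bsub>M\<^esub> m \<in> carrier M" "f \<odot>\<^bsub>M\<^esub> n \<in> carrier M"
      using smult_closed[of g m] smult_closed[of f n] fA m n by simp_all
    have "j (g \<odot>\<^bsub>M\<^esub> m) = j (f \<odot>\<^bsub>M\<^esub> n)"
      unfolding jD(2)[OF fA(2) m(1)] jD(2)[OF fA(1) n(1)] m(2)[symmetric] n(2)[symmetric] by (rule mult.left_commute)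
    then obtain k where k: "k \<in> carrier M" "m = f \<odot>\<^bsub>M\<^esub> k"
      using j_inj[OF sm] fg_CM(4)[OF m(1) n(1)] by blast
    have "f * r = f * j k"
      unfolding m(2) k(2) by (rule jD(2)[OF fA(1) k(1)])
    then have "r = j k"
      using f0 by simp
    then show "r \<in> V"
      using k(1) by (simp add: V_def)
  qed
  obtain P Q and q :: "'k fps2" where PQ: "P \<in> kinds" "Q \<in> kinds" and q1: "cf q 0 0 = 1"
    and q2: "\<And>d :: 'k fps2. q * d \<in> V \<longleftrightarrow> d \<in> Mset P Q"
    by (rule shape) (blast | metis)
  have q0: "cf q 0 0 \<noteq> 0"
    by (simp add: q1)
  obtain q' :: "'k fps2" where q': "q * q' = 1"
    using fps2_unit_inverse[OF q0] .
  define \<iota> where "\<iota> m = q' * j m" for m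
  have q\<iota>: "q * \<iota> m = j m" for m
    unfolding \<iota>_def mult.assoc[symmetric] q' by (rule mult_1)
  have \<iota>M: "\<iota> m \<in> Mset P Q" if "m \<in> carrier M" for m
    unfolding q2[symmetric] q\<iota> V_def by (rule imageI[OF that])
  have "\<iota> \<in> module_iso ring_A M (ideal_module ring_A (Mset P Q))"
    unfolding module_iso_def module_hom_def mem_Collect_eq
  proof (intro conjI ballI)
    show "\<iota> \<in> carrier M \<rightarrow> carrier (ideal_module ring_A (Mset P Q))"
      using \<iota>M by simp
    show "\<iota> (m \<oplus>\<^bsub>M\<^esub> n) = \<iota> m \<oplus>\<^bsub>ideal_module ring_A (Mset P Q)\<^esub> \<iota> n" if "m \<in> carrier M" "n \<in> carrier M" for m n
      using jD(1)[OF that] by (simp add: \<iota>_def distrib_left)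
    show "\<iota> (c \<odot>\<^bsub>M\<^esub> m) = c \<odot>\<^bsub>ideal_module ring_A (Mset P Q)\<^esub> \<iota> m" if "c \<in> carrier ring_A" "m \<in> carrier M" for c m
      using jD(2)[of c m] that by (simp add: \<iota>_def mult.left_commute)
    show "bij_betw \<iota> (carrier M) (carrier (ideal_module ring_A (Mset P Q)))"
      unfolding bij_betw_def ideal_module_simps
    proof
      show "inj_on \<iota> (carrier M)"
      proof (rule inj_onI)
        fix m n
        assume mn: "m \<in> carrier M" "n \<in> carrier M" "\<iota> m = \<iota> n"
        have "j m = j n"
          unfolding q\<iota>[symmetric] mn(3) ..
        then show "m = n"
          by (rule j_inj[OF mn(1,2)])
      qed
      show "\<iota> ` carrier M = Mset P Q"
      proof (intro equalityI subsetI)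
        show "d \<in> Mset P Q" if "d \<in> \<iota> ` carrier M" for d
          using that \<iota>M by blast
        fix d :: "'k fps2"
        assume "d \<in> Mset P Q"
        then have "q * d \<in> V"
          by (simp only: q2)
        then obtain m where m: "q * d = j m" "m \<in> carrier M"
          unfolding V_def by (rule imageE)
        have "\<iota> m = (q * q') * d"
          unfolding \<iota>_def m(1)[symmetric] by (simp only: mult_ac)
        then have d: "d = \<iota> m"
          by (simp add: q')
        show "d \<in> \<iota> ` carrier M"
          unfolding d by (rule imageI[OF m(2)])
      qed
    qed
  qed
  then have "fractional M P Q \<iota>"
    by (intro fractional.intro M PQ)
  then show thesis
    by (rule that)
qed

section \<open>From shapes to the list of ideals\<close>

lemma module_isomorphic_trans:
  assumes "module_isomorphic R L M" "module_isomorphic R M N"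
  shows "module_isomorphic R L N"
proof -
  obtain f g where f: "f \<in> module_hom R L M" "bij_betw f (carrier L) (carrier M)"
    and g: "g \<in> module_hom R M N" "bij_betw g (carrier M) (carrier N)"
    using assms unfolding module_isomorphic_def module_iso_def by blast
  have "g \<circ> f \<in> module_hom R L N"
    using f(1) g(1) unfolding module_hom_def by (auto simp: Pi_iff)
  then show ?thesis
    using bij_betw_trans[OF f(2) g(2)] unfolding module_isomorphic_def module_iso_def by blast
qed

lemma list_entries_all: "list_all2 list_entry (upper_shapes @ lower_shapes)
    ((upper_part :: ('k::field fls mat \<times> 'k fls mat \<times> 'k fps2 set) list) @ lower_part)"
  by (intro list_all2_appendI list_entries)

lemma list_entry_of_mem:
  assumes "list_all2 list_entry ps es" "e \<in> set es"
  shows "\<exists>pq\<in>set ps. list_entry pq e"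
proof -
  obtain i where i: "i < length es" "e = es ! i"
    using assms(2) by (metis in_set_conv_nth)
  then have "i < length ps" "list_entry (ps ! i) e"
    using assms(1) by (auto simp: list_all2_conv_all_nth)
  then show ?thesis
    by (metis nth_mem)
qed

lemma list_entry_of_shape:
  assumes "list_all2 list_entry ps es" "pq \<in> set ps"
  shows "\<exists>e\<in>set es. list_entry pq e"
proof -
  obtain i where i: "i < length ps" "pq = ps ! i"
    using assms(2) by (metis in_set_conv_nth)
  then have "i < length es" "list_entry pq (es ! i)"
    using assms(1) by (auto simp: list_all2_conv_all_nth)
  then show ?thesis
    by (metis nth_mem)
qed

lemma list_entry_props:
  assumes e: "list_entry (P, Q) (\<Theta>1, \<Theta>2, J)"
  shows "ideal J ring_A" "maximal_CM ring_A (ideal_module ring_A J)" "has_rank (ideal_module ring_A J) 1"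
    "has_gluing_datum (ideal_module ring_A J) \<Theta>1 \<Theta>2"
proof -
  obtain \<iota> where "fractional (ideal_module ring_A J) P Q \<iota>"
    by (rule list_entry_fractional[OF e])
  then interpret fractional "ideal_module ring_A J" P Q \<iota> .
  show "maximal_CM ring_A (ideal_module ring_A J)" "has_rank (ideal_module ring_A J) 1"
    by (rule maximal_CM has_rank_1)+
  show "ideal J ring_A" "has_gluing_datum (ideal_module ring_A J) \<Theta>1 \<Theta>2"
    using e has_gluing_datum by (auto simp: list_entry_def)
qed

lemma rank_one_classification:
  fixes M :: "('k::field fps2, 'm) module"
  assumes "maximal_CM ring_A M" "has_rank M 1"
  shows "\<exists>(\<Theta>1, \<Theta>2, J)\<in>set (upper_part @ lower_part). module_isomorphic ring_A M (ideal_module ring_A J)"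
proof -
  obtain P Q \<iota> where "fractional M P Q \<iota>"
    by (rule maximal_CM_rank_one[OF assms])
  then interpret fractional M P Q \<iota> .
  obtain e :: "'k fls mat \<times> 'k fls mat \<times> 'k fps2 set" where e: "e \<in> set (upper_part @ lower_part)" "list_entry (P, Q) e"
    using list_entry_of_shape[OF list_entries_all shapes_complete[OF kP kQ]] by blast
  obtain \<Theta>1 \<Theta>2 J where e_eq: "e = (\<Theta>1, \<Theta>2, J)"
    by (cases e)
  obtain c where c: "c \<in> {1, el_w}" "J = (*) c ` Mset P Q"
    using e(2) unfolding e_eq list_entry_def prod.case by (elim conjE bexE) (rule that)
  have "c \<noteq> 0"
    using c(1) by auto
  then have "module_isomorphic ring_A (ideal_module ring_A (Mset P Q)) (ideal_module ring_A J)"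
    using fractional_scaled(1)[OF kP kQ] unfolding module_isomorphic_def c(2) by blast
  moreover have "module_isomorphic ring_A M (ideal_module ring_A (Mset P Q))"
    using iso unfolding module_isomorphic_def by blast
  ultimately have "module_isomorphic ring_A M (ideal_module ring_A J)"
    by (rule module_isomorphic_trans[rotated])
  then show ?thesis
    using e(1) unfolding e_eq by blast
qed

lemma ideal_module_UNIV: "ideal_module ring_A UNIV = regular_module ring_R"
  by (simp add: ideal_module_def regular_module_def ring_A_def)

theorem proposition12p3:
  shows
    "(\<exists>\<phi>\<in>ring_iso (ring_P Quot relation_ideal) (ring_A :: 'k::field fps2 ring).
        \<forall>F. \<phi> (relation_ideal +>\<^bsub>ring_P\<^esub> F) = subst_P F) \<and>
     (\<forall>(\<Theta>1, \<Theta>2, J) \<in> set ((upper_part :: ('k fls mat \<times> 'k fls mat \<times> 'k fps2 set) list) @ lower_part).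
        ideal J ring_A \<and>
        maximal_CM ring_A (ideal_module ring_A J) \<and>
        has_rank (ideal_module ring_A J) 1 \<and>
        has_gluing_datum (ideal_module ring_A J) \<Theta>1 \<Theta>2) \<and>
     module_isomorphic ring_A (regular_module (ring_R :: 'k fps2 ring)) (ideal_module ring_A conductor_A) \<and>
     (\<forall>M :: ('k fps2, 'm) module. maximal_CM ring_A M \<and> has_rank M 1 \<longrightarrow>
        (\<exists>(\<Theta>1, \<Theta>2, J) \<in> set (upper_part @ lower_part).
           module_isomorphic ring_A M (ideal_module ring_A J))) \<and>
     (let Js = map (snd \<circ> snd) ((upper_part :: ('k fls mat \<times> 'k fls mat \<times> 'k fps2 set) list) @ lower_part)
      in \<forall>i<length Js. \<forall>j<length Js.
           module_isomorphic ring_A (ideal_module ring_A (Js ! i)) (ideal_module ring_A (Js ! j)) \<longrightarrow> i = j) \<and>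
     (\<forall>(\<Theta>1, \<Theta>2, J) \<in> set (upper_part :: ('k fls mat \<times> 'k fls mat \<times> 'k fps2 set) list).
        locally_free_on_punctured_spectrum ring_A (ideal_module ring_A J)) \<and>
     (\<forall>(\<Theta>1, \<Theta>2, J) \<in> set (lower_part :: ('k fls mat \<times> 'k fls mat \<times> 'k fps2 set) list).
        \<not> locally_free_on_punctured_spectrum ring_A (ideal_module ring_A J)) \<and>
     (\<exists>\<C> :: ('k fps2, 'k fps2) module set. finite \<C> \<and>
        (\<forall>M :: ('k fps2, 'm) module. maximal_CM ring_A M \<and> has_rank M 1 \<longrightarrow>
           (\<exists>N\<in>\<C>. module_isomorphic ring_A M N)))"
proof (intro conjI)
  let ?U = "upper_part :: ('k fls mat \<times> 'k fls mat \<times> 'k fps2 set) list"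
  let ?L = "lower_part :: ('k fls mat \<times> 'k fls mat \<times> 'k fps2 set) list"
  show "\<exists>\<phi>\<in>ring_iso (ring_P Quot relation_ideal) (ring_A :: 'k fps2 ring). \<forall>F. \<phi> (relation_ideal +>\<^bsub>ring_P\<^esub> F) = subst_P F"
    by (rule presentation_of_A)
  show "\<forall>(\<Theta>1, \<Theta>2, J)\<in>set (?U @ ?L). ideal J ring_A \<and> maximal_CM ring_A (ideal_module ring_A J) \<and>
      has_rank (ideal_module ring_A J) 1 \<and> has_gluing_datum (ideal_module ring_A J) \<Theta>1 \<Theta>2"
    using list_entry_of_mem[OF list_entries_all] list_entry_props by fast
  show "module_isomorphic ring_A (regular_module (ring_R :: 'k fps2 ring)) (ideal_module ring_A conductor_A)"
    using fractional_scaled(1)[OF kinds_mem(3) kinds_mem(3) xy_nonzero(3)]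
    unfolding module_isomorphic_def Mset_all ideal_module_UNIV conductor_A_eq by blast
  show cls: "\<forall>M :: ('k fps2, 'm) module. maximal_CM ring_A M \<and> has_rank M 1 \<longrightarrow>
      (\<exists>(\<Theta>1, \<Theta>2, J)\<in>set (upper_part @ lower_part). module_isomorphic ring_A M (ideal_module ring_A J))"
    by (intro allI impI rank_one_classification) simp_all
  show "let Js = map (snd \<circ> snd) (?U @ ?L) in \<forall>i<length Js. \<forall>j<length Js.
      module_isomorphic ring_A (ideal_module ring_A (Js ! i)) (ideal_module ring_A (Js ! j)) \<longrightarrow> i = j"
    unfolding Let_def
  proof (intro allI impI)
    \<comment> \<open>Isomorphic ideals have equal shapes, and the nine shapes are pairwise
      distinct.\<close>
    let ?S = "upper_shapes @ lower_shapes" and ?Js = "map (snd \<circ> snd) (?U @ ?L)"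
    fix i j
    assume ij: "i < length ?Js" "j < length ?Js"
      and iso: "module_isomorphic ring_A (ideal_module ring_A (?Js ! i)) (ideal_module ring_A (?Js ! j))"
    have len: "length ?S = length (?U @ ?L)"
      by (rule list_all2_lengthD[OF list_entries_all])
    have entry: "list_entry (?S ! n) ((?U @ ?L) ! n)" "?Js ! n = snd (snd ((?U @ ?L) ! n))" if "n < length ?Js" for n
    proof -
      have n: "n < length (?U @ ?L)"
        using that by simp
      show "list_entry (?S ! n) ((?U @ ?L) ! n)"
        by (rule list_all2_nthD2[OF list_entries_all n])
      show "?Js ! n = snd (snd ((?U @ ?L) ! n))"
        unfolding nth_map[OF n] by simp
    qed
    have frac: "\<exists>\<iota>. fractional (ideal_module ring_A (?Js ! n)) (fst (?S ! n)) (snd (?S ! n)) \<iota>" if "n < length ?Js" for n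
      using entry[OF that] list_entry_fractional by (metis prod.collapse)
    have "fst (?S ! i) = fst (?S ! j) \<and> snd (?S ! i) = snd (?S ! j)"
      using frac[OF ij(1)] frac[OF ij(2)] fractional_shape_unique[OF _ _ iso] by blast
    then have "?S ! i = ?S ! j"
      by (simp only: prod_eq_iff)
    then show "i = j"
      using nth_eq_iff_index_eq[OF shapes_distinct, of i j] ij len by simp
  qed
  show "\<forall>(\<Theta>1, \<Theta>2, J)\<in>set ?U. locally_free_on_punctured_spectrum ring_A (ideal_module ring_A J)"
  proof (clarify)
    fix \<Theta>1 \<Theta>2 J
    assume "(\<Theta>1, \<Theta>2, J) \<in> set ?U"
    then obtain P Q where PQ: "(P, Q) \<in> set upper_shapes" "list_entry (P, Q) (\<Theta>1, \<Theta>2, J)"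
      using list_entry_of_mem[OF list_entries(1)] by fast
    obtain \<iota> where "fractional (ideal_module ring_A J) P Q \<iota>"
      by (rule list_entry_fractional[OF PQ(2)])
    then show "locally_free_on_punctured_spectrum ring_A (ideal_module ring_A J)"
      by (rule upper_locally_free) (use PQ(1) in \<open>auto simp: upper_shapes_def\<close>)
  qed
  show "\<forall>(\<Theta>1, \<Theta>2, J)\<in>set ?L. \<not> locally_free_on_punctured_spectrum ring_A (ideal_module ring_A J)"
  proof (intro ballI, clarify)
    fix \<Theta>1 \<Theta>2 J
    assume "(\<Theta>1, \<Theta>2, J) \<in> set ?L" and free: "locally_free_on_punctured_spectrum ring_A (ideal_module ring_A J)"
    then obtain P Q where PQ: "(P, Q) \<in> set lower_shapes" "list_entry (P, Q) (\<Theta>1, \<Theta>2, J)"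
      using list_entry_of_mem[OF list_entries(2)] by fast
    obtain \<iota> where "fractional (ideal_module ring_A J) P Q \<iota>"
      by (rule list_entry_fractional[OF PQ(2)])
    then have "\<not> locally_free_on_punctured_spectrum ring_A (ideal_module ring_A J)"
      by (rule lower_not_locally_free) (use PQ(1) in \<open>auto simp: lower_shapes_def\<close>)
    then show False
      using free by blast
  qed
  show "\<exists>\<C> :: ('k fps2, 'k fps2) module set. finite \<C> \<and>
      (\<forall>M :: ('k fps2, 'm) module. maximal_CM ring_A M \<and> has_rank M 1 \<longrightarrow> (\<exists>N\<in>\<C>. module_isomorphic ring_A M N))"
  proof (intro exI[of _ "(\<lambda>(\<Theta>1, \<Theta>2, J). ideal_module ring_A J) ` set (?U @ ?L)"] conjI allI impI)
    fix M :: "('k fps2, 'm) module"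
    assume "maximal_CM ring_A M \<and> has_rank M 1"
    then have "\<exists>(\<Theta>1, \<Theta>2, J)\<in>set (?U @ ?L). module_isomorphic ring_A M (ideal_module ring_A J)"
      by (intro rank_one_classification) simp_all
    then obtain e where e: "e \<in> set (?U @ ?L)" "case e of (\<Theta>1, \<Theta>2, J) \<Rightarrow> module_isomorphic ring_A M (ideal_module ring_A J)"
      by (rule bexE)
    obtain \<Theta>1 \<Theta>2 J where eq: "e = (\<Theta>1, \<Theta>2, J)"
      by (cases e)
    show "\<exists>N\<in>(\<lambda>(\<Theta>1, \<Theta>2, J). ideal_module ring_A J) ` set (?U @ ?L). module_isomorphic ring_A M N"
    proof (rule bexI)
      show "module_isomorphic ring_A M (ideal_module ring_A J)"
        using e(2) unfolding eq prod.case .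
      show "ideal_module ring_A J \<in> (\<lambda>(\<Theta>1, \<Theta>2, J). ideal_module ring_A J) ` set (?U @ ?L)"
        using imageI[OF e(1), of "\<lambda>(\<Theta>1, \<Theta>2, J). ideal_module ring_A J"] unfolding eq prod.case .
    qed
  qed simp
qed

end
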